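(* Let $T$ be a countable simple theory in which the extension property is first-order and assume $Lstp=stp$ over sets. Let $s$ be a sort such that $\mathcal C^s$ is not algebraic. Assume that for every $a\in\mathcal C^s\setminus acl(\emptyset)$ there exists $a'\in dcl(a)\setminus acl(\emptyset)$ such that $SU_{se}(a')<\omega$. Then there exists an unbounded $\tau^f_\infty$-open set $\mathcal U$ over a finite set such that $\mathcal U$ has bounded finite $SU_{se}$-rank.
   Context: $T$ is a complete first-order theory in a language $L$; $\mathcal C$ is a highly saturated, highly strongly homogeneous (many-sorted) model of $T$, $\mathcal C^s$ its sort $s$; parameter sets are small; independence means non-forking. An $A$-invariant set is unbounded if it is not contained in $acl(A)$. "$Lstp=stp$ over sets" means that over every set $A$, two tuples with the same strong type over $A$ have the same Lascar strong type over $A$. Extension property: a pair is an $L\cup\{P\}$-structure $(M,P^M)$ with $M\models T$ and $P^M$ the universe of an elementary submodel of $M$. It satisfies the extension property if for every $A\subseteq M$ with $|A|\le|T|$ and every complete $L$-type $p$ over $A$ in at most $|T|$ variables there is $a\in p^M$ independent from $P^M$ over $A$. Let $T_{Ext}$ be the intersection of the complete $L\cup\{P\}$-theories of all pairs satisfying the extension property. The extension property is first-order in $T$ if every $|T|^+$-saturated pair that is a model of $T_{Ext}$ satisfies the extension property. Forking topologies: for a finite tuple of variables $x$, a basic $\tau^f$-open set over $A$ is a set $\{a\mid\phi(a,y)\text{ forks over }A\}$ with $\phi(x,y)\in L(A)$; these form a basis of the $\tau^f$-topology on $S_x(A)$, whose open sets (viewed as $A$-invariant sets) are the $\tau^f$-open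 sets over $A$. The $\tau^f_\infty$-topology on $S_x(A)$ has as basis the family of type-definable $\tau^f$-open sets over $A$. Stable independence: for $A\subseteq B$, $a$ is stably-independent from $B$ over $A$ if for every stable $\phi(x,y)\in L$, whenever $\phi(x,b)$ is over $B$ (i.e. its canonical parameter is in the definable closure of $B$) and $a'\models\phi(x,b)$ for some $a'\in dcl(Aa)$, then $\phi(x,b)$ does not divide over $A$. Otherwise $a$ is stably-dependent on $B$ over $A$. $SU_{se}$-rank: $SU_{se}(a/A)\ge0$ always; $SU_{se}(a/A)\ge\beta+1$ if there exist $B_1\supseteq B_0\supseteq A$ such that $a$ is stably-dependent on $B_1$ over $B_0$ and $SU_{se}(a/B_1)\ge\beta$; for limit $\alpha$, $SU_{se}(a/A)\ge\alpha$ if $SU_{se}(a/A)\ge\beta$ for all $\beta<\alpha$. $SU_{se}(a)=SU_{se}(a/\emptyset)$. For an $A$-invariant set $\mathcal U$, $SU_{se}(\mathcal U)=\alpha$ if $\alpha=\max\{SU_{se}(p)\mid p\in S(A),\ p^{\mathcal C}\subseteq\mathcal U\}$, and $\mathcal U$ has bounded finite $SU_{se}$-rank if $SU_{se}(\mathcal U)=n$ for some $n<\omega$ (computed over the set over which $\mathcal U$ is given). *)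

theory Defs
  imports "HOL-Analysis.Abstract_Topology" "HOL-Library.Extended_Nat" "HOL-Library.Countable_Set"
begin

unbundle cardinal_syntax

section \<open>Many-sorted first-order logic\<close>

text \<open>
  The sorts of a language are all elements of the type \<open>'s\<close>; the function and relation symbols
  are the elements of the sets \<open>Funs\<close> and \<open>Rels\<close>, either of which may be empty.
\<close>

record ('s, 'f, 'r) lang =
  Funs :: "'f set"
  Fdom :: "'f \<Rightarrow> 's list"
  Fcod :: "'f \<Rightarrow> 's"
  Rels :: "'r set"
  Rdom :: "'r \<Rightarrow> 's list"

text \<open>
  Variables are de Bruijn indices. A context is the list of the sorts of the free variables,
  and a valuation is a list of elements matching it; \<open>Ex s\<close> binds index \<open>0\<close>. So a formula
  \<open>\<phi>(x, y)\<close>, with \<open>x\<close> of sorts \<open>\<sigma>\<close> and \<open>y\<close> of sorts \<open>\<tau>\<close>, is a formula in the context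
  \<open>\<sigma> @ \<tau>\<close>, and \<open>\<phi>(a, b)\<close> is its evaluation at \<open>a @ b\<close>.
\<close>

datatype 'f trm = Var nat | App 'f "'f trm list"

datatype ('s, 'f, 'r) fm =
    Fls
  | Eq "'f trm" "'f trm"
  | Rel 'r "'f trm list"
  | Neg "('s, 'f, 'r) fm"
  | Conj "('s, 'f, 'r) fm" "('s, 'f, 'r) fm"
  | Ex 's "('s, 'f, 'r) fm"

inductive has_sort :: "('s, 'f, 'r) lang \<Rightarrow> 's list \<Rightarrow> 'f trm \<Rightarrow> 's \<Rightarrow> bool"
  for L :: "('s, 'f, 'r) lang" and \<sigma> :: "'s list" where
  "i < length \<sigma> \<Longrightarrow> has_sort L \<sigma> (Var i) (\<sigma> ! i)"
| "f \<in> Funs L \<Longrightarrow> list_all2 (has_sort L \<sigma>) ts (Fdom L f) \<Longrightarrow> has_sort L \<sigma> (App f ts) (Fcod L f)"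

primrec wff :: "('s, 'f, 'r) lang \<Rightarrow> 's list \<Rightarrow> ('s, 'f, 'r) fm \<Rightarrow> bool" where
  "wff L \<sigma> Fls \<longleftrightarrow> True"
| "wff L \<sigma> (Eq t u) \<longleftrightarrow> (\<exists>s. has_sort L \<sigma> t s \<and> has_sort L \<sigma> u s)"
| "wff L \<sigma> (Rel r ts) \<longleftrightarrow> r \<in> Rels L \<and> list_all2 (has_sort L \<sigma>) ts (Rdom L r)"
| "wff L \<sigma> (Neg \<phi>) \<longleftrightarrow> wff L \<sigma> \<phi>"
| "wff L \<sigma> (Conj \<phi> \<psi>) \<longleftrightarrow> wff L \<sigma> \<phi> \<and> wff L \<sigma> \<psi>"
| "wff L \<sigma> (Ex s \<phi>) \<longleftrightarrow> wff L (s # \<sigma>) \<phi>"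

definition formulas :: "('s, 'f, 'r) lang \<Rightarrow> ('s, 'f, 'r) fm set" where
  "formulas L = {\<phi>. \<exists>\<sigma>. wff L \<sigma> \<phi>}"

definition sentences :: "('s, 'f, 'r) lang \<Rightarrow> ('s, 'f, 'r) fm set" where
  "sentences L = {\<phi>. wff L [] \<phi>}"

text \<open>\<open>|T| = |L| + \<aleph>\<^sub>0\<close> is the number of formulas.\<close>

definition theory_card :: "('s, 'f, 'r) lang \<Rightarrow> ('s, 'f, 'r) fm rel" where
  "theory_card L = |formulas L|"

text \<open>The universes of different sorts are disjoint: every element has exactly one sort.\<close>

record ('s, 'f, 'r, 'a) struct =
  Univ :: "'a set"
  Sort :: "'a \<Rightarrow> 's"
  FunI :: "'f \<Rightarrow> 'a list \<Rightarrow> 'a"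
  RelI :: "'r \<Rightarrow> 'a list \<Rightarrow> bool"

definition carrier_of :: "('s, 'f, 'r, 'a) struct \<Rightarrow> 's \<Rightarrow> 'a set" where
  "carrier_of M s = {a \<in> Univ M. Sort M a = s}"

definition tuples :: "('s, 'f, 'r, 'a) struct \<Rightarrow> 's list \<Rightarrow> 'a list set" where
  "tuples M \<sigma> = {a. set a \<subseteq> Univ M \<and> map (Sort M) a = \<sigma>}"

definition is_struct :: "('s, 'f, 'r) lang \<Rightarrow> ('s, 'f, 'r, 'a) struct \<Rightarrow> bool" where
  "is_struct L M \<longleftrightarrow> (\<forall>s. carrier_of M s \<noteq> {}) \<and>
     (\<forall>f\<in>Funs L. \<forall>a\<in>tuples M (Fdom L f). FunI M f a \<in> carrier_of M (Fcod L f))"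

primrec teval :: "('s, 'f, 'r, 'a) struct \<Rightarrow> 'a list \<Rightarrow> 'f trm \<Rightarrow> 'a" where
  "teval M e (Var i) = e ! i"
| "teval M e (App f ts) = FunI M f (map (teval M e) ts)"

primrec sat :: "('s, 'f, 'r, 'a) struct \<Rightarrow> 'a list \<Rightarrow> ('s, 'f, 'r) fm \<Rightarrow> bool" where
  "sat M e Fls \<longleftrightarrow> False"
| "sat M e (Eq t u) \<longleftrightarrow> teval M e t = teval M e u"
| "sat M e (Rel r ts) \<longleftrightarrow> RelI M r (map (teval M e) ts)"
| "sat M e (Neg \<phi>) \<longleftrightarrow> \<not> sat M e \<phi>"
| "sat M e (Conj \<phi> \<psi>) \<longleftrightarrow> sat M e \<phi> \<and> sat M e \<psi>"
| "sat M e (Ex s \<phi>) \<longleftrightarrow> (\<exists>a\<in>carrier_of M s. sat M (a # e) \<phi>)"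

definition models :: "('s, 'f, 'r, 'a) struct \<Rightarrow> ('s, 'f, 'r) fm set \<Rightarrow> bool" where
  "models M T \<longleftrightarrow> (\<forall>\<phi>\<in>T. sat M [] \<phi>)"

text \<open>Consistency is not included here: it follows from the existence of a model.\<close>

definition complete_theory :: "('s, 'f, 'r) lang \<Rightarrow> ('s, 'f, 'r) fm set \<Rightarrow> bool" where
  "complete_theory L T \<longleftrightarrow> T \<subseteq> sentences L \<and> (\<forall>\<phi>\<in>sentences L. \<phi> \<in> T \<or> Neg \<phi> \<in> T)"

definition restrict_struct :: "('s, 'f, 'r, 'a) struct \<Rightarrow> 'a set \<Rightarrow> ('s, 'f, 'r, 'a) struct" where
  "restrict_struct M N = M\<lparr>Univ := N\<rparr>"

definition elem_sub :: "('s, 'f, 'r) lang \<Rightarrow> ('s, 'f, 'r, 'a) struct \<Rightarrow> 'a set \<Rightarrow> bool" where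
  "elem_sub L M N \<longleftrightarrow> N \<subseteq> Univ M \<and> is_struct L (restrict_struct M N) \<and>
     (\<forall>\<sigma> \<phi> e. wff L \<sigma> \<phi> \<and> e \<in> tuples (restrict_struct M N) \<sigma> \<longrightarrow>
        (sat (restrict_struct M N) e \<phi> \<longleftrightarrow> sat M e \<phi>))"

text \<open>
  A formula over \<open>A\<close> is a pair \<open>(\<phi>, c)\<close> of an \<open>L\<close>-formula \<open>\<phi>(x, z)\<close> and a tuple \<open>c\<close> from \<open>A\<close>,
  standing for \<open>\<phi>(x, c)\<close>; \<open>x\<close> has the sorts \<open>\<sigma>\<close>.
\<close>

definition formulas_over ::
    "('s, 'f, 'r) lang \<Rightarrow> ('s, 'f, 'r, 'a) struct \<Rightarrow> 's list \<Rightarrow> 'a set \<Rightarrow> (('s, 'f, 'r) fm \<times> 'a list) set"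
  where "formulas_over L M \<sigma> A = {(\<phi>, c). set c \<subseteq> A \<and> wff L (\<sigma> @ map (Sort M) c) \<phi>}"

definition tp :: "('s, 'f, 'r) lang \<Rightarrow> ('s, 'f, 'r, 'a) struct \<Rightarrow> 'a list \<Rightarrow> 'a set \<Rightarrow>
    (('s, 'f, 'r) fm \<times> 'a list) set" where
  "tp L M a A = {(\<phi>, c) \<in> formulas_over L M (map (Sort M) a) A. sat M (a @ c) \<phi>}"

text \<open>
  \<open>S\<^sub>x(A)\<close> for \<open>x\<close> of sorts \<open>\<sigma>\<close>. It is only used for small \<open>A\<close> in the monster model, where every
  complete type over \<open>A\<close> is realised.
\<close>

definition type_space :: "('s, 'f, 'r) lang \<Rightarrow> ('s, 'f, 'r, 'a) struct \<Rightarrow> 's list \<Rightarrow> 'a set \<Rightarrow>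
    (('s, 'f, 'r) fm \<times> 'a list) set set" where
  "type_space L M \<sigma> A = (\<lambda>a. tp L M a A) ` tuples M \<sigma>"

definition realisations :: "('s, 'f, 'r) lang \<Rightarrow> ('s, 'f, 'r, 'a) struct \<Rightarrow> 's list \<Rightarrow> 'a set \<Rightarrow>
    (('s, 'f, 'r) fm \<times> 'a list) set \<Rightarrow> 'a list set" where
  "realisations L M \<sigma> A p = {a \<in> tuples M \<sigma>. tp L M a A = p}"

definition type_definable :: "('s, 'f, 'r) lang \<Rightarrow> ('s, 'f, 'r, 'a) struct \<Rightarrow> 's list \<Rightarrow> 'a set \<Rightarrow>
    'a list set \<Rightarrow> bool" where
  "type_definable L M \<sigma> A U \<longleftrightarrow>
     (\<exists>\<Gamma> \<subseteq> formulas_over L M \<sigma> A. U = {a \<in> tuples M \<sigma>. \<forall>(\<phi>, c)\<in>\<Gamma>. sat M (a @ c) \<phi>})"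

section \<open>The monster model\<close>

definition saturated :: "('s, 'f, 'r) lang \<Rightarrow> ('s, 'f, 'r, 'a) struct \<Rightarrow> 'k rel \<Rightarrow> bool" where
  "saturated L M \<kappa> \<longleftrightarrow>
     (\<forall>A s \<Gamma>. A \<subseteq> Univ M \<and> |A| <o \<kappa> \<and> \<Gamma> \<subseteq> formulas_over L M [s] A \<and>
        (\<forall>\<Delta> \<subseteq> \<Gamma>. finite \<Delta> \<longrightarrow> (\<exists>a\<in>carrier_of M s. \<forall>(\<phi>, c)\<in>\<Delta>. sat M (a # c) \<phi>)) \<longrightarrow>
        (\<exists>a\<in>carrier_of M s. \<forall>(\<phi>, c)\<in>\<Gamma>. sat M (a # c) \<phi>))"

definition automorphism ::
    "('s, 'f, 'r) lang \<Rightarrow> ('s, 'f, 'r, 'a) struct \<Rightarrow> ('a \<Rightarrow> 'a) \<Rightarrow> bool" where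
  "automorphism L M h \<longleftrightarrow> bij_betw h (Univ M) (Univ M) \<and>
     (\<forall>a\<in>Univ M. Sort M (h a) = Sort M a) \<and>
     (\<forall>f\<in>Funs L. \<forall>a\<in>tuples M (Fdom L f). h (FunI M f a) = FunI M f (map h a)) \<and>
     (\<forall>r\<in>Rels L. \<forall>a\<in>tuples M (Rdom L r). RelI M r (map h a) \<longleftrightarrow> RelI M r a)"

definition partial_elementary ::
    "('s, 'f, 'r) lang \<Rightarrow> ('s, 'f, 'r, 'a) struct \<Rightarrow> 'a set \<Rightarrow> ('a \<Rightarrow> 'a) \<Rightarrow> bool" where
  "partial_elementary L M A h \<longleftrightarrow> A \<subseteq> Univ M \<and> h ` A \<subseteq> Univ M \<and>
     (\<forall>a. set a \<subseteq> A \<longrightarrow> tp L M (map h a) {} = tp L M a {})"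

definition strongly_homogeneous ::
    "('s, 'f, 'r) lang \<Rightarrow> ('s, 'f, 'r, 'a) struct \<Rightarrow> 'k rel \<Rightarrow> bool" where
  "strongly_homogeneous L M \<kappa> \<longleftrightarrow>
     (\<forall>A h. partial_elementary L M A h \<and> |A| <o \<kappa> \<longrightarrow>
        (\<exists>g. automorphism L M g \<and> (\<forall>a\<in>A. g a = h a)))"

text \<open>
  ``Highly'' saturated and homogeneous: for some strong limit cardinal \<open>\<kappa> > |T|\<close>. Sets of
  cardinality less than \<open>\<kappa>\<close> are small. (All cardinals below \<open>\<kappa>\<close> are those of subsets of
  \<open>Field \<kappa>\<close>.)
\<close>

definition monster :: "('s, 'f, 'r) lang \<Rightarrow> ('s, 'f, 'r) fm set \<Rightarrow> ('s, 'f, 'r, 'a) struct \<Rightarrow>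
    'k rel \<Rightarrow> bool" where
  "monster L T C \<kappa> \<longleftrightarrow> is_struct L C \<and> models C T \<and>
     Card_order \<kappa> \<and> theory_card L <o \<kappa> \<and>
     (\<forall>X \<subseteq> Field \<kappa>. |X| <o \<kappa> \<longrightarrow> |Pow X| <o \<kappa>) \<and>
     saturated L C \<kappa> \<and> strongly_homogeneous L C \<kappa>"

definition small :: "('s, 'f, 'r, 'a) struct \<Rightarrow> 'k rel \<Rightarrow> 'a set \<Rightarrow> bool" where
  "small C \<kappa> A \<longleftrightarrow> A \<subseteq> Univ C \<and> |A| <o \<kappa>"

section \<open>Closures and imaginaries\<close>

definition acl :: "('s, 'f, 'r) lang \<Rightarrow> ('s, 'f, 'r, 'a) struct \<Rightarrow> 'a set \<Rightarrow> 'a set" where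
  "acl L C A = {a \<in> Univ C. \<exists>(\<phi>, c) \<in> formulas_over L C [Sort C a] A. sat C (a # c) \<phi> \<and>
     finite {a' \<in> carrier_of C (Sort C a). sat C (a' # c) \<phi>}}"

definition dcl :: "('s, 'f, 'r) lang \<Rightarrow> ('s, 'f, 'r, 'a) struct \<Rightarrow> 'a set \<Rightarrow> 'a set" where
  "dcl L C A = {a \<in> Univ C. \<exists>(\<phi>, c) \<in> formulas_over L C [Sort C a] A.
     {a' \<in> carrier_of C (Sort C a). sat C (a' # c) \<phi>} = {a}}"

text \<open>
  The canonical parameter of \<open>\<phi>(x, b)\<close> is the imaginary \<open>b / E\<close>, where \<open>E(y, y')\<close> is the
  \<open>\<emptyset>\<close>-definable equivalence relation \<open>\<forall>x. \<phi>(x, y) \<longleftrightarrow> \<phi>(x, y')\<close>. An imaginary is represented by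
  the equivalence class itself.
\<close>

definition canonical_parameter :: "('s, 'f, 'r, 'a) struct \<Rightarrow> 's list \<Rightarrow>
    ('s, 'f, 'r) fm \<Rightarrow> 'a list \<Rightarrow> 'a list set" where
  "canonical_parameter C \<sigma> \<phi> b = {b' \<in> tuples C (map (Sort C) b).
     \<forall>a\<in>tuples C \<sigma>. sat C (a @ b') \<phi> \<longleftrightarrow> sat C (a @ b) \<phi>}"

text \<open>
  The imaginaries (classes of tuples of sorts \<open>\<tau>\<close>) in the definable closure of \<open>B\<close>. A formula over
  \<open>B\<close> in a variable of the imaginary sort of \<open>E\<close> amounts to an \<open>E\<close>-invariant formula over \<open>B\<close> on
  representatives; it isolates \<open>b / E\<close> iff it defines the class of \<open>b\<close>.
\<close>

definition dcl_imaginaries :: "('s, 'f, 'r) lang \<Rightarrow> ('s, 'f, 'r, 'a) struct \<Rightarrow> 's list \<Rightarrow>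
    'a set \<Rightarrow> 'a list set set" where
  "dcl_imaginaries L C \<tau> B = {e. \<exists>(\<psi>, c) \<in> formulas_over L C \<tau> B.
     e = {b \<in> tuples C \<tau>. sat C (b @ c) \<psi>}}"

section \<open>Forking and simplicity\<close>

text \<open>\<open>\<phi>(x, b)\<close> divides (forks) over \<open>A\<close>, where \<open>x\<close> has the sorts \<open>\<sigma>\<close>.\<close>

definition divides :: "('s, 'f, 'r) lang \<Rightarrow> ('s, 'f, 'r, 'a) struct \<Rightarrow> 'a set \<Rightarrow> 's list \<Rightarrow>
    ('s, 'f, 'r) fm \<Rightarrow> 'a list \<Rightarrow> bool" where
  "divides L C A \<sigma> \<phi> b \<longleftrightarrow>
     (\<exists>k (c :: nat \<Rightarrow> 'a list).
        (\<forall>i. c i \<in> tuples C (map (Sort C) b) \<and> tp L C (c i) A = tp L C b A) \<and>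
        (\<forall>I. finite I \<and> card I = k \<longrightarrow> \<not> (\<exists>a\<in>tuples C \<sigma>. \<forall>i\<in>I. sat C (a @ c i) \<phi>)))"

definition forks :: "('s, 'f, 'r) lang \<Rightarrow> ('s, 'f, 'r, 'a) struct \<Rightarrow> 'a set \<Rightarrow> 's list \<Rightarrow>
    ('s, 'f, 'r) fm \<Rightarrow> 'a list \<Rightarrow> bool" where
  "forks L C A \<sigma> \<phi> b \<longleftrightarrow>
     (\<exists>\<Delta> \<subseteq> formulas_over L C \<sigma> (Univ C). finite \<Delta> \<and>
        (\<forall>(\<psi>, c)\<in>\<Delta>. divides L C A \<sigma> \<psi> c) \<and>
        (\<forall>a\<in>tuples C \<sigma>. sat C (a @ b) \<phi> \<longrightarrow> (\<exists>(\<psi>, c)\<in>\<Delta>. sat C (a @ c) \<psi>)))"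

text \<open>\<open>tp(a / A \<union> B)\<close> does not fork over \<open>A\<close>.\<close>

definition indep :: "('s, 'f, 'r) lang \<Rightarrow> ('s, 'f, 'r, 'a) struct \<Rightarrow> 'a list \<Rightarrow> 'a set \<Rightarrow>
    'a set \<Rightarrow> bool" where
  "indep L C a B A \<longleftrightarrow> (\<forall>(\<phi>, c) \<in> tp L C a (A \<union> B). \<not> forks L C A (map (Sort C) a) \<phi> c)"

text \<open>
  The nodes of the tree \<open>\<omega>\<^bsup><\<omega>\<^esup>\<close> are lists of naturals; the children of \<open>\<eta>\<close> are \<open>\<eta> @ [i]\<close>.
\<close>

definition tree_property :: "('s, 'f, 'r) lang \<Rightarrow> ('s, 'f, 'r, 'a) struct \<Rightarrow> 's list \<Rightarrow> 's list \<Rightarrow>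
    ('s, 'f, 'r) fm \<Rightarrow> bool" where
  "tree_property L C \<sigma> \<tau> \<phi> \<longleftrightarrow>
     (\<exists>k (b :: nat list \<Rightarrow> 'a list). (\<forall>\<eta>. b \<eta> \<in> tuples C \<tau>) \<and>
        (\<forall>\<beta> :: nat \<Rightarrow> nat. \<exists>a\<in>tuples C \<sigma>. \<forall>n. sat C (a @ b (map \<beta> [0..<Suc n])) \<phi>) \<and>
        (\<forall>\<eta> I. finite I \<and> card I = k \<longrightarrow>
           \<not> (\<exists>a\<in>tuples C \<sigma>. \<forall>i\<in>I. sat C (a @ b (\<eta> @ [i])) \<phi>)))"

definition simple_theory :: "('s, 'f, 'r) lang \<Rightarrow> ('s, 'f, 'r, 'a) struct \<Rightarrow> bool" where
  "simple_theory L C \<longleftrightarrow> (\<forall>\<sigma> \<tau> \<phi>. wff L (\<sigma> @ \<tau>) \<phi> \<longrightarrow> \<not> tree_property L C \<sigma> \<tau> \<phi>)"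

section \<open>Strong types and Lascar strong types\<close>

definition definable_rel :: "('s, 'f, 'r) lang \<Rightarrow> ('s, 'f, 'r, 'a) struct \<Rightarrow> 's list \<Rightarrow> 'a set \<Rightarrow>
    'a list rel \<Rightarrow> bool" where
  "definable_rel L C \<sigma> A E \<longleftrightarrow> (\<exists>(\<phi>, c) \<in> formulas_over L C (\<sigma> @ \<sigma>) A.
     E = {(a, b). a \<in> tuples C \<sigma> \<and> b \<in> tuples C \<sigma> \<and> sat C (a @ b @ c) \<phi>})"

definition invariant_rel :: "('s, 'f, 'r) lang \<Rightarrow> ('s, 'f, 'r, 'a) struct \<Rightarrow> 'a set \<Rightarrow>
    'a list rel \<Rightarrow> bool" where
  "invariant_rel L C A E \<longleftrightarrow>
     (\<forall>h. automorphism L C h \<and> (\<forall>x\<in>A. h x = x) \<longrightarrow> (\<forall>(a, b)\<in>E. (map h a, map h b) \<in> E))"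

text \<open>
  Strong types are given by finite \<open>A\<close>-definable equivalence relations, Lascar strong types by
  bounded (less than \<open>\<kappa>\<close> classes) \<open>A\<close>-invariant ones.
\<close>

definition same_stp :: "('s, 'f, 'r) lang \<Rightarrow> ('s, 'f, 'r, 'a) struct \<Rightarrow> 's list \<Rightarrow> 'a set \<Rightarrow>
    'a list \<Rightarrow> 'a list \<Rightarrow> bool" where
  "same_stp L C \<sigma> A a b \<longleftrightarrow>
     (\<forall>E. equiv (tuples C \<sigma>) E \<and> definable_rel L C \<sigma> A E \<and> finite (tuples C \<sigma> // E)
        \<longrightarrow> (a, b) \<in> E)"

definition same_Lstp :: "('s, 'f, 'r) lang \<Rightarrow> ('s, 'f, 'r, 'a) struct \<Rightarrow> 'k rel \<Rightarrow> 's list \<Rightarrow>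
    'a set \<Rightarrow> 'a list \<Rightarrow> 'a list \<Rightarrow> bool" where
  "same_Lstp L C \<kappa> \<sigma> A a b \<longleftrightarrow>
     (\<forall>E. equiv (tuples C \<sigma>) E \<and> invariant_rel L C A E \<and> |tuples C \<sigma> // E| <o \<kappa>
        \<longrightarrow> (a, b) \<in> E)"

definition Lstp_eq_stp :: "('s, 'f, 'r) lang \<Rightarrow> ('s, 'f, 'r, 'a) struct \<Rightarrow> 'k rel \<Rightarrow> bool" where
  "Lstp_eq_stp L C \<kappa> \<longleftrightarrow>
     (\<forall>A \<sigma>. small C \<kappa> A \<longrightarrow>
        (\<forall>a\<in>tuples C \<sigma>. \<forall>b\<in>tuples C \<sigma>. same_stp L C \<sigma> A a b \<longrightarrow> same_Lstp L C \<kappa> \<sigma> A a b))"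

section \<open>Pairs and the extension property\<close>

text \<open>The language \<open>L \<union> {P}\<close>; in the many-sorted setting \<open>P\<close> is a unary predicate on each sort.\<close>

definition pair_lang :: "('s, 'f, 'r) lang \<Rightarrow> ('s, 'f, 'r + 's) lang" where
  "pair_lang L = \<lparr>Funs = Funs L, Fdom = Fdom L, Fcod = Fcod L,
     Rels = Inl ` Rels L \<union> range Inr, Rdom = case_sum (Rdom L) (\<lambda>s. [s])\<rparr>"

definition pair_struct :: "('s, 'f, 'r, 'a) struct \<Rightarrow> 'a set \<Rightarrow> 'a set \<Rightarrow> ('s, 'f, 'r + 's, 'a) struct"
  where "pair_struct C M P = \<lparr>Univ = M, Sort = Sort C, FunI = FunI C,
     RelI = case_sum (RelI C) (\<lambda>s xs. \<exists>x\<in>P. xs = [x] \<and> Sort C x = s)\<rparr>"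

text \<open>
  As usual, models of \<open>T\<close> are taken to be elementary submodels of the monster model \<open>C\<close>, and
  independence is computed in \<open>C\<close>. By Loewenheim-Skolem, pairs of cardinality at most
  \<open>2\<^bsup>|T|\<^esup> < \<kappa>\<close> suffice to determine both \<open>T\<^sub>E\<^sub>x\<^sub>t\<close> and whether the extension property is first-order;
  all of these embed into \<open>C\<close>.
\<close>

definition is_pair :: "('s, 'f, 'r) lang \<Rightarrow> ('s, 'f, 'r, 'a) struct \<Rightarrow> 'a set \<Rightarrow> 'a set \<Rightarrow> bool" where
  "is_pair L C M P \<longleftrightarrow> elem_sub L C M \<and> elem_sub L (restrict_struct C M) P"

text \<open>
  A complete type in the variables \<open>(x\<^sub>i)\<^bsub>i \<in> I\<^esub>\<close> over \<open>A\<close> is given as the type of a realisation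
  \<open>b\<close> in \<open>C\<close>. The index sets \<open>I\<close> are taken inside the type of formulas, where all cardinals up
  to \<open>|T|\<close> occur.
\<close>

definition extension_property ::
    "('s, 'f, 'r) lang \<Rightarrow> ('s, 'f, 'r, 'a) struct \<Rightarrow> 'a set \<Rightarrow> 'a set \<Rightarrow> bool" where
  "extension_property L C M P \<longleftrightarrow>
     (\<forall>A (I :: ('s, 'f, 'r) fm set) (b :: ('s, 'f, 'r) fm \<Rightarrow> 'a).
        A \<subseteq> M \<and> |A| \<le>o theory_card L \<and> |I| \<le>o theory_card L \<and> b ` I \<subseteq> Univ C \<longrightarrow>
        (\<exists>a. a ` I \<subseteq> M \<and>
           (\<forall>is. set is \<subseteq> I \<longrightarrow> tp L C (map a is) A = tp L C (map b is) A) \<and>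
           (\<forall>is. set is \<subseteq> I \<longrightarrow> indep L C (map a is) P A)))"

definition T_Ext :: "('s, 'f, 'r) lang \<Rightarrow> ('s, 'f, 'r, 'a) struct \<Rightarrow> ('s, 'f, 'r + 's) fm set" where
  "T_Ext L C = {\<phi> \<in> sentences (pair_lang L).
     \<forall>M P. is_pair L C M P \<and> extension_property L C M P \<longrightarrow> sat (pair_struct C M P) [] \<phi>}"

definition extension_property_first_order ::
    "('s, 'f, 'r) lang \<Rightarrow> ('s, 'f, 'r, 'a) struct \<Rightarrow> bool" where
  "extension_property_first_order L C \<longleftrightarrow>
     (\<forall>M P. is_pair L C M P \<and> saturated (pair_lang L) (pair_struct C M P) (cardSuc (theory_card L)) \<and>
        models (pair_struct C M P) (T_Ext L C) \<longrightarrow> extension_property L C M P)"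

section \<open>Forking topologies\<close>

text \<open>
  The basic set given by \<open>\<phi>(x, y)\<close> over \<open>A\<close>. The formula \<open>\<phi>\<close> is put in a context listing first \<open>y\<close>
  (sorts \<open>\<tau>\<close>), then \<open>x\<close> (sorts \<open>\<sigma>\<close>), then its parameters \<open>c\<close> from \<open>A\<close>.
\<close>

definition tau_f_basic :: "('s, 'f, 'r) lang \<Rightarrow> ('s, 'f, 'r, 'a) struct \<Rightarrow> 's list \<Rightarrow> 'a set \<Rightarrow>
    'a list set \<Rightarrow> bool" where
  "tau_f_basic L C \<sigma> A U \<longleftrightarrow> (\<exists>\<tau>. \<exists>(\<phi>, c) \<in> formulas_over L C (\<tau> @ \<sigma>) A.
     U = {a \<in> tuples C \<sigma>. forks L C A \<tau> \<phi> (a @ c)})"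

text \<open>
  The topologies are on \<open>S\<^sub>x(A)\<close>. For simple \<open>T\<close> the given families are bases, being closed
  under finite intersections: \<open>\<phi>(a, y)\<close> and \<open>\<psi>(a, z)\<close> both fork over \<open>A\<close> iff
  \<open>\<phi>(a, y) \<or> \<psi>(a, z)\<close>, in the variables \<open>y, z\<close>, does. So generating a topology adds only unions.
\<close>

definition tau_f :: "('s, 'f, 'r) lang \<Rightarrow> ('s, 'f, 'r, 'a) struct \<Rightarrow> 's list \<Rightarrow> 'a set \<Rightarrow>
    (('s, 'f, 'r) fm \<times> 'a list) set topology" where
  "tau_f L C \<sigma> A =
     topology_generated_by {(\<lambda>a. tp L C a A) ` U | U. tau_f_basic L C \<sigma> A U}"

definition tau_f_open :: "('s, 'f, 'r) lang \<Rightarrow> ('s, 'f, 'r, 'a) struct \<Rightarrow> 's list \<Rightarrow> 'a set \<Rightarrow>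
    'a list set \<Rightarrow> bool" where
  "tau_f_open L C \<sigma> A U \<longleftrightarrow>
     (\<exists>V. openin (tau_f L C \<sigma> A) V \<and> U = (\<Union>p\<in>V. realisations L C \<sigma> A p))"

definition tau_f_inf :: "('s, 'f, 'r) lang \<Rightarrow> ('s, 'f, 'r, 'a) struct \<Rightarrow> 's list \<Rightarrow> 'a set \<Rightarrow>
    (('s, 'f, 'r) fm \<times> 'a list) set topology" where
  "tau_f_inf L C \<sigma> A =
     topology_generated_by
       {(\<lambda>a. tp L C a A) ` U | U. tau_f_open L C \<sigma> A U \<and> type_definable L C \<sigma> A U}"

definition tau_f_inf_open :: "('s, 'f, 'r) lang \<Rightarrow> ('s, 'f, 'r, 'a) struct \<Rightarrow> 's list \<Rightarrow> 'a set \<Rightarrow>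
    'a list set \<Rightarrow> bool" where
  "tau_f_inf_open L C \<sigma> A U \<longleftrightarrow>
     (\<exists>V. openin (tau_f_inf L C \<sigma> A) V \<and> U = (\<Union>p\<in>V. realisations L C \<sigma> A p))"

text \<open>A set of tuples is contained in \<open>acl(A)\<close> if all coordinates of its members are in \<open>acl(A)\<close>.\<close>

definition unbounded :: "('s, 'f, 'r) lang \<Rightarrow> ('s, 'f, 'r, 'a) struct \<Rightarrow> 'a set \<Rightarrow> 'a list set \<Rightarrow> bool"
  where "unbounded L C A U \<longleftrightarrow> \<not> (\<forall>a\<in>U. set a \<subseteq> acl L C A)"

section \<open>Stable independence and the rank\<close>

definition stable_formula :: "('s, 'f, 'r) lang \<Rightarrow> ('s, 'f, 'r, 'a) struct \<Rightarrow> 's list \<Rightarrow> 's list \<Rightarrow>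
    ('s, 'f, 'r) fm \<Rightarrow> bool" where
  "stable_formula L C \<sigma> \<tau> \<phi> \<longleftrightarrow> wff L (\<sigma> @ \<tau>) \<phi> \<and>
     \<not> (\<exists>(a :: nat \<Rightarrow> 'a list) (b :: nat \<Rightarrow> 'a list).
          (\<forall>i. a i \<in> tuples C \<sigma> \<and> b i \<in> tuples C \<tau>) \<and>
          (\<forall>i j. sat C (a i @ b j) \<phi> \<longleftrightarrow> i < j))"

definition stably_indep :: "('s, 'f, 'r) lang \<Rightarrow> ('s, 'f, 'r, 'a) struct \<Rightarrow> 'a list \<Rightarrow> 'a set \<Rightarrow>
    'a set \<Rightarrow> bool" where
  "stably_indep L C a B A \<longleftrightarrow>
     (\<forall>\<sigma> \<tau> \<phi>. \<forall>b\<in>tuples C \<tau>. stable_formula L C \<sigma> \<tau> \<phi> \<and>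
        canonical_parameter C \<sigma> \<phi> b \<in> dcl_imaginaries L C \<tau> B \<and>
        (\<exists>a'\<in>tuples C \<sigma>. set a' \<subseteq> dcl L C (A \<union> set a) \<and> sat C (a' @ b) \<phi>)
        \<longrightarrow> \<not> divides L C A \<sigma> \<phi> b)"

primrec SU_se_ge :: "('s, 'f, 'r) lang \<Rightarrow> ('s, 'f, 'r, 'a) struct \<Rightarrow> 'k rel \<Rightarrow> nat \<Rightarrow> 'a list \<Rightarrow>
    'a set \<Rightarrow> bool" where
  "SU_se_ge L C \<kappa> 0 a A \<longleftrightarrow> True"
| "SU_se_ge L C \<kappa> (Suc n) a A \<longleftrightarrow>
     (\<exists>B0 B1. A \<subseteq> B0 \<and> B0 \<subseteq> B1 \<and> small C \<kappa> B1 \<and>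
        \<not> stably_indep L C a B1 B0 \<and> SU_se_ge L C \<kappa> n a B1)"

text \<open>
  The rank is ordinal valued, with \<open>SU\<^sub>s\<^sub>e(a/A) \<ge> \<omega>\<close> iff \<open>SU\<^sub>s\<^sub>e(a/A) \<ge> n\<close> for all \<open>n < \<omega>\<close>. Only
  finite values need to be told apart here; all values \<open>\<ge> \<omega>\<close> are represented by \<open>\<infinity>\<close>.
\<close>

definition SU_se :: "('s, 'f, 'r) lang \<Rightarrow> ('s, 'f, 'r, 'a) struct \<Rightarrow> 'k rel \<Rightarrow> 'a list \<Rightarrow>
    'a set \<Rightarrow> enat" where
  "SU_se L C \<kappa> a A = (SUP n\<in>{n. SU_se_ge L C \<kappa> n a A}. enat n)"

text \<open>\<open>SU\<^sub>s\<^sub>e(p)\<close> is the rank of any realisation of \<open>p\<close>.\<close>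

definition bounded_finite_SU_se :: "('s, 'f, 'r) lang \<Rightarrow> ('s, 'f, 'r, 'a) struct \<Rightarrow> 'k rel \<Rightarrow>
    's list \<Rightarrow> 'a set \<Rightarrow> 'a list set \<Rightarrow> bool" where
  "bounded_finite_SU_se L C \<kappa> \<sigma> A U \<longleftrightarrow>
     (let R = {SU_se L C \<kappa> a A | p a. p \<in> type_space L C \<sigma> A \<and>
                 realisations L C \<sigma> A p \<subseteq> U \<and> a \<in> realisations L C \<sigma> A p}
      in \<exists>n. enat n \<in> R \<and> (\<forall>r\<in>R. r \<le> enat n))"

end

theory Submission
  imports Defs "HOL-Library.Ramsey" "HOL-Library.Countable" "HOL-Library.Countable_Set_Type"
begin

hide_const (open) Ramsey.indep

text \<open>
  Assume that no unbounded \<open>\<tau>\<^sup>f\<^sub>\<infinity>\<close>-open set over a finite set has bounded finite rank. A condition is a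
  definable relation on tuples \<open>d a\<close> together with finitely many requirements that a stable formula
  \<open>R(x, d a)\<close> forks over an initial segment of \<open>d a\<close>; the elements \<open>a\<close> for which some \<open>d\<close> meets them
  form a set closed under limits along ultrafilters, because a stable formula with bounded ladders
  that forks divides with a bounded number. If a condition contains \<open>a\<close> and \<open>c \<in> dcl(a)\<close> is not
  algebraic, insert \<open>c\<close> into \<open>d a\<close> at the last place where it is not algebraic over what precedes it.
  Split each stable requirement there: what remains about \<open>c\<close> is a type-definable basic open set,
  while the other requirements can be met again on a definable set of values of \<open>c\<close>, since the
  extension property is first-order: an ultraproduct of countable pairs is a saturated model of
  \<open>T\<^sub>E\<^sub>x\<^sub>t\<close>, and a failure along the factors would contradict the extension property in it. By assumption this open set contains
  points of arbitrarily large rank, and a chain of stable dependences witnessing the rank is again a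
  finite set of such requirements. Iterating over all definable functions and all ranks, the limit
  is a nonalgebraic \<open>a\<close> with no nonalgebraic \<open>a' \<in> dcl(a)\<close> of finite rank.
\<close>

section \<open>Tuples and definable predicates\<close>

text \<open>Stability enters through one dichotomy. A stable relation without solutions in a model
  divides over every subset of the model, with a number read off its ladder bound; a relation that
  forks over a set has a conjugate over that set without solutions in a prescribed small model. So
  for stable relations forking survives limits, the number being constant, and is a closed condition
  up to conjugacy. The obstacle is that forking is not first-order in the parameters: replacing c by
  another point may destroy what was required of the coordinates after it. The place of insertion
  answers this. A base reaching beyond it has c in its algebraic closure, and adding c to it does
  not affect forking. A requirement with a shorter base is cut into a part about the coordinates
  before c, a part that also involves c, and a remainder that forks over the coordinates up to and
  including c. Only requirements based beyond c must be met again. They are met over bases enlarged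
  by the tuple that witnesses the rank of the new point, because this tuple is inserted just before
  that point.\<close>

lemma tuples_length: "a \<in> tuples M sg ==> length a = length sg"
 by (auto simp: tuples_def)

lemma tuples_Nil [simp]: "tuples M [] = {[]}"
 by (auto simp: tuples_def)

lemma tuples_Cons [simp]: "x # a \<in> tuples M (s # sg) \<longleftrightarrow> x \<in> carrier_of M s \<and> a \<in> tuples M sg"
 by (auto simp: tuples_def carrier_of_def)

lemma tuples_append: "length a = length sg ==> a @ b \<in> tuples M (sg @ ty) \<longleftrightarrow> a \<in> tuples M sg \<and> b \<in> tuples M ty"
 by (auto simp: tuples_def)

lemma tuples_append2 [simp]: "a \<in> tuples M sg ==> a @ b \<in> tuples M (sg @ ty) \<longleftrightarrow> b \<in> tuples M ty"
 by (simp add: tuples_append tuples_length)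

lemma tuples_appendI: "a \<in> tuples M sg ==> b \<in> tuples M ty ==> a @ b \<in> tuples M (sg @ ty)"
 by simp

lemma tuples_appendE:
 assumes "a \<in> tuples M (sg @ ty)"
 obtains b c where "a = b @ c" "b \<in> tuples M sg" "c \<in> tuples M ty"
proof -
 have "a = take (length sg) a @ drop (length sg) a" by simp
 moreover have "take (length sg) a \<in> tuples M sg" "drop (length sg) a \<in> tuples M ty"
  using assms unfolding tuples_def
  by (auto simp: take_map[symmetric] drop_map[symmetric] dest: in_set_takeD in_set_dropD)
 ultimately show ?thesis using that by blast
qed

lemma tuples_self: "set a \<subseteq> Univ M ==> a \<in> tuples M (map (Sort M) a)"
 by (simp add: tuples_def)

lemma tuples_sorts: "a \<in> tuples M sg ==> map (Sort M) a = sg"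
 by (simp add: tuples_def)

lemma tuples_set: "a \<in> tuples M sg ==> set a \<subseteq> Univ M"
 by (simp add: tuples_def)

lemma tuples_nth: "a \<in> tuples M sg ==> i < length sg ==> a ! i \<in> carrier_of M (sg ! i)"
 by (auto simp: tuples_def carrier_of_def)

lemma tuples_single [simp]: "[x] \<in> tuples M [s] \<longleftrightarrow> x \<in> carrier_of M s"
 by (auto simp: tuples_def carrier_of_def)

lemma tuples_singleE: "a \<in> tuples M [s] ==> (\<And>x. a = [x] ==> x \<in> carrier_of M s ==> thesis) ==> thesis"
 by (auto simp: tuples_def carrier_of_def)

lemma tuples_take: "a \<in> tuples M sg ==> take n a \<in> tuples M (take n sg)"
 by (auto simp: tuples_def take_map[symmetric] dest: in_set_takeD)

lemma tuples_drop: "a \<in> tuples M sg ==> drop n a \<in> tuples M (drop n sg)"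
 by (auto simp: tuples_def drop_map[symmetric] dest: in_set_dropD)

lemma tuples_all_nth:
 "a \<in> tuples M sg \<longleftrightarrow> length a = length sg \<and> (\<forall>i<length sg. a ! i \<in> carrier_of M (sg ! i))"
 by (fastforce simp: tuples_def carrier_of_def list_eq_iff_nth_eq set_conv_nth)

lemma tuples_nonempty:
 assumes "is_struct L M" shows "\<exists>a. a \<in> tuples M sg"
proof (induction sg)
 case (Cons s sg)
 obtain x where "x \<in> carrier_of M s" using assms unfolding is_struct_def by blast
 with Cons show ?case by (metis tuples_Cons)
qed auto

lemma carrier_of_sort: "a \<in> Univ M ==> a \<in> carrier_of M (Sort M a)"
 by (simp add: carrier_of_def)

lemma carrier_of_sortD: "a \<in> carrier_of M s ==> Sort M a = s" "a \<in> carrier_of M s ==> a \<in> Univ M"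
 by (auto simp: carrier_of_def)

section \<open>Renaming of variables\<close>

primrec rent :: "(nat => nat) => 'f trm => 'f trm" where
 "rent r (Var i) = Var (r i)"
| "rent r (App f ts) = App f (map (rent r) ts)"

definition liftr :: "(nat => nat) => nat => nat" where
 "liftr r i = (case i of 0 => 0 | Suc j => Suc (r j))"

primrec ren :: "(nat => nat) => ('s, 'f, 'r) fm => ('s, 'f, 'r) fm" where
 "ren r Fls = Fls"
| "ren r (Eq t u) = Eq (rent r t) (rent r u)"
| "ren r (Rel q ts) = Rel q (map (rent r) ts)"
| "ren r (Neg phi) = Neg (ren r phi)"
| "ren r (Conj phi psi) = Conj (ren r phi) (ren r psi)"
| "ren r (Ex s phi) = Ex s (ren (liftr r) phi)"

definition ren_ok :: "(nat => nat) => 's list => 's list => bool" where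
 "ren_ok r sg' sg \<longleftrightarrow> (\<forall>i<length sg'. r i < length sg \<and> sg ! r i = sg' ! i)"

lemma ren_ok_lift: "ren_ok r sg' sg ==> ren_ok (liftr r) (s # sg') (s # sg)"
 by (auto simp: ren_ok_def liftr_def less_Suc_eq_0_disj)

lemma has_sort_rent: "has_sort L sg' t s ==> ren_ok r sg' sg ==> has_sort L sg (rent r t) s"
proof (induction rule: has_sort.induct)
 case (1 i)
 then have "has_sort L sg (Var (r i)) (sg ! r i)" by (intro has_sort.intros) (auto simp: ren_ok_def)
 with 1 show ?case by (auto simp: ren_ok_def)
next
 case (2 f ts)
 have "list_all2 (has_sort L sg) (map (rent r) ts) (Fdom L f)"
  using 2 by (auto simp: list_all2_conv_all_nth)
 then show ?case using 2 by (auto intro: has_sort.intros)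
qed

lemma teval_rent:
 "has_sort L sg' t s ==> (\<And>i. i < length sg' ==> e ! r i = e' ! i) ==> teval M e (rent r t) = teval M e' t"
proof (induction rule: has_sort.induct)
 case (2 f ts)
 then have "map (teval M e \<circ> rent r) ts = map (teval M e') ts"
  by (auto simp: list_all2_conv_all_nth in_set_conv_nth)
 then show ?case by (simp only: rent.simps teval.simps map_map)
qed auto

lemma wff_ren: "wff L sg' phi ==> ren_ok r sg' sg ==> wff L sg (ren r phi)"
proof (induction phi arbitrary: sg sg' r)
 case (Eq t u) then show ?case by (auto intro: has_sort_rent)
next
 case (Rel q ts) then show ?case by (auto simp: list_all2_conv_all_nth intro: has_sort_rent)
next
 case (Ex s phi) then show ?case using ren_ok_lift by fastforce
qed auto

text \<open>Well-sortedness confines the variables of the formula to positions below the length of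
  its context, so the renaming may be arbitrary beyond them. Renamings that are chosen by
  \<open>SOME\<close> are only controlled on that range.\<close>

lemma sat_ren:
 "wff L sg' phi ==> (\<And>i. i < length sg' ==> e ! r i = e' ! i) ==> sat M e (ren r phi) = sat M e' phi"
proof (induction phi arbitrary: sg' e e' r)
 case (Eq t u) then show ?case by (auto simp: teval_rent)
next
 case (Rel q ts)
 then have "map (teval M e \<circ> rent r) ts = map (teval M e') ts"
  by (auto simp: list_all2_conv_all_nth in_set_conv_nth) (metis teval_rent)
 then show ?case by (simp only: ren.simps sat.simps map_map)
next
 case (Ex s phi)
 have "sat M (a # e) (ren (liftr r) phi) = sat M (a # e') phi" for a
 proof (rule Ex.IH)
  show "wff L (s # sg') phi" using Ex.prems by simp
  show "(a # e) ! liftr r i = (a # e') ! i" if "i < length (s # sg')" for i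
   using that Ex.prems by (cases i) (auto simp: liftr_def)
 qed
 then show ?case by simp
next
 case (Conj phi psi)
 then show ?case by (metis ren.simps(5) sat.simps(5) wff.simps(5))
next
 case (Neg phi)
 then show ?case by (metis ren.simps(4) sat.simps(4) wff.simps(4))
qed auto

section \<open>Definable predicates, definable relations and coordinate maps\<close>

text \<open>A predicate on valuations stands for any formula that agrees with it on well-sorted
  tuples. Off these tuples it is unconstrained, so predicates can be built freely from
  \<open>take\<close>, \<open>drop\<close> and \<open>(!)\<close>.\<close>

definition defp :: "('s, 'f, 'r) lang => ('s, 'f, 'r, 'a) struct => 's list => ('a list => bool) => bool" where
 "defp L M sg P \<longleftrightarrow> (\<exists>phi. wff L sg phi \<and> (\<forall>a\<in>tuples M sg. P a \<longleftrightarrow> sat M a phi))"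

lemma defp_wff: "wff L sg phi ==> defp L M sg (\<lambda>a. sat M a phi)"
 by (auto simp: defp_def)

lemma defp_cong: "defp L M sg P ==> (\<And>a. a \<in> tuples M sg ==> P a = Q a) ==> defp L M sg Q"
 by (auto simp: defp_def)

lemma defp_neg: "defp L M sg P ==> defp L M sg (\<lambda>a. \<not> P a)"
 unfolding defp_def by (metis sat.simps(4) wff.simps(4))

lemma defp_conj: "defp L M sg P ==> defp L M sg Q ==> defp L M sg (\<lambda>a. P a \<and> Q a)"
 unfolding defp_def by (metis sat.simps(5) wff.simps(5))

lemma defp_disj: "defp L M sg P ==> defp L M sg Q ==> defp L M sg (\<lambda>a. P a \<or> Q a)"
 using defp_neg[OF defp_conj[OF defp_neg defp_neg], of L M sg P Q] by simp

lemma defp_imp: "defp L M sg P ==> defp L M sg Q ==> defp L M sg (\<lambda>a. P a --> Q a)"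
 by (rule defp_cong[OF defp_disj[OF defp_neg, of L M sg P Q]]) auto

lemma defp_iff: "defp L M sg P ==> defp L M sg Q ==> defp L M sg (\<lambda>a. P a = Q a)"
 using defp_conj[OF defp_imp[of L M sg P Q] defp_imp[of L M sg Q P]]
 by (rule defp_cong) auto

lemma defp_const: "defp L M sg (\<lambda>a. b)"
proof -
 have "defp L M sg (\<lambda>a. sat M a Fls)" by (rule defp_wff) simp
 then have F: "defp L M sg (\<lambda>a. False)" by simp
 show ?thesis using F defp_neg[OF F] by (cases b) auto
qed

lemma defp_ball: "finite I ==> (\<And>i. i \<in> I ==> defp L M sg (P i)) ==> defp L M sg (\<lambda>a. \<forall>i\<in>I. P i a)"
 by (induction I rule: finite_induct) (auto intro: defp_const defp_conj)

lemma defp_ex1: "defp L M (s # sg) P ==> defp L M sg (\<lambda>a. \<exists>x\<in>carrier_of M s. P (x # a))"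
proof -
 assume "defp L M (s # sg) P"
 then obtain phi where "wff L (s # sg) phi" "\<forall>a\<in>tuples M (s # sg). P a \<longleftrightarrow> sat M a phi"
  by (auto simp: defp_def)
 then have "wff L sg (Ex s phi) \<and> (\<forall>a\<in>tuples M sg. (\<exists>x\<in>carrier_of M s. P (x # a)) \<longleftrightarrow> sat M a (Ex s phi))"
  by auto
 then show ?thesis unfolding defp_def by blast
qed

text \<open>Maps that select, repeat and reorder coordinates. Precomposition with them is
  substitution of variables (\<open>defp_coord\<close>), and their closure under composition and
  concatenation takes over the bookkeeping of de Bruijn indices.\<close>

definition coord :: "'s list => 's list => ('a list => 'a list) => bool" where
 "coord sg sg' r \<longleftrightarrow> (\<exists>ix. (\<forall>i\<in>set ix. i < length sg) \<and> sg' = map ((!) sg) ix \<and>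
  (\<forall>a. length a = length sg --> r a = map ((!) a) ix))"

lemma coord_tuples: "coord sg sg' r ==> a \<in> tuples M sg ==> r a \<in> tuples M sg'"
 unfolding coord_def tuples_all_nth by (elim exE conjE) simp

lemma defp_coord:
 assumes "defp L M sg' P" "coord sg sg' r" shows "defp L M sg (\<lambda>a. P (r a))"
proof -
 obtain phi where phi: "wff L sg' phi" "\<forall>a\<in>tuples M sg'. P a \<longleftrightarrow> sat M a phi"
  using assms(1) by (auto simp: defp_def)
 obtain ix where ix: "\<forall>i\<in>set ix. i < length sg" "sg' = map ((!) sg) ix"
  "\<And>a. length a = length sg ==> r a = map ((!) a) ix"
  using assms(2) by (fastforce simp: coord_def)
 have ok: "ren_ok ((!) ix) sg' sg" using ix by (auto simp: ren_ok_def)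
 have "P (r a) \<longleftrightarrow> sat M a (ren ((!) ix) phi)" if "a \<in> tuples M sg" for a
 proof -
  have "sat M a (ren ((!) ix) phi) = sat M (r a) phi"
   by (rule sat_ren[OF phi(1)]) (use ix that in \<open>auto simp: tuples_length\<close>)
  then show ?thesis using phi(2) coord_tuples[OF assms(2) that] by simp
 qed
 then show ?thesis unfolding defp_def using wff_ren[OF phi(1) ok] by blast
qed

lemma coord_id: "coord sg sg (\<lambda>a. a)"
 unfolding coord_def by (rule exI[of _ "[0..<length sg]"]) (auto intro: nth_equalityI)

lemma coord_append:
 assumes "coord sg sg1 r1" "coord sg sg2 r2" shows "coord sg (sg1 @ sg2) (\<lambda>a. r1 a @ r2 a)"
proof -
 from assms obtain ix1 ix2 where "(\<forall>i\<in>set ix1. i < length sg) \<and> sg1 = map ((!) sg) ix1 \<and>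
  (\<forall>a. length a = length sg --> r1 a = map ((!) a) ix1)"
  "(\<forall>i\<in>set ix2. i < length sg) \<and> sg2 = map ((!) sg) ix2 \<and>
  (\<forall>a. length a = length sg --> r2 a = map ((!) a) ix2)" unfolding coord_def by blast
 then show ?thesis unfolding coord_def by (intro exI[of _ "ix1 @ ix2"]) auto
qed

lemma coord_comp:
 assumes "coord sg sg1 r1" "coord sg1 sg2 r2" shows "coord sg sg2 (\<lambda>a. r2 (r1 a))"
proof -
 from assms obtain ix1 ix2 where 1: "(\<forall>i\<in>set ix1. i < length sg) \<and> sg1 = map ((!) sg) ix1 \<and>
  (\<forall>a. length a = length sg --> r1 a = map ((!) a) ix1)"
  "(\<forall>i\<in>set ix2. i < length sg1) \<and> sg2 = map ((!) sg1) ix2 \<and>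
  (\<forall>a. length a = length sg1 --> r2 a = map ((!) a) ix2)" unfolding coord_def by blast
 show ?thesis unfolding coord_def
  by (rule exI[of _ "map ((!) ix1) ix2"]) (use 1 in auto)
qed

lemma coord_take: "coord sg (take n sg) (take n)"
 unfolding coord_def
 by (rule exI[of _ "[0..<min n (length sg)]"]) (auto intro!: nth_equalityI)

lemma coord_drop: "coord sg (drop n sg) (drop n)"
 unfolding coord_def
 by (rule exI[of _ "[n..<length sg]"]) (auto intro!: nth_equalityI)

lemma coord_take': "ty = take n sg ==> coord sg ty (take n)"
 and coord_drop': "ty = drop n sg ==> coord sg ty (drop n)"
 by (simp_all add: coord_take coord_drop)

lemma coord_slice: "ty = take m (drop n sg) ==> coord sg ty (\<lambda>a. take m (drop n a))"
 by (auto intro: coord_comp[OF coord_drop coord_take])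

lemma coord_nil: "coord sg [] (\<lambda>a. [])"
 unfolding coord_def by (rule exI[of _ "[]"]) auto

lemma coord_nth: "i < length sg ==> s = sg ! i ==> coord sg [s] (\<lambda>a. [a ! i])"
 unfolding coord_def by (rule exI[of _ "[i]"]) auto

lemma coord_map_nth: "(\<forall>i\<in>set ix. i < length sg) ==> ty = map ((!) sg) ix ==> coord sg ty (\<lambda>a. map ((!) a) ix)"
 unfolding coord_def by (rule exI[of _ "ix"]) auto

lemma defp_eq: "i < length sg ==> j < length sg ==> sg ! i = sg ! j ==> defp L M sg (\<lambda>a. a ! i = a ! j)"
proof -
 assume "i < length sg" "j < length sg" "sg ! i = sg ! j"
 then have "wff L sg (Eq (Var i) (Var j))" by (auto intro: has_sort.intros) (metis has_sort.intros(1))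
 then have "defp L M sg (\<lambda>a. sat M a (Eq (Var i) (Var j)))" by (rule defp_wff)
 then show ?thesis by simp
qed

lemma defp_ex: "defp L M (xi @ sg) P ==> defp L M sg (\<lambda>a. \<exists>x\<in>tuples M xi. P (x @ a))"
proof (induction xi arbitrary: P)
 case Nil then show ?case by simp
next
 case (Cons s xi)
 have "defp L M (xi @ sg) (\<lambda>a. \<exists>y\<in>carrier_of M s. P (y # a))"
  using defp_ex1[of L M s "xi @ sg" P] Cons.prems by simp
 from Cons.IH[OF this] show ?case
 proof (rule defp_cong)
  fix a
  show "(\<exists>x\<in>tuples M xi. \<exists>y\<in>carrier_of M s. P (y # x @ a)) = (\<exists>x\<in>tuples M (s # xi). P (x @ a))"
  proof
   assume "\<exists>x\<in>tuples M xi. \<exists>y\<in>carrier_of M s. P (y # x @ a)"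
   then show "\<exists>x\<in>tuples M (s # xi). P (x @ a)" by (metis append_Cons tuples_Cons)
  next
   assume "\<exists>x\<in>tuples M (s # xi). P (x @ a)"
   then obtain x where x: "x \<in> tuples M (s # xi)" "P (x @ a)" by blast
   then obtain y z where "x = y # z" by (cases x) (auto simp: tuples_def)
   with x show "\<exists>x\<in>tuples M xi. \<exists>y\<in>carrier_of M s. P (y # x @ a)" by auto
  qed
 qed
qed

lemma defp_all: "defp L M (xi @ sg) P ==> defp L M sg (\<lambda>a. \<forall>x\<in>tuples M xi. P (x @ a))"
 using defp_neg[OF defp_ex[OF defp_neg, of L M xi sg P]] by simp

lemma defp_sat_append:
 assumes "wff L (sg1 @ sg2) phi" "coord sg sg1 r1" "coord sg sg2 r2"
 shows "defp L M sg (\<lambda>a. sat M (r1 a @ r2 a) phi)"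
 using defp_coord[OF defp_wff[OF assms(1)] coord_append[OF assms(2,3)]] .

text \<open>The same as \<open>defp\<close> for the concatenated tuple, but with variables
  \<open>x\<close> and parameters \<open>d\<close> kept apart: stability and dividing treat the two
  arguments differently.\<close>

definition def2 :: "('s, 'f, 'r) lang => ('s, 'f, 'r, 'a) struct => 's list => 's list => ('a list => 'a list => bool) => bool" where
 "def2 L M xi ty R \<longleftrightarrow> (\<exists>psi. wff L (xi @ ty) psi \<and> (\<forall>x\<in>tuples M xi. \<forall>d\<in>tuples M ty. R x d \<longleftrightarrow> sat M (x @ d) psi))"

lemma def2_wff: "wff L (xi @ ty) psi ==> def2 L M xi ty (\<lambda>x d. sat M (x @ d) psi)"
 unfolding def2_def by blast

lemma def2_defp:
 assumes "def2 L M xi ty R" "coord sg xi r1" "coord sg ty r2"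
 shows "defp L M sg (\<lambda>a. R (r1 a) (r2 a))"
proof -
 obtain psi where psi: "wff L (xi @ ty) psi" "\<forall>x\<in>tuples M xi. \<forall>d\<in>tuples M ty. R x d \<longleftrightarrow> sat M (x @ d) psi"
  using assms(1) by (auto simp: def2_def)
 show ?thesis
  by (rule defp_cong[OF defp_sat_append[OF psi(1) assms(2,3)]])
   (use psi(2) assms coord_tuples in blast)
qed

lemma defp_def2:
 assumes "defp L M (xi @ ty) (\<lambda>a. R (take (length xi) a) (drop (length xi) a))"
 shows "def2 L M xi ty R"
proof -
 obtain phi where phi: "wff L (xi @ ty) phi"
  "\<forall>a\<in>tuples M (xi @ ty). R (take (length xi) a) (drop (length xi) a) \<longleftrightarrow> sat M a phi"
  using assms by (auto simp: defp_def)
 have "R x d \<longleftrightarrow> sat M (x @ d) phi" if "x \<in> tuples M xi" "d \<in> tuples M ty" for x d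
  using phi(2)[rule_format, of "x @ d"] that by (simp add: tuples_length)
 then show ?thesis unfolding def2_def using phi(1) by blast
qed

lemma coord_fst: "coord (xi @ ty) xi (take (length xi))"
 and coord_snd: "coord (xi @ ty) ty (drop (length xi))"
 by (auto intro!: coord_take' coord_drop')

lemma def2_cong: "def2 L M xi ty R ==> (\<And>x d. x \<in> tuples M xi ==> d \<in> tuples M ty ==> R x d = S x d) ==> def2 L M xi ty S"
 unfolding def2_def by auto

lemma def2_coord:
 assumes "def2 L M xi ty R" "coord xi' xi r1" "coord ty' ty r2"
 shows "def2 L M xi' ty' (\<lambda>x d. R (r1 x) (r2 d))"
 by (rule defp_def2) (rule def2_defp[OF assms(1) coord_comp[OF coord_fst assms(2)] coord_comp[OF coord_snd assms(3)]])

lemma def2_neg: "def2 L M xi ty R ==> def2 L M xi ty (\<lambda>x d. \<not> R x d)"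
 by (rule defp_def2) (intro defp_neg def2_defp[OF _ coord_fst coord_snd])

lemma def2_conj: "def2 L M xi ty R ==> def2 L M xi ty S ==> def2 L M xi ty (\<lambda>x d. R x d \<and> S x d)"
 by (rule defp_def2) (intro defp_conj def2_defp[OF _ coord_fst coord_snd])

lemma def2_swap: "def2 L M xi ty R ==> def2 L M ty xi (\<lambda>d x. R x d)"
 by (rule defp_def2) (rule def2_defp[OF _ coord_snd coord_fst])

lemma def2_param: "defp L M ty P ==> def2 L M xi ty (\<lambda>x d. P d)"
 by (rule defp_def2) (rule defp_coord[OF _ coord_snd])

section \<open>Ultrafilters\<close>

text \<open>With ultrafilters as values of type \<open>filter\<close>, \<open>eventually\<close>
  plays the role of truth in an ultraproduct and commutes with all connectives.\<close>

definition ultra :: "'i filter => bool" where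
 "ultra F \<longleftrightarrow> F \<noteq> bot \<and> (\<forall>P. eventually P F \<or> eventually (\<lambda>x. \<not> P x) F)"

lemma finite_chain_min:
 fixes X :: "'i filter set"
 assumes "finite X" "X \<noteq> {}" "\<And>a b. a \<in> X ==> b \<in> X ==> a \<le> b \<or> b \<le> a"
 shows "\<exists>m\<in>X. \<forall>a\<in>X. m \<le> a"
 using assms
proof (induction X rule: finite_ne_induct)
 case (insert x X)
 then obtain m where m: "m \<in> X" "\<forall>a\<in>X. m \<le> a" by auto
 then have "x \<le> m \<or> m \<le> x" using insert.prems by blast
 then show ?case using m by (auto intro: order_trans)
qed auto

text \<open>Zorn for the reversed order. The infimum of a chain is proper because a nonempty finite
  subset of the chain has a least member, which is its infimum.\<close>

lemma ultra_exists:
 fixes F :: "'i filter"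
 assumes "F \<noteq> bot" shows "\<exists>U. U \<le> F \<and> ultra U"
proof -
 define A where "A = {G. G \<le> F \<and> G \<noteq> bot}"
 have "\<exists>m\<in>A. \<forall>a\<in>A. a \<le> m --> a = m"
 proof (rule predicate_Zorn[where P = "\<lambda>G H. H \<le> G"])
  show "partial_order_on A (relation_of (\<lambda>G H. H \<le> G) A)"
   by (rule partial_order_on_relation_ofI) auto
  fix Ch assume "Ch \<in> Chains (relation_of (\<lambda>G H. H \<le> G) A)"
  then have Ch: "Ch \<subseteq> A" "\<And>a b. a \<in> Ch ==> b \<in> Ch ==> a \<le> b \<or> b \<le> a"
   unfolding Chains_def relation_of_def by auto
  show "\<exists>u\<in>A. \<forall>a\<in>Ch. u \<le> a"
  proof (cases "Ch = {}")
   case True then show ?thesis using assms by (auto simp: A_def)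
  next
   case False
   have "Inf Ch \<noteq> bot"
   proof (rule Inf_filter_not_bot)
    fix X assume X: "X \<subseteq> Ch" "finite X"
    show "Inf X \<noteq> bot"
    proof (cases "X = {}")
     case True
     have "(top :: 'i filter) \<noteq> bot"
     proof
      assume "(top :: 'i filter) = bot"
      then have "F \<le> bot" using top_greatest[of F] by (simp only:)
      with assms show False by (simp add: bot_unique)
     qed
     then show ?thesis using True by simp
    next
     case False
     then obtain m where m: "m \<in> X" "\<forall>a\<in>X. m \<le> a"
      using finite_chain_min[OF X(2) False] Ch(2) X(1) by blast
     then have "Inf X = m" by (intro antisym) (auto intro: Inf_lower Inf_greatest)
     then show ?thesis using m X Ch by (auto simp: A_def)
    qed
   qed
   moreover have "Inf Ch \<le> F"
   proof -
    obtain G where "G \<in> Ch" using False by blast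
    then show ?thesis using Ch(1) by (intro Inf_lower2[of G]) (auto simp: A_def)
   qed
   ultimately show ?thesis by (intro bexI[of _ "Inf Ch"]) (auto simp: A_def intro: Inf_lower)
  qed
 qed
 then obtain m where m: "m \<le> F" "m \<noteq> bot" "\<And>a. a \<le> F ==> a \<noteq> bot ==> a \<le> m ==> a = m"
  by (auto simp: A_def)
 have "eventually P m \<or> eventually (\<lambda>x. \<not> P x) m" for P
 proof (rule disjCI)
  assume ne: "\<not> eventually (\<lambda>x. \<not> P x) m"
  \<comment> \<open>Restricting \<open>m\<close> to \<open>P\<close> gives a proper filter below
    \<open>m\<close>, hence \<open>m\<close> itself by minimality.\<close>
  have "inf m (principal {x. P x}) \<noteq> bot"
   using ne by (simp add: trivial_limit_def eventually_inf_principal)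
  then have "inf m (principal {x. P x}) = m" using m(3) m(1)
   by (meson inf.cobounded1 order_trans)
  moreover have "eventually P (inf m (principal {x. P x}))" by (simp add: eventually_inf_principal)
  ultimately show "eventually P m" by simp
 qed
 with m show ?thesis by (auto simp: ultra_def)
qed

lemma ultra_not: "ultra F ==> eventually (\<lambda>x. \<not> P x) F \<longleftrightarrow> \<not> eventually P F"
proof -
 assume u: "ultra F"
 have "\<not> (eventually P F \<and> eventually (\<lambda>x. \<not> P x) F)"
 proof
  assume "eventually P F \<and> eventually (\<lambda>x. \<not> P x) F"
  then have "eventually (\<lambda>x. P x \<and> \<not> P x) F" by (simp only: eventually_conj_iff)
  then show False using u by (simp add: ultra_def)
 qed
 then show ?thesis using u unfolding ultra_def by blast
qed

lemma ultra_conj: "eventually (\<lambda>x. P x \<and> Q x) F \<longleftrightarrow> eventually P F \<and> eventually Q F"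
 by (simp add: eventually_conj_iff)

lemma ultra_const: "ultra F ==> eventually (\<lambda>x. P) F \<longleftrightarrow> P"
 by (auto simp: ultra_def)

section \<open>The monster model\<close>

text \<open>The assumption \<open>strong\<close> makes the continuum small, and with it the
  ultraproduct of a sequence of countable structures and the set of branches of a countable tree of
  parameters.\<close>

locale monster_model =
 fixes L :: "('s, 'f, 'r) lang" and C :: "('s, 'f, 'r, 'a) struct" and \<kappa> :: "'k rel"
 assumes struct: "is_struct L C" and card: "Card_order \<kappa>"
  and ctbl: "countable (formulas L)" and tcard: "theory_card L <o \<kappa>"
  and strong: "\<And>X. X \<subseteq> Field \<kappa> ==> |X| <o \<kappa> ==> |Pow X| <o \<kappa>"
  and sat: "saturated L C \<kappa>" and hom: "strongly_homogeneous L C \<kappa>"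
begin

abbreviation "tup \<equiv> tuples C"
abbreviation "car \<equiv> carrier_of C"
abbreviation "srt \<equiv> map (Sort C)"
abbreviation "aut \<equiv> automorphism L C"
abbreviation "U \<equiv> Univ C"

text \<open>Smallness for sets of any type: the index sets of limits and of compactness arguments
  are not subsets of the monster model.\<close>

definition sm :: "'x set => bool" where "sm A \<longleftrightarrow> |A| <o \<kappa>"

lemma infinite_formulas: "infinite (formulas L)"
proof
 assume fin: "finite (formulas L)"
 have "wff L [] ((Neg ^^ n) Fls)" for n by (induction n) auto
 then have "range (\<lambda>n. (Neg ^^ n) Fls) \<subseteq> formulas L" by (auto simp: formulas_def)
 moreover have "inj (\<lambda>n. (Neg ^^ n) (Fls :: ('s, 'f, 'r) fm))"
 proof (rule injI)
  fix m n :: nat assume "(Neg ^^ m) (Fls :: ('s, 'f, 'r) fm) = (Neg ^^ n) Fls"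
  then show "m = n"
  proof (induction m arbitrary: n)
   case 0 then show ?case by (cases n) auto
  next
   case (Suc m) then show ?case by (cases n) auto
  qed
 qed
 ultimately show False using fin finite_subset range_inj_infinite by blast
qed

lemma natLeq_theory_card: "natLeq \<le>o theory_card L"
 unfolding theory_card_def using infinite_formulas infinite_iff_natLeq_ordLeq by blast

lemma infinite_Field: "infinite (Field \<kappa>)"
 using tcard natLeq_theory_card card
 by (metis Card_order_iff_ordLeq_card_of infinite_iff_natLeq_ordLeq
   ordLeq_ordLess_trans ordLess_imp_ordLeq ordLess_ordLeq_trans)

lemma sm_Un: "sm A ==> sm B ==> sm (A \<union> B)"
 unfolding sm_def by (rule card_of_Un_ordLess_infinite_Field[OF infinite_Field card])

lemma sm_mono: "A \<subseteq> B ==> sm B ==> sm A"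
 unfolding sm_def using card_of_mono1 ordLeq_ordLess_trans by blast

lemma sm_image: "sm A ==> sm (f ` A)"
 unfolding sm_def using card_of_image ordLeq_ordLess_trans by blast

lemma sm_ordLeq: "|A| \<le>o |B| ==> sm B ==> sm A"
 unfolding sm_def using ordLeq_ordLess_trans by blast

lemma sm_theory: "|A| \<le>o theory_card L ==> sm A"
 unfolding sm_def using tcard ordLeq_ordLess_trans by blast

lemma countable_theory: "countable A ==> |A| \<le>o theory_card L"
proof -
 assume "countable A"
 then have "|A| \<le>o natLeq" by (simp add: countable_card_le_natLeq)
 then show ?thesis using natLeq_theory_card ordLeq_transitive by blast
qed

lemma theory_countable: "|A| \<le>o theory_card L ==> countable A"
 using ctbl unfolding theory_card_def countable_card_le_natLeq using ordLeq_transitive by blast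

lemma sm_countable: "countable A ==> sm A"
 using countable_theory sm_theory by blast

lemma sm_finite: "finite A ==> sm A"
 by (simp add: countable_finite sm_countable)

text \<open>The strong limit property speaks of subsets of \<open>Field \<kappa>\<close> only, so
  the power set of \<open>nat\<close> is first embedded into that of a countable subset of this
  field.\<close>

lemma sm_Pow_nat: "sm (X :: nat set set)"
proof -
 obtain Y :: "'k set" where Y: "Y \<subseteq> Field \<kappa>" "countable Y" "infinite Y"
  using infinite_Field infinite_countable_subset'[of "Field \<kappa>"] by blast
 then have "sm (Pow Y)" using strong sm_countable unfolding sm_def by blast
 moreover obtain g :: "nat => 'k" where "inj g" "range g \<subseteq> Y"
  using Y infinite_countable_subset by blast
 then have "inj_on ((`) g) X \<and> ((`) g) ` X \<subseteq> Pow Y"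
  by (auto simp: inj_on_def inj_image_eq_iff)
 then have "|X| \<le>o |Pow Y|" using card_of_ordLeq by blast
 ultimately show ?thesis using sm_ordLeq by blast
qed

lemma sm_Plus: "sm A ==> sm B ==> sm (Inl ` A \<union> Inr ` B)"
 by (intro sm_Un sm_image)

subsection \<open>Limits along ultrafilters\<close>

text \<open>\<open>e\<close> is a limit along \<open>F\<close> of the sequences \<open>f j\<close>,
  one for each name \<open>j\<close> of sort \<open>v j\<close>: the family \<open>e\<close> has the
  type that the sequences have in the ultraproduct. One implication is enough, since for an
  ultrafilter the converse follows from negations (\<open>lcorD\<close>).\<close>

definition lcor :: "'i filter => 'j set => ('j => 's) => ('j => 'i => 'a) => ('j => 'a) => bool" where
 "lcor F J v f e \<longleftrightarrow> (\<forall>j\<in>J. e j \<in> car (v j)) \<and>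
  (\<forall>idx phi. set idx \<subseteq> J \<and> wff L (map v idx) phi \<and> eventually (\<lambda>i. sat C (map (\<lambda>j. f j i) idx) phi) F
    --> sat C (map e idx) phi)"

lemma map_tuples: "(\<And>j. j \<in> set idx ==> e j \<in> car (v j)) ==> map e idx \<in> tup (map v idx)"
 by (auto simp: tuples_def carrier_of_def)

lemma lcorD:
 assumes "ultra F" "lcor F J v f e" "set idx \<subseteq> J" "defp L C (map v idx) P"
  "\<And>j i. j \<in> J ==> f j i \<in> car (v j)"
 shows "P (map e idx) \<longleftrightarrow> eventually (\<lambda>i. P (map (\<lambda>j. f j i) idx)) F"
proof -
 obtain phi where phi: "wff L (map v idx) phi" "\<forall>a\<in>tup (map v idx). P a \<longleftrightarrow> sat C a phi"
  using assms(4) by (auto simp: defp_def)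
 have 1: "map e idx \<in> tup (map v idx)" using assms(2,3)
  by (intro map_tuples) (auto simp: lcor_def)
 have 2: "map (\<lambda>j. f j i) idx \<in> tup (map v idx)" for i using assms(3,5)
  by (intro map_tuples) auto
 have "sat C (map e idx) phi \<longleftrightarrow> eventually (\<lambda>i. sat C (map (\<lambda>j. f j i) idx) phi) F"
 proof
  assume s: "sat C (map e idx) phi"
  show "eventually (\<lambda>i. sat C (map (\<lambda>j. f j i) idx) phi) F"
  proof (rule ccontr)
   assume "\<not> ?thesis"
   then have "eventually (\<lambda>i. sat C (map (\<lambda>j. f j i) idx) (Neg phi)) F"
    using ultra_not[OF assms(1)] by simp
   moreover have "wff L (map v idx) (Neg phi)" using phi(1) by simp
   ultimately have "sat C (map e idx) (Neg phi)" using assms(2,3) unfolding lcor_def by blast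
   with s show False by simp
  qed
 qed (use assms(2,3) phi(1) in \<open>auto simp: lcor_def\<close>)
 then show ?thesis using 1 2 phi(2) by simp
qed

text \<open>Zorn gives a maximal partial limit that extends \<open>e0\<close>; by saturation one
  more element could be added, so it is total. Prescribing \<open>e0\<close> on \<open>S\<close> is
  what keeps parameters fixed in \<open>compactness\<close>.\<close>

lemma ulim_ext:
 fixes f :: "'j => 'i => 'a"
 assumes F: "ultra F" and J: "sm J" and S: "S \<subseteq> J"
  and f: "\<And>j i. j \<in> J ==> f j i \<in> car (v j)"
  and e0: "lcor F S v f e0"
 shows "\<exists>e. (\<forall>j\<in>S. e j = e0 j) \<and> lcor F J v f e"
proof -
 \<comment> \<open>Partial limits are sets of pairs rather than functions. Single-valuedness is not
   imposed: it follows from the equality formula, applied to two values of one name.\<close>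
 define ok where "ok G \<longleftrightarrow> G \<subseteq> J \<times> U \<and> (\<forall>ps phi. set ps \<subseteq> G --> (\<forall>p\<in>set ps. snd p \<in> car (v (fst p))) \<and>
  (wff L (map (\<lambda>p. v (fst p)) ps) phi \<and> eventually (\<lambda>i. sat C (map (\<lambda>p. f (fst p) i) ps) phi) F
   --> sat C (map snd ps) phi))" for G :: "('j \<times> 'a) set"
 define G0 where "G0 = (\<lambda>j. (j, e0 j)) ` S"
 have ok0: "ok G0"
  unfolding ok_def
 proof (intro conjI allI impI ballI)
  show "G0 \<subseteq> J \<times> U" using S e0 by (auto simp: G0_def lcor_def carrier_of_def)
  fix ps phi assume ps: "set ps \<subseteq> G0"
  then have snd: "\<And>p. p \<in> set ps ==> snd p = e0 (fst p) \<and> fst p \<in> S" by (auto simp: G0_def)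
  show "snd p \<in> car (v (fst p))" if "p \<in> set ps" for p using snd[OF that] e0 by (auto simp: lcor_def)
  assume a: "wff L (map (\<lambda>p. v (fst p)) ps) phi \<and> eventually (\<lambda>i. sat C (map (\<lambda>p. f (fst p) i) ps) phi) F"
  have "sat C (map e0 (map fst ps)) phi"
  proof -
   have "set (map fst ps) \<subseteq> S" using snd by auto
   moreover have "map v (map fst ps) = map (\<lambda>p. v (fst p)) ps"
    "\<And>i. map (\<lambda>j. f j i) (map fst ps) = map (\<lambda>p. f (fst p) i) ps" by simp_all
   then have "wff L (map v (map fst ps)) phi \<and> eventually (\<lambda>i. sat C (map (\<lambda>j. f j i) (map fst ps)) phi) F"
    using a by (simp only: simp_thms)
   ultimately show ?thesis using e0 unfolding lcor_def by blast
  qed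
  moreover have "map e0 (map fst ps) = map snd ps" using snd by auto
  ultimately show "sat C (map snd ps) phi" by metis
 qed
 have "\<exists>G. ok G \<and> G0 \<subseteq> G \<and> (\<forall>H. ok H --> G \<subseteq> H --> H = G)"
 proof -
  have "\<exists>M\<in>{G. ok G \<and> G0 \<subseteq> G}. \<forall>X\<in>{G. ok G \<and> G0 \<subseteq> G}. M \<subseteq> X --> X = M"
  proof (rule subset_Zorn_nonempty)
   show "{G. ok G \<and> G0 \<subseteq> G} \<noteq> {}" using ok0 by auto
   fix Ch assume Ch: "Ch \<noteq> {}" "subset.chain {G. ok G \<and> G0 \<subseteq> G} Ch"
   have sub: "\<exists>G\<in>Ch. set ps \<subseteq> G" if "set ps \<subseteq> \<Union>Ch" for ps
    using that
   proof (induction ps)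
    case Nil then show ?case using Ch(1) by auto
   next
    case (Cons p ps)
    then obtain G H where "G \<in> Ch" "set ps \<subseteq> G" "H \<in> Ch" "p \<in> H" by auto
    moreover then have "G \<subseteq> H \<or> H \<subseteq> G" using Ch(2) unfolding subset.chain_def by blast
    ultimately show ?case by (metis insert_subset list.simps(15) subset_trans in_mono)
   qed
   have "ok (\<Union>Ch)" unfolding ok_def
   proof (intro conjI allI impI ballI)
    show "\<Union>Ch \<subseteq> J \<times> U" using Ch(2) unfolding subset.chain_def ok_def by blast
    fix ps phi assume "set ps \<subseteq> \<Union>Ch"
    then obtain G where G: "G \<in> Ch" "set ps \<subseteq> G" using sub by blast
    then have okG: "ok G" using Ch(2) unfolding subset.chain_def by blast
    show "snd p \<in> car (v (fst p))" if "p \<in> set ps" for p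
     using okG G(2) that unfolding ok_def by blast
    show "wff L (map (\<lambda>p. v (fst p)) ps) phi \<and> eventually (\<lambda>i. sat C (map (\<lambda>p. f (fst p) i) ps) phi) F
     ==> sat C (map snd ps) phi" using okG G(2) unfolding ok_def by blast
   qed
   moreover have "G0 \<subseteq> \<Union>Ch" using Ch unfolding subset.chain_def by blast
   ultimately show "\<Union>Ch \<in> {G. ok G \<and> G0 \<subseteq> G}" by simp
  qed
  then show ?thesis by (metis (mono_tags, lifting) mem_Collect_eq order_trans)
 qed
 then obtain G where G: "ok G" "G0 \<subseteq> G" "\<And>H. ok H ==> G \<subseteq> H ==> H = G" by blast
 have single: "a = b" if "(j, a) \<in> G" "(j, b) \<in> G" for j a b
 proof -
  have w: "wff L [v j, v j] (Eq (Var 0) (Var 1))"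
   using has_sort.intros(1)[of 0 "[v j, v j]"] has_sort.intros(1)[of 1 "[v j, v j]"] by auto
  have "sat C (map snd [(j, a), (j, b)]) (Eq (Var 0) (Var 1))"
   using G(1) that w unfolding ok_def
   by (elim conjE allE[of _ "[(j, a), (j, b)]"] allE[of _ "Eq (Var 0) (Var 1)"]) auto
  then show ?thesis by simp
 qed
 have sv: "inj_on fst G"
  by (rule inj_onI) (metis prod.collapse single)
 have GJ: "G \<subseteq> J \<times> U" using G(1) by (simp add: ok_def)
 have smG: "sm (snd ` G)"
 proof (rule sm_image, rule sm_ordLeq[OF _ J])
  show "|G| \<le>o |J|" using sv GJ card_of_ordLeq by fastforce
 qed
 have dom: "fst ` G = J"
 proof (rule ccontr)
  assume "fst ` G \<noteq> J"
  then obtain j where j: "j \<in> J" "j \<notin> fst ` G" using GJ by fastforce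
  \<comment> \<open>The type over the values already chosen that a limit of the sequence
    \<open>f j\<close> must realise.\<close>
  define \<Gamma> where "\<Gamma> = {(phi, map snd ps) | phi ps. set ps \<subseteq> G \<and>
   wff L (v j # map (\<lambda>p. v (fst p)) ps) phi \<and>
   eventually (\<lambda>i. sat C (f j i # map (\<lambda>p. f (fst p) i) ps) phi) F}"
  have sorts: "srt (map snd ps) = map (\<lambda>p. v (fst p)) ps"
   "map snd ps \<in> tup (map (\<lambda>p. v (fst p)) ps)"
   "\<And>i. map (\<lambda>p. f (fst p) i) ps \<in> tup (map (\<lambda>p. v (fst p)) ps)"
   if "set ps \<subseteq> G" for ps
  proof -
   have "\<forall>p\<in>set ps. snd p \<in> car (v (fst p))" using G(1) that unfolding ok_def by blast
   then show "srt (map snd ps) = map (\<lambda>p. v (fst p)) ps"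
    "map snd ps \<in> tup (map (\<lambda>p. v (fst p)) ps)"
    by (auto simp: carrier_of_def tuples_def)
   have "\<forall>p\<in>set ps. f (fst p) i \<in> car (v (fst p))" for i using f GJ that by fastforce
   then show "map (\<lambda>p. f (fst p) i) ps \<in> tup (map (\<lambda>p. v (fst p)) ps)" for i
    by (auto simp: carrier_of_def tuples_def)
  qed
  \<comment> \<open>Finitely many members of \<open>\<Gamma>\<close> are collected in one predicate
    \<open>Q\<close>, so that solvability of \<open>Q\<close> is a single formula about the values
    already chosen and passes to them from the sequences.\<close>
  have fin: "\<exists>ps Q. set ps \<subseteq> G \<and> defp L C (v j # map (\<lambda>p. v (fst p)) ps) Q \<and>
   eventually (\<lambda>i. Q (f j i # map (\<lambda>p. f (fst p) i) ps)) F \<and>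
   (\<forall>x\<in>car (v j). Q (x # map snd ps) --> (\<forall>(phi, c)\<in>Dl. sat C (x # c) phi))"
   if "finite Dl" "Dl \<subseteq> \<Gamma>" for Dl using that
  proof (induction Dl rule: finite_induct)
   case empty
   then show ?case by (intro exI[of _ "[]"] exI[of _ "\<lambda>_. True"]) (auto intro: defp_const)
  next
   case (insert \<gamma> Dl)
   then obtain ps Q where Q: "set ps \<subseteq> G" "defp L C (v j # map (\<lambda>p. v (fst p)) ps) Q"
   "eventually (\<lambda>i. Q (f j i # map (\<lambda>p. f (fst p) i) ps)) F"
   "\<forall>x\<in>car (v j). Q (x # map snd ps) --> (\<forall>(phi, c)\<in>Dl. sat C (x # c) phi)" by auto
   from insert.prems obtain phi qs where phi: "\<gamma> = (phi, map snd qs)" "set qs \<subseteq> G"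
    "wff L (v j # map (\<lambda>p. v (fst p)) qs) phi"
    "eventually (\<lambda>i. sat C (f j i # map (\<lambda>p. f (fst p) i) qs) phi) F"
    by (auto simp: \<Gamma>_def)
   let ?n = "length ps"
   let ?sg = "v j # map (\<lambda>p. v (fst p)) (ps @ qs)"
   define R where "R a = (Q (take (Suc ?n) a) \<and> sat C (take 1 a @ drop (Suc ?n) a) phi)" for a
   have c1: "coord ?sg (v j # map (\<lambda>p. v (fst p)) ps) (take (Suc ?n))"
    by (rule coord_take') simp
   have c2: "coord ?sg ([v j] @ map (\<lambda>p. v (fst p)) qs) (\<lambda>a. take 1 a @ drop (Suc ?n) a)"
    by (rule coord_append[OF coord_take' coord_drop']) auto
   have "defp L C ?sg R" unfolding R_def
    by (rule defp_conj[OF defp_coord[OF Q(2) c1] defp_coord[OF _ c2, of L C "\<lambda>a. sat C a phi"]])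
     (use defp_wff[OF phi(3)] in simp)
   moreover have R: "R (x # map h (ps @ qs)) \<longleftrightarrow> Q (x # map h ps) \<and> sat C (x # map h qs) phi"
    for x h by (simp add: R_def)
   have "eventually (\<lambda>i. R (f j i # map (\<lambda>p. f (fst p) i) (ps @ qs))) F"
    unfolding R using Q(3) phi(4) by (rule eventually_conj)
   moreover have "\<forall>x\<in>car (v j). R (x # map snd (ps @ qs)) --> (\<forall>(phi, c)\<in>insert \<gamma> Dl. sat C (x # c) phi)"
    unfolding R using Q(4) phi(1) by auto
   ultimately show ?case using Q(1) phi(2) by (intro exI[of _ "ps @ qs"] exI[of _ R]) auto
  qed
  have "\<exists>a\<in>car (v j). \<forall>(phi, c)\<in>\<Gamma>. sat C (a # c) phi"
  proof -
   have "\<Gamma> \<subseteq> formulas_over L C [v j] (snd ` G)"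
   proof
    fix \<gamma> assume "\<gamma> \<in> \<Gamma>"
    then obtain phi ps where 1: "\<gamma> = (phi, map snd ps)" "set ps \<subseteq> G"
     "wff L (v j # map (\<lambda>p. v (fst p)) ps) phi" unfolding \<Gamma>_def by blast
    have "set (map snd ps) \<subseteq> snd ` G" using 1(2) by auto
    moreover have "wff L ([v j] @ srt (map snd ps)) phi" 
     unfolding sorts(1)[OF 1(2)] using 1(3) by simp
    ultimately show "\<gamma> \<in> formulas_over L C [v j] (snd ` G)"
     unfolding formulas_over_def 1(1) by blast
   qed
   moreover have "\<exists>a\<in>car (v j). \<forall>(phi, c)\<in>Dl. sat C (a # c) phi" if Dl: "Dl \<subseteq> \<Gamma>" "finite Dl" for Dl
   proof -
    obtain ps Q where Q: "set ps \<subseteq> G" "defp L C (v j # map (\<lambda>p. v (fst p)) ps) Q"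
     "eventually (\<lambda>i. Q (f j i # map (\<lambda>p. f (fst p) i) ps)) F"
     "\<forall>x\<in>car (v j). Q (x # map snd ps) --> (\<forall>(phi, c)\<in>Dl. sat C (x # c) phi)"
     using fin[OF Dl(2,1)] by blast
    obtain \<chi> where \<chi>: "wff L (map (\<lambda>p. v (fst p)) ps) \<chi>"
     "\<forall>a\<in>tup (map (\<lambda>p. v (fst p)) ps). (\<exists>x\<in>car (v j). Q (x # a)) \<longleftrightarrow> sat C a \<chi>"
     using defp_ex1[OF Q(2)] unfolding defp_def by blast
    have "eventually (\<lambda>i. sat C (map (\<lambda>p. f (fst p) i) ps) \<chi>) F"
     using Q(3)
    proof eventually_elim
     case (elim i)
     then show ?case using \<chi>(2) sorts(3)[OF Q(1)] f[OF j(1), of i] by blast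
    qed
    then have "sat C (map snd ps) \<chi>" using G(1) Q(1) \<chi>(1) unfolding ok_def by blast
    then show ?thesis using \<chi>(2) sorts(2)[OF Q(1)] Q(4) by blast
   qed
   moreover have "snd ` G \<subseteq> U" using GJ by auto
   moreover have "|snd ` G| <o \<kappa>" using smG by (simp add: sm_def)
   ultimately show ?thesis
    by (intro sat[unfolded saturated_def, rule_format, of "snd ` G" \<Gamma> "v j"]) auto
  qed
  then obtain a where a: "a \<in> car (v j)" "\<forall>(phi, c)\<in>\<Gamma>. sat C (a # c) phi" by blast
  have "ok (insert (j, a) G)"
   unfolding ok_def
  proof (intro conjI allI impI ballI)
   show "insert (j, a) G \<subseteq> J \<times> U" using GJ j a by (auto simp: carrier_of_def)
   fix ps phi assume ps: "set ps \<subseteq> insert (j, a) G"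
   show "snd p \<in> car (v (fst p))" if "p \<in> set ps" for p
   proof (cases "p = (j, a)")
    case False
    then have "set [p] \<subseteq> G" using ps that by auto
    then have "\<forall>q\<in>set [p]. snd q \<in> car (v (fst q))" using G(1) unfolding ok_def by blast
    then show ?thesis by simp
   qed (use a in auto)
   assume w: "wff L (map (\<lambda>p. v (fst p)) ps) phi \<and> eventually (\<lambda>i. sat C (map (\<lambda>p. f (fst p) i) ps) phi) F"
   \<comment> \<open>All occurrences of the new pair in \<open>ps\<close> are renamed to variable
     \<open>0\<close>, which gives the formula the shape required by
     \<open>\<Gamma>\<close>.\<close>
   define qs where "qs = filter (\<lambda>p. p \<noteq> (j, a)) ps"
   have qs: "set qs \<subseteq> G" using ps by (auto simp: qs_def)
   define pos where "pos t = (if ps ! t = (j, a) then 0 else Suc (SOME k. k < length qs \<and> qs ! k = ps ! t))" for t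
   have pos: "pos t = 0 \<and> ps ! t = (j, a) \<or> (\<exists>k. pos t = Suc k \<and> k < length qs \<and> qs ! k = ps ! t)"
    if "t < length ps" for t
   proof (cases "ps ! t = (j, a)")
    case False
    then have "ps ! t \<in> set qs" using that by (auto simp: qs_def)
    then have "\<exists>k. k < length qs \<and> qs ! k = ps ! t" by (metis in_set_conv_nth)
    from someI_ex[OF this] show ?thesis using False by (auto simp: pos_def)
   qed (auto simp: pos_def)
   have nth: "(h (j, a) # map h qs) ! pos t = map h ps ! t" if "t < length ps" for t and h :: "_ => 'z"
    using pos[OF that] that by auto
   have w': "wff L (v j # map (\<lambda>p. v (fst p)) qs) (ren pos phi)"
   proof (rule wff_ren[OF conjunct1[OF w]], unfold ren_ok_def, intro allI impI conjI)
    fix t assume t: "t < length (map (\<lambda>p. v (fst p)) ps)"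
    then show "pos t < length (v j # map (\<lambda>p. v (fst p)) qs)" using pos[of t] by auto
    show "(v j # map (\<lambda>p. v (fst p)) qs) ! pos t = map (\<lambda>p. v (fst p)) ps ! t"
     using nth[of t "\<lambda>p. v (fst p)"] t by simp
   qed
   have s: "sat C (h (j, a) # map h qs) (ren pos phi) = sat C (map h ps) phi" for h
    by (rule sat_ren[OF conjunct1[OF w]]) (use nth in simp)
   have "eventually (\<lambda>i. sat C (f j i # map (\<lambda>p. f (fst p) i) qs) (ren pos phi)) F"
    using conjunct2[OF w] s[of "\<lambda>p. f (fst p) _"] by simp
   then have "(ren pos phi, map snd qs) \<in> \<Gamma>" using w' qs unfolding \<Gamma>_def by blast
   then have "sat C (a # map snd qs) (ren pos phi)" using a(2) by blast
   then show "sat C (map snd ps) phi" using s[of snd] by simp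
  qed
  then have "insert (j, a) G = G" using G(3) by blast
  with j(2) show False by force
 qed
 define e where "e j = (SOME a. (j, a) \<in> G)" for j
 have e: "(j, e j) \<in> G" if "j \<in> J" for j
  unfolding e_def using that dom by (metis (mono_tags, lifting) image_iff prod.collapse someI)
 have "lcor F J v f e" unfolding lcor_def
 proof (intro conjI ballI allI impI)
  fix j assume "j \<in> J"
  then have "set [(j, e j)] \<subseteq> G" using e by simp
  then show "e j \<in> car (v j)" using G(1) unfolding ok_def by (metis fst_conv list.set_intros(1) snd_conv)
 next
  fix idx phi assume a: "set idx \<subseteq> J \<and> wff L (map v idx) phi \<and> eventually (\<lambda>i. sat C (map (\<lambda>j. f j i) idx) phi) F"
  have "set (map (\<lambda>j. (j, e j)) idx) \<subseteq> G" using e a by auto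
  then have "wff L (map (\<lambda>p. v (fst p)) (map (\<lambda>j. (j, e j)) idx)) phi \<and>
    eventually (\<lambda>i. sat C (map (\<lambda>p. f (fst p) i) (map (\<lambda>j. (j, e j)) idx)) phi) F
   --> sat C (map snd (map (\<lambda>j. (j, e j)) idx)) phi" using G(1) unfolding ok_def by blast
  then show "sat C (map e idx) phi" using a by (simp add: comp_def)
 qed
 moreover have "e j = e0 j" if "j \<in> S" for j
  using single[OF e[of j], of "e0 j"] that S G(2) by (auto simp: G0_def)
 ultimately show ?thesis by blast
qed

lemma ulim:
 fixes f :: "'j => 'i => 'a"
 assumes F: "ultra F" and J: "sm J" and f: "\<And>j i. j \<in> J ==> f j i \<in> car (v j)"
 shows "\<exists>e. lcor F J v f e"
proof -
 have "lcor F {} v f (\<lambda>_. undefined)"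
  unfolding lcor_def
 proof (intro conjI allI impI)
  fix idx :: "'j list" and phi :: "('s, 'f, 'r) fm"
  assume "set idx \<subseteq> {} \<and> wff L (map v idx) phi \<and> (\<forall>\<^sub>F i in F. sat C (map (\<lambda>j. f j i) idx) phi)"
  then have "idx = []" "eventually (\<lambda>i. sat C [] phi) F" by auto
  then show "sat C (map (\<lambda>_. undefined) idx) phi" using ultra_const[OF F, of "sat C [] phi"] by simp
 qed simp
 from ulim_ext[OF F J _ f this] show ?thesis by auto
qed

text \<open>An ultrafilter that refines the filter of finite subsets of \<open>\<G>\<close> turns
  finite solutions into a limit. The parameters from \<open>B\<close> run along as constant
  sequences and are their own limits.\<close>

lemma compactness:
 assumes J: "sm J" and B: "B \<subseteq> U" "sm B"
  and \<G>: "\<And>idx c P. (idx, c, P) \<in> \<G> ==> set idx \<subseteq> J \<and> set c \<subseteq> B \<and> defp L C (map v idx @ srt c) P"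
  and fin: "\<And>\<G>0. finite \<G>0 ==> \<G>0 \<subseteq> \<G> ==>
   \<exists>e. (\<forall>j\<in>J. e j \<in> car (v j)) \<and> (\<forall>(idx, c, P)\<in>\<G>0. P (map e idx @ c))"
 shows "\<exists>e. (\<forall>j\<in>J. e j \<in> car (v j)) \<and> (\<forall>(idx, c, P)\<in>\<G>. P (map e idx @ c))"
proof -
 obtain F where F: "F \<le> finite_subsets_at_top \<G>" "ultra F"
  using ultra_exists[OF finite_subsets_at_top_neq_bot] by blast
 define E where "E X = (SOME e. (\<forall>j\<in>J. e j \<in> car (v j)) \<and> (\<forall>(idx, c, P)\<in>X. P (map e idx @ c)))" for X
 have E: "(\<forall>j\<in>J. E X j \<in> car (v j)) \<and> (\<forall>(idx, c, P)\<in>X. P (map (E X) idx @ c))" if "finite X" "X \<subseteq> \<G>" for X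
  unfolding E_def by (rule someI_ex[OF fin[OF that]])
 \<comment> \<open>Off the finite subsets of \<open>\<G>\<close> the value is \<open>{}\<close>, so
   that the chosen solutions are well-sorted everywhere.\<close>
 define g where "g X = (if finite X \<and> X \<subseteq> \<G> then X else {})" for X
 have g: "finite (g X)" "g X \<subseteq> \<G>" for X by (auto simp: g_def)
 define f where "f j X = (case j of Inl j => E (g X) j | Inr b => b)" for j X
 define w where "w j = (case j of Inl j => v j | Inr b => Sort C b)" for j
 have fw: "f j X \<in> car (w j)" if "j \<in> Inl ` J \<union> Inr ` B" for j X
  using that E[OF g] B by (auto simp: f_def w_def carrier_of_def)
 have l0: "lcor F (Inr ` B) w f (case_sum undefined (\<lambda>b. b))"
  unfolding lcor_def
 proof (intro conjI ballI allI impI)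
  fix idx phi assume a: "set idx \<subseteq> Inr ` B \<and> wff L (map w idx) phi \<and> eventually (\<lambda>i. sat C (map (\<lambda>j. f j i) idx) phi) F"
  have "map (\<lambda>j. f j i) idx = map (case_sum undefined (\<lambda>b. b)) idx" for i
   using a by (auto simp: f_def)
  then have "eventually (\<lambda>i. sat C (map (case_sum undefined (\<lambda>b. b)) idx) phi) F"
   using a by (simp only: simp_thms)
  then show "sat C (map (case_sum undefined (\<lambda>b. b)) idx) phi"
   using ultra_const[OF F(2)] by blast
 qed (use B in \<open>auto simp: w_def carrier_of_def\<close>)
 obtain e where e: "\<forall>j\<in>Inr ` B. e j = (case j of Inl x => undefined x | Inr b => b)" "lcor F (Inl ` J \<union> Inr ` B) w f e"
  using ulim_ext[OF F(2) sm_Plus[OF J B(2)] _ fw l0] by auto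
 have "P (map (\<lambda>j. e (Inl j)) idx @ c)" if "(idx, c, P) \<in> \<G>" for idx c P
 proof -
  let ?idx = "map Inl idx @ map Inr c"
  have s: "set ?idx \<subseteq> Inl ` J \<union> Inr ` B" using \<G>[OF that] by auto
  have d: "defp L C (map w ?idx) P" using \<G>[OF that] by (simp add: w_def comp_def)
  have "eventually (\<lambda>X. X \<subseteq> \<G> \<and> finite X \<and> (idx, c, P) \<in> X) (finite_subsets_at_top \<G>)"
   unfolding eventually_finite_subsets_at_top
   by (rule exI[of _ "{(idx, c, P)}"]) (use that in auto)
  then have "eventually (\<lambda>X. X \<subseteq> \<G> \<and> finite X \<and> (idx, c, P) \<in> X) F" using F(1) by (simp add: le_filter_def)
  then have "eventually (\<lambda>X. P (map (\<lambda>j. f j X) ?idx)) F"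
  proof eventually_elim
   case (elim X)
   then have "P (map (E X) idx @ c)" using E[of X] by auto
   moreover have "map (\<lambda>j. f j X) ?idx = map (E X) idx @ c"
    using elim by (simp add: f_def g_def comp_def)
   ultimately show ?case by (simp only:)
  qed
  then have "P (map e ?idx)" using lcorD[OF F(2) e(2) s d fw] by blast
  moreover have "map e ?idx = map (\<lambda>j. e (Inl j)) idx @ c"
  proof -
   have "\<forall>b\<in>set c. e (Inr b) = b" using e(1) \<G>[OF that] by auto
   then have "map (\<lambda>b. e (Inr b)) c = c" by (simp add: map_idI)
   then show ?thesis by (simp add: comp_def)
  qed
  ultimately show ?thesis by (simp only:)
 qed
 moreover have "e (Inl j) \<in> car (v j)" if "j \<in> J" for j
 proof -
  have "e (Inl j) \<in> car (w (Inl j))" using e(2) that unfolding lcor_def by blast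
  then show ?thesis by (simp add: w_def)
 qed
 ultimately show ?thesis by (intro exI[of _ "\<lambda>j. e (Inl j)"]) auto
qed

end

section \<open>Elementary substructures\<close>

lemma carrier_restrict: "carrier_of (restrict_struct M N) s = {x \<in> N. Sort M x = s}"
 by (simp add: carrier_of_def restrict_struct_def)

lemma tuples_restrict: "tuples (restrict_struct M N) sg = {a. set a \<subseteq> N \<and> map (Sort M) a = sg}"
 by (simp add: tuples_def restrict_struct_def)

lemma restrict_restrict: "restrict_struct (restrict_struct M N) N' = restrict_struct M N'"
 by (simp add: restrict_struct_def)

lemma restrict_Univ: "restrict_struct M (Univ M) = M"
 by (simp add: restrict_struct_def)

lemma teval_restrict: "teval (restrict_struct M N) e t = teval M e t"
 by (induction t) (auto simp: restrict_struct_def cong: map_cong)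

lemma elem_sub_sub: "elem_sub L M N ==> N \<subseteq> Univ M"
 by (simp add: elem_sub_def)

lemma elem_sub_sat:
 "elem_sub L M N ==> wff L sg phi ==> e \<in> tuples M sg ==> set e \<subseteq> N ==> sat (restrict_struct M N) e phi = sat M e phi"
 unfolding elem_sub_def tuples_restrict by (auto simp: tuples_def)

lemma elem_sub_ex:
 assumes N: "elem_sub L M N" and P: "defp L M (s # sg) P" and e: "e \<in> tuples M sg" "set e \<subseteq> N"
  and x: "x \<in> carrier_of M s" "P (x # e)"
 shows "\<exists>x\<in>N. x \<in> carrier_of M s \<and> P (x # e)"
proof -
 obtain phi where phi: "wff L (s # sg) phi" "\<forall>a\<in>tuples M (s # sg). P a \<longleftrightarrow> sat M a phi"
  using P by (auto simp: defp_def)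
 then have "sat M e (Ex s phi)" using x e by auto
 then have "sat (restrict_struct M N) e (Ex s phi)" using elem_sub_sat[OF N, of sg "Ex s phi" e] phi e by simp
 then obtain y where y: "y \<in> N" "Sort M y = s" "sat (restrict_struct M N) (y # e) phi"
  by (auto simp: carrier_restrict)
 have yc: "y \<in> carrier_of M s" using y elem_sub_sub[OF N] by (auto simp: carrier_of_def)
 have "sat M (y # e) phi" using elem_sub_sat[OF N phi(1), of "y # e"] y yc e by simp
 then show ?thesis using y yc phi(2) e by auto
qed

lemma elem_sub_exs:
 assumes N: "elem_sub L M N" and P: "defp L M (xi @ sg) P" and e: "e \<in> tuples M sg" "set e \<subseteq> N"
  and x: "x \<in> tuples M xi" "P (x @ e)"
 shows "\<exists>x\<in>tuples M xi. set x \<subseteq> N \<and> P (x @ e)"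
 using P x e
proof (induction xi arbitrary: P sg e x rule: rev_induct)
 case Nil then show ?case by auto
next
 case (snoc s xi)
 obtain y z where yz: "x = y @ [z]" "y \<in> tuples M xi" "z \<in> carrier_of M s"
  using snoc.prems(2) by (metis tuples_appendE tuples_singleE)
 have d: "defp L M (xi @ s # sg) P" using snoc.prems(1) by simp
 have "defp L M (s # sg) (\<lambda>a. \<exists>x\<in>tuples M xi. P (x @ a))" by (rule defp_ex[OF d])
 from elem_sub_ex[OF N this snoc.prems(4,5) yz(3)] obtain z' where z':
  "z' \<in> N" "z' \<in> carrier_of M s" "\<exists>x\<in>tuples M xi. P (x @ z' # e)"
  using yz snoc.prems(3) by auto
 then obtain y0 where "y0 \<in> tuples M xi" "P (y0 @ z' # e)" by blast
 from snoc.IH[OF d this] z' snoc.prems obtain y' where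
  "y' \<in> tuples M xi" "set y' \<subseteq> N" "P (y' @ z' # e)" by auto
 then show ?case using z' by (intro bexI[of _ "y' @ [z']"]) auto
qed

lemma Tarski_Vaught:
 assumes N: "N \<subseteq> Univ M"
  and tv: "\<And>sg s phi e x. wff L (s # sg) phi ==> e \<in> tuples M sg ==> set e \<subseteq> N ==> x \<in> carrier_of M s ==>
   sat M (x # e) phi ==> \<exists>x\<in>N. x \<in> carrier_of M s \<and> sat M (x # e) phi"
  and st: "is_struct L M"
 shows "elem_sub L M N"
 unfolding elem_sub_def
proof (intro conjI allI impI)
 show "N \<subseteq> Univ M" by fact
 show "is_struct L (restrict_struct M N)"
  unfolding is_struct_def
 proof (intro conjI allI ballI)
  fix s
  obtain x where "x \<in> carrier_of M s" using st unfolding is_struct_def by blast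
  with tv[of s "[]" "Neg Fls" "[]" x] have "\<exists>y\<in>N. y \<in> carrier_of M s" by auto
  then show "carrier_of (restrict_struct M N) s \<noteq> {}"
   unfolding carrier_restrict by (auto simp: carrier_of_def)
 next
  fix f a assume f: "f \<in> Funs L" and a: "a \<in> tuples (restrict_struct M N) (Fdom L f)"
  let ?sg = "Fdom L f"
  have at: "a \<in> tuples M ?sg" "set a \<subseteq> N" using a N unfolding tuples_restrict by (auto simp: tuples_def)
  have y: "FunI M f a \<in> carrier_of M (Fcod L f)" using st f at(1) by (auto simp: is_struct_def)
  \<comment> \<open>Closure under function symbols is the test applied to the equation
    \<open>Var 0 = f(a)\<close>, whose only solution is the value.\<close>
  let ?t = "App f (map (\<lambda>i. Var (Suc i)) [0..<length ?sg])"
  have "list_all2 (has_sort L (Fcod L f # ?sg)) (map (\<lambda>i. Var (Suc i)) [0..<length ?sg]) ?sg" (is "list_all2 _ ?vs _")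
   unfolding list_all2_conv_all_nth
  proof (intro conjI allI impI)
   fix i assume "i < length ?vs"
   then have i: "i < length ?sg" by simp
   then have "has_sort L (Fcod L f # ?sg) (Var (Suc i)) ((Fcod L f # ?sg) ! Suc i)"
    by (intro has_sort.intros) auto
   then show "has_sort L (Fcod L f # ?sg) (map (\<lambda>i. Var (Suc i)) [0..<length ?sg] ! i) (?sg ! i)"
    using i by simp
  qed simp
  then have "has_sort L (Fcod L f # ?sg) ?t (Fcod L f)" using f by (intro has_sort.intros)
  moreover have "has_sort L (Fcod L f # ?sg) (Var 0) (Fcod L f)"
   using has_sort.intros(1)[of 0 "Fcod L f # ?sg"] by simp
  ultimately have w: "wff L (Fcod L f # ?sg) (Eq (Var 0) ?t)" by auto
  have ev: "sat M (x # a) (Eq (Var 0) ?t) \<longleftrightarrow> x = FunI M f a" for x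
  proof -
   have "map (teval M (x # a) \<circ> (\<lambda>i. Var (Suc i))) [0..<length ?sg] = a"
    using tuples_length[OF at(1)] by (auto intro!: nth_equalityI)
   then show ?thesis by simp
  qed
  from tv[OF w at y] ev have "FunI M f a \<in> N" by auto
  then show "FunI (restrict_struct M N) f a \<in> carrier_of (restrict_struct M N) (Fcod L f)"
   using y by (simp add: carrier_restrict carrier_of_def restrict_struct_def)
 qed
next
 fix sg phi e assume "wff L sg phi \<and> e \<in> tuples (restrict_struct M N) sg"
 then have "wff L sg phi" "e \<in> tuples M sg" "set e \<subseteq> N" using N unfolding tuples_restrict by (auto simp: tuples_def)
 then show "sat (restrict_struct M N) e phi = sat M e phi"
 proof (induction phi arbitrary: sg e)
  case (Rel q ts)
  then show ?case by (simp add: restrict_struct_def teval_restrict[unfolded restrict_struct_def] cong: map_cong)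
 next
  case (Ex s phi)
  have IH: "sat (restrict_struct M N) (x # e) phi = sat M (x # e) phi" if "x \<in> N" "Sort M x = s" for x
   by (rule Ex.IH[of "s # sg"]) (use Ex.prems that N in \<open>auto simp: carrier_of_def\<close>)
  have "(\<exists>x\<in>N. Sort M x = s \<and> sat M (x # e) phi) \<longleftrightarrow> (\<exists>x\<in>carrier_of M s. sat M (x # e) phi)"
  proof
   assume "\<exists>x\<in>N. Sort M x = s \<and> sat M (x # e) phi"
   then show "\<exists>x\<in>carrier_of M s. sat M (x # e) phi" using N unfolding carrier_of_def by blast
  next
   assume "\<exists>x\<in>carrier_of M s. sat M (x # e) phi"
   then show "\<exists>x\<in>N. Sort M x = s \<and> sat M (x # e) phi"
    using tv[of s sg phi e] Ex.prems carrier_of_sortD(1) by fastforce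
  qed
  then show ?case using IH by (auto simp: carrier_restrict)
 qed (auto simp: teval_restrict)
qed

lemma Loewenheim_Skolem:
 fixes L :: "('s, 'f, 'r) lang" and M :: "('s, 'f, 'r, 'a) struct"
 assumes st: "is_struct L M" and ct: "countable (formulas L)" and S: "countable S" "S \<subseteq> Univ M"
 shows "\<exists>N. countable N \<and> S \<subseteq> N \<and> elem_sub L M N"
proof -
 \<comment> \<open>The formulas \<open>Ex s Fls\<close> show that there are only countably many
   sorts.\<close>
 have "range (\<lambda>s. Ex s Fls) \<subseteq> formulas L"
  unfolding formulas_def by (metis (mono_tags, lifting) image_subsetI mem_Collect_eq wff.simps(1) wff.simps(6))
 then have "countable (range (\<lambda>s::'s. Ex s (Fls :: ('s, 'f, 'r) fm)))" using ct countable_subset by blast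
 moreover have "inj (\<lambda>s::'s. Ex s (Fls :: ('s, 'f, 'r) fm))" by (auto simp: inj_def)
 ultimately have cs: "countable (UNIV :: 's set)" using countable_image_inj_on by blast
 define w where "w s phi e = (SOME x. x \<in> carrier_of M s \<and> sat M (x # e) phi)" for s and phi :: "('s, 'f, 'r) fm" and e
 define st where "st A = A \<union> {w s phi e | s phi e. phi \<in> formulas L \<and> e \<in> lists A \<and> (\<exists>x. x \<in> carrier_of M s \<and> sat M (x # e) phi)}" for A
 have stc: "countable (st A)" if "countable A" for A
 proof -
  have "{w s phi e | s phi e. phi \<in> formulas L \<and> e \<in> lists A \<and> (\<exists>x. x \<in> carrier_of M s \<and> sat M (x # e) phi)}
   \<subseteq> (\<lambda>(s, phi, e). w s phi e) ` (UNIV \<times> formulas L \<times> lists A)" by force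
  moreover have "countable (UNIV \<times> formulas L \<times> lists A :: ('s \<times> _ \<times> _) set)"
   using cs ct that by (intro countable_SIGMA) auto
  ultimately show ?thesis unfolding st_def using that
   by (meson countable_Un countable_image countable_subset)
 qed
 have wU: "w s phi e \<in> carrier_of M s \<and> sat M (w s phi e # e) phi" if "x \<in> carrier_of M s" "sat M (x # e) phi" for s phi e x
  unfolding w_def by (rule someI[of _ x]) (use that in auto)
 have stU: "st A \<subseteq> Univ M" if "A \<subseteq> Univ M" for A
  unfolding st_def using that wU by (auto simp: carrier_of_def)
 define N where "N = (\<Union>n. (st ^^ n) S)"
 have A: "countable ((st ^^ n) S) \<and> (st ^^ n) S \<subseteq> Univ M" for n
  by (induction n) (use S stc stU in auto)
 have mono: "(st ^^ m) S \<subseteq> (st ^^ n) S" if "m \<le> n" for m n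
  using that by (induction n) (auto simp: le_Suc_eq st_def)
 have "elem_sub L M N"
 proof (rule Tarski_Vaught)
  show "N \<subseteq> Univ M" using A by (auto simp: N_def)
  show "is_struct L M" by fact
  fix sg s phi e x assume a: "wff L (s # sg) phi" "e \<in> tuples M sg" "set e \<subseteq> N" "x \<in> carrier_of M s" "sat M (x # e) phi"
  have "\<exists>n. set e \<subseteq> (st ^^ n) S" using a(3)
  proof (induction e)
   case (Cons y e)
   then obtain n m where "set e \<subseteq> (st ^^ n) S" "y \<in> (st ^^ m) S" by (auto simp: N_def)
   then show ?case using mono[of n "max m n"] mono[of m "max m n"] by (intro exI[of _ "max m n"]) auto
  qed auto
  then obtain n where "set e \<subseteq> (st ^^ n) S" by blast
  then have el: "e \<in> lists ((st ^^ n) S)" by auto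
  have "phi \<in> formulas L" using a(1) unfolding formulas_def by blast
  then have "w s phi e \<in> st ((st ^^ n) S)" using el a(4,5) unfolding st_def by blast
  then have "w s phi e \<in> (st ^^ Suc n) S" by simp
  then have "w s phi e \<in> N" unfolding N_def by blast
  with wU[OF a(4,5)] show "\<exists>x\<in>N. x \<in> carrier_of M s \<and> sat M (x # e) phi" by blast
 qed
 moreover have "countable N" unfolding N_def using A by auto
 moreover have "S \<subseteq> N" unfolding N_def by (metis UN_upper UNIV_I funpow_0)
 ultimately show ?thesis by blast
qed

section \<open>Automorphisms and types\<close>

context monster_model begin

lemma teval_car:
 "has_sort L sg t s ==> e \<in> tup sg ==> teval C e t \<in> car s"
proof (induction rule: has_sort.induct)
 case (1 i) then show ?case by (simp add: tuples_nth)
next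
 case (2 f ts)
 have "map (teval C e) ts \<in> tup (Fdom L f)"
  unfolding tuples_all_nth using 2 by (auto simp: list_all2_conv_all_nth)
 then show ?case using struct 2(1) by (auto simp: is_struct_def)
qed

lemma terms_tup: "list_all2 (has_sort L sg) ts ty ==> e \<in> tup sg ==> map (teval C e) ts \<in> tup ty"
 unfolding tuples_all_nth[of _ _ ty] by (auto simp: list_all2_conv_all_nth intro: teval_car)

lemma aut_car: "aut h ==> h x \<in> car s \<longleftrightarrow> x \<in> car s" if "x \<in> U"
 using that unfolding automorphism_def carrier_of_def bij_betw_def by auto

lemma aut_U: "aut h ==> x \<in> U ==> h x \<in> U"
 unfolding automorphism_def bij_betw_def by auto

lemma aut_inj: "aut h ==> x \<in> U ==> y \<in> U ==> h x = h y \<longleftrightarrow> x = y"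
 unfolding automorphism_def bij_betw_def inj_on_def by auto

lemma aut_tup: "aut h ==> e \<in> tup sg ==> map h e \<in> tup sg"
 unfolding tuples_all_nth using aut_car carrier_of_sortD(2)
 by (metis (no_types, lifting) length_map nth_map)

lemma aut_teval:
 assumes "aut h" shows "has_sort L sg t s ==> e \<in> tup sg ==> teval C (map h e) t = h (teval C e t)"
proof (induction rule: has_sort.induct)
 case (1 i) then show ?case by (simp add: tuples_length)
next
 case (2 f ts)
 have l: "list_all2 (has_sort L sg) ts (Fdom L f)" using 2(2) by (auto simp: list_all2_conv_all_nth)
 have "map (teval C (map h e)) ts = map h (map (teval C e) ts)"
  using 2 by (auto simp: list_all2_conv_all_nth in_set_conv_nth)
 moreover have "h (FunI C f (map (teval C e) ts)) = FunI C f (map h (map (teval C e) ts))"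
  using assms 2(1) terms_tup[OF l 2(3)] unfolding automorphism_def by blast
 ultimately show ?case by (simp del: map_map)
qed

lemma aut_sat:
 assumes h: "aut h" shows "wff L sg phi ==> e \<in> tup sg ==> sat C (map h e) phi = sat C e phi"
proof (induction phi arbitrary: sg e)
 case (Eq t u)
 then obtain s where s: "has_sort L sg t s" "has_sort L sg u s" by auto
 then show ?case using Eq.prems aut_teval[OF h s(1)] aut_teval[OF h s(2)] teval_car
  by (metis aut_inj[OF h] carrier_of_sortD(2) sat.simps(2))
next
 case (Rel q ts)
 then have l: "list_all2 (has_sort L sg) ts (Rdom L q)" "q \<in> Rels L" by auto
 have "map (teval C (map h e)) ts = map h (map (teval C e) ts)"
  using l by (auto simp: list_all2_conv_all_nth in_set_conv_nth) (meson aut_teval[OF h _ Rel.prems(2)])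
 moreover have "RelI C q (map h (map (teval C e) ts)) = RelI C q (map (teval C e) ts)"
  using h l terms_tup[OF l(1) Rel.prems(2)] unfolding automorphism_def by blast
 ultimately show ?case by (simp del: map_map)
next
 case (Ex s phi)
 have IH: "sat C (h x # map h e) phi = sat C (x # e) phi" if "x \<in> car s" for x
  using Ex.IH[of "s # sg" "x # e"] Ex.prems that by simp
 have surj: "\<exists>y\<in>car s. x = h y" if "x \<in> car s" for x
 proof -
  have "x \<in> h ` U" using h that unfolding automorphism_def bij_betw_def by (auto simp: carrier_of_def)
  then show ?thesis using aut_car[OF _ h] that by auto
 qed
 show ?case
 proof
  assume "sat C (map h e) (Ex s phi)"
  then obtain x where x: "x \<in> car s" "sat C (x # map h e) phi" by auto
  then obtain y where "y \<in> car s" "x = h y" using surj by blast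
  then show "sat C e (Ex s phi)" using IH x by auto
 next
  assume "sat C e (Ex s phi)"
  then obtain y where y: "y \<in> car s" "sat C (y # e) phi" by auto
  then have "h y \<in> car s" using aut_car[OF _ h] by (auto simp: carrier_of_def)
  then show "sat C (map h e) (Ex s phi)" using IH[OF y(1)] y(2) by auto
 qed
next
 case (Conj phi psi) then show ?case by (metis sat.simps(5) wff.simps(5))
next
 case (Neg phi) then show ?case by (metis sat.simps(4) wff.simps(4))
qed auto

lemma aut_defp: "aut h ==> defp L C sg P ==> e \<in> tup sg ==> P (map h e) = P e"
 unfolding defp_def using aut_sat aut_tup by metis

lemma aut_def2: "aut h ==> def2 L C xi ty R ==> x \<in> tup xi ==> d \<in> tup ty ==> R (map h x) (map h d) = R x d"
proof -
 assume a: "aut h" "def2 L C xi ty R" "x \<in> tup xi" "d \<in> tup ty"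
 obtain psi where psi: "wff L (xi @ ty) psi" "\<And>x d. x \<in> tup xi ==> d \<in> tup ty ==> R x d \<longleftrightarrow> sat C (x @ d) psi"
  using a(2) unfolding def2_def by blast
 have "sat C (map h (x @ d)) psi = sat C (x @ d) psi" using aut_sat[OF a(1) psi(1), of "x @ d"] a(3,4) by simp
 then show ?thesis using psi(2)[OF a(3,4)] psi(2)[OF aut_tup[OF a(1,3)] aut_tup[OF a(1,4)]] by simp
qed

lemma aut_inv:
 assumes h: "aut h"
 obtains g where "aut g" "\<And>x. x \<in> U ==> g (h x) = x" "\<And>x. x \<in> U ==> h (g x) = x"
proof -
 define g where "g = inv_into U h"
 have b: "bij_betw h U U" using h by (simp add: automorphism_def)
 have bg: "bij_betw g U U" unfolding g_def by (rule bij_betw_inv_into[OF b])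
 have gh: "g (h x) = x" "h (g x) = x" if "x \<in> U" for x
  using b that unfolding g_def
  by (auto simp: bij_betw_def inv_into_f_f f_inv_into_f)
 have hs: "Sort C (h x) = Sort C x" if "x \<in> U" for x using h that by (simp add: automorphism_def)
 have gU: "g x \<in> U" if "x \<in> U" for x using bg that by (auto simp: bij_betw_def)
 have gt: "map g a \<in> tup sg" if "a \<in> tup sg" for a sg
 proof -
  have "Sort C (g x) = Sort C x" if "x \<in> U" for x
   using hs[OF gU[OF that]] gh(2)[OF that] by simp
  then show ?thesis using that gU unfolding tuples_def by (auto simp: subset_iff)
 qed
 have hg: "map h (map g a) = a" if "a \<in> tup sg" for a sg
  using tuples_set[OF that] gh by (auto simp: map_idI subset_iff)
 have "aut g" unfolding automorphism_def
 proof (intro conjI ballI)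
  show "bij_betw g U U" by fact
  show "Sort C (g x) = Sort C x" if "x \<in> U" for x
   using hs[OF gU[OF that]] gh(2)[OF that] by simp
  show "g (FunI C f a) = FunI C f (map g a)" if f: "f \<in> Funs L" and a: "a \<in> tup (Fdom L f)" for f a
  proof -
   have "FunI C f a = h (FunI C f (map g a))"
   proof -
    have "h (FunI C f (map g a)) = FunI C f (map h (map g a))"
     using h f gt[OF a] unfolding automorphism_def by blast
    then show ?thesis using hg[OF a] by (simp only:)
   qed
   moreover have "FunI C f (map g a) \<in> U"
    using struct f gt[OF a] unfolding is_struct_def carrier_of_def by blast
   ultimately show ?thesis using gh by simp
  qed
  show "RelI C r (map g a) = RelI C r a" if r: "r \<in> Rels L" and a: "a \<in> tup (Rdom L r)" for r a
  proof -
   have "RelI C r (map h (map g a)) = RelI C r (map g a)"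
    using h r gt[OF a] unfolding automorphism_def by blast
   then show ?thesis using hg[OF a] by (simp only:)
  qed
 qed
 then show ?thesis using that gh by blast
qed

lemma aut_inv_map: "(\<And>x. x \<in> U ==> g (h x) = x) ==> set a \<subseteq> U ==> map g (map h a) = a"
 by (auto simp: subset_iff intro!: map_idI)

lemma aut_fix_map: "(\<forall>x\<in>A. h x = x) ==> set c \<subseteq> A ==> map h c = c"
 by (auto simp: subset_iff intro!: map_idI)

lemma tp_eq_sort: "tp L C a A = tp L C b A ==> a \<in> tup sg ==> b \<in> tup sg ==> set c \<subseteq> A ==>
 defp L C (sg @ srt c) P ==> A \<subseteq> U ==> P (a @ c) = P (b @ c)"
proof -
 assume a: "tp L C a A = tp L C b A" "a \<in> tup sg" "b \<in> tup sg" "set c \<subseteq> A" "defp L C (sg @ srt c) P" "A \<subseteq> U"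
 obtain phi where phi: "wff L (sg @ srt c) phi" "\<forall>a\<in>tup (sg @ srt c). P a \<longleftrightarrow> sat C a phi"
  using a(5) by (auto simp: defp_def)
 have c: "c \<in> tup (srt c)" using a by (intro tuples_self) auto
 have "(phi, c) \<in> tp L C a A \<longleftrightarrow> sat C (a @ c) phi" "(phi, c) \<in> tp L C b A \<longleftrightarrow> sat C (b @ c) phi"
  using a phi by (auto simp: tp_def formulas_over_def tuples_sorts)
 then show ?thesis using a(1) phi(2) a(2,3) c by simp
qed

lemma tp_eqI:
 assumes "a \<in> tup sg" "b \<in> tup sg" "\<And>c phi. set c \<subseteq> A ==> wff L (sg @ srt c) phi ==> sat C (a @ c) phi = sat C (b @ c) phi"
 shows "tp L C a A = tp L C b A"
 using assms unfolding tp_def formulas_over_def by (auto simp: tuples_sorts)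

lemma tp_eq_mono: "tp L C a A = tp L C b A ==> a \<in> tup sg ==> b \<in> tup sg ==> B \<subseteq> A ==> A \<subseteq> U ==> tp L C a B = tp L C b B"
proof -
 assume a: "tp L C a A = tp L C b A" "a \<in> tup sg" "b \<in> tup sg" "B \<subseteq> A" "A \<subseteq> U"
 show ?thesis
 proof (rule tp_eqI[OF a(2,3)])
  fix c phi assume c: "set c \<subseteq> B" "wff L (sg @ srt c) phi"
  show "sat C (a @ c) phi = sat C (b @ c) phi"
   by (rule tp_eq_sort[OF a(1-3) _ defp_wff[OF c(2)] a(5)]) (use c a in auto)
 qed
qed

lemma aut_tp:
 assumes h: "aut h" "\<forall>x\<in>A. h x = x" "A \<subseteq> U" "a \<in> tup sg" shows "tp L C (map h a) A = tp L C a A"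
proof (rule tp_eqI)
 show "map h a \<in> tup sg" "a \<in> tup sg" using assms aut_tup by auto
 fix c phi assume c: "set c \<subseteq> A" "wff L (sg @ srt c) phi"
 have "map h (a @ c) = map h a @ c" using aut_fix_map[OF h(2) c(1)] by simp
 moreover have "a @ c \<in> tup (sg @ srt c)" using assms c by (auto intro: tuples_self)
 ultimately show "sat C (map h a @ c) phi = sat C (a @ c) phi" using aut_sat[OF h(1) c(2)] by metis
qed

text \<open>Strong homogeneity for indexed families, possibly with repetitions: the equality formula
  shows that \<open>e j\<close> determines \<open>e' j\<close>, so that the correspondence is a
  partial elementary map.\<close>

lemma hom_ext:
 assumes J: "sm J" and e: "\<And>j. j \<in> J ==> e j \<in> car (v j)" "\<And>j. j \<in> J ==> e' j \<in> car (v j)"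
  and t: "\<And>idx phi. set idx \<subseteq> J ==> wff L (map v idx) phi ==> sat C (map e idx) phi = sat C (map e' idx) phi"
 shows "\<exists>h. aut h \<and> (\<forall>j\<in>J. h (e j) = e' j)"
proof -
 define g where "g x = e' (SOME j. j \<in> J \<and> e j = x)" for x
 have g: "g (e j) = e' j" if "j \<in> J" for j
 proof -
  have "\<exists>k. k \<in> J \<and> e k = e j" using that by blast
  then obtain k where k: "k \<in> J" "e k = e j" "g (e j) = e' k" unfolding g_def by (metis (mono_tags, lifting) someI_ex)
  have vv: "v k = v j" using e(1)[OF k(1)] e(1)[OF that] k(2) by (auto simp: carrier_of_def)
  have "wff L (map v [k, j]) (Eq (Var 0) (Var 1))"
   using has_sort.intros(1)[of 0 "[v k, v j]"] has_sort.intros(1)[of 1 "[v k, v j]"] vv by auto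
  from t[OF _ this] k that have "e' k = e' j" by auto
  with k show ?thesis by simp
 qed
 have "partial_elementary L C (e ` J) g" unfolding partial_elementary_def
 proof (intro conjI allI impI)
  show "e ` J \<subseteq> U" using e by (auto simp: carrier_of_def)
  show "g ` e ` J \<subseteq> U" using e g by (auto simp: carrier_of_def)
  fix a assume "set a \<subseteq> e ` J"
  then have "\<exists>idx. set idx \<subseteq> J \<and> a = map e idx"
  proof (induction a)
   case (Cons x a)
   then obtain idx j where "set idx \<subseteq> J" "a = map e idx" "j \<in> J" "x = e j" by auto
   then show ?case by (intro exI[of _ "j # idx"]) auto
  qed auto
  then obtain idx where idx: "set idx \<subseteq> J" "a = map e idx" by blast
  have ga: "map g a = map e' idx" using idx g by auto
  have 1: "a \<in> tup (map v idx)" "map g a \<in> tup (map v idx)"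
   unfolding ga unfolding idx using idx(1) e by (auto intro!: map_tuples)
  show "tp L C (map g a) {} = tp L C a {}"
  proof (rule tp_eqI[OF 1(2,1)])
   fix c phi assume "set c \<subseteq> {}" "wff L (map v idx @ srt c) phi"
   then have "c = []" "wff L (map v idx) phi" by auto
   then show "sat C (map g a @ c) phi = sat C (a @ c) phi"
    using t[OF idx(1)] unfolding ga unfolding idx(2) by simp
  qed
 qed
 moreover have "|e ` J| <o \<kappa>" using sm_image[OF J] by (simp add: sm_def)
 ultimately obtain h where "aut h" "\<forall>x\<in>e ` J. h x = g x"
  using hom unfolding strongly_homogeneous_def by blast
 then show ?thesis using g by (intro exI[of _ h]) auto
qed

text \<open>A list mixing unknowns (\<open>Inl\<close>) and parameters (\<open>Inr\<close>) is a
  rearrangement of unknowns followed by parameters. The positions \<open>r\<close> do not depend on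
  \<open>f\<close>, so one rearrangement serves both families that are to be compared.\<close>

lemma ex_append_split:
 assumes "set idx \<subseteq> Inl ` J \<union> Inr ` B"
 shows "\<exists>idx' c r. set idx' \<subseteq> J \<and> set c \<subseteq> B \<and> length r = length idx \<and>
  (\<forall>i\<in>set r. i < length idx' + length c) \<and>
  (\<forall>f :: _ => 'z. map f idx = map ((!) (map (\<lambda>j. f (Inl j)) idx' @ map (\<lambda>b. f (Inr b)) c)) r)"
proof -
 define idx' where "idx' = map projl (filter isl idx)"
 define c where "c = map projr (filter (\<lambda>j. \<not> isl j) idx)"
 let ?w = "map Inl idx' @ map Inr c"
 have s: "set idx \<subseteq> set ?w"
 proof
  fix j assume j: "j \<in> set idx"
  show "j \<in> set ?w"
  proof (cases j)
   case (Inl x) then have "x \<in> set idx'" using j by (force simp: idx'_def image_iff)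
   then show ?thesis using Inl by simp
  next
   case (Inr x) then have "x \<in> set c" using j by (force simp: c_def image_iff)
   then show ?thesis using Inr by simp
  qed
 qed
 define p where "p j = (SOME i. i < length ?w \<and> ?w ! i = j)" for j
 have p: "p j < length ?w \<and> ?w ! p j = j" if "j \<in> set idx" for j
 proof -
  have "\<exists>i. i < length ?w \<and> ?w ! i = j" using that s by (metis in_set_conv_nth subsetD)
  from someI_ex[OF this] show ?thesis by (simp add: p_def)
 qed
 have m: "map f idx = map ((!) (map (\<lambda>j. f (Inl j)) idx' @ map (\<lambda>b. f (Inr b)) c)) (map p idx)" for f :: "_ => 'z"
 proof (rule nth_equalityI)
  fix i assume i: "i < length (map f idx)"
  have "map f ?w ! p (idx ! i) = f (idx ! i)" using p[of "idx ! i"] i by (metis length_map nth_map nth_mem)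
  then show "map f idx ! i = map ((!) (map (\<lambda>j. f (Inl j)) idx' @ map (\<lambda>b. f (Inr b)) c)) (map p idx) ! i"
   using i by (simp add: comp_def)
 qed simp
 have "set idx' \<subseteq> J" "set c \<subseteq> B" using assms by (auto simp: idx'_def c_def)
 moreover have "length (map p idx) = length idx" "\<forall>i\<in>set (map p idx). i < length idx' + length c" using p by auto
 ultimately show ?thesis using m by blast
qed

text \<open>The parameters in \<open>A\<close> join the family as names of themselves, which makes
  the automorphism fix them. One implication between the types suffices, as negations are among the
  predicates.\<close>

lemma hom_ext_over:
 assumes J: "sm J" and A: "A \<subseteq> U" "sm A"
  and e: "\<And>j. j \<in> J ==> e j \<in> car (v j)" "\<And>j. j \<in> J ==> e' j \<in> car (v j)"
  and t: "\<And>idx c P. set idx \<subseteq> J ==> set c \<subseteq> A ==> defp L C (map v idx @ srt c) P ==> P (map e idx @ c) ==> P (map e' idx @ c)"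
 shows "\<exists>h. aut h \<and> (\<forall>a\<in>A. h a = a) \<and> (\<forall>j\<in>J. h (e j) = e' j)"
proof -
 let ?e = "case_sum e (\<lambda>a. a)" and ?e' = "case_sum e' (\<lambda>a. a)" and ?v = "case_sum v (Sort C)"
 have "\<exists>h. aut h \<and> (\<forall>j\<in>Inl ` J \<union> Inr ` A. h (?e j) = ?e' j)"
 proof (rule hom_ext[where v = ?v])
  show "sm (Inl ` J \<union> Inr ` A)" by (rule sm_Plus[OF J A(2)])
  show "?e j \<in> car (?v j)" "?e' j \<in> car (?v j)" if "j \<in> Inl ` J \<union> Inr ` A" for j
   using that e A by (auto simp: carrier_of_def)
  fix idx phi assume idx: "set idx \<subseteq> Inl ` J \<union> Inr ` A" and w: "wff L (map ?v idx) phi"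
  from idx obtain idx' c r where s: "set idx' \<subseteq> J" "set c \<subseteq> A" "\<forall>i\<in>set r. i < length idx' + length c"
   and m: "\<forall>f :: _ => 'a. map f idx = map ((!) (map (\<lambda>j. f (Inl j)) idx' @ map (\<lambda>b. f (Inr b)) c)) r"
   using ex_append_split[OF idx] by blast
  have ev: "map ?v idx = map ((!) (map v idx' @ srt c)) r"
  proof -
   let ?g = "case_sum (\<lambda>j. e j) (\<lambda>a. a)"
   have "map ?v idx = map (Sort C) (map ?g idx)"
    using idx e(1) by (auto simp: carrier_of_def)
   also have "... = map (Sort C) (map ((!) (map e idx' @ c)) r)" using m by simp
   also have "... = map ((!) (map v idx' @ srt c)) r"
   proof -
    have "Sort C ((map e idx' @ c) ! i) = (map v idx' @ srt c) ! i" if "i \<in> set r" for i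
    proof (cases "i < length idx'")
     case True
     then have "idx' ! i \<in> J" using s(1) by auto
     then show ?thesis using True e(1) by (simp add: nth_append carrier_of_def)
    next
     case False
     then show ?thesis using s(3) that by (auto simp: nth_append)
    qed
    then show ?thesis by simp
   qed
   finally show ?thesis .
  qed
  define P where "P a = sat C (map ((!) a) r) phi" for a
  have co: "coord (map v idx' @ srt c) (map ?v idx) (\<lambda>a. map ((!) a) r)"
   by (rule coord_map_nth) (use s(3) ev in auto)
  have d: "defp L C (map v idx' @ srt c) P" unfolding P_def
   using defp_coord[OF defp_wff[OF w] co] .
  have "P (map e idx' @ c) = P (map e' idx' @ c)"
   using t[OF s(1,2) d] t[OF s(1,2) defp_neg[OF d]] by blast
  then show "sat C (map ?e idx) phi = sat C (map ?e' idx) phi"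
   unfolding P_def using m[rule_format, of ?e] m[rule_format, of ?e'] by simp
 qed
 then show ?thesis by (metis (no_types, lifting) Un_iff image_eqI sum.case)
qed

lemma hom_tuple:
 assumes "a \<in> tup sg" "b \<in> tup sg" "A \<subseteq> U" "sm A" "tp L C a A = tp L C b A"
 shows "\<exists>h. aut h \<and> (\<forall>x\<in>A. h x = x) \<and> map h a = b"
proof -
 have l: "length a = length sg" "length b = length sg" using assms by (auto simp: tuples_length)
 have "\<exists>h. aut h \<and> (\<forall>x\<in>A. h x = x) \<and> (\<forall>j\<in>{..<length sg}. h (a ! j) = b ! j)"
 proof (rule hom_ext_over[where v = "(!) sg"])
  show "sm {..<length sg}" by (simp add: sm_finite)
  show "A \<subseteq> U" "sm A" by fact+
  show "a ! j \<in> car (sg ! j)" "b ! j \<in> car (sg ! j)" if "j \<in> {..<length sg}" for j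
   using assms that by (auto intro: tuples_nth)
  fix idx c P assume i: "set idx \<subseteq> {..<length sg}" "set c \<subseteq> A" "defp L C (map ((!) sg) idx @ srt c) P"
   "P (map ((!) a) idx @ c)"
  have co: "coord (sg @ srt c) (map ((!) sg) idx @ srt c) (\<lambda>x. map ((!) (take (length sg) x)) idx @ drop (length sg) x)"
   by (rule coord_append[OF coord_comp[OF coord_take' coord_map_nth] coord_drop']) (use i in auto)
  have "P (map ((!) (take (length sg) (a @ c))) idx @ drop (length sg) (a @ c)) =
   P (map ((!) (take (length sg) (b @ c))) idx @ drop (length sg) (b @ c))"
   by (rule tp_eq_sort[OF assms(5,1,2) i(2) defp_coord[OF i(3) co] assms(3)])
  then show "P (map ((!) b) idx @ c)" using i(4) l by simp
 qed
 then show ?thesis using l by (auto intro!: nth_equalityI)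
qed

lemma aut_elem_sub:
 assumes h: "aut h" and P: "elem_sub L C P" shows "elem_sub L C (h ` P)"
proof (rule Tarski_Vaught)
 have PU: "P \<subseteq> U" using P by (rule elem_sub_sub)
 show "h ` P \<subseteq> U" using PU h aut_U by blast
 show "is_struct L C" by (rule struct)
 fix sg s phi e x assume a: "wff L (s # sg) phi" "e \<in> tup sg" "set e \<subseteq> h ` P" "x \<in> car s" "sat C (x # e) phi"
 obtain g where g: "aut g" "\<And>x. x \<in> U ==> g (h x) = x" "\<And>x. x \<in> U ==> h (g x) = x" using aut_inv[OF h] by blast
 have ge: "set (map g e) \<subseteq> P" "map h (map g e) = e"
 proof -
  have "g x \<in> P" if x: "x \<in> set e" for x
  proof -
   obtain y where "y \<in> P" "x = h y" using a(3) x by blast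
   then show ?thesis using g(2) PU by auto
  qed
  then show "set (map g e) \<subseteq> P" by auto
  show "map h (map g e) = e" using tuples_set[OF a(2)] g(3) by (auto intro!: map_idI)
 qed
 have "sat C (map g (x # e)) phi" using aut_sat[OF g(1) a(1), of "x # e"] a by simp
 then obtain y where y: "y \<in> P" "y \<in> car s" "sat C (y # map g e) phi"
  using elem_sub_ex[OF P defp_wff[OF a(1)] aut_tup[OF g(1) a(2)] ge(1), of "g x"] aut_car[OF _ g(1)] a(4)
  by (auto simp: carrier_of_def)
 have "sat C (map h (y # map g e)) phi" using aut_sat[OF h a(1), of "y # map g e"] y aut_tup[OF g(1) a(2)] by simp
 then have "sat C (h y # e) phi" using ge by simp
 then show "\<exists>x\<in>h ` P. x \<in> car s \<and> sat C (x # e) phi" using y aut_car[OF _ h, of y] PU by auto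
qed

lemma LS: "countable S ==> S \<subseteq> U ==> \<exists>N. countable N \<and> S \<subseteq> N \<and> elem_sub L C N"
 using Loewenheim_Skolem[OF struct ctbl] .

end

section \<open>Families of tuples\<close>

text \<open>Finitely many parameter tuples of equal sorts are handled as one concatenated tuple;
  this reads off its block number \<open>t\<close>.\<close>

definition slice :: "nat => nat => 'a list => 'a list" where
 "slice l t w = take l (drop (t * l) w)"

lemma slice_concat:
 assumes "\<And>i. i \<in> set I ==> length (c i) = l" "t < length I"
 shows "slice l t (concat (map c I)) = c (I ! t)"
 using assms unfolding slice_def
proof (induction I arbitrary: t)
 case (Cons i I)
 then show ?case by (cases t) auto
qed simp

lemma concat_replicate_length: "length (concat (replicate n xs)) = n * length xs"
 by (induction n) auto

lemma slice_replicate: "t < n ==> slice (length ty) t (concat (replicate n ty)) = ty"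
 using slice_concat[of "replicate n ty" "\<lambda>x. x" "length ty" t] by simp

lemma coord_slice_replicate: "t < n ==> coord (concat (replicate n ty)) ty (slice (length ty) t)"
 unfolding slice_def[abs_def] by (rule coord_slice) (simp add: slice_replicate[unfolded slice_def])

lemma map_const_concat: "(\<And>i. i \<in> set I ==> g i = ty) ==> concat (map g I) = concat (replicate (length I) ty)"
 by (induction I) auto

text \<open>Consistency of \<open>n\<close> instances is first-order in the concatenated parameters;
  in negated form this carries inconsistency of instances to limits.\<close>

lemma defp_common:
 assumes "def2 L M xi ty R"
 shows "defp L M (concat (replicate n ty)) (\<lambda>w. \<exists>a\<in>tuples M xi. \<forall>t<n. R a (slice (length ty) t w))"
proof -
 let ?sg = "concat (replicate n ty)"
 have "defp L M (xi @ ?sg) (\<lambda>w. \<forall>t\<in>{..<n}. R (take (length xi) w) (slice (length ty) t (drop (length xi) w)))"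
  by (rule defp_ball, simp, rule def2_defp[OF assms coord_fst coord_comp[OF coord_snd coord_slice_replicate]]) simp
 from defp_ex[OF this] show ?thesis
  by (rule defp_cong) (auto simp: tuples_length)
qed

context monster_model begin

lemma sm_Times_nat: "sm K ==> sm (K \<times> (UNIV :: nat set))"
proof -
 assume K: "sm K"
 show ?thesis
 proof (cases "finite K")
  case True
  then have "countable (K \<times> (UNIV :: nat set))" by (simp add: countable_finite)
  then show ?thesis by (rule sm_countable)
 next
  case False
  then have "|UNIV :: nat set| \<le>o |K|" using infinite_iff_card_of_nat by blast
  then have "|K \<times> (UNIV :: nat set)| =o |K|" using card_of_Times_infinite[OF False, of "UNIV :: nat set"] by blast
  then show ?thesis using sm_ordLeq[OF _ K] ordIso_imp_ordLeq by blast
 qed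
qed

lemma sm_nat_fun: "sm (X :: (nat => nat) set)"
proof -
 define g where "g f = range (\<lambda>k. prod_encode (k, f k))" for f :: "nat => nat"
 have "inj g"
 proof (rule injI, rule ext)
  fix f f' k assume "g f = g f'"
  then have "prod_encode (k, f k) \<in> range (\<lambda>k. prod_encode (k, f' k))" by (auto simp: g_def)
  then show "f k = f' k" by auto
 qed
 then have "inj_on g X \<and> g ` X \<subseteq> UNIV" by (auto simp: inj_on_def)
 then have "|X| \<le>o |UNIV :: nat set set|" using card_of_ordLeq by blast
 then show ?thesis using sm_ordLeq sm_Pow_nat by blast
qed

text \<open>\<open>ulim\<close> for sequences of tuples: the names are pairs of a tuple and a
  position in it.\<close>

lemma tulim:
 fixes c :: "'i => 'x => 'a list"
 assumes F: "ultra F" and K: "sm K" and c: "\<And>x i. x \<in> K ==> c i x \<in> tup (ty x)"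
 shows "\<exists>d. (\<forall>x\<in>K. d x \<in> tup (ty x)) \<and> (\<forall>xs P. set xs \<subseteq> K --> defp L C (concat (map ty xs)) P -->
  (P (concat (map d xs)) \<longleftrightarrow> eventually (\<lambda>i. P (concat (map (c i) xs))) F))"
proof -
 let ?J = "{(x, p). x \<in> K \<and> p < length (ty x)}"
 let ?v = "\<lambda>(x, p). ty x ! p" and ?f = "\<lambda>(x, p) i. c i x ! p"
 have f: "?f j i \<in> car (?v j)" if "j \<in> ?J" for j i
  using that c tuples_nth by (auto split: prod.splits) blast
 have "sm ?J" by (rule sm_mono[OF _ sm_Times_nat[OF K]]) auto
 then have "\<exists>e. lcor F ?J ?v ?f e" by (rule ulim[OF F]) (rule f)
 then obtain e where e: "lcor F ?J ?v ?f e" by blast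
 define d where "d x = map (\<lambda>p. e (x, p)) [0..<length (ty x)]" for x
 have dt: "d x \<in> tup (ty x)" if "x \<in> K" for x
  unfolding tuples_all_nth using e that by (auto simp: d_def lcor_def)
 let ?ix = "\<lambda>xs. concat (map (\<lambda>x. map (Pair x) [0..<length (ty x)]) xs)"
 have 1: "map e (?ix xs) = concat (map d xs)" for xs
  by (induction xs) (auto simp: d_def)
 have 2: "map (\<lambda>j. ?f j i) (?ix xs) = concat (map (c i) xs)" if "set xs \<subseteq> K" for xs i
  using that by (induction xs) (auto intro!: nth_equalityI simp: tuples_length[OF c])
 have 3: "map ?v (?ix xs) = concat (map ty xs)" for xs
  by (induction xs) (auto intro!: nth_equalityI)
 have "P (concat (map d xs)) \<longleftrightarrow> eventually (\<lambda>i. P (concat (map (c i) xs))) F"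
  if s: "set xs \<subseteq> K" and P: "defp L C (concat (map ty xs)) P" for xs P
 proof -
  have "set (?ix xs) \<subseteq> ?J" using s by auto
  from lcorD[OF F e this _ f] P show ?thesis unfolding 1 2[OF s] 3 by blast
 qed
 then show ?thesis using dt by (intro exI[of _ d]) blast
qed

subsection \<open>Forking\<close>

text \<open>The forking ideal over \<open>A\<close>, taken on sets of tuples instead of formulas, so
  that monotonicity and finite unions need no syntax.\<close>

definition fset :: "'a set => 's list => 'a list set => bool" where
 "fset A xi Y \<longleftrightarrow> (\<exists>Dl \<subseteq> formulas_over L C xi U. finite Dl \<and> (\<forall>(psi, c)\<in>Dl. divides L C A xi psi c) \<and>
    (\<forall>a\<in>tup xi. a \<in> Y --> (\<exists>(psi, c)\<in>Dl. sat C (a @ c) psi)))"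

lemma forks_fset: "forks L C A xi phi b \<longleftrightarrow> fset A xi {a. sat C (a @ b) phi}"
 by (simp add: forks_def fset_def)

lemma fset_mono: "fset A xi Y ==> (\<And>a. a \<in> tup xi ==> a \<in> X ==> a \<in> Y) ==> fset A xi X"
 unfolding fset_def by meson

lemma fset_empty: "fset A xi {}"
 unfolding fset_def by (rule exI[of _ "{}"]) auto

lemma fset_Un: "fset A xi X ==> fset A xi Y ==> fset A xi (X \<union> Y)"
proof -
 assume "fset A xi X" "fset A xi Y"
 then obtain Dl1 Dl2 where "Dl1 \<subseteq> formulas_over L C xi U \<and> finite Dl1 \<and> (\<forall>(psi, c)\<in>Dl1. divides L C A xi psi c) \<and>
    (\<forall>a\<in>tup xi. a \<in> X --> (\<exists>(psi, c)\<in>Dl1. sat C (a @ c) psi))"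
  "Dl2 \<subseteq> formulas_over L C xi U \<and> finite Dl2 \<and> (\<forall>(psi, c)\<in>Dl2. divides L C A xi psi c) \<and>
    (\<forall>a\<in>tup xi. a \<in> Y --> (\<exists>(psi, c)\<in>Dl2. sat C (a @ c) psi))" unfolding fset_def by blast
 then show ?thesis unfolding fset_def by (intro exI[of _ "Dl1 \<union> Dl2"]) (auto; blast)
qed

lemma fset_UN: "finite T ==> (\<And>t. t \<in> T ==> fset A xi (Y t)) ==> fset A xi (\<Union>t\<in>T. Y t)"
 by (induction T rule: finite_induct) (auto intro: fset_empty fset_Un)

text \<open>Dividing with its number \<open>k\<close> kept visible: limits of dividing relations are
  controlled only if this number does not vary.\<close>

definition kdiv :: "nat => 'a set => 's list => 's list => ('a list => 'a list => bool) => 'a list => bool" where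
 "kdiv k A xi ty R d \<longleftrightarrow> (\<exists>c :: nat => 'a list. (\<forall>i. c i \<in> tup ty \<and> tp L C (c i) A = tp L C d A) \<and>
  (\<forall>I. finite I \<and> card I = k --> \<not> (\<exists>a\<in>tup xi. \<forall>i\<in>I. R a (c i))))"

lemma divides_kdiv:
 assumes "d \<in> tup ty" "\<And>x d. x \<in> tup xi ==> d \<in> tup ty ==> R x d \<longleftrightarrow> sat C (x @ d) psi"
 shows "divides L C A xi psi d \<longleftrightarrow> (\<exists>k. kdiv k A xi ty R d)"
proof -
 have eq: "(\<exists>a\<in>tup xi. \<forall>i\<in>I. R a (c i)) \<longleftrightarrow> (\<exists>a\<in>tup xi. \<forall>i\<in>I. sat C (a @ c i) psi)"
  if "\<forall>i. c i \<in> tup ty \<and> Q i" for c :: "nat => 'a list" and I Q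
  using assms(2) that by blast
 show ?thesis unfolding divides_def kdiv_def tuples_sorts[OF assms(1)]
  by (intro iff_exI conj_cong refl) (simp add: eq)
qed

lemma kdiv_fset:
 assumes "kdiv k A xi ty R d" "def2 L C xi ty R" "d \<in> tup ty" shows "fset A xi {x. R x d}"
proof -
 obtain psi where psi: "wff L (xi @ ty) psi" "\<And>x d. x \<in> tup xi ==> d \<in> tup ty ==> R x d \<longleftrightarrow> sat C (x @ d) psi"
  using assms(2) unfolding def2_def by blast
 have "divides L C A xi psi d" using divides_kdiv[OF assms(3) psi(2)] assms(1) by blast
 moreover have "(psi, d) \<in> formulas_over L C xi U"
  using psi(1) assms(3) by (auto simp: formulas_over_def tuples_sorts tuples_set)
 ultimately show ?thesis unfolding fset_def
  by (intro exI[of _ "{(psi, d)}"]) (use psi(2) assms(3) in auto)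
qed

lemma kdiv_coord:
 assumes "kdiv k A xi ty R d" "coord xi' xi r" shows "kdiv k A xi' ty (\<lambda>x. R (r x)) d"
 using assms(1) coord_tuples[OF assms(2)] unfolding kdiv_def by meson

text \<open>Dummy variables change neither the dividing sequences nor their numbers.\<close>

lemma fset_coord:
 assumes f: "fset A xi Y" and r: "coord xi' xi r" shows "fset A xi' {x. r x \<in> Y}"
proof -
 obtain Dl where Dl: "Dl \<subseteq> formulas_over L C xi U" "finite Dl" "\<forall>(psi, c)\<in>Dl. divides L C A xi psi c"
  "\<forall>a\<in>tup xi. a \<in> Y --> (\<exists>(psi, c)\<in>Dl. sat C (a @ c) psi)" using f unfolding fset_def by blast
 have "fset A xi' {x. sat C (r x @ snd q) (fst q)}" if q: "q \<in> Dl" for q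
 proof -
  obtain psi c where qc: "q = (psi, c)" by (cases q)
  have w: "wff L (xi @ srt c) psi" "set c \<subseteq> U" using q Dl(1) qc by (auto simp: formulas_over_def)
  have ct: "c \<in> tup (srt c)" by (rule tuples_self[OF w(2)])
  have "divides L C A xi psi c" using Dl(3) q qc by auto
  then obtain k where "kdiv k A xi (srt c) (\<lambda>x d. sat C (x @ d) psi) c"
   using divides_kdiv[OF ct, of xi "\<lambda>x d. sat C (x @ d) psi"] by blast
  from kdiv_fset[OF kdiv_coord[OF this r] def2_coord[OF def2_wff[OF w(1)] r coord_id] ct]
  show ?thesis by (simp add: qc)
 qed
 then have "fset A xi' (\<Union>q\<in>Dl. {x. sat C (r x @ snd q) (fst q)})" by (rule fset_UN[OF Dl(2)])
 then show ?thesis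
 proof (rule fset_mono)
  fix a assume a: "a \<in> tup xi'" "a \<in> {x. r x \<in> Y}"
  then show "a \<in> (\<Union>q\<in>Dl. {x. sat C (r x @ snd q) (fst q)})"
   using Dl(4) coord_tuples[OF r a(1)] by fastforce
 qed
qed

lemma kdiv_mono: "kdiv k A xi ty R d ==> d \<in> tup ty ==> B \<subseteq> A ==> A \<subseteq> U ==> kdiv k B xi ty R d"
 unfolding kdiv_def using tp_eq_mono by metis

text \<open>A sequence that witnesses dividing over \<open>A\<close> also witnesses it over every
  subset of \<open>A\<close>.\<close>

lemma fset_base_mono:
 assumes f: "fset A xi Y" and B: "B \<subseteq> A" "A \<subseteq> U" shows "fset B xi Y"
proof -
 obtain Dl where Dl: "Dl \<subseteq> formulas_over L C xi U" "finite Dl" "\<forall>(psi, c)\<in>Dl. divides L C A xi psi c"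
  "\<forall>a\<in>tup xi. a \<in> Y --> (\<exists>(psi, c)\<in>Dl. sat C (a @ c) psi)" using f unfolding fset_def by blast
 have "divides L C B xi psi c" if q: "(psi, c) \<in> Dl" for psi c
 proof -
  have ct: "c \<in> tup (srt c)" using q Dl(1) by (intro tuples_self) (auto simp: formulas_over_def)
  have "\<exists>k. kdiv k A xi (srt c) (\<lambda>x d. sat C (x @ d) psi) c"
   using divides_kdiv[OF ct, of xi "\<lambda>x d. sat C (x @ d) psi"] Dl(3) q by blast
  then show ?thesis using divides_kdiv[OF ct, of xi "\<lambda>x d. sat C (x @ d) psi"] kdiv_mono[OF _ ct B] by blast
 qed
 then show ?thesis unfolding fset_def using Dl by (intro exI[of _ Dl]) auto
qed

lemma indep_iff:
 assumes "a \<in> tup sg" "A \<subseteq> U" "B \<subseteq> U"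
 shows "indep L C a B A \<longleftrightarrow> (\<forall>c P. set c \<subseteq> A \<union> B --> defp L C (sg @ srt c) P --> P (a @ c) --> \<not> fset A sg {x. P (x @ c)})"
proof
 assume i: "indep L C a B A"
 show "\<forall>c P. set c \<subseteq> A \<union> B --> defp L C (sg @ srt c) P --> P (a @ c) --> \<not> fset A sg {x. P (x @ c)}"
 proof (intro allI impI)
  fix c P assume c: "set c \<subseteq> A \<union> B" "defp L C (sg @ srt c) P" "P (a @ c)"
  obtain phi where phi: "wff L (sg @ srt c) phi" "\<forall>a\<in>tup (sg @ srt c). P a \<longleftrightarrow> sat C a phi"
   using c(2) unfolding defp_def by blast
  have ct: "c \<in> tup (srt c)" using c assms by (intro tuples_self) auto
  have "sat C (a @ c) phi" using phi(2) c(3) assms(1) ct by simp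
  then have t: "(phi, c) \<in> tp L C a (A \<union> B)"
   using c(1) phi(1) unfolding tp_def formulas_over_def tuples_sorts[OF assms(1)] by simp
  then have "\<not> fset A sg {x. sat C (x @ c) phi}"
   using bspec[OF i[unfolded Defs.indep_def] t] by (simp add: forks_fset tuples_sorts[OF assms(1)])
  then show "\<not> fset A sg {x. P (x @ c)}"
   using fset_mono[of A sg "{x. P (x @ c)}" "{x. sat C (x @ c) phi}"] phi(2) ct by auto
 qed
next
 assume "\<forall>c P. set c \<subseteq> A \<union> B --> defp L C (sg @ srt c) P --> P (a @ c) --> \<not> fset A sg {x. P (x @ c)}"
 then show "indep L C a B A"
  unfolding Defs.indep_def forks_fset tp_def formulas_over_def tuples_sorts[OF assms(1)]
  using defp_wff by blast
qed

lemma indepD: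
 assumes "indep L C a B A" "a \<in> tup sg" "A \<subseteq> U" "B \<subseteq> U" "d \<in> tup ty" "set d \<subseteq> A \<union> B" "def2 L C sg ty R" "R a d"
 shows "\<not> fset A sg {x. R x d}"
proof -
 have "defp L C (sg @ srt d) (\<lambda>w. R (take (length sg) w) (drop (length sg) w))"
  using def2_defp[OF assms(7) coord_fst coord_snd] assms(5) by (simp add: tuples_sorts)
 moreover have "(\<lambda>w. R (take (length sg) w) (drop (length sg) w)) (a @ d)"
  using assms(2,8) by (simp add: tuples_length)
 ultimately have "\<not> fset A sg {x. R (take (length sg) (x @ d)) (drop (length sg) (x @ d))}"
  using indep_iff[OF assms(2-4)] assms(1,6) by blast
 moreover have "fset A sg {x. R (take (length sg) (x @ d)) (drop (length sg) (x @ d))} \<longleftrightarrow> fset A sg {x. R x d}"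
  by (auto elim!: fset_mono simp: tuples_length)
 ultimately show ?thesis by simp
qed

lemma indep_base_mono:
 assumes "indep L C a B A" "a \<in> tup sg" "A \<subseteq> A'" "A' \<subseteq> A \<union> B" "A \<subseteq> U" "B \<subseteq> U"
 shows "indep L C a B A'"
proof -
 have 1: "A' \<subseteq> U" "A' \<union> B = A \<union> B" using assms by auto
 have i: "\<not> fset A sg {x. P (x @ c)}" if "set c \<subseteq> A \<union> B" "defp L C (sg @ srt c) P" "P (a @ c)" for c P
  using assms(1) indep_iff[OF assms(2,5,6)] that by blast
 show ?thesis unfolding indep_iff[OF assms(2) 1(1) assms(6)] 1(2)
  using i fset_base_mono[OF _ assms(3) 1(1)] by blast
qed

end

subsection \<open>Consistent formulas do not fork over their parameters\<close>

locale simple_monster = monster_model L C \<kappa>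
 for L :: "('s, 'f, 'r) lang" and C :: "('s, 'f, 'r, 'a) struct" and \<kappa> :: "'k rel" +
 assumes simple: "simple_theory L C"
begin

text \<open>A local rank: \<open>X\<close> is consistent with every path through an infinitely
  branching tree whose levels carry the labels in \<open>w\<close>, each a formula with the sorts of
  its parameters and a number of inconsistency for siblings. The recursion shrinks \<open>X\<close>
  instead of naming the nodes.\<close>

primrec Tr :: "'s list => (('s, 'f, 'r) fm \<times> 's list \<times> nat) list => 'a list set => bool" where
 "Tr xi [] X \<longleftrightarrow> (\<exists>a\<in>tup xi. a \<in> X)"
| "Tr xi (q # w) X \<longleftrightarrow> (\<exists>c :: nat => 'a list. (\<forall>i. c i \<in> tup (fst (snd q))) \<and>
  (\<forall>I. finite I \<and> card I = snd (snd q) --> \<not> (\<exists>a\<in>tup xi. \<forall>i\<in>I. sat C (a @ c i) (fst q))) \<and>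
  (\<forall>i. Tr xi w (X \<inter> {a. sat C (a @ c i) (fst q)})))"

lemma TrE:
 assumes "Tr xi (q # w) X"
 obtains c :: "nat => 'a list" where "\<forall>i. c i \<in> tup (fst (snd q))"
  "\<forall>I. finite I \<and> card I = snd (snd q) --> \<not> (\<exists>a\<in>tup xi. \<forall>i\<in>I. sat C (a @ c i) (fst q))"
  "\<forall>i. Tr xi w (X \<inter> {a. sat C (a @ c i) (fst q)})"
 using assms unfolding Tr.simps by blast

lemma Tr_mono: "Tr xi w X ==> (\<And>a. a \<in> tup xi ==> a \<in> X ==> a \<in> Y) ==> Tr xi w Y"
proof (induction w arbitrary: X Y)
 case (Cons q w)
 obtain c :: "nat => 'a list" where c: "\<forall>i. c i \<in> tup (fst (snd q))"
  "\<forall>I. finite I \<and> card I = snd (snd q) --> \<not> (\<exists>a\<in>tup xi. \<forall>i\<in>I. sat C (a @ c i) (fst q))"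
  "\<forall>i. Tr xi w (X \<inter> {a. sat C (a @ c i) (fst q)})" using TrE[OF Cons.prems(1)] by blast
 have "Tr xi w (Y \<inter> {a. sat C (a @ c i) (fst q)})" for i
  by (rule Cons.IH[OF c(3)[rule_format]]) (use Cons.prems(2) in auto)
 then show ?case using c unfolding Tr.simps by blast
qed auto

text \<open>Infinitely many children survive in \<open>X\<close> or infinitely many in
  \<open>Y\<close>; renumbering those by \<open>enumerate\<close> keeps siblings
  inconsistent.\<close>

lemma Tr_Un: "Tr xi w (X \<union> Y) ==> Tr xi w X \<or> Tr xi w Y"
proof (induction w arbitrary: X Y)
 case (Cons q w)
 obtain c :: "nat => 'a list" where c: "\<forall>i. c i \<in> tup (fst (snd q))"
  "\<forall>I. finite I \<and> card I = snd (snd q) --> \<not> (\<exists>a\<in>tup xi. \<forall>i\<in>I. sat C (a @ c i) (fst q))"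
  "\<forall>i. Tr xi w ((X \<union> Y) \<inter> {a. sat C (a @ c i) (fst q)})" using TrE[OF Cons.prems(1)] by blast
 have or: "Tr xi w (X \<inter> {a. sat C (a @ c i) (fst q)}) \<or> Tr xi w (Y \<inter> {a. sat C (a @ c i) (fst q)})" for i
  using Cons.IH[of "X \<inter> {a. sat C (a @ c i) (fst q)}" "Y \<inter> {a. sat C (a @ c i) (fst q)}"] c(3)
  by (simp add: Int_Un_distrib2)
 have sub: "Tr xi (q # w) Z" if inf: "infinite {i. Tr xi w (Z \<inter> {a. sat C (a @ c i) (fst q)})}" for Z
 proof -
  let ?S = "{i. Tr xi w (Z \<inter> {a. sat C (a @ c i) (fst q)})}"
  have en: "enumerate ?S n \<in> ?S" for n using inf enumerate_in_set by blast
  have inj: "inj (enumerate ?S)" using inf by (simp add: strict_mono_enumerate strict_mono_imp_inj_on)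
  have "\<not> (\<exists>a\<in>tup xi. \<forall>i\<in>I. sat C (a @ c (enumerate ?S i)) (fst q))"
   if I: "finite I" "card I = snd (snd q)" for I
  proof -
   have "card (enumerate ?S ` I) = snd (snd q)" "finite (enumerate ?S ` I)"
    using I inj by (auto simp: card_image inj_on_subset)
   then have "\<not> (\<exists>a\<in>tup xi. \<forall>i\<in>enumerate ?S ` I. sat C (a @ c i) (fst q))" using c(2) by blast
   then show ?thesis by simp
  qed
  then show ?thesis unfolding Tr.simps using c(1) en by (intro exI[of _ "\<lambda>n. c (enumerate ?S n)"]) auto
 qed
 have "infinite ({i. Tr xi w (X \<inter> {a. sat C (a @ c i) (fst q)})} \<union> {i. Tr xi w (Y \<inter> {a. sat C (a @ c i) (fst q)})})"
 proof -
  have "{i. Tr xi w (X \<inter> {a. sat C (a @ c i) (fst q)})} \<union> {i. Tr xi w (Y \<inter> {a. sat C (a @ c i) (fst q)})} = UNIV"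
   using or by auto
  then show ?thesis by simp
 qed
 then show ?case using sub by auto
qed auto

lemma Tr_not_empty: "\<not> Tr xi w {}"
 by (induction w) auto

lemma Tr_UN: "finite T ==> Tr xi w (\<Union>t\<in>T. X t) ==> \<exists>t\<in>T. Tr xi w (X t)"
proof (induction T rule: finite_induct)
 case empty then show ?case using Tr_not_empty by simp
next
 case (insert t T) then show ?case using Tr_Un[of xi w "X t" "\<Union>t\<in>T. X t"] by auto
qed

lemma Tr_aut:
 assumes h: "aut h"
 shows "Tr xi w X ==> (\<forall>q\<in>set w. wff L (xi @ fst (snd q)) (fst q)) ==>
  (\<And>a. a \<in> tup xi ==> a \<in> X ==> map h a \<in> Y) ==> Tr xi w Y"
proof (induction w arbitrary: X Y)
 case Nil then show ?case using aut_tup[OF h] by auto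
next
 case (Cons q w)
 obtain c :: "nat => 'a list" where c: "\<forall>i. c i \<in> tup (fst (snd q))"
  "\<forall>I. finite I \<and> card I = snd (snd q) --> \<not> (\<exists>a\<in>tup xi. \<forall>i\<in>I. sat C (a @ c i) (fst q))"
  "\<forall>i. Tr xi w (X \<inter> {a. sat C (a @ c i) (fst q)})" using TrE[OF Cons.prems(1)] by blast
 have w: "wff L (xi @ fst (snd q)) (fst q)" using Cons.prems(2) by simp
 have s: "sat C (map h a @ map h (c i)) (fst q) \<longleftrightarrow> sat C (a @ c i) (fst q)" if "a \<in> tup xi" for a i
  using aut_sat[OF h w, of "a @ c i"] that c(1) by simp
 obtain g where g: "aut g" "\<And>x. x \<in> U ==> g (h x) = x" "\<And>x. x \<in> U ==> h (g x) = x" using aut_inv[OF h] by blast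
 have hg: "map h (map g a) = a" if "a \<in> tup xi" for a
  by (rule aut_inv_map[where g = h and h = g, OF g(3) tuples_set[OF that]])
 have "Tr xi w (Y \<inter> {a. sat C (a @ map h (c i)) (fst q)})" for i
  by (rule Cons.IH[OF c(3)[rule_format]]) (use Cons.prems s in auto)
 moreover have "\<not> (\<exists>a\<in>tup xi. \<forall>i\<in>I. sat C (a @ map h (c i)) (fst q))" if "finite I" "card I = snd (snd q)" for I
 proof
  assume "\<exists>a\<in>tup xi. \<forall>i\<in>I. sat C (a @ map h (c i)) (fst q)"
  then obtain a where a: "a \<in> tup xi" "\<forall>i\<in>I. sat C (a @ map h (c i)) (fst q)" by blast
  have "\<forall>i\<in>I. sat C (map g a @ c i) (fst q)"
   using s[OF aut_tup[OF g(1) a(1)]] a(2) hg[OF a(1)] by (simp del: map_map)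
  then show False using c(2) that aut_tup[OF g(1) a(1)] by blast
 qed
 ultimately show ?case unfolding Tr.simps using aut_tup[OF h] c(1)
  by (intro exI[of _ "\<lambda>i. map h (c i)"]) blast
qed

text \<open>A level with another label is skipped by descending to its child
  \<open>0\<close>.\<close>

lemma Tr_filter: "Tr xi w X ==> Tr xi (filter ((=) q) w) X"
proof (induction w arbitrary: X)
 case (Cons p w)
 obtain c :: "nat => 'a list" where c: "\<forall>i. c i \<in> tup (fst (snd p))"
  "\<forall>I. finite I \<and> card I = snd (snd p) --> \<not> (\<exists>a\<in>tup xi. \<forall>i\<in>I. sat C (a @ c i) (fst p))"
  "\<forall>i. Tr xi w (X \<inter> {a. sat C (a @ c i) (fst p)})" using TrE[OF Cons.prems(1)] by blast
 have IH: "Tr xi (filter ((=) q) w) (X \<inter> {a. sat C (a @ c i) (fst p)})" for i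
  using Cons.IH c(3) by blast
 then show ?case 
 proof (cases "q = p")
  case True
  have "Tr xi (p # filter ((=) q) w) X" unfolding Tr.simps
   by (rule exI[of _ c]) (intro conjI c(1,2) allI IH)
  then show ?thesis using True by simp
 next
  case False
  have "Tr xi (filter ((=) q) w) X"
   by (rule Tr_mono[of xi "filter ((=) q) w" "X \<inter> {a. sat C (a @ c 0) (fst p)}" X]) (use IH in auto)
  then show ?thesis using False by simp
 qed
qed auto

lemma Tr_replicate_le: "Tr xi (replicate n q) X ==> m \<le> n ==> Tr xi (replicate m q) X"
proof (induction n arbitrary: X)
 case (Suc n)
 show ?case
 proof (cases "m = Suc n")
  case False
  have "\<exists>c :: nat => 'a list. \<forall>i. Tr xi (replicate n q) (X \<inter> {a. sat C (a @ c i) (fst q)})"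
   by (rule TrE[OF Suc.prems(1)[unfolded replicate_Suc]]) (rule exI)
  then obtain c :: "nat => 'a list" where "\<forall>i. Tr xi (replicate n q) (X \<inter> {a. sat C (a @ c i) (fst q)})"
   by blast
  then have "Tr xi (replicate n q) X" using Tr_mono[of xi "replicate n q" "X \<inter> {a. sat C (a @ c 0) (fst q)}" X] by auto
  then show ?thesis using Suc False by auto
 qed (use Suc in simp)
qed simp

lemma Tr_tree:
 "Tr xi (replicate m (psi, ty, k)) X ==> \<exists>b :: nat list => 'a list. (\<forall>\<eta>. b \<eta> \<in> tup ty) \<and>
  (\<forall>\<beta> :: nat => nat. \<exists>a\<in>tup xi. a \<in> X \<and> (\<forall>n<m. sat C (a @ b (map \<beta> [0..<Suc n])) psi)) \<and>
  (\<forall>\<eta> I. length \<eta> < m --> finite I \<and> card I = k --> \<not> (\<exists>a\<in>tup xi. \<forall>i\<in>I. sat C (a @ b (\<eta> @ [i])) psi))"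
proof (induction m arbitrary: X)
 case 0
 obtain d where "d \<in> tup ty" using tuples_nonempty[OF struct] by blast
 then show ?case using 0 by (intro exI[of _ "\<lambda>_. d"]) auto
next
 case (Suc m)
 obtain c :: "nat => 'a list" where c: "\<forall>i. c i \<in> tup ty"
  "\<forall>I. finite I \<and> card I = k --> \<not> (\<exists>a\<in>tup xi. \<forall>i\<in>I. sat C (a @ c i) psi)"
  "\<forall>i. Tr xi (replicate m (psi, ty, k)) (X \<inter> {a. sat C (a @ c i) psi})"
  by (rule TrE[OF Suc.prems(1)[unfolded replicate_Suc]]) (simp only: fst_conv snd_conv)
 let ?Q = "\<lambda>i b. (\<forall>\<eta>. b \<eta> \<in> tup ty) \<and>
  (\<forall>\<beta> :: nat => nat. \<exists>a\<in>tup xi. a \<in> X \<inter> {a. sat C (a @ c i) psi} \<and> (\<forall>n<m. sat C (a @ b (map \<beta> [0..<Suc n])) psi)) \<and>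
  (\<forall>\<eta> I. length \<eta> < m --> finite I \<and> card I = k --> \<not> (\<exists>a\<in>tup xi. \<forall>i\<in>I. sat C (a @ b (\<eta> @ [i])) psi))"
 have "\<forall>i. \<exists>b. ?Q i b" using Suc.IH[OF c(3)[rule_format]] by blast
 then obtain b where b: "\<And>i. ?Q i (b i)" using choice[of ?Q] by blast
 \<comment> \<open>The root has no parameter of its own; \<open>c 0\<close> only supplies a tuple of
   the right sorts there.\<close>
 define B where "B \<eta> = (case \<eta> of [] => c 0 | i # \<eta>' => (if \<eta>' = [] then c i else b i \<eta>'))" for \<eta>
 have "B \<eta> \<in> tup ty" for \<eta> using c(1) b by (cases \<eta>) (auto simp: B_def)
 moreover have "\<exists>a\<in>tup xi. a \<in> X \<and> (\<forall>n<Suc m. sat C (a @ B (map \<beta> [0..<Suc n])) psi)" for \<beta> :: "nat => nat"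
 proof -
  from b[of "\<beta> 0"] obtain a where a: "a \<in> tup xi" "a \<in> X" "sat C (a @ c (\<beta> 0)) psi"
   "\<forall>n<m. sat C (a @ b (\<beta> 0) (map (\<lambda>i. \<beta> (Suc i)) [0..<Suc n])) psi" by blast
  have m: "map \<beta> [0..<Suc n] = \<beta> 0 # map (\<lambda>i. \<beta> (Suc i)) [0..<n]" for n
   by (subst upt_conv_Cons) (auto simp: map_Suc_upt[symmetric] comp_def simp del: upt_Suc)
  have "sat C (a @ B (map \<beta> [0..<Suc n])) psi" if "n < Suc m" for n
  proof (cases n)
   case 0 then show ?thesis using a(3) by (simp add: B_def)
  next
   case (Suc n') then show ?thesis unfolding m using a(4) that by (auto simp: B_def)
  qed
  then show ?thesis using a by blast
 qed
 moreover have "\<not> (\<exists>a\<in>tup xi. \<forall>i\<in>I. sat C (a @ B (\<eta> @ [i])) psi)"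
  if "length \<eta> < Suc m" "finite I" "card I = k" for \<eta> I
 proof (cases \<eta>)
  case Nil then show ?thesis using c(2) that by (simp add: B_def)
 next
  case (Cons j \<eta>') then show ?thesis using b[of j] that by (simp add: B_def)
 qed
 ultimately show ?case by (intro exI[of _ B]) blast
qed

text \<open>Trees of all finite heights have a limit of height \<omega>, which contradicts
  simplicity.\<close>

lemma Tr_bounded:
 assumes w: "wff L (xi @ ty) psi" and all: "\<And>m. Tr xi (replicate m (psi, ty, k)) X" shows False
proof -
 let ?Q = "\<lambda>m b. (\<forall>\<eta>. b \<eta> \<in> tup ty) \<and>
  (\<forall>\<beta> :: nat => nat. \<exists>a\<in>tup xi. a \<in> X \<and> (\<forall>n<m. sat C (a @ b (map \<beta> [0..<Suc n])) psi)) \<and>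
  (\<forall>\<eta> I. length \<eta> < m --> finite I \<and> card I = k --> \<not> (\<exists>a\<in>tup xi. \<forall>i\<in>I. sat C (a @ b (\<eta> @ [i])) psi))"
 have "\<forall>m. \<exists>b. ?Q m b" using Tr_tree[OF all] by blast
 then obtain b where b: "\<And>m. ?Q m (b m)" using choice[of ?Q] by blast
 have "\<forall>m \<beta>. \<exists>a. a \<in> tup xi \<and> (\<forall>n<m. sat C (a @ b m (map \<beta> [0..<Suc n])) psi)" using b by blast
 then obtain a where a: "\<And>m \<beta>. a m \<beta> \<in> tup xi" "\<And>m \<beta> n. n < m ==> sat C (a m \<beta> @ b m (map \<beta> [0..<Suc n])) psi"
  by metis
 obtain F where F: "F \<le> sequentially" "ultra F" using ultra_exists[of sequentially] by auto
 have ev: "eventually (\<lambda>m. n < m) F" for n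
  using F(1) eventually_gt_at_top[of n] by (auto simp: le_filter_def)
 \<comment> \<open>The limit is taken over the nodes and, at the same time, over solutions for all
   branches, of which there are continuum many.\<close>
 let ?K = "Inl ` (UNIV :: nat list set) \<union> Inr ` (UNIV :: (nat => nat) set)"
 let ?ty = "case_sum (\<lambda>\<eta>. ty) (\<lambda>\<beta>. xi)" and ?c = "\<lambda>m. case_sum (b m) (a m)"
 have "sm ?K" by (rule sm_Plus[OF sm_countable sm_nat_fun]) simp
 moreover have "?c m x \<in> tup (?ty x)" if "x \<in> ?K" for x m
  using b a(1) by (cases x) auto
 ultimately have "\<exists>d. (\<forall>x\<in>?K. d x \<in> tup (?ty x)) \<and> (\<forall>xs P. set xs \<subseteq> ?K --> defp L C (concat (map ?ty xs)) P -->
  (P (concat (map d xs)) \<longleftrightarrow> eventually (\<lambda>i. P (concat (map (?c i) xs))) F))"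
  by (rule tulim[OF F(2)])
 then obtain d where
  d: "\<And>x. x \<in> ?K ==> d x \<in> tup (?ty x)" "\<And>xs P. set xs \<subseteq> ?K ==> defp L C (concat (map ?ty xs)) P ==>
  (P (concat (map d xs)) \<longleftrightarrow> eventually (\<lambda>m. P (concat (map (?c m) xs))) F)"
  by blast
 define B where "B \<eta> = d (Inl \<eta>)" for \<eta>
 have "tree_property L C xi ty psi"
  unfolding tree_property_def
 proof (intro exI[of _ k] exI[of _ B] conjI allI impI)
  show Bt: "B \<eta> \<in> tup ty" for \<eta> using d(1)[of "Inl \<eta>"] by (simp add: B_def)
  show "\<exists>a\<in>tup xi. \<forall>n. sat C (a @ B (map \<beta> [0..<Suc n])) psi" for \<beta>
  proof (intro bexI[of _ "d (Inr \<beta>)"] allI)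
   show "d (Inr \<beta>) \<in> tup xi" using d(1)[of "Inr \<beta>"] by simp
   fix n
   have D: "defp L C (concat (map ?ty [Inr \<beta>, Inl (map \<beta> [0..<Suc n])])) (\<lambda>w. sat C w psi)"
    using defp_wff[OF w] by simp
   have "eventually (\<lambda>m. sat C (concat (map (?c m) [Inr \<beta>, Inl (map \<beta> [0..<Suc n])])) psi) F"
    using ev[of n] by eventually_elim (use a(2) in simp)
   then have "sat C (concat (map d [Inr \<beta>, Inl (map \<beta> [0..<Suc n])])) psi" using d(2)[OF _ D] by simp
   then show "sat C (d (Inr \<beta>) @ B (map \<beta> [0..<Suc n])) psi" by (simp add: B_def)
  qed
  fix \<eta> and I :: "nat set" assume I: "finite I \<and> card I = k"
  obtain js where js: "set js = I" "distinct js" using I finite_distinct_list by blast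
  then have len: "length js = k" using I distinct_card by fastforce
  let ?xs = "map (\<lambda>i. Inl (\<eta> @ [i])) js :: (nat list + (nat => nat)) list"
  let ?P = "\<lambda>w. \<not> (\<exists>a\<in>tup xi. \<forall>t<k. sat C (a @ slice (length ty) t w) psi)"
  have cc: "concat (map ?ty ?xs) = concat (replicate k ty)"
   unfolding len[symmetric] by (induction js) auto
  have D: "defp L C (concat (map ?ty ?xs)) ?P"
   unfolding cc by (rule defp_neg, rule defp_common[OF def2_wff[OF w]])
  have eq: "?P (concat (map (\<lambda>i. g (\<eta> @ [i])) js)) \<longleftrightarrow> \<not> (\<exists>a\<in>tup xi. \<forall>i\<in>I. sat C (a @ g (\<eta> @ [i])) psi)"
   if "\<forall>\<eta>. g \<eta> \<in> tup ty" for g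
  proof -
   have sl: "slice (length ty) t (concat (map (\<lambda>i. g (\<eta> @ [i])) js)) = g (\<eta> @ [js ! t])" if t: "t < k" for t
    by (rule slice_concat) (use tuples_length \<open>\<forall>\<eta>. g \<eta> \<in> tup ty\<close> t len in auto)
   have "(\<forall>t<k. sat C (a @ slice (length ty) t (concat (map (\<lambda>i. g (\<eta> @ [i])) js))) psi) \<longleftrightarrow>
    (\<forall>t<k. sat C (a @ g (\<eta> @ [js ! t])) psi)" for a
    using sl by simp
   moreover have "(\<forall>t<k. sat C (a @ g (\<eta> @ [js ! t])) psi) \<longleftrightarrow> (\<forall>i\<in>I. sat C (a @ g (\<eta> @ [i])) psi)" for a
    unfolding js(1)[symmetric] all_set_conv_all_nth len ..
   ultimately show ?thesis by simp
  qed
  have "eventually (\<lambda>m. ?P (concat (map (?c m) ?xs))) F"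
   using ev[of "length \<eta>"]
  proof eventually_elim
   case (elim m)
   then have "\<not> (\<exists>a\<in>tup xi. \<forall>i\<in>I. sat C (a @ b m (\<eta> @ [i])) psi)" using b[of m] I by blast
   then show ?case using eq[of "b m"] b[of m] by (simp add: comp_def)
  qed
  moreover have "set ?xs \<subseteq> ?K" by auto
  ultimately have "?P (concat (map d ?xs))" using d(2)[OF _ D] by (simp only: simp_thms)
  then show "\<not> (\<exists>a\<in>tup xi. \<forall>i\<in>I. sat C (a @ B (\<eta> @ [i])) psi)"
   using eq[of B] Bt by (simp add: comp_def B_def)
 qed
 then show False using simple w unfolding simple_theory_def by blast
qed

text \<open>A nonempty set defined over \<open>A\<close> and covered by finitely many formulas
  dividing over \<open>A\<close> would have trees of every height with labels from a finite set. By
  pigeonhole one label then occurs arbitrarily often, which simplicity forbids.\<close>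

lemma not_fset:
 assumes A: "A \<subseteq> U" "sm A" and c: "set c \<subseteq> A" and P: "defp L C (xi @ srt c) P"
  and a0: "a0 \<in> tup xi" "P (a0 @ c)"
 shows "\<not> fset A xi {a. P (a @ c)}"
proof
 assume "fset A xi {a. P (a @ c)}"
 then obtain Dl where Dl: "Dl \<subseteq> formulas_over L C xi U" "finite Dl" "\<forall>(psi, c)\<in>Dl. divides L C A xi psi c"
  "\<forall>a\<in>tup xi. P (a @ c) --> (\<exists>(psi, c)\<in>Dl. sat C (a @ c) psi)" unfolding fset_def by blast
 have ct: "c \<in> tup (srt c)" using c A by (intro tuples_self) auto
 have "\<forall>q\<in>Dl. \<exists>k. kdiv k A xi (srt (snd q)) (\<lambda>x d. sat C (x @ d) (fst q)) (snd q)"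
 proof
  fix q assume q: "q \<in> Dl"
  then have "set (snd q) \<subseteq> U" using Dl(1) by (cases q) (auto simp: formulas_over_def)
  then have "snd q \<in> tup (srt (snd q))" by (rule tuples_self)
  from divides_kdiv[OF this, of xi "\<lambda>x d. sat C (x @ d) (fst q)" "fst q"] Dl(3) q
  show "\<exists>k. kdiv k A xi (srt (snd q)) (\<lambda>x d. sat C (x @ d) (fst q)) (snd q)" by auto
 qed
 then obtain k where k: "\<And>q. q \<in> Dl ==> kdiv (k q) A xi (srt (snd q)) (\<lambda>x d. sat C (x @ d) (fst q)) (snd q)"
  by metis
 define Q where "Q = (\<lambda>q. (fst q, srt (snd q), k q)) ` Dl"
 have Q: "finite Q" "\<And>q. q \<in> Q ==> wff L (xi @ fst (snd q)) (fst q)"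
  using Dl(1,2) by (auto simp: Q_def formulas_over_def)
 define Y where "Y = {a \<in> tup xi. P (a @ c)}"
 \<comment> \<open>The tree for \<open>w\<close> survives on one of the covering formulas. Its
   images under automorphisms over \<open>A\<close> that move the parameter along the dividing
   sequence become the subtrees of a new root; \<open>Y\<close> is preserved because it is defined
   over \<open>A\<close>.\<close>
 have step: "\<exists>q\<in>Q. Tr xi (q # w) Y" if w: "Tr xi w Y" "set w \<subseteq> Q" for w
 proof -
  have "Tr xi w (\<Union>q\<in>Dl. Y \<inter> {a. sat C (a @ snd q) (fst q)})"
   by (rule Tr_mono[OF w(1)]) (use Dl(4) in \<open>fastforce simp: Y_def\<close>)
  then obtain q where q: "q \<in> Dl" "Tr xi w (Y \<inter> {a. sat C (a @ snd q) (fst q)})"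
   using Tr_UN[OF Dl(2)] by blast
  obtain psi b where qb: "q = (psi, b)" by (cases q)
  have b: "b \<in> tup (srt b)" "wff L (xi @ srt b) psi"
   using Dl(1) q(1) qb by (auto simp: formulas_over_def intro!: tuples_self)
  obtain d :: "nat => 'a list" where d: "\<forall>i. d i \<in> tup (srt b) \<and> tp L C (d i) A = tp L C b A"
   "\<forall>I. finite I \<and> card I = k q --> \<not> (\<exists>a\<in>tup xi. \<forall>i\<in>I. sat C (a @ d i) psi)"
   using k[OF q(1)] unfolding kdiv_def qb by auto
  have "Tr xi w (Y \<inter> {a. sat C (a @ d i) psi})" for i
  proof -
   obtain h where h: "aut h" "\<forall>x\<in>A. h x = x" "map h b = d i"
    using hom_tuple[OF b(1) _ A] d(1) by metis
   show ?thesis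
   proof (rule Tr_aut[OF h(1) q(2)])
    show "\<forall>q\<in>set w. wff L (xi @ fst (snd q)) (fst q)" using w(2) Q(2) by auto
    fix a assume a: "a \<in> tup xi" "a \<in> Y \<inter> {a. sat C (a @ snd q) (fst q)}"
    have "P (map h (a @ c)) = P (a @ c)" by (rule aut_defp[OF h(1) P]) (use a ct in simp)
    then have "map h a \<in> Y" using a aut_tup[OF h(1)] aut_fix_map[OF h(2) c] by (simp add: Y_def)
    moreover have "sat C (map h (a @ b)) psi = sat C (a @ b) psi" by (rule aut_sat[OF h(1) b(2)]) (use a b in simp)
    ultimately show "map h a \<in> Y \<inter> {a. sat C (a @ d i) psi}" using a h(3) qb by simp
   qed
  qed
  then have "Tr xi ((psi, srt b, k q) # w) Y" unfolding Tr.simps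
   by (intro exI[of _ d]) (use d in simp)
  moreover have "(psi, srt b, k q) \<in> Q" using q(1) qb by (auto simp: Q_def image_iff intro!: bexI[of _ q])
  ultimately show ?thesis by blast
 qed
 have long: "\<exists>w. length w = n \<and> set w \<subseteq> Q \<and> Tr xi w Y" for n
 proof (induction n)
  case 0 then show ?case using a0 by (intro exI[of _ "[]"]) (auto simp: Y_def)
 next
  case (Suc n)
  then obtain w where w: "length w = n" "set w \<subseteq> Q" "Tr xi w Y" by blast
  then obtain q where "q \<in> Q" "Tr xi (q # w) Y" using step by blast
  then show ?case using w by (intro exI[of _ "q # w"]) simp
 qed
 have "\<exists>q\<in>Q. Tr xi (replicate m q) Y" for m
 proof -
  \<comment> \<open>With one level more than \<open>card Q * m\<close>, some label occurs at least
    \<open>m\<close> times.\<close>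
  obtain w where w: "length w = card Q * m + 1" "set w \<subseteq> Q" "Tr xi w Y" using long by blast
  have "\<exists>q\<in>Q. m \<le> count_list w q"
  proof (rule ccontr)
   assume "\<not> ?thesis"
   then have "\<forall>q\<in>Q. count_list w q \<le> m" by auto
   then have "sum (count_list w) Q \<le> card Q * m" using sum_bounded_above[of Q "count_list w" m] by simp
   then show False using sum_count_set[OF w(2) Q(1)] w(1) by simp
  qed
  then obtain q where q: "q \<in> Q" "m \<le> count_list w q" by blast
  have "filter ((=) q) w = replicate (count_list w q) q"
   by (simp add: count_list_eq_length_filter replicate_length_filter)
  then have "Tr xi (replicate (count_list w q) q) Y" using Tr_filter[OF w(3), of q] by simp
  then show ?thesis using Tr_replicate_le q by blast
 qed
 \<comment> \<open>A label that fails at some height fails at all larger ones, so the maximum of the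
   failing heights would exclude every label.\<close>
 have "\<exists>q\<in>Q. \<forall>m. Tr xi (replicate m q) Y"
 proof (rule ccontr)
  assume "\<not> ?thesis"
  then have "\<forall>q\<in>Q. \<exists>m. \<not> Tr xi (replicate m q) Y" by blast
  then obtain m where m: "\<forall>q\<in>Q. \<not> Tr xi (replicate (m q) q) Y" by metis
  obtain q where q: "q \<in> Q" "Tr xi (replicate (Max (m ` Q)) q) Y" using \<open>\<And>m. \<exists>q\<in>Q. Tr xi (replicate m q) Y\<close> by blast
  have "m q \<le> Max (m ` Q)" using q(1) Q(1) by simp
  then show False using m q Tr_replicate_le by blast
 qed
 then obtain q where q: "q \<in> Q" "\<And>m. Tr xi (replicate m q) Y" by blast
 obtain psi ty k where "q = (psi, ty, k)" by (cases q)
 then show False using Tr_bounded[of xi ty psi k Y] q Q(2) by auto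
qed

end

context simple_monster begin

subsection \<open>Nonforking extensions\<close>

text \<open>If the type of \<open>e\<close> over \<open>A \<union> B\<close> were inconsistent with
  the negations of the formulas over \<open>A \<union> E\<close> that fork over \<open>A\<close>,
  then one formula of this type would be covered by finitely many forking ones and fork itself. The
  family may be infinite, so that whole models can be moved.\<close>

lemma nonfork_ext:
 fixes J :: "'j set"
 assumes J: "sm J" and A: "A \<subseteq> U" "sm A" and B: "B \<subseteq> U" "sm B" and E: "E \<subseteq> U" "sm E"
  and e: "\<And>j. j \<in> J ==> e j \<in> car (v j)"
  and ind: "\<And>idx. set idx \<subseteq> J ==> indep L C (map e idx) B A"
 shows "\<exists>h. aut h \<and> (\<forall>x\<in>A \<union> B. h x = x) \<and> (\<forall>idx. set idx \<subseteq> J --> indep L C (map (\<lambda>j. h (e j)) idx) E A)"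
proof -
 have et: "map e idx \<in> tup (map v idx)" if "set idx \<subseteq> J" for idx
  using that e by (intro map_tuples) auto
 define G1 where "G1 = {(idx, c, P). set idx \<subseteq> J \<and> set c \<subseteq> A \<union> B \<and> defp L C (map v idx @ srt c) P \<and> P (map e idx @ c)}"
 \<comment> \<open>\<open>P\<close> is demanded when its complement forks over \<open>A\<close>; a
   solution then satisfies no forking formula over \<open>A \<union> E\<close>.\<close>
 define G2 where "G2 = {(idx, c, P). set idx \<subseteq> J \<and> set c \<subseteq> A \<union> E \<and> defp L C (map v idx @ srt c) P \<and> fset A (map v idx) {x. \<not> P (x @ c)}}"
 have "\<exists>e'. (\<forall>j\<in>J. e' j \<in> car (v j)) \<and> (\<forall>(idx, c, P)\<in>G1 \<union> G2. P (map e' idx @ c))"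
 proof (rule compactness[OF J])
  show "A \<union> B \<union> E \<subseteq> U" "sm (A \<union> B \<union> E)" using A B E by (auto intro: sm_Un)
  show "set idx \<subseteq> J \<and> set c \<subseteq> A \<union> B \<union> E \<and> defp L C (map v idx @ srt c) P" if "(idx, c, P) \<in> G1 \<union> G2" for idx c P
   using that unfolding G1_def G2_def by blast
  fix G0 assume G0: "finite G0" "G0 \<subseteq> G1 \<union> G2"
  have "finite (\<Union>g\<in>G0. set (fst g))" using G0(1) by simp
  from finite_list[OF this] obtain js where js: "set js = (\<Union>g\<in>G0. set (fst g))" ..
  have jsJ: "set js \<subseteq> J" using js G0(2) by (fastforce simp: G1_def G2_def)
  define pos where "pos j = (SOME i. i < length js \<and> js ! i = j)" for j
  have pos: "pos j < length js \<and> js ! pos j = j" if "j \<in> set js" for j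
   unfolding pos_def by (rule someI_ex) (use that in \<open>auto simp: in_set_conv_nth\<close>)
  let ?sg = "map v js"
  define r where "r idx x = map ((!) x) (map pos idx)" for idx and x :: "'a list"
  have rg: "r idx (map g js) = map g idx" if "set idx \<subseteq> set js" for idx g
   unfolding r_def using pos that by (auto simp: subset_iff)
  have rc: "coord ?sg (map v idx) (r idx)" if "set idx \<subseteq> set js" for idx
   unfolding r_def by (rule coord_map_nth) (use pos that in \<open>auto simp: subset_iff\<close>)
  have idxjs: "set idx \<subseteq> set js" if "(idx, c, P) \<in> G0" for idx c P using js that by force
  have "\<exists>c0 Q. set c0 \<subseteq> A \<union> B \<and> defp L C (?sg @ srt c0) Q \<and> Q (map e js @ c0) \<and>
   (\<forall>x\<in>tup ?sg. Q (x @ c0) --> (\<forall>(idx, c, P)\<in>G. P (r idx x @ c)))"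
   if "finite G" "G \<subseteq> G0 \<inter> G1" for G using that
  proof (induction G rule: finite_induct)
   case empty
   then show ?case by (intro exI[of _ "[]"] exI[of _ "\<lambda>_. True"]) (auto intro: defp_const)
  next
   case (insert g G)
   then obtain c0 Q where Q: "set c0 \<subseteq> A \<union> B" "defp L C (?sg @ srt c0) Q" "Q (map e js @ c0)"
    "\<forall>x\<in>tup ?sg. Q (x @ c0) --> (\<forall>(idx, c, P)\<in>G. P (r idx x @ c))" by auto
   obtain idx c P where g: "g = (idx, c, P)" by (cases g)
   have gG: "(idx, c, P) \<in> G0" "set c \<subseteq> A \<union> B" "defp L C (map v idx @ srt c) P" "P (map e idx @ c)"
    using insert.prems g by (auto simp: G1_def)
   let ?n = "length js"
   define R where "R w = (Q (take (?n + length c0) w) \<and> P (r idx (take ?n w) @ drop (?n + length c0) w))" for w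
   have c1: "coord (?sg @ srt (c0 @ c)) (?sg @ srt c0) (take (?n + length c0))"
    by (rule coord_take') simp
   have c2: "coord (?sg @ srt (c0 @ c)) (map v idx @ srt c) (\<lambda>w. r idx (take ?n w) @ drop (?n + length c0) w)"
    by (rule coord_append[OF coord_comp[OF coord_take' rc[OF idxjs[OF gG(1)]]] coord_drop']) simp_all
   have "defp L C (?sg @ srt (c0 @ c)) R"
    unfolding R_def by (rule defp_conj[OF defp_coord[OF Q(2) c1] defp_coord[OF gG(3) c2]])
   moreover have Rx: "R (x @ c0 @ c) \<longleftrightarrow> Q (x @ c0) \<and> P (r idx x @ c)" if "length x = ?n" for x
    using that by (simp add: R_def)
   have "R (map e js @ c0 @ c)" using Rx Q(3) gG(4) rg[OF idxjs[OF gG(1)]] by simp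
   moreover have "\<forall>x\<in>tup ?sg. R (x @ c0 @ c) --> (\<forall>(idx, c, P)\<in>insert g G. P (r idx x @ c))"
    using Rx Q(4) g by (auto simp: tuples_length)
   ultimately show ?case using Q(1) gG(2) by (intro exI[of _ "c0 @ c"] exI[of _ R]) auto
  qed
  from this[of "G0 \<inter> G1"] G0(1) obtain c0 Q where Q: "set c0 \<subseteq> A \<union> B" "defp L C (?sg @ srt c0) Q" "Q (map e js @ c0)"
    "\<forall>x\<in>tup ?sg. Q (x @ c0) --> (\<forall>(idx, c, P)\<in>G0 \<inter> G1. P (r idx x @ c))" by auto
  show "\<exists>e'. (\<forall>j\<in>J. e' j \<in> car (v j)) \<and> (\<forall>(idx, c, P)\<in>G0. P (map e' idx @ c))"
  proof (rule ccontr)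
   assume no: "\<not> ?thesis"
   \<comment> \<open>A solution of \<open>Q\<close> that also satisfied the finitely many demands
     from \<open>G2\<close> would, continued by \<open>e\<close>, solve all of
     \<open>G0\<close>.\<close>
   have cov: "\<exists>g\<in>G0 \<inter> G2. \<not> (snd (snd g)) (r (fst g) x @ fst (snd g))" if x: "x \<in> tup ?sg" "Q (x @ c0)" for x
   proof (rule ccontr)
    assume n2: "\<not> ?thesis"
    define e' where "e' j = (if j \<in> set js then x ! pos j else e j)" for j
    have "e' j \<in> car (v j)" if "j \<in> J" for j
     using tuples_nth[OF x(1), of "pos j"] pos[of j] e[OF that] by (auto simp: e'_def)
    moreover have "P (map e' idx @ c)" if g: "(idx, c, P) \<in> G0" for idx c P
    proof -
     have "r idx x = map e' idx" using idxjs[OF g] by (auto simp: r_def e'_def)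
     moreover have "P (r idx x @ c)"
     proof (cases "(idx, c, P) \<in> G1")
      case True
      have "\<forall>(idx, c, P)\<in>G0 \<inter> G1. P (r idx x @ c)" using Q(4) x by blast
      from bspec[OF this, of "(idx, c, P)"] show ?thesis using True g by simp
     next
      case False
      then have "(idx, c, P) \<in> G0 \<inter> G2" using G0(2) g by blast
      then have "\<not> \<not> (snd (snd (idx, c, P))) (r (fst (idx, c, P)) x @ fst (snd (idx, c, P)))"
       using n2 by blast
      then show ?thesis by simp
     qed
     ultimately show ?thesis by simp
    qed
    ultimately have "(\<forall>j\<in>J. e' j \<in> car (v j)) \<and> (\<forall>(idx, c, P)\<in>G0. P (map e' idx @ c))" by auto
    then show False using no by blast
   qed
   have "fset A ?sg (\<Union>g\<in>G0 \<inter> G2. {x. r (fst g) x \<in> {y. \<not> (snd (snd g)) (y @ fst (snd g))}})"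
   proof (rule fset_UN)
    show "finite (G0 \<inter> G2)" using G0 by simp
    fix g assume g: "g \<in> G0 \<inter> G2"
    obtain idx c P where gg: "g = (idx, c, P)" by (cases g)
    have "fset A (map v idx) {y. \<not> P (y @ c)}" using g gg by (auto simp: G2_def)
    from fset_coord[OF this rc[OF idxjs]] g gg
    show "fset A ?sg {x. r (fst g) x \<in> {y. \<not> (snd (snd g)) (y @ fst (snd g))}}" by auto
   qed
   then have "fset A ?sg {x. Q (x @ c0)}" by (rule fset_mono) (use cov in auto)
   moreover have "\<not> fset A ?sg {x. Q (x @ c0)}"
    using ind[OF jsJ] indep_iff[OF et[OF jsJ] A(1) B(1)] Q by blast
   ultimately show False by blast
  qed
 qed
 then obtain e' where "(\<forall>j\<in>J. e' j \<in> car (v j)) \<and> (\<forall>(idx, c, P)\<in>G1 \<union> G2. P (map e' idx @ c))" ..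
 then have e': "\<And>j. j \<in> J ==> e' j \<in> car (v j)" "\<And>idx c P. (idx, c, P) \<in> G1 \<union> G2 ==> P (map e' idx @ c)"
  by (auto dest: bspec)
 have "\<exists>h. aut h \<and> (\<forall>a\<in>A \<union> B. h a = a) \<and> (\<forall>j\<in>J. h (e j) = e' j)"
 proof (rule hom_ext_over[OF J _ _ e e'(1)])
  show "A \<union> B \<subseteq> U" "sm (A \<union> B)" using A B by (auto intro: sm_Un)
  fix idx c P assume "set idx \<subseteq> J" "set c \<subseteq> A \<union> B" "defp L C (map v idx @ srt c) P" "P (map e idx @ c)"
  then have "(idx, c, P) \<in> G1" by (simp add: G1_def)
  then show "P (map e' idx @ c)" using e'(2) by blast
 qed
 then obtain h where h: "aut h" "\<forall>a\<in>A \<union> B. h a = a" "\<forall>j\<in>J. h (e j) = e' j" by blast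
 have "indep L C (map (\<lambda>j. h (e j)) idx) E A" if idx: "set idx \<subseteq> J" for idx
 proof -
  have eq: "map (\<lambda>j. h (e j)) idx = map e' idx" using h(3) idx by auto
  have "map e' idx \<in> tup (map v idx)" using idx e'(1) by (intro map_tuples) auto
  moreover have "\<not> fset A (map v idx) {x. P (x @ c)}"
   if c: "set c \<subseteq> A \<union> E" "defp L C (map v idx @ srt c) P" "P (map e' idx @ c)" for c P
  proof
   assume "fset A (map v idx) {x. P (x @ c)}"
   then have "(idx, c, \<lambda>w. \<not> P w) \<in> G2" using c idx defp_neg by (simp add: G2_def)
   then show False using e'(2) c(3) by blast
  qed
  ultimately show ?thesis unfolding eq using indep_iff[OF _ A(1) E(1)] by blast
 qed
 then show ?thesis using h by blast
qed

lemma indep_empty: "a \<in> tup sg ==> A \<subseteq> U ==> sm A ==> indep L C a {} A"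
 unfolding indep_iff[OF _ _ empty_subsetI] using not_fset by (simp add: indep_iff)

text \<open>The automorphism moves \<open>P\<close> as a whole, over \<open>A\<close>; its inverse
  can be used to move \<open>E\<close> instead.\<close>

lemma nonfork_exists:
 assumes A: "A \<subseteq> U" "sm A" and P: "P \<subseteq> U" "sm P" and E: "E \<subseteq> U" "sm E"
 obtains h where "aut h" "\<forall>x\<in>A. h x = x" "\<And>a. set a \<subseteq> P ==> indep L C (map h a) E A"
proof -
 have "\<exists>h. aut h \<and> (\<forall>x\<in>A \<union> {}. h x = x) \<and> (\<forall>idx. set idx \<subseteq> P --> indep L C (map (\<lambda>j. h (id j)) idx) E A)"
 proof (rule nonfork_ext[OF P(2) A _ _ E])
  show "id j \<in> car (Sort C j)" if "j \<in> P" for j using that P by (auto simp: carrier_of_def)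
  show "indep L C (map id idx) {} A" if "set idx \<subseteq> P" for idx
   using indep_empty[OF tuples_self A, of idx] that P by auto
 qed (auto intro: sm_finite)
 then show ?thesis using that by auto
qed

end

section \<open>Stable relations\<close>

lemma ramsey_pairs:
 fixes Q :: "nat => nat => bool"
 shows "\<exists>g :: nat => nat. strict_mono g \<and> ((\<forall>i j. i < j --> Q (g i) (g j)) \<or> (\<forall>i j. i < j --> \<not> Q (g i) (g j)))"
proof -
 define f where "f X = (if Q (Min X) (Max X) then 0 else Suc 0)" for X
 have "\<exists>Y t. Y \<subseteq> (UNIV :: nat set) \<and> infinite Y \<and> t < Suc (Suc 0) \<and> (\<forall>x\<in>Y. \<forall>y\<in>Y. x \<noteq> y --> f {x, y} = t)"
  by (rule Ramsey2) (auto simp: f_def)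
 then obtain Y t where Y: "infinite Y" "\<forall>x\<in>Y. \<forall>y\<in>Y. x \<noteq> y --> f {x, y} = t" by blast
 have g: "strict_mono (enumerate Y)" "\<And>i. enumerate Y i \<in> Y"
  using Y(1) by (auto simp: strict_mono_enumerate enumerate_in_set)
 have "(if Q (enumerate Y i) (enumerate Y j) then 0 else Suc 0) = t" if "i < j" for i j
 proof -
  have lt: "enumerate Y i < enumerate Y j" using g(1) that by (simp add: strict_mono_def)
  then have "f {enumerate Y i, enumerate Y j} = t" using Y(2) g(2) by (metis less_irrefl)
  moreover have "Min {enumerate Y i, enumerate Y j} = enumerate Y i" "Max {enumerate Y i, enumerate Y j} = enumerate Y j"
   using lt by auto
  ultimately show ?thesis by (simp only: f_def)
 qed
 then have e: "Q (enumerate Y i) (enumerate Y j) \<longleftrightarrow> t = 0" if "i < j" for i j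
  using that by (metis zero_neq_one One_nat_def)
 show ?thesis by (rule exI[of _ "enumerate Y"]) (use e g(1) in auto)
qed

section \<open>Ladders and closure properties of stable relations\<close>

context monster_model begin

definition lad :: "nat => 's list => 's list => ('a list => 'a list => bool) => bool" where
 "lad n xi ty R \<longleftrightarrow> (\<exists>a b :: nat => 'a list. (\<forall>i<n. a i \<in> tup xi \<and> b i \<in> tup ty) \<and> (\<forall>i<n. \<forall>j<n. R (a i) (b j) \<longleftrightarrow> i < j))"

text \<open>Stability as a bound on the length of ladders. For definable relations this amounts to
  the absence of infinite ladders (\<open>inf_ladder\<close>), but the bound is what yields a
  uniform number of dividing.\<close>

definition stab :: "'s list => 's list => ('a list => 'a list => bool) => bool" where
 "stab xi ty R \<longleftrightarrow> def2 L C xi ty R \<and> (\<exists>n. \<not> lad n xi ty R)"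

lemma stab_def2: "stab xi ty R ==> def2 L C xi ty R"
 by (simp add: stab_def)

lemma ladE:
 assumes "lad n xi ty R"
 obtains a b :: "nat => 'a list" where "\<forall>i<n. a i \<in> tup xi \<and> b i \<in> tup ty" "\<forall>i<n. \<forall>j<n. R (a i) (b j) \<longleftrightarrow> i < j"
 using assms unfolding lad_def by (elim exE conjE)

lemma ladI:
 fixes a b :: "nat => 'a list"
 assumes "\<And>i. i < n ==> a i \<in> tup xi" "\<And>i. i < n ==> b i \<in> tup ty" "\<And>i j. i < n ==> j < n ==> R (a i) (b j) \<longleftrightarrow> i < j"
 shows "lad n xi ty R"
 unfolding lad_def by (rule exI[of _ a], rule exI[of _ b]) (use assms in simp)

lemma inf_ladder:
 assumes "def2 L C xi ty R" "\<forall>n. lad n xi ty R"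
 shows "\<exists>a b :: nat => 'a list. (\<forall>i. a i \<in> tup xi \<and> b i \<in> tup ty) \<and> (\<forall>i j. R (a i) (b j) \<longleftrightarrow> i < j)"
proof -
 obtain x0 d0 where x0: "x0 \<in> tup xi" "d0 \<in> tup ty" using tuples_nonempty[OF struct] by metis
 have "\<forall>n. \<exists>a b :: nat => 'a list. (\<forall>i<n. a i \<in> tup xi \<and> b i \<in> tup ty) \<and> (\<forall>i<n. \<forall>j<n. R (a i) (b j) \<longleftrightarrow> i < j)"
  using assms(2) unfolding lad_def .
 from choice[OF this] obtain a where "\<forall>n. \<exists>b :: nat => 'a list. (\<forall>i<n. a n i \<in> tup xi \<and> b i \<in> tup ty) \<and> (\<forall>i<n. \<forall>j<n. R (a n i) (b j) \<longleftrightarrow> i < j)" ..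
 from choice[OF this] obtain b where "\<forall>n. (\<forall>i<n. a n i \<in> tup xi \<and> b n i \<in> tup ty) \<and> (\<forall>i<n. \<forall>j<n. R (a n i) (b n j) \<longleftrightarrow> i < j)" ..
 then have ab: "\<And>n i. i < n ==> a n i \<in> tup xi \<and> b n i \<in> tup ty"
  "\<And>n i j. i < n ==> j < n ==> R (a n i) (b n j) \<longleftrightarrow> i < (j :: nat)" by auto
 obtain F where F: "F \<le> sequentially" "ultra F" using ultra_exists[of sequentially] by auto
 have ev: "eventually (\<lambda>m. n < m) F" for n
  using F(1) eventually_gt_at_top[of n] by (auto simp: le_filter_def)
 let ?ty = "case_sum (\<lambda>i. xi) (\<lambda>i. ty)"
 \<comment> \<open>Beyond its length the ladder number \<open>n\<close> is continued by the
   constants \<open>x0\<close> and \<open>d0\<close>.\<close>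
 let ?c = "\<lambda>n. case_sum (\<lambda>i. if i < n then a n i else x0) (\<lambda>i. if i < n then b n i else d0)"
 have "\<exists>d. (\<forall>x\<in>(UNIV :: (nat + nat) set). d x \<in> tup (?ty x)) \<and> (\<forall>xs P. set xs \<subseteq> UNIV --> defp L C (concat (map ?ty xs)) P -->
  (P (concat (map d xs)) \<longleftrightarrow> eventually (\<lambda>i. P (concat (map (?c i) xs))) F))"
 proof (rule tulim[OF F(2)])
  show "sm (UNIV :: (nat + nat) set)" by (simp add: sm_countable)
  show "?c n x \<in> tup (?ty x)" for n x using ab(1) x0 by (cases x) auto
 qed
 then obtain d where "(\<forall>x\<in>(UNIV :: (nat + nat) set). d x \<in> tup (?ty x)) \<and> (\<forall>xs P. set xs \<subseteq> UNIV --> defp L C (concat (map ?ty xs)) P -->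
  (P (concat (map d xs)) \<longleftrightarrow> eventually (\<lambda>i. P (concat (map (?c i) xs))) F))" ..
 then have d: "\<And>x. d x \<in> tup (?ty x)"
  "\<And>xs P. defp L C (concat (map ?ty xs)) P ==>
  (P (concat (map d xs)) \<longleftrightarrow> eventually (\<lambda>i. P (concat (map (?c i) xs))) F)" by (simp_all only: UNIV_I subset_UNIV simp_thms)
 have "R (d (Inl i)) (d (Inr j)) \<longleftrightarrow> i < j" for i j
 proof -
  let ?P = "\<lambda>w. R (take (length xi) w) (drop (length xi) w)"
  have D: "defp L C (concat (map ?ty [Inl i, Inr j])) ?P"
   using def2_defp[OF assms(1) coord_fst coord_snd] by simp
  have lt: "length (d (Inl i)) = length xi" using d(1)[of "Inl i"] by (simp add: tuples_length)
  have "R (d (Inl i)) (d (Inr j)) \<longleftrightarrow> ?P (concat (map d [Inl i, Inr j]))" using lt by simp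
  also have "... \<longleftrightarrow> eventually (\<lambda>n. ?P (concat (map (?c n) [Inl i, Inr j]))) F" by (rule d(2)[OF D])
  also have "... \<longleftrightarrow> eventually (\<lambda>n. i < j) F"
  proof (rule eventually_cong[OF eventually_conj[OF ev[of i] ev[of j]]])
   fix n assume "i < n \<and> j < n"
   then show "?P (concat (map (?c n) [Inl i, Inr j])) \<longleftrightarrow> i < j"
    using ab(2)[of i n j] tuples_length[OF conjunct1[OF ab(1)], of i n] by simp
  qed
  also have "... \<longleftrightarrow> i < j" by (rule ultra_const[OF F(2)])
  finally show ?thesis .
 qed
 moreover have "d (Inl i) \<in> tup xi" "d (Inr i) \<in> tup ty" for i using d(1)[of "Inl i"] d(1)[of "Inr i"] by simp_all
 ultimately show ?thesis by (intro exI[of _ "\<lambda>i. d (Inl i)"] exI[of _ "\<lambda>i. d (Inr i)"]) simp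
qed

lemma stable_formula_stab: "stable_formula L C xi ty phi \<longleftrightarrow> wff L (xi @ ty) phi \<and> stab xi ty (\<lambda>x d. sat C (x @ d) phi)"
proof
 assume s: "stable_formula L C xi ty phi"
 then have w: "wff L (xi @ ty) phi" unfolding stable_formula_def by (rule conjunct1)
 have "\<not> (\<forall>n. lad n xi ty (\<lambda>x d. sat C (x @ d) phi))"
  using inf_ladder[OF def2_wff[OF w, of C]] s unfolding stable_formula_def by argo
 then show "wff L (xi @ ty) phi \<and> stab xi ty (\<lambda>x d. sat C (x @ d) phi)"
  unfolding stab_def using w def2_wff[OF w, of C] by (simp only: not_all simp_thms)
next
 assume s: "wff L (xi @ ty) phi \<and> stab xi ty (\<lambda>x d. sat C (x @ d) phi)"
 then obtain n where n: "\<not> lad n xi ty (\<lambda>x d. sat C (x @ d) phi)" unfolding stab_def by (elim conjE exE)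
 have "lad n xi ty (\<lambda>x d. sat C (x @ d) phi)"
  if "(\<forall>i. a i \<in> tup xi \<and> b i \<in> tup ty) \<and> (\<forall>i j. sat C (a i @ b j) phi \<longleftrightarrow> i < j)" for a b :: "nat => 'a list"
  unfolding lad_def by (rule exI[of _ a], rule exI[of _ b]) (use that in simp)
 then show "stable_formula L C xi ty phi"
  unfolding stable_formula_def using n s by blast
qed

lemma stab_cong:
 assumes "stab xi ty R" "\<And>x d. x \<in> tup xi ==> d \<in> tup ty ==> R x d = S x d" shows "stab xi ty S"
proof -
 have "lad n xi ty S ==> lad n xi ty R" for n
  unfolding lad_def using assms(2) by (metis (no_types, lifting))
 then show ?thesis using assms def2_cong[of L C xi ty R S] unfolding stab_def by blast
qed

lemma stab_coord:
 assumes "stab xi ty R" "coord xi' xi r1" "coord ty' ty r2"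
 shows "stab xi' ty' (\<lambda>x d. R (r1 x) (r2 d))"
proof -
 have "lad n xi ty R" if "lad n xi' ty' (\<lambda>x d. R (r1 x) (r2 d))" for n
 proof -
  from that obtain a b :: "nat => 'a list" where "\<forall>i<n. a i \<in> tup xi' \<and> b i \<in> tup ty'"
   "\<forall>i<n. \<forall>j<n. R (r1 (a i)) (r2 (b j)) \<longleftrightarrow> i < j" by (rule ladE)
  then show ?thesis
   by (intro ladI[of _ "\<lambda>i. r1 (a i)" _ "\<lambda>i. r2 (b i)"]) (auto intro: coord_tuples[OF assms(2)] coord_tuples[OF assms(3)])
 qed
 then show ?thesis using assms def2_coord[of L C xi ty R] unfolding stab_def by blast
qed

text \<open>In a ladder for the negation, \<open>R (a i) (b j)\<close> holds iff
  \<open>j \<le> i\<close>. Reversing both sequences, with \<open>b\<close> shifted by one, turns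
  this into \<open>i < j\<close>; the shift costs one rung.\<close>

lemma stab_neg: assumes "stab xi ty R" shows "stab xi ty (\<lambda>x d. \<not> R x d)"
proof -
 have "lad n xi ty R" if "lad (Suc n) xi ty (\<lambda>x d. \<not> R x d)" for n
 proof -
  from that obtain a b :: "nat => 'a list" where ab: "\<forall>i<Suc n. a i \<in> tup xi \<and> b i \<in> tup ty"
   "\<forall>i<Suc n. \<forall>j<Suc n. \<not> R (a i) (b j) \<longleftrightarrow> i < j" by (rule ladE)
  have "R (a (n - 1 - i)) (b (n - j)) \<longleftrightarrow> i < j" if "i < n" "j < n" for i j
  proof -
   have "n - 1 - i < Suc n" "n - j < Suc n" "\<not> n - 1 - i < n - j \<longleftrightarrow> i < j" using that by arith+
   then show ?thesis using ab(2) by blast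
  qed
  then show ?thesis unfolding lad_def using ab(1)
   by (intro exI[of _ "\<lambda>i. a (n - 1 - i)"] exI[of _ "\<lambda>j. b (n - j)"]) auto
 qed
 then show ?thesis using assms def2_neg unfolding stab_def by blast
qed

lemma stab_swap: assumes "stab xi ty R" shows "stab ty xi (\<lambda>d x. R x d)"
proof -
 have "lad n xi ty R" if "lad n ty xi (\<lambda>d x. R x d)" for n
 proof -
  from that obtain a b :: "nat => 'a list" where ab: "\<forall>i<n. a i \<in> tup ty \<and> b i \<in> tup xi"
   "\<forall>i<n. \<forall>j<n. R (b j) (a i) \<longleftrightarrow> i < j" by (rule ladE)
  have "R (b (n - 1 - i)) (a (n - 1 - j)) \<longleftrightarrow> i < j" if "i < n" "j < n" for i j
   using ab(2)[rule_format, of "n - 1 - j" "n - 1 - i"] that by auto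
  then show ?thesis unfolding lad_def using ab(1)
   by (intro exI[of _ "\<lambda>i. b (n - 1 - i)"] exI[of _ "\<lambda>j. a (n - 1 - j)"]) auto
 qed
 then show ?thesis using assms def2_swap unfolding stab_def by blast
qed

text \<open>Below the diagonal of an infinite ladder the conjunction fails. By Ramsey the same
  conjunct fails for all such pairs from a subsequence, and this conjunct then has ladders of every
  length.\<close>

lemma stab_conj: assumes R: "stab xi ty R" and S: "stab xi ty S" shows "stab xi ty (\<lambda>x d. R x d \<and> S x d)"
proof (rule ccontr)
 assume no: "\<not> ?thesis"
 have d: "def2 L C xi ty (\<lambda>x d. R x d \<and> S x d)" using R S by (intro def2_conj stab_def2)
 then have "\<forall>n. lad n xi ty (\<lambda>x d. R x d \<and> S x d)" using no unfolding stab_def by blast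
 from inf_ladder[OF d this] obtain a b :: "nat => 'a list" where "(\<forall>i. a i \<in> tup xi \<and> b i \<in> tup ty) \<and>
  (\<forall>i j. R (a i) (b j) \<and> S (a i) (b j) \<longleftrightarrow> i < j)" by (elim exE)
 then have ab: "\<And>i. a i \<in> tup xi" "\<And>i. b i \<in> tup ty"
  "\<And>i j. R (a i) (b j) \<and> S (a i) (b j) \<longleftrightarrow> i < j" by auto
 from ramsey_pairs[of "\<lambda>i j. R (a j) (b i)"]
 obtain g :: "nat => nat" where g: "strict_mono g" "(\<forall>i j. i < j --> R (a (g j)) (b (g i))) \<or> (\<forall>i j. i < j --> \<not> R (a (g j)) (b (g i)))"
  by (elim exE conjE)
 have lad: "lad n xi ty T" if "\<forall>i j. i < j --> \<not> T (a (g j)) (b (g i))" "\<forall>i j. i < j --> T (a i) (b j)" for n T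
 proof -
  \<comment> \<open>Odd positions for \<open>a\<close> and even ones for \<open>b\<close> avoid the
    diagonal, where the chosen conjunct is not controlled.\<close>
  have "T (a (g (2 * i + 1))) (b (g (2 * j))) \<longleftrightarrow> i < j" for i j
  proof (cases "i < j")
   case True
   then have "g (2 * i + 1) < g (2 * j)" using g(1) by (auto simp: strict_mono_def)
   then show ?thesis using that(2) True by blast
  next
   case False
   then have "2 * j < 2 * i + 1" by simp
   then show ?thesis using that(1) False by blast
  qed
  then show ?thesis unfolding lad_def using ab
   by (intro exI[of _ "\<lambda>i. a (g (2 * i + 1))"] exI[of _ "\<lambda>i. b (g (2 * i))"]) auto
 qed
 show False
 proof (cases "\<forall>i j. i < j --> R (a (g j)) (b (g i))")
  case True
  have "g i < g j" if "i < j" for i j using g(1) that by (simp add: strict_mono_def)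
  then have "\<forall>i j. i < j --> \<not> S (a (g j)) (b (g i))" using True ab(3) by (metis less_asym)
  then have "lad n xi ty S" for n by (rule lad) (use ab(3) in blast)
  then show False using S unfolding stab_def by simp
 next
  case False
  then have "\<forall>i j. i < j --> \<not> R (a (g j)) (b (g i))" using g(2) by blast
  then have "lad n xi ty R" for n by (rule lad) (use ab(3) in blast)
  then show False using R unfolding stab_def by simp
 qed
qed

lemma stab_disj: "stab xi ty R ==> stab xi ty S ==> stab xi ty (\<lambda>x d. R x d \<or> S x d)"
 using stab_neg[OF stab_conj[OF stab_neg stab_neg, of xi ty R S]] by simp

lemma stab_param: "defp L C ty P ==> stab xi ty (\<lambda>x d. P d)"
proof -
 assume "defp L C ty P"
 moreover have "\<not> lad 3 xi ty (\<lambda>x d. P d)"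
 proof
  assume "lad 3 xi ty (\<lambda>x d. P d)"
  then obtain a b :: "nat => 'a list" where "\<forall>i<3. a i \<in> tup xi \<and> b i \<in> tup ty"
   and b: "\<forall>i<3::nat. \<forall>j<3::nat. P (b j) = (i < j)" by (rule ladE)
  have "P (b 1) = (0 < (1::nat))" "P (b 1) = (1 < (1::nat))" 
   using b[rule_format, of 0 1] b[rule_format, of 1 1] by simp_all
  then show False by simp
 qed
 ultimately show ?thesis unfolding stab_def using def2_param by blast
qed

lemma stab_const: "stab xi ty (\<lambda>x d. b)"
 by (rule stab_param[OF defp_const])

lemma stab_ball: "finite I ==> (\<And>i. i \<in> I ==> stab xi ty (R i)) ==> stab xi ty (\<lambda>x d. \<forall>i\<in>I. R i x d)"
 by (induction I rule: finite_induct) (auto intro: stab_const stab_conj)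

lemma stab_bex: "finite I ==> (\<And>i. i \<in> I ==> stab xi ty (R i)) ==> stab xi ty (\<lambda>x d. \<exists>i\<in>I. R i x d)"
 by (induction I rule: finite_induct) (auto intro: stab_const stab_disj)

lemma stab_eq: "stab sg sg (\<lambda>x d. x = d)"
proof -
 have "def2 L C sg sg (\<lambda>x d. x = d)"
 proof (rule defp_def2)
  have "defp L C (sg @ sg) (\<lambda>a. \<forall>i\<in>{..<length sg}. a ! i = a ! (length sg + i))"
   by (rule defp_ball, simp, rule defp_eq) (auto simp: nth_append)
  then show "defp L C (sg @ sg) (\<lambda>a. take (length sg) a = drop (length sg) a)"
  proof (rule defp_cong)
   fix a assume "a \<in> tup (sg @ sg)"
   then have "length a = length sg + length sg" by (simp add: tuples_length)
   then show "(\<forall>i\<in>{..<length sg}. a ! i = a ! (length sg + i)) = (take (length sg) a = drop (length sg) a)"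
    unfolding list_eq_iff_nth_eq[of "take (length sg) a"] by (simp add: Ball_def)
  qed
 qed
 moreover have "\<not> lad 3 sg sg (\<lambda>x d. x = d)"
 proof
  assume "lad 3 sg sg (\<lambda>x d. x = d)"
  then obtain a b :: "nat => 'a list" where "\<forall>i<3. a i \<in> tup sg \<and> b i \<in> tup sg"
   and ab: "\<forall>i<3. \<forall>j<3. (a i = b j) = (i < j)" by (rule ladE)
  have "a 0 = b 1" "a 0 = b 2" "a 1 = b 2" "a 1 \<noteq> b 1" using ab by auto
  then show False by simp
 qed
 ultimately show ?thesis unfolding stab_def by blast
qed

lemma lad_le:
 assumes "\<forall>i<Suc n. A i \<in> tup xi \<and> E i \<in> tup ty" "\<forall>i<Suc n. \<forall>j<Suc n. R (A j) (E i) \<longleftrightarrow> i \<le> j"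
 shows "lad n xi ty R"
proof -
 have "R (A (n - 1 - i)) (E (n - j)) \<longleftrightarrow> i < j" if "i < n" "j < n" for i j
  using assms(2)[rule_format, of "n - j" "n - 1 - i"] that by auto
 then show ?thesis unfolding lad_def using assms(1)
  by (intro exI[of _ "\<lambda>i. A (n - 1 - i)"] exI[of _ "\<lambda>j. E (n - j)"]) auto
qed

end

lemma slice_concat':
 assumes "\<And>w. w \<in> set ws ==> length w = l" "t < length ws"
 shows "slice l t (concat ws) = ws ! t"
 using slice_concat[of ws "\<lambda>w. w" l t] assms by simp

lemma tuples_concat_replicate: "(\<And>w. w \<in> set ws ==> w \<in> tuples M ty) ==> concat ws \<in> tuples M (concat (replicate (length ws) ty))"
 by (induction ws) auto

lemma ball_slice:
 assumes "\<And>w. w \<in> set ws ==> w \<in> tuples M ty"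
 shows "(\<forall>t<length ws. Q (slice (length ty) t (concat ws))) \<longleftrightarrow> (\<forall>w\<in>set ws. Q w)"
proof -
 have "slice (length ty) t (concat ws) = ws ! t" if "t < length ws" for t
  by (rule slice_concat'[OF _ that]) (use assms tuples_length in blast)
 then show ?thesis by (auto simp: all_set_conv_all_nth)
qed

lemma take_concat_tuples:
 assumes "\<And>w. w \<in> set ws ==> w \<in> tuples M ty"
 shows "take (length ws * length ty) (concat ws @ v) = concat ws" "drop (length ws * length ty) (concat ws @ v) = v"
proof -
 have "length (concat ws) = length ws * length ty"
  using tuples_length[OF tuples_concat_replicate[OF assms]] by (simp add: concat_replicate_length)
 then show "take (length ws * length ty) (concat ws @ v) = concat ws" "drop (length ws * length ty) (concat ws @ v) = v" by simp_all
qed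

lemma take_concat_replicate: "take (n * length xi) (concat (replicate n xi) @ v) = concat (replicate n xi)"
 and drop_concat_replicate: "drop (n * length xi) (concat (replicate n xi) @ v) = v"
 using concat_replicate_length[of n xi] by simp_all

text \<open>The type of \<open>y\<close> over an elementary submodel is finitely satisfiable in it.
  The finitely many tuples are concatenated in order to apply \<open>elem_sub_exs\<close>.\<close>

lemma elem_sub_approx:
 assumes P: "elem_sub L M P" and R: "def2 L M xi ty R" and y: "y \<in> tuples M ty"
  and As: "\<And>a. a \<in> set As ==> a \<in> tuples M xi \<and> set a \<subseteq> P \<and> R a y"
  and Bs: "\<And>a. a \<in> set Bs ==> a \<in> tuples M xi \<and> set a \<subseteq> P \<and> \<not> R a y"
 shows "\<exists>e\<in>tuples M ty. set e \<subseteq> P \<and> (\<forall>a\<in>set As. R a e) \<and> (\<forall>a\<in>set Bs. \<not> R a e)"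
proof -
 let ?A = "concat (replicate (length As) xi)" and ?B = "concat (replicate (length Bs) xi)"
 let ?n = "length ty + length As * length xi"
 define Q where "Q w = ((\<forall>t\<in>{..<length As}. R (slice (length xi) t (take (length As * length xi) (drop (length ty) w))) (take (length ty) w)) \<and>
  (\<forall>t\<in>{..<length Bs}. \<not> R (slice (length xi) t (drop (length As * length xi) (drop (length ty) w))) (take (length ty) w)))" for w
 have cA: "coord (ty @ ?A @ ?B) ?A (\<lambda>w. take (length As * length xi) (drop (length ty) w))"
  by (rule coord_slice) (simp add: concat_replicate_length)
 have cB: "coord (ty @ ?A @ ?B) ?B (\<lambda>w. drop (length As * length xi) (drop (length ty) w))"
 proof (rule coord_comp[OF coord_drop'[OF refl] coord_drop'])
  have "drop (length ty) (ty @ ?A @ ?B) = ?A @ ?B" by simp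
  then show "?B = drop (length As * length xi) (drop (length ty) (ty @ ?A @ ?B))"
   by (simp only: drop_concat_replicate)
 qed
 have ct: "coord (ty @ ?A @ ?B) ty (take (length ty))" by (rule coord_take') simp
 have DA: "defp L M (ty @ ?A @ ?B) (\<lambda>w. R (slice (length xi) t (take (length As * length xi) (drop (length ty) w))) (take (length ty) w))"
  if "t \<in> {..<length As}" for t
  by (rule def2_defp[OF R coord_comp[OF cA coord_slice_replicate] ct]) (use that in simp)
 have DB: "defp L M (ty @ ?A @ ?B) (\<lambda>w. R (slice (length xi) t (drop (length As * length xi) (drop (length ty) w))) (take (length ty) w))"
  if "t \<in> {..<length Bs}" for t
  by (rule def2_defp[OF R coord_comp[OF cB coord_slice_replicate] ct]) (use that in simp)
 have D: "defp L M (ty @ ?A @ ?B) Q" unfolding Q_def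
  by (intro defp_conj defp_ball defp_neg finite_lessThan DA DB)
 have At: "\<And>w. w \<in> set As ==> w \<in> tuples M xi" and Bt: "\<And>w. w \<in> set Bs ==> w \<in> tuples M xi" using As Bs by auto
 have Q: "Q (e @ concat As @ concat Bs) \<longleftrightarrow> (\<forall>a\<in>set As. R a e) \<and> (\<forall>a\<in>set Bs. \<not> R a e)" if "e \<in> tuples M ty" for e
 proof -
  have "Q (e @ concat As @ concat Bs) \<longleftrightarrow> (\<forall>t<length As. R (slice (length xi) t (concat As)) e) \<and>
   (\<forall>t<length Bs. \<not> R (slice (length xi) t (concat Bs)) e)"
   unfolding Q_def using take_concat_tuples[where ws = As, OF At] tuples_length[OF that] by (simp add: Ball_def)
  then show ?thesis using ball_slice[where ws = As, OF At, of "\<lambda>a. R a e"] ball_slice[where ws = Bs, OF Bt, of "\<lambda>a. \<not> R a e"] by simp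
 qed
 have "\<exists>e\<in>tuples M ty. set e \<subseteq> P \<and> Q (e @ concat As @ concat Bs)"
 proof (rule elem_sub_exs[OF P D])
  show "concat As @ concat Bs \<in> tuples M (?A @ ?B)"
   by (intro tuples_appendI tuples_concat_replicate At Bt)
  show "set (concat As @ concat Bs) \<subseteq> P" using As Bs by fastforce
  show "y \<in> tuples M ty" by fact
  show "Q (y @ concat As @ concat Bs)" using Q[OF y] As Bs by blast
 qed
 then show ?thesis using Q by blast
qed

section \<open>Coheirs and stable relations without solutions in a model\<close>

context monster_model begin

definition smod :: "'a set => bool" where "smod P \<longleftrightarrow> elem_sub L C P \<and> sm P"
text \<open>The working form of forking for stable relations. Unlike forking it is visibly
  type-definable in \<open>d\<close>: a conjunction of formulas with parameters in
  \<open>P\<close>.\<close>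

definition misses :: "'a set => 's list => ('a list => 'a list => bool) => 'a list => bool" where
 "misses P xi R d \<longleftrightarrow> (\<forall>x\<in>tup xi. set x \<subseteq> P --> \<not> R x d)"

lemma smodD: "smod P ==> P \<subseteq> U" "smod P ==> sm P" "smod P ==> elem_sub L C P"
 unfolding smod_def using elem_sub_sub by blast+

lemma smod_ex: "countable S ==> S \<subseteq> U ==> \<exists>P. smod P \<and> countable P \<and> S \<subseteq> P"
 using LS[of S] sm_countable unfolding smod_def by blast

text \<open>The sets definable over \<open>P\<close> that contain \<open>d\<close> meet
  \<open>P\<close> by elementarity and are closed under intersection. The average of the resulting
  ultrafilter over any set is a coheir of the type of \<open>d\<close> over
  \<open>P\<close>.\<close>

lemma coheir_filter:
 assumes P: "elem_sub L C P" and d: "d \<in> tup ty"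
 shows "\<exists>V. ultra V \<and> eventually (\<lambda>e. e \<in> tup ty \<and> set e \<subseteq> P) V \<and>
  (\<forall>c Q. set c \<subseteq> P --> defp L C (ty @ srt c) Q --> Q (d @ c) --> eventually (\<lambda>e. Q (e @ c)) V)"
proof -
 define X where "X c Q = {e. e \<in> tup ty \<and> set e \<subseteq> P \<and> Q (e @ c)}" for c Q
 define S where "S = {X c Q | c Q. set c \<subseteq> P \<and> defp L C (ty @ srt c) Q \<and> Q (d @ c)}"
 have ne: "X c Q \<noteq> {}" if "set c \<subseteq> P" "defp L C (ty @ srt c) Q" "Q (d @ c)" for c Q
 proof -
  have "c \<in> tup (srt c)" using that(1) elem_sub_sub[OF P] by (intro tuples_self) auto
  from elem_sub_exs[OF P that(2) this that(1) d that(3)] show ?thesis by (auto simp: X_def)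
 qed
 let ?B = "principal ` S"
 have S0: "X [] (\<lambda>_. True) \<in> S" unfolding S_def using defp_const by fastforce
 have base: "\<exists>x\<in>?B. x \<le> inf F G" if FG: "F \<in> ?B" "G \<in> ?B" for F G
 proof -
  obtain c Q c' Q' where F: "F = principal (X c Q)" "set c \<subseteq> P" "defp L C (ty @ srt c) Q" "Q (d @ c)"
   and G: "G = principal (X c' Q')" "set c' \<subseteq> P" "defp L C (ty @ srt c') Q'" "Q' (d @ c')"
   using FG unfolding S_def by blast
  define R where "R w = (Q (take (length ty + length c) w) \<and> Q' (take (length ty) w @ drop (length ty + length c) w))" for w
  have c1: "coord (ty @ srt (c @ c')) (ty @ srt c) (take (length ty + length c))" by (rule coord_take') simp
  have c2: "coord (ty @ srt (c @ c')) (ty @ srt c') (\<lambda>w. take (length ty) w @ drop (length ty + length c) w)"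
   by (rule coord_append[OF coord_take' coord_drop']) simp_all
  have D: "defp L C (ty @ srt (c @ c')) R"
   unfolding R_def by (rule defp_conj[OF defp_coord[OF F(3) c1] defp_coord[OF G(3) c2]])
  have R: "R (e @ c @ c') \<longleftrightarrow> Q (e @ c) \<and> Q' (e @ c')" if "e \<in> tup ty" for e
   using tuples_length[OF that] by (simp add: R_def)
  have "X (c @ c') R \<in> S" unfolding S_def using D F G R[OF d] by fastforce
  moreover have "X (c @ c') R \<subseteq> X c Q \<inter> X c' Q'" using R by (auto simp: X_def)
  ultimately show ?thesis using F(1) G(1)
   by (intro bexI[of _ "principal (X (c @ c') R)"]) auto
 qed
 have ev: "eventually Q (Inf ?B) \<longleftrightarrow> (\<exists>b\<in>?B. eventually Q b)" for Q
  by (rule eventually_Inf_base) (use S0 base in auto)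
 have "Inf ?B \<noteq> bot"
 proof
  assume "Inf ?B = bot"
  then have "\<exists>b\<in>?B. eventually (\<lambda>e. False) b" using ev[of "\<lambda>e. False"] by simp
  then show False using ne by (auto simp: S_def eventually_principal)
 qed
 then obtain V where V: "V \<le> Inf ?B" "ultra V" using ultra_exists by blast
 have evV: "eventually (\<lambda>e. e \<in> Y) V" if "Y \<in> S" for Y
 proof -
  have "eventually (\<lambda>e. e \<in> Y) (Inf ?B)" using ev[of "\<lambda>e. e \<in> Y"] that by (auto simp: eventually_principal)
  then show ?thesis using V(1) by (simp add: le_filter_def)
 qed
 have "eventually (\<lambda>e. e \<in> tup ty \<and> set e \<subseteq> P) V" using evV[OF S0] by (simp add: X_def)
 moreover have "eventually (\<lambda>e. Q (e @ c)) V" if "set c \<subseteq> P" "defp L C (ty @ srt c) Q" "Q (d @ c)" for c Q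
 proof -
  have "X c Q \<in> S" using that unfolding S_def by blast
  from evV[OF this] show ?thesis by eventually_elim (simp add: X_def)
 qed
 ultimately show ?thesis using V(2) by blast
qed

text \<open>The average of \<open>V\<close> over \<open>B\<close> is finitely satisfiable by tuples
  from \<open>P\<close>, hence realised.\<close>

lemma coheir_step:
 assumes V: "ultra V" "eventually (\<lambda>e. e \<in> tup ty \<and> set e \<subseteq> P) V" and B: "B \<subseteq> U" "sm B"
 shows "\<exists>d. d \<in> tup ty \<and> (\<forall>c Q. set c \<subseteq> B --> defp L C (ty @ srt c) Q --> (Q (d @ c) \<longleftrightarrow> eventually (\<lambda>e. Q (e @ c)) V))"
proof -
 let ?ix = "[0..<length ty]"
 have mt: "map ((!) ty) ?ix = ty" by (simp add: map_nth)
 define G where "G = {(?ix, c, Q) | c Q. set c \<subseteq> B \<and> defp L C (ty @ srt c) Q \<and> eventually (\<lambda>e. Q (e @ c)) V}"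
 have "\<exists>e. (\<forall>j\<in>{..<length ty}. e j \<in> car (ty ! j)) \<and> (\<forall>(idx, c, P)\<in>G. P (map e idx @ c))"
 proof (rule compactness)
  show "sm {..<length ty}" by (simp add: sm_finite)
  show "B \<subseteq> U" "sm B" by fact+
  show "set idx \<subseteq> {..<length ty} \<and> set c \<subseteq> B \<and> defp L C (map ((!) ty) idx @ srt c) Q" if "(idx, c, Q) \<in> G" for idx c Q
   using that mt by (auto simp: G_def)
  fix G0 assume G0: "finite G0" "G0 \<subseteq> G"
  have "eventually (\<lambda>e. \<forall>g\<in>G0. (snd (snd g)) (e @ fst (snd g))) V"
   by (rule eventually_ball_finite[OF G0(1)]) (use G0(2) in \<open>fastforce simp: G_def\<close>)
  with V(2) have "eventually (\<lambda>e. e \<in> tup ty \<and> (\<forall>g\<in>G0. (snd (snd g)) (e @ fst (snd g)))) V"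
   by eventually_elim blast
  moreover have "V \<noteq> bot" using V(1) by (simp add: ultra_def)
  ultimately obtain e where e: "e \<in> tup ty" "\<forall>g\<in>G0. (snd (snd g)) (e @ fst (snd g))"
   using eventually_happens by blast
  have me: "map ((!) e) ?ix = e" using tuples_length[OF e(1)] by (metis map_nth)
  show "\<exists>e. (\<forall>j\<in>{..<length ty}. e j \<in> car (ty ! j)) \<and> (\<forall>(idx, c, P)\<in>G0. P (map e idx @ c))"
  proof (intro exI[of _ "(!) e"] conjI ballI)
   show "e ! j \<in> car (ty ! j)" if "j \<in> {..<length ty}" for j using e(1) that by (auto intro: tuples_nth)
   fix g assume g: "g \<in> G0"
   then have "fst g = ?ix" using G0(2) by (auto simp: G_def)
   then show "case g of (idx, c, P) => P (map ((!) e) idx @ c)"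
    using bspec[OF e(2) g] me by (simp add: split_beta)
  qed
 qed
 then obtain e where "(\<forall>j\<in>{..<length ty}. e j \<in> car (ty ! j)) \<and> (\<forall>(idx, c, P)\<in>G. P (map e idx @ c))" ..
 then have e: "\<forall>j\<in>{..<length ty}. e j \<in> car (ty ! j)" "\<forall>(idx, c, P)\<in>G. P (map e idx @ c)" by blast+
 have d: "map e ?ix \<in> tup ty" using map_tuples[of ?ix e "(!) ty"] e(1) mt by simp
 have imp: "Q (map e ?ix @ c)" if "set c \<subseteq> B" "defp L C (ty @ srt c) Q" "eventually (\<lambda>e. Q (e @ c)) V" for c Q
 proof -
  have "(?ix, c, Q) \<in> G" using that by (simp add: G_def)
  from bspec[OF e(2) this] show ?thesis by simp
 qed
 have "Q (map e ?ix @ c) \<longleftrightarrow> eventually (\<lambda>e. Q (e @ c)) V" if "set c \<subseteq> B" "defp L C (ty @ srt c) Q" for c Q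
  using imp[OF that] imp[OF that(1) defp_neg[OF that(2)]] ultra_not[OF V(1), of "\<lambda>e. Q (e @ c)"] by blast
 then show ?thesis using d by blast
qed

text \<open>The Morley sequence of a coheir: since each term realises the average over
  \<open>P\<close> and its predecessors, a formula true of it is also true of a tuple in
  \<open>P\<close>, with the same predecessors as parameters.\<close>

lemma coheir_seq:
 assumes V: "ultra V" "eventually (\<lambda>e. e \<in> tup ty \<and> set e \<subseteq> P) V" and P: "P \<subseteq> U" "sm P"
 shows "\<exists>D :: nat => 'a list. \<forall>i. D i \<in> tup ty \<and> (\<forall>c Q. set c \<subseteq> P \<union> (\<Union>j<i. set (D j)) --> defp L C (ty @ srt c) Q -->
  (Q (D i @ c) \<longleftrightarrow> eventually (\<lambda>e. Q (e @ c)) V))"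
proof (rule dependent_wellorder_choice)
 fix r and f g :: "nat => 'a list" and x :: nat
 assume "\<And>y. y < x ==> f y = g y"
 then have "(\<Union>j<x. set (f j)) = (\<Union>j<x. set (g j))" by simp
 then show "(r \<in> tup ty \<and> (\<forall>c Q. set c \<subseteq> P \<union> (\<Union>j<x. set (f j)) --> defp L C (ty @ srt c) Q --> (Q (r @ c) \<longleftrightarrow> eventually (\<lambda>e. Q (e @ c)) V))) =
  (r \<in> tup ty \<and> (\<forall>c Q. set c \<subseteq> P \<union> (\<Union>j<x. set (g j)) --> defp L C (ty @ srt c) Q --> (Q (r @ c) \<longleftrightarrow> eventually (\<lambda>e. Q (e @ c)) V)))"
  by (simp only:)
next
 fix x :: nat and f :: "nat => 'a list"
 assume "\<And>y. y < x ==> f y \<in> tup ty \<and> (\<forall>c Q. set c \<subseteq> P \<union> (\<Union>j<y. set (f j)) --> defp L C (ty @ srt c) Q --> (Q (f y @ c) \<longleftrightarrow> eventually (\<lambda>e. Q (e @ c)) V))"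
 then have f: "\<And>y. y < x ==> f y \<in> tup ty" by blast
 have "P \<union> (\<Union>j<x. set (f j)) \<subseteq> U" using P f tuples_set by fastforce
 moreover have "sm (P \<union> (\<Union>j<x. set (f j)))" by (intro sm_Un P sm_finite) auto
 ultimately show "\<exists>r. r \<in> tup ty \<and> (\<forall>c Q. set c \<subseteq> P \<union> (\<Union>j<x. set (f j)) --> defp L C (ty @ srt c) Q --> (Q (r @ c) \<longleftrightarrow> eventually (\<lambda>e. Q (e @ c)) V))"
  by (rule coheir_step[OF V])
qed

text \<open>A stable formula without solutions in a model divides over it: otherwise a coheir sequence
 of its parameters yields a ladder inside the model.\<close>

lemma misses_kdiv:
 assumes R: "stab xi ty R" "\<not> lad n xi ty R" and P: "smod P" and d: "d \<in> tup ty" and m: "misses P xi R d"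
 shows "kdiv (Suc n) P xi ty R d"
proof -
 note P' = smodD[OF P]
 note R2 = stab_def2[OF R(1)]
 obtain V where V: "ultra V" "eventually (\<lambda>e. e \<in> tup ty \<and> set e \<subseteq> P) V"
  "\<And>c Q. set c \<subseteq> P ==> defp L C (ty @ srt c) Q ==> Q (d @ c) ==> eventually (\<lambda>e. Q (e @ c)) V"
  using coheir_filter[OF P'(3) d] by blast
 from coheir_seq[OF V(1,2) P'(1,2)] obtain D :: "nat => 'a list" where
  "\<forall>i. D i \<in> tup ty \<and> (\<forall>c Q. set c \<subseteq> P \<union> (\<Union>j<i. set (D j)) --> defp L C (ty @ srt c) Q -->
  (Q (D i @ c) \<longleftrightarrow> eventually (\<lambda>e. Q (e @ c)) V))" ..
 then have D: "\<And>i. D i \<in> tup ty" "\<And>i c Q. set c \<subseteq> P \<union> (\<Union>j<i. set (D j)) ==> defp L C (ty @ srt c) Q ==>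
  (Q (D i @ c) \<longleftrightarrow> eventually (\<lambda>e. Q (e @ c)) V)" by blast+
 have Dd: "Q (D i @ c) \<longleftrightarrow> Q (d @ c)" if "set c \<subseteq> P" "defp L C (ty @ srt c) Q" for i c Q
 proof -
  have c: "set c \<subseteq> P \<union> (\<Union>j<i. set (D j))" using that by auto
  show ?thesis using D(2)[OF c that(2)] V(3)[OF that] V(3)[OF that(1) defp_neg[OF that(2)]]
   ultra_not[OF V(1), of "\<lambda>e. Q (e @ c)"] by blast
 qed
 have tpD: "tp L C (D i) P = tp L C d P" for i
  by (rule tp_eqI[OF D(1) d]) (rule Dd, auto intro: defp_wff)
 have "\<not> (\<exists>a\<in>tup xi. \<forall>i\<in>I. R a (D i))" if I: "finite I" "card I = Suc n" for I
 proof
  assume "\<exists>a\<in>tup xi. \<forall>i\<in>I. R a (D i)"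
  then obtain a where a: "a \<in> tup xi" "\<forall>i\<in>I. R a (D i)" by blast
  define s where "s = sorted_list_of_set I"
  have s: "set s = I" "length s = Suc n" "sorted_wrt (<) s"
   using I by (auto simp: s_def)
  \<comment> \<open>From the last term backwards, the terms of the sequence are replaced by tuples
    \<open>Es\<close> of \<open>P\<close>, keeping a common solution \<open>x\<close>. The new tuple
    is also avoided by the elements \<open>As\<close> of \<open>P\<close> found so far, because the
    term it imitates is; an element of \<open>P\<close> imitating \<open>x\<close> on
    \<open>Es\<close> then prolongs the ladder.\<close>
  have "\<exists>Es As. length Es = m \<and> length As = m \<and> (\<forall>e\<in>set Es. e \<in> tup ty \<and> set e \<subseteq> P) \<and>
   (\<forall>e\<in>set As. e \<in> tup xi \<and> set e \<subseteq> P) \<and> (\<forall>i<m. \<forall>j<m. R (As ! j) (Es ! i) \<longleftrightarrow> i \<le> j) \<and>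
   (\<exists>x\<in>tup xi. (\<forall>e\<in>set Es. R x e) \<and> (\<forall>t<Suc n - m. R x (D (s ! t))))" if "m \<le> Suc n" for m using that
  proof (induction m)
   case 0
   have "\<exists>x\<in>tup xi. \<forall>t<Suc n. R x (D (s ! t))" using a s by (metis nth_mem)
   then show ?case by (intro exI[of _ "[]"]) auto
  next
   case (Suc m)
   then obtain Es As where EA: "length Es = m" "length As = m" "\<forall>e\<in>set Es. e \<in> tup ty \<and> set e \<subseteq> P"
    "\<forall>e\<in>set As. e \<in> tup xi \<and> set e \<subseteq> P" "\<forall>i<m. \<forall>j<m. R (As ! j) (Es ! i) \<longleftrightarrow> i \<le> j"
    "\<exists>x\<in>tup xi. (\<forall>e\<in>set Es. R x e) \<and> (\<forall>t<Suc n - m. R x (D (s ! t)))" by auto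
   define t0 where "t0 = n - m"
   have t0: "Suc n - m = Suc t0" "t0 < length s" using Suc.prems s(2) by (auto simp: t0_def)
   let ?y = "D (s ! t0)"
   define Ds where "Ds = map (\<lambda>t. D (s ! t)) [0..<t0]"
   let ?k = "length (Es @ Ds)"
   \<comment> \<open>\<open>Q\<close> says of a candidate that it shares a solution with
     \<open>Es\<close> and the remaining terms and is avoided by \<open>As\<close>. Its parameters
     lie in \<open>P\<close> and among the earlier terms, so it passes from the term to a tuple of
     \<open>P\<close>.\<close>
   define Q where "Q w = ((\<exists>x\<in>tup xi. \<forall>t<Suc ?k. R x (slice (length ty) t (take (Suc ?k * length ty) w))) \<and>
    (\<forall>j\<in>{..<m}. \<not> R (slice (length xi) j (drop (Suc ?k * length ty) w)) (take (length ty) w)))" for w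
   let ?sg = "concat (replicate (Suc ?k) ty) @ concat (replicate m xi)"
   have cT: "coord ?sg (concat (replicate (Suc ?k) ty)) (take (Suc ?k * length ty))"
    by (rule coord_take') (simp add: concat_replicate_length)
   have cX: "coord ?sg (concat (replicate m xi)) (drop (Suc ?k * length ty))"
    by (rule coord_drop') (simp add: concat_replicate_length)
   have c0: "coord ?sg ty (take (length ty))" by (rule coord_take') simp
   have DR: "defp L C ?sg (\<lambda>w. R (slice (length xi) j (drop (Suc ?k * length ty) w)) (take (length ty) w))"
    if "j \<in> {..<m}" for j
    by (rule def2_defp[OF R2 coord_comp[OF cX coord_slice_replicate] c0]) (use that in simp)
   have DQ: "defp L C ?sg Q" unfolding Q_def
    by (intro defp_conj defp_ball defp_neg finite_lessThan DR defp_coord[OF defp_common[OF R2] cT])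
   have At: "\<And>w. w \<in> set As ==> w \<in> tup xi" and Et: "\<And>w. w \<in> set (Es @ Ds) ==> w \<in> tup ty"
    using EA D(1) by (auto simp: Ds_def)
   let ?c = "concat (Es @ Ds) @ concat As"
   have Qe: "Q (e @ ?c) \<longleftrightarrow> (\<exists>x\<in>tup xi. R x e \<and> (\<forall>w\<in>set (Es @ Ds). R x w)) \<and> (\<forall>w\<in>set As. \<not> R w e)"
    if e: "e \<in> tup ty" for e
   proof -
    have t: "\<And>w. w \<in> set (e # Es @ Ds) ==> w \<in> tup ty" using e Et by auto
    have q1: "take (Suc ?k * length ty) (e @ ?c) = concat (e # Es @ Ds)"
     "drop (Suc ?k * length ty) (e @ ?c) = concat As"
     using take_concat_tuples[where ws = "e # Es @ Ds" and v = "concat As", OF t] by simp_all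
    have q2: "take (length ty) (e @ ?c) = e" using tuples_length[OF e] by simp
    have b1: "(\<forall>t<Suc ?k. R x (slice (length ty) t (concat (e # Es @ Ds)))) \<longleftrightarrow> R x e \<and> (\<forall>w\<in>set (Es @ Ds). R x w)" for x
     using ball_slice[where ws = "e # Es @ Ds" and Q = "R x", OF t] by simp
    have b2: "(\<forall>j\<in>{..<m}. \<not> R (slice (length xi) j (concat As)) e) \<longleftrightarrow> (\<forall>w\<in>set As. \<not> R w e)"
     using ball_slice[where ws = As, OF At, of "\<lambda>w. \<not> R w e"] EA(2) by (simp add: Ball_def)
    show ?thesis unfolding Q_def q1 q2 b1 b2 ..
   qed
   have srtc: "ty @ srt ?c = ?sg"
   proof -
    have "e @ ?c \<in> tup ?sg" if "e \<in> tup ty" for e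
    proof -
     have t: "\<And>w. w \<in> set (e # Es @ Ds) ==> w \<in> tup ty" using that Et by auto
     show ?thesis using tuples_appendI[OF tuples_concat_replicate[where ws = "e # Es @ Ds", OF t] tuples_concat_replicate[where ws = As, OF At]] EA(2) by simp
    qed
    from tuples_sorts[OF this[OF d]] show ?thesis using tuples_sorts[OF d] by simp
   qed
   have sub: "set ?c \<subseteq> P \<union> (\<Union>j<s ! t0. set (D j))"
   proof -
    have "s ! t < s ! t0" if "t < t0" for t using s(3) that t0(2) by (simp add: sorted_wrt_nth_less)
    then have "set (concat Ds) \<subseteq> (\<Union>j<s ! t0. set (D j))" by (fastforce simp: Ds_def)
    then show ?thesis using EA(3,4) by fastforce
   qed
   have "Q (?y @ ?c)" unfolding Qe[OF D(1)]
   proof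
    obtain x where x: "x \<in> tup xi" "\<forall>e\<in>set Es. R x e" "\<forall>t<Suc n - m. R x (D (s ! t))" using EA(6) by blast
    then show "\<exists>x\<in>tup xi. R x ?y \<and> (\<forall>w\<in>set (Es @ Ds). R x w)"
     by (intro bexI[of _ x]) (auto simp: Ds_def t0(1))
    show "\<forall>w\<in>set As. \<not> R w ?y"
    proof
     fix w assume w: "w \<in> set As"
     have "R w ?y \<longleftrightarrow> R w d"
     proof -
      have "defp L C (ty @ srt w) (\<lambda>v. R (drop (length ty) v) (take (length ty) v))"
       using def2_defp[OF R2 coord_snd coord_fst] At[OF w] by (metis tuples_sorts)
      from Dd[OF _ this, of "s ! t0"] w EA(4) D(1)[of "s ! t0"] d show ?thesis by (simp add: tuples_length)
     qed
     then show "\<not> R w ?y" using m w EA(4) by (simp add: misses_def)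
    qed
   qed
   then have "eventually (\<lambda>e. Q (e @ ?c)) V" using D(2)[OF sub] DQ srtc by metis
   with V(2) have "eventually (\<lambda>e. e \<in> tup ty \<and> set e \<subseteq> P \<and> Q (e @ ?c)) V" by eventually_elim blast
   moreover have "V \<noteq> bot" using V(1) by (simp add: ultra_def)
   ultimately obtain e where e: "e \<in> tup ty" "set e \<subseteq> P" "Q (e @ ?c)" using eventually_happens by blast
   then obtain x where x: "x \<in> tup xi" "R x e" "\<forall>w\<in>set (Es @ Ds). R x w" and nA: "\<forall>w\<in>set As. \<not> R w e"
    using Qe[OF e(1)] by blast
   have "\<exists>z\<in>tup xi. set z \<subseteq> P \<and> (\<forall>a\<in>set (Es @ [e]). R z a) \<and> (\<forall>a\<in>set []. \<not> R z a)"
    by (rule elem_sub_approx[OF P'(3) def2_swap[OF R2] x(1)]) (use EA e x in auto)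
   then obtain z where z: "z \<in> tup xi" "set z \<subseteq> P" "\<forall>a\<in>set (Es @ [e]). R z a" by blast
   show ?case
   proof (rule exI[of _ "Es @ [e]"], rule exI[of _ "As @ [z]"], intro conjI)
    show "\<forall>i<Suc m. \<forall>j<Suc m. R ((As @ [z]) ! j) ((Es @ [e]) ! i) \<longleftrightarrow> i \<le> j"
    proof (intro allI impI)
     fix i j assume ij: "i < Suc m" "j < Suc m"
     show "R ((As @ [z]) ! j) ((Es @ [e]) ! i) \<longleftrightarrow> i \<le> j"
     proof (cases "j = m")
      case True
      have "(Es @ [e]) ! i \<in> set (Es @ [e])" by (rule nth_mem) (use ij EA in simp)
      then show ?thesis using z(3) True ij EA by (simp add: nth_append)
     next
      case False
      then have j: "j < m" using ij by simp
      show ?thesis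
      proof (cases "i = m")
       case True
       have "As ! j \<in> set As" using j EA by simp
       then show ?thesis using nA True j EA by (simp add: nth_append)
      next
       case False
       then show ?thesis using EA j ij by (simp add: nth_append)
      qed
     qed
    qed
    show "\<exists>x\<in>tup xi. (\<forall>e\<in>set (Es @ [e]). R x e) \<and> (\<forall>t<Suc n - Suc m. R x (D (s ! t)))"
    proof (intro bexI[of _ x] conjI)
     show "\<forall>t<Suc n - Suc m. R x (D (s ! t))"
      using x(3) by (auto simp: Ds_def t0_def)
     show "\<forall>e\<in>set (Es @ [e]). R x e" using x by auto
    qed (rule x(1))
    show "length (Es @ [e]) = Suc m" "length (As @ [z]) = Suc m" using EA by simp_all
    show "\<forall>e\<in>set (Es @ [e]). e \<in> tup ty \<and> set e \<subseteq> P" using EA e by auto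
    show "\<forall>e\<in>set (As @ [z]). e \<in> tup xi \<and> set e \<subseteq> P" using EA z by auto
   qed
  qed
  from this[of "Suc n"] obtain Es As where EA: "length Es = Suc n" "length As = Suc n"
   "\<forall>e\<in>set Es. e \<in> tup ty \<and> set e \<subseteq> P" "\<forall>e\<in>set As. e \<in> tup xi \<and> set e \<subseteq> P"
   "\<forall>i<Suc n. \<forall>j<Suc n. R (As ! j) (Es ! i) \<longleftrightarrow> i \<le> j" by auto
  have "lad n xi ty R" by (rule lad_le[of n "(!) As" _ "(!) Es"]) (use EA in auto)
  then show False using R(2) by simp
 qed
 then show ?thesis unfolding kdiv_def using D(1) tpD by (intro exI[of _ D]) blast
qed

lemma misses_fset:
 assumes R: "stab xi ty R" and P: "smod P" and D: "D \<subseteq> P" and d: "d \<in> tup ty" and m: "misses P xi R d"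
 shows "fset D xi {x. R x d}"
proof -
 obtain n where "\<not> lad n xi ty R" using R unfolding stab_def by (elim conjE exE)
 from misses_kdiv[OF R this P d m] have "kdiv (Suc n) P xi ty R d" .
 from kdiv_fset[OF kdiv_mono[OF this d D smodD(1)[OF P]] stab_def2[OF R] d] show ?thesis .
qed

text \<open>Suppose \<open>p\<close> in \<open>A \<union> B\<close> were a solution. That
  \<open>p\<close> is a solution while the members of \<open>As\<close> are not is a stable
  condition on \<open>d\<close>, with parameters \<open>p\<close> and \<open>As\<close>. By
  independence it does not fork over \<open>A\<close>, hence has a solution in \<open>A\<close>;
  repeating this with copies of \<open>p\<close> in \<open>A\<close> builds a ladder.\<close>

lemma indep_misses:
 assumes R: "stab xi ty R" and A: "smod A" and d: "d \<in> tup ty" and m: "misses A xi R d"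
  and i: "indep L C d B A" and B: "B \<subseteq> U"
 shows "misses (A \<union> B) xi R d"
 unfolding misses_def
proof (intro ballI impI notI)
 fix p assume p: "p \<in> tup xi" "set p \<subseteq> A \<union> B" "R p d"
 obtain n where n: "\<not> lad n xi ty R" using R unfolding stab_def by (elim conjE exE)
 note R2 = stab_def2[OF R]
 have "\<exists>Es As. length Es = m \<and> length As = m \<and> (\<forall>e\<in>set Es. e \<in> tup ty \<and> set e \<subseteq> A \<and> R p e) \<and>
   (\<forall>e\<in>set As. e \<in> tup xi \<and> set e \<subseteq> A) \<and> (\<forall>i<m. \<forall>j<m. R (As ! j) (Es ! i) \<longleftrightarrow> i \<le> j)" for m
 proof (induction m)
  case 0
  show ?case by (intro exI[of _ "[]"]) simp
 next
  case (Suc m)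
  then obtain Es As where EA: "length Es = m" "length As = m" "\<forall>e\<in>set Es. e \<in> tup ty \<and> set e \<subseteq> A \<and> R p e"
   "\<forall>e\<in>set As. e \<in> tup xi \<and> set e \<subseteq> A" "\<forall>i<m. \<forall>j<m. R (As ! j) (Es ! i) \<longleftrightarrow> i \<le> j" by blast
  let ?\<zeta> = "concat (replicate (Suc m) xi)"
  define Y where "Y y z = (R (slice (length xi) 0 z) y \<and> (\<forall>j\<in>{..<m}. \<not> R (slice (length xi) (Suc j) z) y))" for y z
  have sR: "stab ty ?\<zeta> (\<lambda>y z. R (slice (length xi) j z) y)" if "j < Suc m" for j
   by (rule stab_coord[OF stab_swap[OF R] coord_id coord_slice_replicate[OF that]])
  have sY: "stab ty ?\<zeta> Y" unfolding Y_def
   by (intro stab_conj stab_ball stab_neg finite_lessThan sR) simp_all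
  have t: "\<And>w. w \<in> set (p # As) ==> w \<in> tup xi" using EA p by auto
  let ?z = "concat (p # As)"
  have zt: "?z \<in> tup ?\<zeta>" using tuples_concat_replicate[where ws = "p # As", OF t] EA(2) by simp
  have sl: "slice (length xi) j ?z = (p # As) ! j" if "j < Suc m" for j
  proof (rule slice_concat')
   show "length w = length xi" if "w \<in> set (p # As)" for w using tuples_length[OF t[OF that]] .
  qed (use that EA in simp)
  have Ye: "Y y ?z \<longleftrightarrow> R p y \<and> (\<forall>w\<in>set As. \<not> R w y)" for y
   unfolding Y_def using sl EA(2) by (auto simp: all_set_conv_all_nth)
  have "Y d ?z" unfolding Ye using p m EA(4) by (auto simp: misses_def)
  have "\<not> misses A ty Y ?z"
  proof
   assume "misses A ty Y ?z"
   from misses_fset[OF sY A subset_refl zt this] have "fset A ty {y. Y y ?z}" .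
   moreover have "\<not> fset A ty {y. Y y ?z}"
    by (rule indepD[OF i d smodD(1)[OF A] B zt _ stab_def2[OF sY] \<open>Y d ?z\<close>]) (use p EA(4) in auto)
   ultimately show False by blast
  qed
  then obtain e where e: "e \<in> tup ty" "set e \<subseteq> A" "R p e" "\<forall>w\<in>set As. \<not> R w e" unfolding misses_def Ye by blast
  have "\<exists>z\<in>tup xi. set z \<subseteq> A \<and> (\<forall>a\<in>set (Es @ [e]). R z a) \<and> (\<forall>a\<in>set []. \<not> R z a)"
   by (rule elem_sub_approx[OF smodD(3)[OF A] def2_swap[OF R2] p(1)]) (use EA e in auto)
  then obtain z where z: "z \<in> tup xi" "set z \<subseteq> A" "\<forall>a\<in>set (Es @ [e]). R z a" by blast
  show ?case
  proof (rule exI[of _ "Es @ [e]"], rule exI[of _ "As @ [z]"], intro conjI)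
   show "\<forall>i<Suc m. \<forall>j<Suc m. R ((As @ [z]) ! j) ((Es @ [e]) ! i) \<longleftrightarrow> i \<le> j"
   proof (intro allI impI)
    fix i j assume ij: "i < Suc m" "j < Suc m"
    show "R ((As @ [z]) ! j) ((Es @ [e]) ! i) \<longleftrightarrow> i \<le> j"
    proof (cases "j = m")
     case True
     have "(Es @ [e]) ! i \<in> set (Es @ [e])" by (rule nth_mem) (use ij EA in simp)
     then show ?thesis using z(3) True ij EA by (simp add: nth_append)
    next
     case False
     then have j: "j < m" using ij by simp
     show ?thesis
     proof (cases "i = m")
      case True
      have "As ! j \<in> set As" using j EA by simp
      then show ?thesis using e(4) True j EA by (simp add: nth_append)
     next
      case False
      then show ?thesis using EA j ij by (simp add: nth_append)
     qed
    qed
   qed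
   show "length (Es @ [e]) = Suc m" "length (As @ [z]) = Suc m" using EA by simp_all
   show "\<forall>e\<in>set (Es @ [e]). e \<in> tup ty \<and> set e \<subseteq> A \<and> R p e" using EA e by auto
   show "\<forall>e\<in>set (As @ [z]). e \<in> tup xi \<and> set e \<subseteq> A" using EA z by auto
  qed
 qed
 from this[of "Suc n"] obtain Es As where EA: "length Es = Suc n" "length As = Suc n"
   "\<forall>e\<in>set Es. e \<in> tup ty \<and> set e \<subseteq> A \<and> R p e" "\<forall>e\<in>set As. e \<in> tup xi \<and> set e \<subseteq> A"
   "\<forall>i<Suc n. \<forall>j<Suc n. R (As ! j) (Es ! i) \<longleftrightarrow> i \<le> j" by blast
 have "lad n xi ty R" by (rule lad_le[of n "(!) As" _ "(!) Es"]) (use EA in auto)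
 then show False using n by simp
qed

text \<open>Entries \<open>e\<close> from the base can be moved from the variables to the
  parameters: adjoined to each term of a dividing sequence over \<open>A\<close>, they leave its
  type over \<open>A\<close> constant along the sequence.\<close>

lemma fset_section:
 assumes e: "e \<in> tup sg" "set e \<subseteq> A" and A: "A \<subseteq> U" and f: "fset A (xi @ sg) Y"
 shows "fset A xi {x. x @ e \<in> Y}"
proof -
 obtain Dl where Dl: "Dl \<subseteq> formulas_over L C (xi @ sg) U" "finite Dl" "\<forall>(psi, c)\<in>Dl. divides L C A (xi @ sg) psi c"
  "\<forall>a\<in>tup (xi @ sg). a \<in> Y --> (\<exists>(psi, c)\<in>Dl. sat C (a @ c) psi)" using f unfolding fset_def by blast
 have "fset A xi {x. sat C ((x @ e) @ snd q) (fst q)}" if q: "q \<in> Dl" for q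
 proof -
  obtain psi b where qb: "q = (psi, b)" by (cases q)
  have w: "wff L ((xi @ sg) @ srt b) psi" "set b \<subseteq> U" using q Dl(1) qb by (auto simp: formulas_over_def)
  have bt: "b \<in> tup (srt b)" by (rule tuples_self[OF w(2)])
  have dv: "divides L C A (xi @ sg) psi b" using Dl(3) q qb by auto
  then obtain k where "kdiv k A (xi @ sg) (srt b) (\<lambda>x d. sat C (x @ d) psi) b"
   using divides_kdiv[OF bt, of "xi @ sg" "\<lambda>x d. sat C (x @ d) psi"] by blast
  then obtain c :: "nat => 'a list" where c: "\<forall>i. c i \<in> tup (srt b) \<and> tp L C (c i) A = tp L C b A"
   "\<forall>I. finite I \<and> card I = k --> \<not> (\<exists>a\<in>tup (xi @ sg). \<forall>i\<in>I. sat C (a @ c i) psi)"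
   unfolding kdiv_def by (elim exE conjE)
  have "kdiv k A xi (sg @ srt b) (\<lambda>x d. sat C (x @ d) psi) (e @ b)"
   unfolding kdiv_def
  proof (rule exI[of _ "\<lambda>i. e @ c i"], intro conjI allI impI)
   fix i show "e @ c i \<in> tup (sg @ srt b)" using e c by simp
   show "tp L C (e @ c i) A = tp L C (e @ b) A"
   proof (rule tp_eqI)
    show "e @ c i \<in> tup (sg @ srt b)" "e @ b \<in> tup (sg @ srt b)" using e c bt by simp_all
    fix v phi assume v: "set v \<subseteq> A" "wff L ((sg @ srt b) @ srt v) phi"
    let ?P = "\<lambda>w. sat C (take (length e) (drop (length b) w) @ take (length b) w @ drop (length b + length e) w) phi"
    have co: "coord (srt b @ srt (e @ v)) ((sg @ srt b) @ srt v)
     (\<lambda>w. take (length e) (drop (length b) w) @ take (length b) w @ drop (length b + length e) w)"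
     unfolding append_assoc
     by (intro coord_append coord_slice coord_take' coord_drop') (use tuples_sorts[OF e(1)] in auto)
    have "?P (c i @ e @ v) = ?P (b @ e @ v)"
     by (rule tp_eq_sort[OF _ _ bt _ defp_coord[OF defp_wff[OF v(2)] co] A]) (use c e v in auto)
    then show "sat C ((e @ c i) @ v) phi = sat C ((e @ b) @ v) phi"
     using tuples_length[OF conjunct1[OF spec[OF c(1)]], of i] by simp
   qed
  next
   fix I :: "nat set" assume I: "finite I \<and> card I = k"
   show "\<not> (\<exists>a\<in>tup xi. \<forall>i\<in>I. sat C (a @ e @ c i) psi)"
   proof
    assume "\<exists>a\<in>tup xi. \<forall>i\<in>I. sat C (a @ e @ c i) psi"
    then obtain a where a: "a \<in> tup xi" "\<forall>i\<in>I. sat C ((a @ e) @ c i) psi" by auto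
    then have "a @ e \<in> tup (xi @ sg)" using e by simp
    then show False using c(2) I a(2) by blast
   qed
  qed
  moreover have "def2 L C xi (sg @ srt b) (\<lambda>x d. sat C (x @ d) psi)" using w(1) by (intro def2_wff) simp
  ultimately have "fset A xi {x. sat C (x @ e @ b) psi}" by (rule kdiv_fset) (use e bt in simp)
  then show ?thesis by (simp add: qb)
 qed
 then have "fset A xi (\<Union>q\<in>Dl. {x. sat C ((x @ e) @ snd q) (fst q)})" by (rule fset_UN[OF Dl(2)])
 then show ?thesis
 proof (rule fset_mono)
  fix a assume a: "a \<in> tup xi" "a \<in> {x. x @ e \<in> Y}"
  then have "a @ e \<in> tup (xi @ sg)" "a @ e \<in> Y" using e by auto
  then show "a \<in> (\<Union>q\<in>Dl. {x. sat C ((x @ e) @ snd q) (fst q)})" using Dl(4) by fastforce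
 qed
qed

lemma indep_append:
 assumes i: "indep L C d B A" and d: "d \<in> tup ty" and e: "e \<in> tup sg" "set e \<subseteq> A" and A: "A \<subseteq> U" and B: "B \<subseteq> U"
 shows "indep L C (d @ e) B A"
proof -
 have de: "d @ e \<in> tup (ty @ sg)" using d e by simp
 show ?thesis unfolding indep_iff[OF de A B]
 proof (intro allI impI notI)
  fix c P assume c: "set c \<subseteq> A \<union> B" "defp L C ((ty @ sg) @ srt c) P" "P ((d @ e) @ c)"
   and f: "fset A (ty @ sg) {x. P (x @ c)}"
  have "defp L C (ty @ srt (e @ c)) P" "P (d @ e @ c)" "set (e @ c) \<subseteq> A \<union> B"
   using c e tuples_sorts[OF e(1)] by auto
  then have "\<not> fset A ty {x. P (x @ e @ c)}" using i unfolding indep_iff[OF d A B] by blast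
  moreover have "fset A ty {x. x @ e \<in> {x. P (x @ c)}}" by (rule fset_section[OF e A f])
  ultimately show False by simp
 qed
qed

section \<open>Definability of types for stable relations\<close>

text \<open>Otherwise there are \<open>p i\<close>, \<open>q i\<close>, \<open>e i\<close> in
  \<open>P\<close> with \<open>R (p i) d\<close> and not \<open>R (q i) d\<close>, where
  \<open>p i\<close> and \<open>q i\<close> agree on \<open>e j\<close> for \<open>j < i\<close> and
  the \<open>e j\<close> with \<open>i \<le> j\<close> behave like \<open>d\<close> on them. Ramsey
  fixes the truth value of \<open>R (p i) (e j)\<close> for \<open>j < i\<close>; if it is true the
  \<open>q i\<close> form ladders with the \<open>e j\<close>, if false the \<open>p i\<close>
  do.\<close>

lemma finite_determination:
 assumes R: "stab xi ty R" and P: "elem_sub L C P" and d: "d \<in> tup ty"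
 shows "\<exists>Es. (\<forall>e\<in>set Es. e \<in> tup ty \<and> set e \<subseteq> P) \<and> (\<forall>p\<in>tup xi. \<forall>q\<in>tup xi. set p \<subseteq> P --> set q \<subseteq> P -->
  map (R p) Es = map (R q) Es --> R p d --> R q d)"
proof (rule ccontr)
 assume no: "\<not> ?thesis"
 define S where "S f i r \<longleftrightarrow> (case r of (p, q, e) => p \<in> tup xi \<and> q \<in> tup xi \<and> e \<in> tup ty \<and> set p \<subseteq> P \<and> set q \<subseteq> P \<and> set e \<subseteq> P \<and>
  R p d \<and> \<not> R q d \<and> (\<forall>j<i. R p (snd (snd (f j))) = R q (snd (snd (f j)))) \<and>
  (\<forall>j<i. R (fst (f j)) e \<and> \<not> R (fst (snd (f j))) e) \<and> R p e \<and> \<not> R q e)"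
  for f :: "nat => 'a list \<times> 'a list \<times> 'a list" and i :: nat and r :: "'a list \<times> 'a list \<times> 'a list"
 have "\<exists>f. \<forall>i. S f i (f i)"
 proof (rule dependent_wellorder_choice)
  fix r :: "'a list \<times> 'a list \<times> 'a list" and f g :: "nat => 'a list \<times> 'a list \<times> 'a list" and x :: nat assume "\<And>y. y < x ==> f y = g y"
  then show "S f x r = S g x r" unfolding S_def by (auto split: prod.splits)
 next
  fix x and f :: "nat => 'a list \<times> 'a list \<times> 'a list" assume f: "\<And>y. y < x ==> S f y (f y)"
  let ?Es = "map (\<lambda>j. snd (snd (f j))) [0..<x]"
  have fj: "fst (f j) \<in> tup xi \<and> fst (snd (f j)) \<in> tup xi \<and> snd (snd (f j)) \<in> tup ty \<and> set (fst (f j)) \<subseteq> P \<and>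
   set (fst (snd (f j))) \<subseteq> P \<and> set (snd (snd (f j))) \<subseteq> P \<and> R (fst (f j)) d \<and> \<not> R (fst (snd (f j))) d"
   if "j < x" for j using f[OF that] unfolding S_def by (simp add: split_beta)
  have "\<forall>e\<in>set ?Es. e \<in> tup ty \<and> set e \<subseteq> P" using fj by auto
  then have "\<not> (\<forall>p\<in>tup xi. \<forall>q\<in>tup xi. set p \<subseteq> P --> set q \<subseteq> P -->
   map (R p) ?Es = map (R q) ?Es --> R p d --> R q d)" using no by blast
  then obtain p q where pq: "p \<in> tup xi" "q \<in> tup xi" "set p \<subseteq> P" "set q \<subseteq> P" "map (R p) ?Es = map (R q) ?Es" "R p d" "\<not> R q d"
   by blast
  have "\<exists>e\<in>tup ty. set e \<subseteq> P \<and> (\<forall>a\<in>set (p # map (\<lambda>j. fst (f j)) [0..<x]). R a e) \<and>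
   (\<forall>a\<in>set (q # map (\<lambda>j. fst (snd (f j))) [0..<x]). \<not> R a e)"
  proof (rule elem_sub_approx[OF P stab_def2[OF R] d])
   fix a assume "a \<in> set (p # map (\<lambda>j. fst (f j)) [0..<x])"
   then have "a = p \<or> (\<exists>j<x. a = fst (f j))" by auto
   then show "a \<in> tup xi \<and> set a \<subseteq> P \<and> R a d" using pq fj by blast
  next
   fix a assume "a \<in> set (q # map (\<lambda>j. fst (snd (f j))) [0..<x])"
   then have "a = q \<or> (\<exists>j<x. a = fst (snd (f j)))" by auto
   then show "a \<in> tup xi \<and> set a \<subseteq> P \<and> \<not> R a d" using pq fj by blast
  qed
  then obtain e where e: "e \<in> tup ty" "set e \<subseteq> P" "\<forall>a\<in>set (p # map (\<lambda>j. fst (f j)) [0..<x]). R a e"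
   "\<forall>a\<in>set (q # map (\<lambda>j. fst (snd (f j))) [0..<x]). \<not> R a e" by blast
  have "S f x (p, q, e)" unfolding S_def using pq e by auto
  then show "\<exists>r. S f x r" ..
 qed
 then obtain f where f: "\<And>i. S f i (f i)" by blast
 define p q e where "p i = fst (f i)" and "q i = fst (snd (f i))" and "e i = snd (snd (f i))" for i
 have t: "p i \<in> tup xi" "q i \<in> tup xi" "e i \<in> tup ty" for i
  using f[of i] unfolding S_def p_def q_def e_def by (simp_all add: split_beta)
 have eq: "R (p i) (e j) = R (q i) (e j)" if "j < i" for i j
  using f[of i] that unfolding S_def p_def q_def e_def by (simp add: split_beta)
 have le: "R (p i) (e j) \<and> \<not> R (q i) (e j)" if "i \<le> j" for i j
 proof (cases "i = j")
  case True then show ?thesis using f[of i] unfolding S_def p_def q_def e_def by (simp add: split_beta)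
 next
  case False then show ?thesis using f[of j] that unfolding S_def p_def q_def e_def by (simp add: split_beta)
 qed
 obtain n where n: "\<not> lad n xi ty R" using R unfolding stab_def by (elim conjE exE)
 from ramsey_pairs[of "\<lambda>j i. R (p i) (e j)"] obtain g :: "nat => nat" where g: "strict_mono g"
  "(\<forall>j i. j < i --> R (p (g i)) (e (g j))) \<or> (\<forall>j i. j < i --> \<not> R (p (g i)) (e (g j)))" by (elim exE conjE)
 have gl: "g i < g j \<longleftrightarrow> i < j" "g i \<le> g j \<longleftrightarrow> i \<le> j" for i j
  using g(1) by (simp_all add: strict_mono_less strict_mono_less_eq)
 show False
 proof (cases "\<forall>j i. j < i --> R (p (g i)) (e (g j))")
  case True
  have q: "R (q (g u)) (e (g v)) \<longleftrightarrow> v < u" for u v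
  proof (cases "v < u")
   case True then show ?thesis using \<open>\<forall>j i. j < i --> R (p (g i)) (e (g j))\<close> eq[of "g v" "g u"] gl by blast
  next
   case False then show ?thesis using le[of "g u" "g v"] gl by simp
  qed
  have "lad n xi ty R"
   by (rule ladI[of n "\<lambda>i. q (g (n - i))" _ "\<lambda>i. e (g (n - i))"]) (use t q in auto)
  then show False using n by simp
 next
  case False
  then have no: "\<forall>j i. j < i --> \<not> R (p (g i)) (e (g j))" using g(2) by blast
  have q: "R (p (g u)) (e (g v)) \<longleftrightarrow> u \<le> v" for u v
  proof (cases "v < u")
   case True then show ?thesis using no by simp
  next
   case False then show ?thesis using le[of "g u" "g v"] gl by simp
  qed
  have "lad n xi ty R"
   by (rule ladI[of n "\<lambda>i. p (g (Suc i))" _ "\<lambda>i. e (g i)"]) (use t q in auto)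
  then show False using n by simp
 qed
qed

text \<open>The definition is the disjunction of the patterns of truth values on the finite list
  \<open>Es\<close> that occur at solutions in \<open>P\<close>. As a Boolean combination of
  instances of \<open>R\<close> it is stable.\<close>

lemma definability:
 assumes R: "stab xi ty R" and P: "elem_sub L C P" and d: "d \<in> tup ty"
 shows "\<exists>ty' B e. stab xi ty' B \<and> e \<in> tup ty' \<and> set e \<subseteq> P \<and> (\<forall>x\<in>tup xi. set x \<subseteq> P --> R x d = B x e)"
proof -
 obtain Es where Es: "\<And>e. e \<in> set Es ==> e \<in> tup ty" "\<And>e. e \<in> set Es ==> set e \<subseteq> P"
  "\<And>p q. p \<in> tup xi ==> q \<in> tup xi ==> set p \<subseteq> P ==> set q \<subseteq> P ==> map (R p) Es = map (R q) Es ==> R p d ==> R q d"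
  using finite_determination[OF assms] by blast
 define k where "k = length Es"
 define T where "T = {map (R p) Es | p. p \<in> tup xi \<and> set p \<subseteq> P \<and> R p d}"
 let ?ty = "concat (replicate k ty)"
 define B where "B x z \<longleftrightarrow> (\<exists>u\<in>T. \<forall>t\<in>{..<k}. R x (slice (length ty) t z) = u ! t)" for x z
 have fT: "finite T"
 proof (rule finite_subset)
  show "T \<subseteq> {u. set u \<subseteq> UNIV \<and> length u = k}" by (auto simp: T_def k_def)
  show "finite {u :: bool list. set u \<subseteq> UNIV \<and> length u = k}" by (rule finite_lists_length_eq) simp
 qed
 have sR: "stab xi ?ty (\<lambda>x z. R x (slice (length ty) t z) = b)" if t: "t \<in> {..<k}" for t b
 proof -
  have "stab xi ?ty (\<lambda>x z. R x (slice (length ty) t z))"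
   by (rule stab_coord[OF R coord_id coord_slice_replicate]) (use t in simp)
  then show ?thesis using stab_neg by (cases b) auto
 qed
 have sB: "stab xi ?ty B" unfolding B_def by (intro stab_bex stab_ball fT sR finite_lessThan)
 have Bx: "B x (concat Es) \<longleftrightarrow> map (R x) Es \<in> T" for x
 proof -
  have sl: "slice (length ty) t (concat Es) = Es ! t" if "t < k" for t
   by (rule slice_concat') (use Es(1) tuples_length that in \<open>auto simp: k_def\<close>)
  have "(\<forall>t\<in>{..<k}. R x (slice (length ty) t (concat Es)) = u ! t) \<longleftrightarrow> map (R x) Es = u" if "u \<in> T" for u
  proof -
   have "length u = k" using that by (auto simp: T_def k_def)
   then have "map (R x) Es = u \<longleftrightarrow> (\<forall>t<k. R x (Es ! t) = u ! t)"
    unfolding list_eq_iff_nth_eq by (simp add: k_def)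
   moreover have "(\<forall>t\<in>{..<k}. R x (slice (length ty) t (concat Es)) = u ! t) \<longleftrightarrow> (\<forall>t<k. R x (Es ! t) = u ! t)"
    by (simp add: sl Ball_def)
   ultimately show ?thesis by simp
  qed
  then show ?thesis unfolding B_def by blast
 qed
 have "R x d = B x (concat Es)" if "x \<in> tup xi" "set x \<subseteq> P" for x
 proof
  assume "R x d"
  then show "B x (concat Es)" unfolding Bx T_def using that by blast
 next
  assume "B x (concat Es)"
  then obtain p where "map (R x) Es = map (R p) Es" "p \<in> tup xi" "set p \<subseteq> P" "R p d"
   unfolding Bx T_def by blast
  then show "R x d" using Es(3)[of p x] that by simp
 qed
 moreover have "concat Es \<in> tup ?ty" unfolding k_def by (rule tuples_concat_replicate) (rule Es(1))
 moreover have "set (concat Es) \<subseteq> P" using Es(2) by auto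
 ultimately show ?thesis using sB by blast
qed

text \<open>A ladder for \<open>Z\<close> becomes a ladder for \<open>R\<close>. Only nonempty
  instances are known to come from \<open>R\<close>, so the first rung is given up: its left element
  witnesses that the later instances are nonempty.\<close>

lemma stab_instances:
 assumes R: "stab xi ty R" and Z: "def2 L C xi ty' Z"
  and inst: "\<And>d. d \<in> tup ty' ==> (\<forall>x\<in>tup xi. \<not> Z x d) \<or> (\<exists>w\<in>tup ty. \<forall>x\<in>tup xi. Z x d = R x w)"
 shows "stab xi ty' Z"
proof -
 have "lad n xi ty R" if "lad (Suc n) xi ty' Z" for n
 proof -
  from that obtain a b :: "nat => 'a list" where ab: "\<forall>i<Suc n. a i \<in> tup xi \<and> b i \<in> tup ty'"
   "\<forall>i<Suc n. \<forall>j<Suc n. Z (a i) (b j) \<longleftrightarrow> i < j" by (rule ladE)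
  have "\<forall>j. \<exists>w. j < n --> w \<in> tup ty \<and> (\<forall>x\<in>tup xi. Z x (b (Suc j)) = R x w)"
  proof
   fix j show "\<exists>w. j < n --> w \<in> tup ty \<and> (\<forall>x\<in>tup xi. Z x (b (Suc j)) = R x w)"
   proof (cases "j < n")
    case True
    then have "Z (a 0) (b (Suc j))" "a 0 \<in> tup xi" "b (Suc j) \<in> tup ty'" using ab by auto
    then show ?thesis using inst by blast
   qed auto
  qed
  from choice[OF this] obtain w where w: "\<And>j. j < n ==> w j \<in> tup ty" "\<And>j x. j < n ==> x \<in> tup xi ==> Z x (b (Suc j)) = R x (w j)"
   by blast
  show ?thesis
  proof (rule ladI[of n "\<lambda>i. a (Suc i)" _ w])
   fix i j assume ij: "i < n" "j < n"
   then have "R (a (Suc i)) (w j) = Z (a (Suc i)) (b (Suc j))" using w(2)[of j "a (Suc i)"] ab(1) by simp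
   then show "R (a (Suc i)) (w j) \<longleftrightarrow> i < j" using ab(2) ij by simp
  qed (use ab w in auto)
 qed
 then show ?thesis using R Z unfolding stab_def by blast
qed

lemma tp_eq_setI:
 assumes a: "a \<in> tup sg" and b: "b \<in> tup sg" and c: "c \<in> tup ty"
  and imp: "\<And>P. defp L C (sg @ ty) P ==> P (a @ c) ==> P (b @ c)"
 shows "tp L C a (set c) = tp L C b (set c)"
proof (rule tp_eqI[OF a b])
 fix c' phi assume c': "set c' \<subseteq> set c" "wff L (sg @ srt c') phi"
 have "\<exists>ix. set ix \<subseteq> {..<length c} \<and> c' = map ((!) c) ix" using c'(1)
 proof (induction c')
  case (Cons x c')
  then obtain ix i where "set ix \<subseteq> {..<length c}" "c' = map ((!) c) ix" "i < length c" "c ! i = x"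
   by (auto simp: in_set_conv_nth)
  then show ?case by (intro exI[of _ "i # ix"]) auto
 qed auto
 then obtain ix where ix: "set ix \<subseteq> {..<length c}" "c' = map ((!) c) ix" by blast
 let ?r = "\<lambda>w. take (length sg) w @ map ((!) (drop (length sg) w)) ix"
 have "srt c' = map ((!) ty) ix" using ix tuples_nth[OF c] tuples_length[OF c]
  by (auto simp: carrier_of_def subset_iff)
 then have co: "coord (sg @ ty) (sg @ srt c') ?r"
  by (intro coord_append coord_comp[OF coord_drop' coord_map_nth] coord_take')
   (use ix tuples_length[OF c] in auto)
 note d = defp_coord[OF defp_wff[OF c'(2)] co, of C]
 have r: "?r (x @ c) = x @ c'" if "x \<in> tup sg" for x using ix(2) tuples_length[OF that] by simp
 show "sat C (a @ c') phi = sat C (b @ c') phi"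
  using imp[OF d] imp[OF defp_neg[OF d]] r[OF a] r[OF b] by auto
qed

lemma kdiv_tp: "kdiv k A xi ty R d ==> tp L C d A = tp L C d' A ==> kdiv k A xi ty R d'"
 unfolding kdiv_def by simp

end

section \<open>Forking of stable relations over arbitrary sets\<close>

context simple_monster begin

text \<open>A conjugate of \<open>P\<close> over \<open>D\<close> that is independent from
  \<open>E\<close> contains no solution of a forking relation with parameters in \<open>E\<close>;
  the inverse automorphism moves \<open>E\<close> instead of \<open>P\<close>. One automorphism
  serves all relations at once.\<close>

lemma forks_misses:
 assumes P: "P \<subseteq> U" "sm P" and D: "D \<subseteq> U" "sm D" and E: "E \<subseteq> U" "sm E"
 shows "\<exists>h. aut h \<and> (\<forall>x\<in>D. h x = x) \<and> (\<forall>xi ty R d. def2 L C xi ty R --> d \<in> tup ty --> set d \<subseteq> E -->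
  fset D xi {x. R x d} --> misses P xi R (map h d))"
proof -
 obtain g where g: "aut g" "\<forall>x\<in>D. g x = x" "\<And>a. set a \<subseteq> P ==> indep L C (map g a) E D"
  using nonfork_exists[OF D P E] by blast
 obtain h where h: "aut h" "\<And>x. x \<in> U ==> h (g x) = x" "\<And>x. x \<in> U ==> g (h x) = x" using aut_inv[OF g(1)] by blast
 have "h x = x" if "x \<in> D" for x using h(2)[of x] g(2) that D by auto
 moreover have "misses P xi R (map h d)" if R: "def2 L C xi ty R" "d \<in> tup ty" "set d \<subseteq> E" "fset D xi {x. R x d}" for xi ty R d
  unfolding misses_def
 proof (intro ballI impI notI)
  fix x assume x: "x \<in> tup xi" "set x \<subseteq> P" "R x (map h d)"
  have "map g (map h d) = d" by (rule aut_inv_map[where g = g and h = h, OF h(3) tuples_set[OF R(2)]])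
  then have "R (map g x) d" using aut_def2[OF g(1) R(1) x(1) aut_tup[OF h(1) R(2)]] x(3) by simp
  then have "\<not> fset D xi {x. R x d}"
   by (intro indepD[OF g(3)[OF x(2)] aut_tup[OF g(1) x(1)] D(1) E(1) R(2) _ R(1)]) (use R in auto)
  then show False using R(4) by simp
 qed
 ultimately show ?thesis using h(1) by blast
qed

text \<open>Over \<open>D\<close> the parameter \<open>d\<close> is moved until the relation misses
  a model that contains \<open>D\<close>, where \<open>misses_kdiv\<close> applies. The number
  depends on the ladder bound alone, not on \<open>d\<close> or \<open>D\<close>.\<close>

lemma stab_kdiv:
 assumes R: "stab xi ty R" "\<not> lad n xi ty R" and d: "d \<in> tup ty" and D: "countable D" "D \<subseteq> U" and f: "fset D xi {x. R x d}"
 shows "kdiv (Suc n) D xi ty R d"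
proof -
 obtain P where P: "smod P" "D \<subseteq> P" using smod_ex[OF D] by blast
 note P' = smodD[OF P(1)]
 have "set d \<subseteq> U" "sm (set d)" using tuples_set[OF d] by (auto intro: sm_finite)
 from forks_misses[OF P'(1,2) D(2) sm_countable[OF D(1)] this] obtain h where h: "aut h" "\<forall>x\<in>D. h x = x"
  "misses P xi R (map h d)" using stab_def2[OF R(1)] d f by blast
 have "kdiv (Suc n) P xi ty R (map h d)" by (rule misses_kdiv[OF R P(1) aut_tup[OF h(1) d] h(3)])
 then have "kdiv (Suc n) D xi ty R (map h d)" using kdiv_mono[OF _ aut_tup[OF h(1) d] P(2) P'(1)] by blast
 then show ?thesis by (rule kdiv_tp) (rule aut_tp[OF h(1,2) D(2) d])
qed

text \<open>Forking of a stable relation is dividing, and dividing depends on the type over the base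
  only.\<close>

lemma stab_fset_tp:
 assumes R: "stab xi ty R" and d: "d \<in> tup ty" "d' \<in> tup ty" and D: "countable D" "D \<subseteq> U"
  and t: "tp L C d D = tp L C d' D" and f: "fset D xi {x. R x d}"
 shows "fset D xi {x. R x d'}"
proof -
 obtain n where n: "\<not> lad n xi ty R" using R unfolding stab_def by (elim conjE exE)
 from kdiv_fset[OF kdiv_tp[OF stab_kdiv[OF R n d(1) D f] t] stab_def2[OF R] d(2)] show ?thesis .
qed

lemma stab_fset_aut:
 assumes R: "stab xi ty R" and d: "d \<in> tup ty" and D: "countable D" "D \<subseteq> U" and h: "aut h" "\<forall>x\<in>D. h x = x"
  and f: "fset D xi {x. R x d}"
 shows "fset D xi {x. R x (map h d)}"
 by (rule stab_fset_tp[OF R d aut_tup[OF h(1) d] D _ f]) (simp add: aut_tp[OF h D(2) d])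

end

context monster_model begin

lemma stab_iff: "stab xi ty R ==> stab xi ty S ==> stab xi ty (\<lambda>x d. R x d = S x d)"
 by (rule stab_cong[OF stab_disj[OF stab_conj[of xi ty R S] stab_conj[OF stab_neg stab_neg, of xi ty R S]]]) auto

lemma defp_all_iff:
 assumes "def2 L C xi ty A" "def2 L C xi sg B"
 shows "defp L C (ty @ sg) (\<lambda>w. \<forall>x\<in>tup xi. A x (take (length ty) w) = B x (drop (length ty) w))"
proof -
 let ?n = "length xi" and ?m = "length ty"
 have "defp L C (xi @ ty @ sg) (\<lambda>w. A (take ?n w) (take ?m (drop ?n w)) = B (take ?n w) (drop ?m (drop ?n w)))"
  by (rule defp_iff[OF def2_defp[OF assms(1) coord_fst coord_slice] def2_defp[OF assms(2) coord_fst coord_comp[OF coord_snd coord_snd]]]) simp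
 from defp_all[OF this] show ?thesis by (rule defp_cong) (auto simp: tuples_length)
qed

end

section \<open>Cutting a requirement at an intermediate tuple\<close>

context simple_monster begin

text \<open>Splitting a forking condition along an intermediate tuple \<open>take k d\<close>. The relation \<open>Z\<close> is the
 union of the finitely many conjugates of a nonforking definition of the \<open>R\<close>-type of \<open>d\<close>.\<close>

lemma decompose:
 assumes R: "stab xi ty R" and d: "d \<in> tup ty" and D: "D \<subseteq> set (take k d)" and f: "fset D xi {x. R x d}"
 shows "\<exists>Z. stab xi (take k ty) Z \<and> fset D xi {x. Z x (take k d)} \<and>
  fset (set (take k d)) xi {x. R x d \<and> \<not> Z x (take k d)}"
proof -
 let ?c = "take k d" and ?tyc = "take k ty"
 have c: "?c \<in> tup ?tyc" by (rule tuples_take[OF d])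
 have dU: "set d \<subseteq> U" by (rule tuples_set[OF d])
 have cU: "set ?c \<subseteq> U" by (rule tuples_set[OF c])
 have DU: "D \<subseteq> U" using D cU by auto
 have Dc: "countable D" using finite_subset[OF D] by (simp add: countable_finite)
 have smc: "sm (set ?c)" "sm (set d)" by (auto intro: sm_finite)
 have "countable (set ?c)" by (simp add: countable_finite)
 from smod_ex[OF this cU] obtain P0 where P0: "smod P0" "countable P0" "set ?c \<subseteq> P0" by blast
 note P0' = smodD[OF P0(1)]
 obtain h1 where h1: "aut h1" "\<forall>x\<in>set ?c. h1 x = x" "\<And>a. set a \<subseteq> set d ==> indep L C (map h1 a) P0 (set ?c)"
  using nonfork_exists[OF cU smc(1) dU smc(2) P0'(1,2)] by blast
 define d1 where "d1 = map h1 d"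
 have d1: "d1 \<in> tup ty" unfolding d1_def by (rule aut_tup[OF h1(1) d])
 have d1c: "take k d1 = ?c" unfolding d1_def take_map by (rule aut_fix_map[OF h1(2) subset_refl])
 have tp1: "tp L C d1 (set ?c) = tp L C d (set ?c)" unfolding d1_def by (rule aut_tp[OF h1(1,2) cU d])
 obtain ty' B e where B: "stab xi ty' B" and e: "e \<in> tup ty'" "set e \<subseteq> P0"
  and Be: "\<forall>x\<in>tup xi. set x \<subseteq> P0 --> R x d1 = B x e"
  using definability[OF R P0'(3) d1] by blast
 note B2 = stab_def2[OF B]

 \<comment> \<open>The relation \<open>B(x, e)\<close> is almost over \<open>?c\<close>: each of its
   conjugates over \<open>?c\<close> is defined with parameters in \<open>P0\<close>. With
   \<open>g\<close> the inverse of \<open>h\<close>, a conjugate \<open>d2\<close> of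
   \<open>d1\<close> over \<open>P0\<close> that is independent over \<open>?c\<close> from a model
   \<open>P2\<close> above \<open>P0\<close> and \<open>g P0\<close> has its \<open>R\<close>-type
   on \<open>P2\<close> defined over either of the two models; the definitions agree on
   \<open>P2\<close> and therefore everywhere.\<close>
 have claim: "\<exists>sg B' e'. stab xi sg B' \<and> e' \<in> tup sg \<and> set e' \<subseteq> P0 \<and> (\<forall>x\<in>tup xi. B x (map h e) = B' x e')"
  if h: "aut h" "\<forall>x\<in>set ?c. h x = x" for h
 proof -
  obtain g where g: "aut g" "\<And>x. x \<in> U ==> g (h x) = x" "\<And>x. x \<in> U ==> h (g x) = x" using aut_inv[OF h(1)] by blast
  have gc: "g x = x" if "x \<in> set ?c" for x using g(2)[of x] h(2) that cU by auto
  have "countable (P0 \<union> g ` P0)" "P0 \<union> g ` P0 \<subseteq> U" using P0(2) P0'(1) aut_U[OF g(1)] by auto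
  from smod_ex[OF this] obtain P2 where P2: "smod P2" "P0 \<subseteq> P2" "g ` P0 \<subseteq> P2" by blast
  note P2' = smodD[OF P2(1)]
  have "\<exists>h2. aut h2 \<and> (\<forall>x\<in>set ?c \<union> P0. h2 x = x) \<and>
   (\<forall>idx. set idx \<subseteq> {..<length d} --> indep L C (map (\<lambda>j. h2 (d1 ! j)) idx) P2 (set ?c))"
  proof (rule nonfork_ext[where v = "(!) ty", OF _ cU smc(1) P0'(1,2) P2'(1,2)])
   show "sm {..<length d}" by (simp add: sm_finite)
   show "d1 ! j \<in> car (ty ! j)" if "j \<in> {..<length d}" for j
    using tuples_nth[OF d1] that tuples_length[OF d] by simp
   fix idx assume idx: "set idx \<subseteq> {..<length d}"
   then have "map ((!) d1) idx = map h1 (map ((!) d) idx)" by (auto simp: d1_def)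
   moreover have "set (map ((!) d) idx) \<subseteq> set d" using idx by auto
   ultimately show "indep L C (map ((!) d1) idx) P0 (set ?c)" using h1(3) by metis
  qed
  then obtain h2 where h2: "aut h2" "\<forall>x\<in>set ?c \<union> P0. h2 x = x"
   "\<forall>idx. set idx \<subseteq> {..<length d} --> indep L C (map (\<lambda>j. h2 (d1 ! j)) idx) P2 (set ?c)" by (elim exE conjE)
  define d2 where "d2 = map h2 d1"
  have d2: "d2 \<in> tup ty" unfolding d2_def by (rule aut_tup[OF h2(1) d1])
  have "map (\<lambda>j. h2 (d1 ! j)) [0..<length d] = d2"
   unfolding d2_def using tuples_length[OF d] tuples_length[OF d1] by (auto intro!: nth_equalityI)
  then have i2: "indep L C d2 P2 (set ?c)" using h2(3)[rule_format, of "[0..<length d]"] by (simp add: atLeast0LessThan)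
  \<comment> \<open>A definition valid on a model \<open>A\<close> stays valid on \<open>P2\<close>:
    the difference of the two sides is a stable relation that misses \<open>A\<close>, and
    \<open>d2\<close> is independent from \<open>P2\<close> over \<open>A\<close>.\<close>
  have agree: "R x d2 = B' x e'"
   if A: "smod A" "set ?c \<subseteq> A" "A \<subseteq> P2" and B': "stab xi sg B'" and e': "e' \<in> tup sg" "set e' \<subseteq> A"
    and eq: "\<forall>x\<in>tup xi. set x \<subseteq> A --> R x d2 = B' x e'" and x: "x \<in> tup xi" "set x \<subseteq> P2"
   for A sg B' e' x
  proof -
   define S where "S x w \<longleftrightarrow> \<not> (R x (take (length ty) w) = B' x (drop (length ty) w))" for x w
   have sS: "stab xi (ty @ sg) S" unfolding S_def
    by (intro stab_neg stab_iff stab_coord[OF R coord_id coord_fst] stab_coord[OF B' coord_id coord_snd])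
   have Sx: "S x (d2 @ e') \<longleftrightarrow> R x d2 \<noteq> B' x e'" for x unfolding S_def using tuples_length[OF d2] by simp
   have "misses A xi S (d2 @ e')" unfolding misses_def Sx using eq by blast
   moreover have "indep L C (d2 @ e') P2 A"
    by (rule indep_append[OF indep_base_mono[OF i2 d2 A(2) _ cU P2'(1)] d2 e' _ P2'(1)])
     (use A smodD(1)[OF A(1)] in auto)
   moreover have "d2 @ e' \<in> tup (ty @ sg)" using d2 e' by simp
   ultimately have "misses (A \<union> P2) xi S (d2 @ e')" using indep_misses[OF sS A(1)] P2'(1) by blast
   then show ?thesis using x unfolding misses_def Sx by blast
  qed
  have eq0: "R x d2 = B x e" if x: "x \<in> tup xi" "set x \<subseteq> P0" for x
  proof -
   have "map h2 x = x" by (rule aut_fix_map[OF h2(2)]) (use x in auto)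
   then have "R x d2 = R x d1" using aut_def2[OF h2(1) stab_def2[OF R] x(1) d1] by (simp add: d2_def)
   then show ?thesis using Be x by simp
  qed
  have gP: "smod (g ` P0)" using aut_elem_sub[OF g(1) P0'(3)] sm_image[OF P0'(2)] by (simp add: smod_def)
  have gcP: "set ?c \<subseteq> g ` P0"
  proof
   fix x assume "x \<in> set ?c" then show "x \<in> g ` P0" using gc P0(3) by (metis image_eqI subsetD)
  qed
  obtain sg B' e' where B': "stab xi sg B'" and e': "e' \<in> tup sg" "set e' \<subseteq> g ` P0"
   and Be': "\<forall>x\<in>tup xi. set x \<subseteq> g ` P0 --> R x d2 = B' x e'"
   using definability[OF R smodD(3)[OF gP] d2] by blast
  have eP2: "B x e = B' x e'" if x: "x \<in> tup xi" "set x \<subseteq> P2" for x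
   using agree[OF P0(1,3) P2(2) B e _ x] agree[OF gP gcP P2(3) B' e' Be' x] eq0 by blast
  have all: "B x e = B' x e'" if x: "x \<in> tup xi" for x
  proof (rule ccontr)
   assume ne: "B x e \<noteq> B' x e'"
   have "defp L C (xi @ ty' @ sg) (\<lambda>w. \<not> (B (take (length xi) w) (take (length ty') (drop (length xi) w)) =
    B' (take (length xi) w) (drop (length ty') (drop (length xi) w))))"
    by (intro defp_neg defp_iff def2_defp[OF B2 coord_fst coord_comp[OF coord_snd coord_fst]]
      def2_defp[OF stab_def2[OF B'] coord_fst coord_comp[OF coord_snd coord_snd]])
   from elem_sub_exs[OF P2'(3) this _ _ x, of "e @ e'"] ne e e' P2
   obtain y where "y \<in> tup xi" "set y \<subseteq> P2" "B y e \<noteq> B' y e'"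
    using tuples_length[OF x] tuples_length[OF e(1)] by (fastforce simp: tuples_length)
   then show False using eP2 by blast
  qed
  have "B x (map h e) = B' x (map h e')" if x: "x \<in> tup xi" for x
  proof -
   have hx: "map h (map g x) = x" by (rule aut_inv_map[where g = h and h = g, OF g(3) tuples_set[OF x]])
   have "B (map h (map g x)) (map h e) = B (map g x) e" by (rule aut_def2[OF h(1) B2 aut_tup[OF g(1) x] e(1)])
   moreover have "B' (map h (map g x)) (map h e') = B' (map g x) e'"
    by (rule aut_def2[OF h(1) stab_def2[OF B'] aut_tup[OF g(1) x] e'(1)])
   ultimately show ?thesis using all[OF aut_tup[OF g(1) x]] unfolding hx by simp
  qed
  moreover have "set (map h e') \<subseteq> P0"
  proof
   fix y assume "y \<in> set (map h e')"
   then obtain z where "z \<in> P0" "y = h (g z)" using e'(2) by auto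
   then show "y \<in> P0" using g(3)[of z] P0'(1) by auto
  qed
  ultimately show ?thesis using B' aut_tup[OF h(1) e'(1)] by blast
 qed

 let ?ix = "[0..<length ty']"
 have mt: "map ((!) ty') ?ix = ty'" by (simp add: map_nth)
 define G1 where "G1 = {(?ix, ?c, Q) | Q. defp L C (ty' @ ?tyc) Q \<and> Q (e @ ?c)}"
 \<comment> \<open>By the claim nothing realises the type of \<open>e\<close> over \<open>?c\<close>
   (\<open>G1\<close>) and also differs from all conjugates defined over \<open>P0\<close>
   (\<open>G2\<close>); a finite inconsistent part leaves only finitely many conjugates.\<close>
 define G2 where "G2 = {(?ix, e', \<lambda>w. \<not> (\<forall>x\<in>tup xi. B x (take (length ty') w) = B' x (drop (length ty') w))) | sg B' e'.
  stab xi sg B' \<and> e' \<in> tup sg \<and> set e' \<subseteq> P0 \<and> (\<exists>h. aut h \<and> (\<forall>x\<in>set ?c. h x = x) \<and> (\<forall>x\<in>tup xi. B x (map h e) = B' x e'))}"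
 have G2h: "\<exists>h. aut h \<and> (\<forall>x\<in>set ?c. h x = x) \<and> (\<forall>z\<in>tup ty'. \<not> (snd (snd g)) (z @ fst (snd g)) --> (\<forall>x\<in>tup xi. B x z = B x (map h e)))"
  if g: "g \<in> G2" for g
 proof -
  obtain sg B' e' h where g': "g = (?ix, e', \<lambda>w. \<not> (\<forall>x\<in>tup xi. B x (take (length ty') w) = B' x (drop (length ty') w)))"
   "aut h" "\<forall>x\<in>set ?c. h x = x" "\<forall>x\<in>tup xi. B x (map h e) = B' x e'"
   using g unfolding G2_def by blast
  show ?thesis using g' by (intro exI[of _ h]) (auto simp: tuples_length)
 qed
 have "\<exists>G0. finite G0 \<and> G0 \<subseteq> G1 \<union> G2 \<and> \<not> (\<exists>z. (\<forall>j\<in>{..<length ty'}. z j \<in> car (ty' ! j)) \<and> (\<forall>(idx, c, P)\<in>G0. P (map z idx @ c)))"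
 proof (rule ccontr)
  assume no: "\<not> ?thesis"
  have "\<exists>z. (\<forall>j\<in>{..<length ty'}. z j \<in> car (ty' ! j)) \<and> (\<forall>(idx, c, P)\<in>G1 \<union> G2. P (map z idx @ c))"
  proof (rule compactness[OF _ P0'(1,2)])
   show "sm {..<length ty'}" by (simp add: sm_finite)
   show "set idx \<subseteq> {..<length ty'} \<and> set c \<subseteq> P0 \<and> defp L C (map ((!) ty') idx @ srt c) P"
    if "(idx, c, P) \<in> G1 \<union> G2" for idx c P
    using that
   proof
    assume "(idx, c, P) \<in> G1"
    then show ?thesis using mt P0(3) tuples_sorts[OF c] by (auto simp: G1_def)
   next
    assume "(idx, c, P) \<in> G2"
    then obtain sg B' where g: "idx = ?ix" "P = (\<lambda>w. \<not> (\<forall>x\<in>tup xi. B x (take (length ty') w) = B' x (drop (length ty') w)))"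
     "stab xi sg B'" "c \<in> tup sg" "set c \<subseteq> P0" unfolding G2_def by blast
    have "defp L C (ty' @ sg) P" unfolding g(2) by (intro defp_neg defp_all_iff B2 stab_def2[OF g(3)])
    then show ?thesis using g(1,5) mt tuples_sorts[OF g(4)] by auto
   qed
  qed (use no in blast)
  then obtain z where z: "\<forall>j\<in>{..<length ty'}. z j \<in> car (ty' ! j)" "\<forall>(idx, c, P)\<in>G1 \<union> G2. P (map z idx @ c)" by blast
  let ?z = "map z ?ix"
  have zt: "?z \<in> tup ty'" using map_tuples[of ?ix z "(!) ty'"] z(1) mt by simp
  have "tp L C e (set ?c) = tp L C ?z (set ?c)"
  proof (rule tp_eq_setI[OF e(1) zt c])
   fix Q assume "defp L C (ty' @ ?tyc) Q" "Q (e @ ?c)"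
   then have "(?ix, ?c, Q) \<in> G1" by (simp add: G1_def)
   then show "Q (?z @ ?c)" using z(2) by blast
  qed
  from hom_tuple[OF e(1) zt cU smc(1) this] obtain h where h: "aut h" "\<forall>x\<in>set ?c. h x = x" "map h e = ?z" by blast
  obtain sg B' e' where B': "stab xi sg B'" "e' \<in> tup sg" "set e' \<subseteq> P0" "\<forall>x\<in>tup xi. B x (map h e) = B' x e'"
   using claim[OF h(1,2)] by blast
  have "(?ix, e', \<lambda>w. \<not> (\<forall>x\<in>tup xi. B x (take (length ty') w) = B' x (drop (length ty') w))) \<in> G1 \<union> G2"
   unfolding G2_def using B' h(1,2) by blast
  from bspec[OF z(2) this] have "\<not> (\<forall>x\<in>tup xi. B x (take (length ty') (?z @ e')) = B' x (drop (length ty') (?z @ e')))"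
   unfolding prod.case .
  then show False using B'(4) h(3) tuples_length[OF zt] by simp
 qed
 then obtain G0 where G0: "finite G0" "G0 \<subseteq> G1 \<union> G2"
  "\<not> (\<exists>z. (\<forall>j\<in>{..<length ty'}. z j \<in> car (ty' ! j)) \<and> (\<forall>(idx, c, P)\<in>G0. P (map z idx @ c)))" by blast
 \<comment> \<open>The part of the type of \<open>e\<close> over \<open>?c\<close> that already
   restricts \<open>B(x, z)\<close> to finitely many conjugates.\<close>
 define \<rho> where "\<rho> w \<longleftrightarrow> (\<forall>g\<in>G0 \<inter> G1. (snd (snd g)) w)" for w
 have \<rho>: "defp L C (ty' @ ?tyc) \<rho>" unfolding \<rho>_def
  by (rule defp_ball) (use G0(1) in \<open>auto simp: G1_def\<close>)
 have \<rho>e: "\<rho> (e @ ?c)" unfolding \<rho>_def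
 proof
  fix g assume "g \<in> G0 \<inter> G1"
  then have "g \<in> G1" by simp
  then show "(snd (snd g)) (e @ ?c)" unfolding G1_def by (elim CollectE exE conjE) simp
 qed
 have "\<forall>g\<in>G0 \<inter> G2. \<exists>h. aut h \<and> (\<forall>x\<in>set ?c. h x = x) \<and> (\<forall>z\<in>tup ty'. \<not> (snd (snd g)) (z @ fst (snd g)) --> (\<forall>x\<in>tup xi. B x z = B x (map h e)))"
  using G2h by blast
 from bchoice[OF this] obtain H where H: "\<forall>g\<in>G0 \<inter> G2. aut (H g) \<and> (\<forall>x\<in>set ?c. H g x = x) \<and>
  (\<forall>z\<in>tup ty'. \<not> (snd (snd g)) (z @ fst (snd g)) --> (\<forall>x\<in>tup xi. B x z = B x (map (H g) e)))" ..
 have \<rho>z: "\<exists>g\<in>G0 \<inter> G2. \<forall>x\<in>tup xi. B x z = B x (map (H g) e)" if z: "z \<in> tup ty'" "\<rho> (z @ ?c)" for z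
 proof -
  have mz: "map ((!) z) ?ix = z" using tuples_length[OF z(1)] by (metis map_nth)
  have "\<exists>g\<in>G0 \<inter> G2. \<not> (snd (snd g)) (z @ fst (snd g))"
  proof (rule ccontr)
   assume no: "\<not> ?thesis"
   have "P (map ((!) z) idx @ c)" if g: "(idx, c, P) \<in> G0" for idx c P
   proof (cases "(idx, c, P) \<in> G1")
    case True
    then have "idx = ?ix" "c = ?c" by (auto simp: G1_def)
    moreover have "P (z @ ?c)" using z(2) g True unfolding \<rho>_def by force
    ultimately show ?thesis using mz by simp
   next
    case False
    then have g2: "(idx, c, P) \<in> G0 \<inter> G2" using g G0(2) by blast
    then have "idx = ?ix" by (auto simp: G2_def)
    moreover have "P (z @ c)" using no g2 by force
    ultimately show ?thesis using mz by simp
   qed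
   moreover have "\<forall>j\<in>{..<length ty'}. z ! j \<in> car (ty' ! j)" using tuples_nth[OF z(1)] by simp
   ultimately show False using G0(3) by blast
  qed
  then show ?thesis using H z(1) by blast
 qed
 obtain gs where gs: "set gs = G0 \<inter> G2" using finite_list[of "G0 \<inter> G2"] G0(1) by blast
 define es where "es = map (\<lambda>g. map (H g) e) gs"
 have est: "w \<in> tup ty'" if "w \<in> set es" for w
  using that gs H aut_tup[OF _ e(1)] by (auto simp: es_def)
 define M where "M = length es"
 let ?\<zeta> = "concat (replicate M ty')"
 define Z0 where "Z0 x c' \<longleftrightarrow> (\<exists>z\<in>tup ty'. \<rho> (z @ c') \<and> B x z)" for x c'
 define R1 where "R1 x w \<longleftrightarrow> (\<exists>t\<in>{..<M}. B x (slice (length ty') t w))" for x w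
 \<comment> \<open>At \<open>?c\<close> the relation \<open>Z0\<close> is a finite union of
   conjugates of \<open>B(x, e)\<close>, but its stability at other parameters is not known. The
   second clause keeps only those where it coincides with a union of \<open>M\<close> instances of
   \<open>B\<close>, which makes \<open>stab_instances\<close> applicable.\<close>
 define Z where "Z x c' \<longleftrightarrow> Z0 x c' \<and> (\<exists>w\<in>tup ?\<zeta>. \<forall>x'\<in>tup xi. R1 x' w = Z0 x' c')" for x c'
 have sB: "stab xi ?\<zeta> (\<lambda>x w. B x (slice (length ty') t w))" if "t \<in> {..<M}" for t
  by (rule stab_coord[OF B coord_id coord_slice_replicate]) (use that in simp)
 have sR1: "stab xi ?\<zeta> R1" unfolding R1_def by (intro stab_bex finite_lessThan sB)
 have Z0d: "def2 L C xi ?tyc Z0"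
 proof (rule defp_def2)
  let ?n = "length ty'" and ?m = "length xi"
  have c1: "coord (ty' @ xi @ ?tyc) (ty' @ ?tyc) (\<lambda>w. take ?n w @ drop ?m (drop ?n w))"
   by (rule coord_append[OF coord_fst coord_comp[OF coord_snd coord_snd]])
  have "defp L C (ty' @ xi @ ?tyc) (\<lambda>w. \<rho> (take ?n w @ drop ?m (drop ?n w)) \<and> B (take ?m (drop ?n w)) (take ?n w))"
   by (rule defp_conj[OF defp_coord[OF \<rho> c1] def2_defp[OF B2 coord_comp[OF coord_snd coord_fst] coord_fst]])
  from defp_ex[OF this] show "defp L C (xi @ ?tyc) (\<lambda>a. Z0 (take ?m a) (drop ?m a))"
   by (rule defp_cong) (auto simp: Z0_def tuples_length)
 qed
 have Z2: "def2 L C xi ?tyc Z"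
 proof -
  have "defp L C (?\<zeta> @ ?tyc) (\<lambda>w. \<forall>x\<in>tup xi. R1 x (take (length ?\<zeta>) w) = Z0 x (drop (length ?\<zeta>) w))"
   by (rule defp_all_iff[OF stab_def2[OF sR1] Z0d])
  from defp_ex[OF this] have "defp L C ?tyc (\<lambda>c'. \<exists>w\<in>tup ?\<zeta>. \<forall>x\<in>tup xi. R1 x w = Z0 x c')"
   by (rule defp_cong) (auto simp: tuples_length)
  from def2_conj[OF Z0d def2_param[OF this]] show ?thesis unfolding Z_def .
 qed
 have sZ: "stab xi ?tyc Z"
  by (rule stab_instances[OF sR1 Z2]) (auto simp: Z_def)
 have Z0c: "Z0 x ?c \<longleftrightarrow> (\<exists>w\<in>set es. B x w)" if x: "x \<in> tup xi" for x
 proof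
  assume "Z0 x ?c"
  then obtain z where z: "z \<in> tup ty'" "\<rho> (z @ ?c)" "B x z" unfolding Z0_def by blast
  from \<rho>z[OF z(1,2)] obtain g where "g \<in> G0 \<inter> G2" "B x (map (H g) e)" using x z(3) by blast
  then show "\<exists>w\<in>set es. B x w" using gs by (auto simp: es_def)
 next
  assume "\<exists>w\<in>set es. B x w"
  then obtain g where g: "g \<in> G0 \<inter> G2" "B x (map (H g) e)" using gs by (auto simp: es_def)
  then have Hg: "aut (H g)" "\<forall>x\<in>set ?c. H g x = x" using H by blast+
  have "\<rho> (map (H g) (e @ ?c)) = \<rho> (e @ ?c)" by (rule aut_defp[OF Hg(1) \<rho>]) (use e c in simp)
  then have "\<rho> (map (H g) e @ ?c)" using \<rho>e aut_fix_map[OF Hg(2) subset_refl] by simp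
  then show "Z0 x ?c" unfolding Z0_def using g(2) aut_tup[OF Hg(1) e(1)] by blast
 qed
 have R1es: "R1 x (concat es) \<longleftrightarrow> (\<exists>w\<in>set es. B x w)" for x
  using ball_slice[where ws = es and Q = "\<lambda>w. \<not> B x w", OF est] unfolding R1_def M_def by auto
 have Zc: "Z x ?c \<longleftrightarrow> Z0 x ?c" if "x \<in> tup xi" for x
 proof -
  have "concat es \<in> tup ?\<zeta>" unfolding M_def by (rule tuples_concat_replicate[OF est])
  then show ?thesis unfolding Z_def using R1es Z0c by blast
 qed

 \<comment> \<open>Take a model \<open>g P1\<close> that contains \<open>D\<close> and is
   independent over \<open>D\<close> from \<open>P0\<close> and \<open>d1\<close>. A solution of
   \<open>B(x, e)\<close> in it would solve \<open>R(x, d1)\<close> or the difference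
   \<open>S\<close>. Both fork over \<open>D\<close>, the latter since it misses \<open>P0\<close>,
   so neither has a solution there.\<close>
 have fB: "fset D xi {x. B x e}"
 proof -
  from smod_ex[OF Dc DU] obtain P1 where P1: "smod P1" "D \<subseteq> P1" by blast
  note P1' = smodD[OF P1(1)]
  have E: "P0 \<union> set d1 \<subseteq> U" "sm (P0 \<union> set d1)" using P0' tuples_set[OF d1] by (auto intro: sm_Un sm_finite)
  obtain g where g: "aut g" "\<forall>x\<in>D. g x = x" "\<And>a. set a \<subseteq> P1 ==> indep L C (map g a) (P0 \<union> set d1) D"
   using nonfork_exists[OF DU sm_countable[OF Dc] P1'(1,2) E] by blast
  have gP: "smod (g ` P1)" using aut_elem_sub[OF g(1) P1'(3)] sm_image[OF P1'(2)] by (simp add: smod_def)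
  have DgP: "D \<subseteq> g ` P1"
  proof
   fix x assume "x \<in> D" then show "x \<in> g ` P1" using g(2) P1(2) by (metis image_eqI subsetD)
  qed
  define S where "S x w \<longleftrightarrow> B x (drop (length ty) w) \<and> \<not> R x (take (length ty) w)" for x w
  have sS: "stab xi (ty @ ty') S" unfolding S_def
   by (intro stab_conj stab_neg stab_coord[OF R coord_id coord_fst] stab_coord[OF B coord_id coord_snd])
  have Sx: "S x (d1 @ e) \<longleftrightarrow> B x e \<and> \<not> R x d1" for x unfolding S_def using tuples_length[OF d1] by simp
  have d1e: "d1 @ e \<in> tup (ty @ ty')" using d1 e by simp
  have fS: "fset D xi {x. S x (d1 @ e)}"
   by (rule misses_fset[OF sS P0(1) _ d1e]) (use D P0(3) Be in \<open>auto simp: misses_def Sx\<close>)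
  have "tp L C d D = tp L C d1 D" by (rule tp_eq_mono[OF tp1[symmetric] d d1 D cU])
  then have fR: "fset D xi {x. R x d1}" by (rule stab_fset_tp[OF R d d1 Dc DU _ f])
  have "misses (g ` P1) xi B e"
   unfolding misses_def
  proof (intro ballI impI notI)
   fix p assume p: "p \<in> tup xi" "set p \<subseteq> g ` P1" "B p e"
   then have "p \<in> map g ` lists P1" using lists_image[of g P1] by auto
   then obtain a where a: "p = map g a" "set a \<subseteq> P1" by auto
   have ip: "indep L C p (P0 \<union> set d1) D" using g(3)[OF a(2)] a(1) by simp
   show False
   proof (cases "R p d1")
    case True
    have "\<not> fset D xi {x. R x d1}" by (rule indepD[OF ip p(1) DU E(1) d1 _ stab_def2[OF R] True]) auto
    then show False using fR by simp
   next
    case False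
    then have "S p (d1 @ e)" using Sx p(3) by simp
    then have "\<not> fset D xi {x. S x (d1 @ e)}"
     by (rule indepD[OF ip p(1) DU E(1) d1e _ stab_def2[OF sS], rotated]) (use e in auto)
    then show False using fS by simp
   qed
  qed
  then show ?thesis by (rule misses_fset[OF B gP DgP e(1)])
 qed
 have "fset D xi (\<Union>g\<in>G0 \<inter> G2. {x. B x (map (H g) e)})"
 proof (rule fset_UN)
  show "finite (G0 \<inter> G2)" using G0(1) by simp
  fix g assume "g \<in> G0 \<inter> G2"
  then have "aut (H g)" "\<forall>x\<in>D. H g x = x" using H D by blast+
  then show "fset D xi {x. B x (map (H g) e)}" by (rule stab_fset_aut[OF B e(1) Dc DU _ _ fB])
 qed
 then have 1: "fset D xi {x. Z x ?c}"
  by (rule fset_mono) (use Zc Z0c gs in \<open>auto simp: es_def\<close>)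
 \<comment> \<open>On \<open>P0\<close> the relation \<open>R(x, d1)\<close> agrees with
   \<open>B(x, e)\<close> and so implies \<open>Z\<close>; the difference misses \<open>P0\<close>,
   and its forking over \<open>?c\<close> transfers from \<open>d1\<close> to
   \<open>d\<close>.\<close>
 have 2: "fset (set ?c) xi {x. R x d \<and> \<not> Z x ?c}"
 proof -
  have sS: "stab xi ty (\<lambda>x w. R x w \<and> \<not> Z x (take k w))"
   by (intro stab_conj R stab_neg stab_coord[OF sZ coord_id coord_take])
  have "misses P0 xi (\<lambda>x w. R x w \<and> \<not> Z x (take k w)) d1"
   unfolding misses_def d1c
  proof (intro ballI impI notI)
   fix x assume x: "x \<in> tup xi" "set x \<subseteq> P0" "R x d1 \<and> \<not> Z x ?c"
   then have "B x e" using Be by blast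
   then have "Z0 x ?c" unfolding Z0_def using e(1) \<rho>e by blast
   then show False using x Zc by blast
  qed
  from misses_fset[OF sS P0(1,3) d1 this] have "fset (set ?c) xi {x. R x d1 \<and> \<not> Z x (take k d1)}" .
  from stab_fset_tp[OF sS d1 d _ cU tp1 this] show ?thesis by (simp add: countable_finite)
 qed
 from sZ 1 2 show ?thesis by blast
qed

end

section \<open>Pairs\<close>

instance trm :: (countable) countable by countable_datatype
instance fm :: (countable, countable, countable) countable by countable_datatype

lemma countable_sorts:
 fixes L :: "('s, 'f, 'r) lang"
 assumes "countable (formulas L)" shows "countable (UNIV :: 's set)"
proof -
 have "range (\<lambda>s. Ex s Fls) \<subseteq> formulas L"
  unfolding formulas_def by (metis (mono_tags, lifting) image_subsetI mem_Collect_eq wff.simps(1) wff.simps(6))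
 then have "countable (range (\<lambda>s::'s. Ex s (Fls :: ('s, 'f, 'r) fm)))" using assms countable_subset by blast
 moreover have "inj (\<lambda>s::'s. Ex s (Fls :: ('s, 'f, 'r) fm))" by (auto simp: inj_def)
 ultimately show ?thesis using countable_image_inj_on by blast
qed

lemma has_sort_vars: "list_all2 (has_sort L sg) (map Var [0..<length sg]) sg"
 unfolding list_all2_conv_all_nth by (auto intro: has_sort.intros)

lemma countable_symbols:
 fixes L :: "('s, 'f, 'r) lang"
 assumes ct: "countable (formulas L)" shows "countable (Funs L)" "countable (Rels L)"
proof -
 let ?g = "\<lambda>f. Eq (App f (map Var [0..<length (Fdom L f)])) (App f (map Var [0..<length (Fdom L f)])) :: ('s, 'f, 'r) fm"
 have "?g f \<in> formulas L" if "f \<in> Funs L" for f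
 proof -
  have h: "has_sort L (Fdom L f) (App f (map Var [0..<length (Fdom L f)])) (Fcod L f)"
   by (rule has_sort.intros(2)[OF that has_sort_vars])
  have "wff L (Fdom L f) (?g f)" unfolding wff.simps by (rule exI, rule conjI[OF h h])
  have "\<exists>sg. wff L sg (?g f)" by (rule exI[where x="Fdom L f"]) fact
  then show ?thesis by (simp only: formulas_def mem_Collect_eq)
 qed
 then have "?g ` Funs L \<subseteq> formulas L" by (intro image_subsetI)
 then have "countable (?g ` Funs L)" by (rule countable_subset[OF _ ct])
 moreover have "inj_on ?g (Funs L)" by (auto simp: inj_on_def)
 ultimately show "countable (Funs L)" by (rule countable_image_inj_on)
 let ?h = "\<lambda>q. Rel q (map Var [0..<length (Rdom L q)]) :: ('s, 'f, 'r) fm"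
 have "?h q \<in> formulas L" if "q \<in> Rels L" for q
 proof -
  have "wff L (Rdom L q) (?h q)" unfolding wff.simps by (rule conjI[OF that has_sort_vars])
  have "\<exists>sg. wff L sg (?h q)" by (rule exI[where x="Rdom L q"]) fact
  then show ?thesis by (simp only: formulas_def mem_Collect_eq)
 qed
 then have "?h ` Rels L \<subseteq> formulas L" by (intro image_subsetI)
 then have "countable (?h ` Rels L)" by (rule countable_subset[OF _ ct])
 moreover have "inj_on ?h (Rels L)" by (auto simp: inj_on_def)
 ultimately show "countable (Rels L)" by (rule countable_image_inj_on)
qed

lemma has_sort_syms: "has_sort L sg t s ==> set_trm t \<subseteq> Funs L"
proof (induction rule: has_sort.induct)
 case (2 f ts)
 then show ?case by (fastforce simp: list_all2_conv_all_nth in_set_conv_nth)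
qed auto

lemma wff_syms: "wff L sg phi ==> set2_fm phi \<subseteq> Funs L \<and> set3_fm phi \<subseteq> Rels L"
proof (induction phi arbitrary: sg)
 case (Eq t u) 
 then obtain s where "has_sort L sg t s" "has_sort L sg u s" by auto
 from has_sort_syms[OF this(1)] has_sort_syms[OF this(2)] show ?case by simp
next
 case (Rel q ts)
 then have "set_trm t \<subseteq> Funs L" if "t \<in> set ts" for t
  using that has_sort_syms by (fastforce simp: list_all2_conv_all_nth in_set_conv_nth)
 then show ?case using Rel by auto
next
 case (Conj phi psi)
 then have "wff L sg phi" "wff L sg psi" by simp_all
 from Conj.IH(1)[OF this(1)] Conj.IH(2)[OF this(2)] show ?case by simp
qed auto

text \<open>The types of the symbols may be uncountable, so the symbols that occur are first coded
  by natural numbers.\<close>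

lemma countable_formulasI:
 fixes L :: "('s, 'f, 'r) lang"
 assumes "countable (UNIV :: 's set)" "countable (Funs L)" "countable (Rels L)"
 shows "countable (formulas L)"
proof -
 let ?m = "map_fm (to_nat_on (UNIV :: 's set)) (to_nat_on (Funs L)) (to_nat_on (Rels L))"
 have "inj_on ?m (formulas L)"
 proof (rule inj_onI)
  fix phi psi assume "phi \<in> formulas L" "psi \<in> formulas L" and eq: "?m phi = ?m psi"
  then have s: "set2_fm phi \<subseteq> Funs L" "set3_fm phi \<subseteq> Rels L" "set2_fm psi \<subseteq> Funs L" "set3_fm psi \<subseteq> Rels L"
   unfolding formulas_def using wff_syms by blast+
  show "phi = psi"
  proof (rule fm.inj_map_strong[OF _ _ _ eq])
   show "z = za" if "to_nat_on UNIV z = to_nat_on UNIV za" for z za :: 's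
    using that assms(1) by simp
   show "z = za" if "z \<in> set2_fm phi" "za \<in> set2_fm psi" "to_nat_on (Funs L) z = to_nat_on (Funs L) za" for z za
    using that s assms(2) by (meson in_mono to_nat_on_inj)
   show "z = za" if "z \<in> set3_fm phi" "za \<in> set3_fm psi" "to_nat_on (Rels L) z = to_nat_on (Rels L) za" for z za
    using that s assms(3) by (meson in_mono to_nat_on_inj)
  qed
 qed
 moreover have "countable (?m ` formulas L)" by simp
 ultimately show ?thesis using countable_image_inj_on by blast
qed

lemma countable_pair_lang:
 fixes L :: "('s, 'f, 'r) lang"
 assumes "countable (formulas L)" shows "countable (formulas (pair_lang L))"
 by (rule countable_formulasI)
  (use countable_sorts[OF assms] countable_symbols[OF assms] in \<open>auto simp: pair_lang_def\<close>)

lemma has_sort_pair: "has_sort (pair_lang L) sg t s \<longleftrightarrow> has_sort L sg t s"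
proof
 assume "has_sort (pair_lang L) sg t s" then show "has_sort L sg t s"
 proof (induction rule: has_sort.induct)
  case (2 f ts)
  have "list_all2 (has_sort L sg) ts (Fdom L f)" "f \<in> Funs L"
   using 2 by (auto simp: list_all2_conv_all_nth pair_lang_def)
  from has_sort.intros(2)[OF this(2,1)] show ?case by (simp add: pair_lang_def)
 qed (rule has_sort.intros)
next
 assume "has_sort L sg t s" then show "has_sort (pair_lang L) sg t s"
 proof (induction rule: has_sort.induct)
  case (2 f ts)
  have "list_all2 (has_sort (pair_lang L) sg) ts (Fdom (pair_lang L) f)" "f \<in> Funs (pair_lang L)"
   using 2 by (auto simp: list_all2_conv_all_nth pair_lang_def)
  from has_sort.intros(2)[OF this(2,1)] show ?case by (simp add: pair_lang_def)
 qed (rule has_sort.intros)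
qed

definition liftf :: "('s, 'f, 'r) fm => ('s, 'f, 'r + 's) fm" where
 "liftf = map_fm id id Inl"

lemma liftf_simps [simp]:
 "liftf Fls = Fls" "liftf (Eq t u) = Eq t u" "liftf (Rel q ts) = Rel (Inl q) ts"
 "liftf (Neg phi) = Neg (liftf phi)" "liftf (Conj phi psi) = Conj (liftf phi) (liftf psi)" "liftf (Ex s phi) = Ex s (liftf phi)"
 by (simp_all add: liftf_def trm.map_id0)

lemma wff_liftf: "wff (pair_lang L) sg (liftf phi) \<longleftrightarrow> wff L sg phi"
proof (induction phi arbitrary: sg)
 case (Rel q ts)
 have "has_sort (pair_lang L) sg = has_sort L sg" by (intro ext) (rule has_sort_pair)
 then show ?case by (auto simp: pair_lang_def)
qed (auto simp: has_sort_pair)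

lemma teval_pair: "teval (pair_struct C M P) e t = teval C e t"
 by (induction t) (auto simp: pair_struct_def cong: map_cong)

lemma carrier_pair: "carrier_of (pair_struct C M P) s = {x \<in> M. Sort C x = s}"
 by (simp add: carrier_of_def pair_struct_def)

lemma tuples_pair: "tuples (pair_struct C M P) sg = {a. set a \<subseteq> M \<and> map (Sort C) a = sg}"
 by (simp add: tuples_def pair_struct_def)

lemma restrict_pair: "restrict_struct (pair_struct C M P) N = pair_struct C N P"
 by (simp add: restrict_struct_def pair_struct_def)

lemma Sort_pair [simp]: "Sort (pair_struct C M P) = Sort C" "Univ (pair_struct C M P) = M"
 by (simp_all add: pair_struct_def)

lemma sat_liftf: "sat (pair_struct C M P) e (liftf phi) = sat (restrict_struct C M) e phi"
proof (induction phi arbitrary: e)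
 case (Rel q ts)
 then show ?case by (simp add: teval_pair teval_restrict cong: map_cong)
  (simp add: pair_struct_def restrict_struct_def)
qed (auto simp: teval_pair teval_restrict carrier_pair carrier_restrict)

lemma sat_pred: "sat (pair_struct C M P) e (Rel (Inr s) [t]) \<longleftrightarrow> teval C e t \<in> P \<and> Sort C (teval C e t) = s"
 by (auto simp: teval_pair pair_struct_def teval_pair[unfolded pair_struct_def])

lemma elem_sub_trans:
 assumes N: "elem_sub L M N" and A: "elem_sub L (restrict_struct M N) A" shows "elem_sub L M A"
proof -
 have sub: "A \<subseteq> N" "N \<subseteq> Univ M" using N A by (auto simp: elem_sub_def restrict_struct_def)
 show ?thesis unfolding elem_sub_def
 proof (intro conjI allI impI)
  show "A \<subseteq> Univ M" using sub by auto
  show "is_struct L (restrict_struct M A)" using A by (simp add: elem_sub_def restrict_restrict)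
  fix sg phi e assume a: "wff L sg phi \<and> e \<in> tuples (restrict_struct M A) sg"
  have 1: "sat (restrict_struct M A) e phi = sat (restrict_struct M N) e phi"
   using A a unfolding elem_sub_def restrict_restrict by blast
  have "e \<in> tuples (restrict_struct M N) sg" using a sub by (auto simp: tuples_restrict)
  then have "sat (restrict_struct M N) e phi = sat M e phi" using N a unfolding elem_sub_def by blast
  with 1 show "sat (restrict_struct M A) e phi = sat M e phi" by simp
 qed
qed

lemma elem_sub_between:
 assumes N: "elem_sub L M N" and A: "elem_sub L M A" "A \<subseteq> N" shows "elem_sub L (restrict_struct M N) A"
 unfolding elem_sub_def restrict_restrict
proof (intro conjI allI impI)
 show "A \<subseteq> Univ (restrict_struct M N)" using A(2) by (simp add: restrict_struct_def)
 show "is_struct L (restrict_struct M A)" using A(1) by (simp add: elem_sub_def)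
 fix sg phi e assume a: "wff L sg phi \<and> e \<in> tuples (restrict_struct M A) sg"
 then have "sat (restrict_struct M A) e phi = sat M e phi" using A(1) unfolding elem_sub_def by blast
 moreover have "e \<in> tuples (restrict_struct M N) sg" using a A(2) by (auto simp: tuples_restrict)
 then have "sat (restrict_struct M N) e phi = sat M e phi" using N a unfolding elem_sub_def by blast
 ultimately show "sat (restrict_struct M A) e phi = sat (restrict_struct M N) e phi" by simp
qed

context monster_model begin

abbreviation "pl \<equiv> pair_lang L"
abbreviation "ps \<equiv> pair_struct C"

lemma sat_liftf_U: "sat (ps U P) e (liftf phi) = sat C e phi"
 by (simp add: sat_liftf restrict_Univ)

lemma pair_is_struct: "is_struct pl (ps U P)"
 using struct unfolding is_struct_def carrier_pair tuples_pair
 by (auto simp: pair_lang_def pair_struct_def carrier_of_def tuples_def)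

lemma defp_liftf: "defp L C sg P ==> defp pl (ps U Q) sg P"
 unfolding defp_def tuples_pair
 by (metis (no_types, lifting) mem_Collect_eq sat_liftf_U tuples_def wff_liftf)

lemma tuples_pair_U: "tuples (ps U Q) sg = tup sg"
 by (simp add: tuples_pair tuples_def)

lemma defp_pred: "i < length sg ==> defp pl (ps U Q) sg (\<lambda>a. a ! i \<in> Q)"
proof -
 assume i: "i < length sg"
 have "has_sort pl sg (Var i) (sg ! i)" using i by (intro has_sort.intros)
 then have w: "wff pl sg (Rel (Inr (sg ! i)) [Var i])" by (simp add: pair_lang_def)
 show ?thesis
 proof (rule defp_cong[OF defp_wff[OF w]])
  fix a assume "a \<in> tuples (ps U Q) sg"
  then have "Sort C (a ! i) = sg ! i" using i unfolding tuples_pair by auto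
  then show "sat (ps U Q) a (Rel (Inr (sg ! i)) [Var i]) = (a ! i \<in> Q)" unfolding sat_pred by simp
 qed
qed

text \<open>The Tarski-Vaught test in the pair language covers the formulas of \<open>L\<close> and
  also their solutions inside the predicate; the latter give \<open>Q \<inter> N\<close>.\<close>

lemma pair_elem_sub:
 assumes N: "elem_sub pl (ps U Q) N" and Q: "elem_sub L C Q"
 shows "elem_sub L C N" "elem_sub L C (Q \<inter> N)"
proof -
 have NU: "N \<subseteq> U" using elem_sub_sub[OF N] by simp
 show "elem_sub L C N"
 proof (rule Tarski_Vaught[OF NU _ struct])
  fix sg s phi e x assume a: "wff L (s # sg) phi" "e \<in> tup sg" "set e \<subseteq> N" "x \<in> car s" "sat C (x # e) phi"
  have "defp pl (ps U Q) (s # sg) (\<lambda>w. sat C w phi)" by (rule defp_liftf[OF defp_wff[OF a(1)]])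
  from elem_sub_ex[OF N this _ a(3), of x] a show "\<exists>x\<in>N. x \<in> car s \<and> sat C (x # e) phi"
   by (auto simp: tuples_pair_U carrier_pair carrier_of_def)
 qed
 show "elem_sub L C (Q \<inter> N)"
 proof (rule Tarski_Vaught[OF _ _ struct])
  show "Q \<inter> N \<subseteq> U" using NU by auto
  fix sg s phi e x assume a: "wff L (s # sg) phi" "e \<in> tup sg" "set e \<subseteq> Q \<inter> N" "x \<in> car s" "sat C (x # e) phi"
  obtain y where y: "y \<in> Q" "y \<in> car s" "sat C (y # e) phi"
   using elem_sub_ex[OF Q defp_wff[OF a(1)] a(2) _ a(4,5)] a(3) by auto
  have "defp pl (ps U Q) (s # sg) (\<lambda>w. sat C w phi \<and> w ! 0 \<in> Q)"
   by (intro defp_conj defp_liftf[OF defp_wff[OF a(1)]] defp_pred) simp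
  from elem_sub_ex[OF N this _ _, of e y] a y show "\<exists>x\<in>Q \<inter> N. x \<in> car s \<and> sat C (x # e) phi"
   by (auto simp: tuples_pair_U carrier_pair carrier_of_def)
 qed
qed

subsection \<open>Ultraproducts of countable pairs inside the monster model\<close>

text \<open>Names for the elements of the ultraproduct. A constant sort along the sequence lets
  \<open>vs\<close> read it off at index \<open>0\<close>.\<close>

definition sections :: "(nat => 'a set) => (nat => 'a) set" where
 "sections N = {j. (\<forall>k. j k \<in> N k) \<and> (\<exists>s. \<forall>k. Sort C (j k) = s)}"

definition vs :: "(nat => 'a) => 's" where "vs j = Sort C (j 0)"

lemma sections_vs: "j \<in> sections N ==> (\<And>k. N k \<subseteq> U) ==> j k \<in> car (vs j)"
 unfolding sections_def vs_def carrier_of_def by (auto simp: subset_iff)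

lemma sm_sections:
 assumes "\<And>k. countable (N k)" shows "sm (sections N)"
proof -
 define W where "W = (\<Union>k. N k)"
 have W: "countable W" unfolding W_def using assms by auto
 define g where "g j = (\<lambda>k :: nat. to_nat_on W (j k))" for j
 have "inj_on g (sections N)"
 proof (rule inj_onI, rule ext)
  fix i j k assume "i \<in> sections N" "j \<in> sections N" "g i = g j"
  then have "to_nat_on W (i k) = to_nat_on W (j k)" "i k \<in> W" "j k \<in> W"
   by (auto simp: g_def W_def sections_def dest: fun_cong)
  then show "i k = j k" using W by simp
 qed
 then have "|sections N| \<le>o |UNIV :: (nat => nat) set|" using card_of_ordLeq by blast
 then show ?thesis using sm_ordLeq sm_nat_fun by blast
qed

end

text \<open>The map \<open>el\<close> induces an embedding of the ultraproduct of the
  \<open>N k\<close>, as an \<open>L\<close>-structure, into the monster model, with image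
  \<open>M\<close>; \<open>Q\<close> consists of the limits of sections that lie in
  \<open>P k\<close> for almost all \<open>k\<close>. Thus the ultraproduct of the pairs becomes a
  pair of elementary submodels of \<open>C\<close>.\<close>

locale ultraproduct = monster_model L C \<kappa>
 for L :: "('s, 'f, 'r) lang" and C :: "('s, 'f, 'r, 'a) struct" and \<kappa> :: "'k rel" +
 fixes F :: "nat filter" and N P :: "nat => 'a set" and el :: "(nat => 'a) => 'a"
 assumes F: "ultra F" "F \<le> sequentially"
  and N: "\<And>k. elem_sub L C (N k)" and PN: "\<And>k. elem_sub L C (P k \<inter> N k)"
  and el: "lcor F (sections N) vs (\<lambda>j k. j k) el"
begin

abbreviation "J \<equiv> sections N"
definition "M = el ` J"
definition "Q = el ` {j \<in> J. eventually (\<lambda>k. j k \<in> P k) F}"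

lemma NU: "N k \<subseteq> U"
 by (rule elem_sub_sub[OF N])

lemma el_car: "j \<in> J ==> el j \<in> car (vs j)"
 using el by (simp add: lcor_def)

lemma elD: "set idx \<subseteq> J ==> defp L C (map vs idx) X ==> X (map el idx) \<longleftrightarrow> eventually (\<lambda>k. X (map (\<lambda>j. j k) idx)) F"
 by (rule lcorD[OF F(1) el]) (auto intro!: sections_vs NU[THEN subsetD])

lemma M_list: "set a \<subseteq> M ==> \<exists>idx. set idx \<subseteq> J \<and> a = map el idx"
proof (induction a)
 case (Cons x a)
 then obtain idx j where "set idx \<subseteq> J" "a = map el idx" "j \<in> J" "x = el j" by (auto simp: M_def)
 then show ?case by (intro exI[of _ "j # idx"]) auto
qed auto

lemma idx_tup: "set idx \<subseteq> J ==> map (\<lambda>j. j k) idx \<in> tup (map vs idx)" "set idx \<subseteq> J ==> map el idx \<in> tup (map vs idx)"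
 by (rule map_tuples, rule sections_vs, use NU in \<open>auto dest: subsetD\<close>)
  (rule map_tuples, rule el_car, auto)

lemma el_eq: "i \<in> J ==> j \<in> J ==> el i = el j ==> eventually (\<lambda>k. i k = j k) F"
proof -
 assume a: "i \<in> J" "j \<in> J" "el i = el j"
 then have v: "vs i = vs j" using el_car[of i] el_car[of j] by (auto simp: carrier_of_def)
 have "defp L C (map vs [i, j]) (\<lambda>a. a ! 0 = a ! 1)" by (rule defp_eq) (use v in auto)
 from elD[OF _ this] a show ?thesis by simp
qed

lemma choose_section:
 assumes "eventually (\<lambda>k. \<exists>x\<in>N k. Sort C x = s \<and> X k x) F"
 shows "\<exists>j\<in>J. vs j = s \<and> eventually (\<lambda>k. X k (j k)) F"
proof -
 have "\<exists>x. x \<in> N k \<and> Sort C x = s \<and> ((\<exists>x\<in>N k. Sort C x = s \<and> X k x) --> X k x)" for k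
 proof (cases "\<exists>x\<in>N k. Sort C x = s \<and> X k x")
  case False
  have "carrier_of (restrict_struct C (N k)) s \<noteq> {}" using N[of k] unfolding elem_sub_def is_struct_def by blast
  then show ?thesis using False by (auto simp: carrier_restrict)
 qed auto
 then have "\<forall>k. \<exists>x. x \<in> N k \<and> Sort C x = s \<and> ((\<exists>x\<in>N k. Sort C x = s \<and> X k x) --> X k x)" by blast
 from choice[OF this] obtain j where j: "\<forall>k. j k \<in> N k \<and> Sort C (j k) = s \<and> ((\<exists>x\<in>N k. Sort C x = s \<and> X k x) --> X k (j k))" ..
 have "j \<in> J" "vs j = s" using j by (auto simp: sections_def vs_def)
 moreover have "eventually (\<lambda>k. X k (j k)) F" using assms by eventually_elim (use j in blast)
 ultimately show ?thesis by blast
qed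

text \<open>For equations and relations of \<open>L\<close> this is the choice of \<open>el\<close>.
  The predicate is the new atom: the values of its argument form a section, whose image under
  \<open>el\<close> is the value of the term in the limit.\<close>

lemma Los:
 "wff pl (map vs idx) phi ==> set idx \<subseteq> J ==>
  sat (ps M Q) (map el idx) phi \<longleftrightarrow> eventually (\<lambda>k. sat (ps (N k) (P k)) (map (\<lambda>j. j k) idx) phi) F"
proof (induction phi arbitrary: idx)
 case Fls then show ?case using ultra_const[OF F(1), of False] by simp
next
 case (Eq t u)
 then have w: "wff L (map vs idx) (Eq t u)" by (simp add: has_sort_pair)
 from elD[OF Eq.prems(2) defp_wff[OF w]] show ?case by (simp add: teval_pair)
next
 case (Rel q ts)
 have hs: "has_sort pl sg = has_sort L sg" for sg by (intro ext) (rule has_sort_pair)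
 show ?case
 proof (cases q)
  case (Inl r)
  then have w: "wff L (map vs idx) (Rel r ts)" using Rel.prems(1) hs by (simp add: pair_lang_def) blast
  have "sat (ps A B) e (Rel q ts) = sat C e (Rel r ts)" for A B e
   by (simp add: teval_pair Inl cong: map_cong) (simp add: pair_struct_def)
  then show ?thesis using elD[OF Rel.prems(2) defp_wff[OF w]] by simp
 next
  case (Inr s)
  then obtain t where t: "ts = [t]" "has_sort L (map vs idx) t s"
   using Rel.prems(1) hs[unfolded pair_lang_def] by (auto simp: pair_lang_def list_all2_Cons2)
  let ?j = "\<lambda>k. teval C (map (\<lambda>j. j k) idx) t"
  have jN: "?j k \<in> N k" for k
  proof -
   have N': "set (map (\<lambda>j. j k) idx) \<subseteq> N k" using Rel.prems(2) by (auto simp: sections_def)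
   have w: "wff L (s # map vs idx) (Eq (Var 0) (rent Suc t))"
    using has_sort.intros(1)[of 0 "s # map vs idx" L] has_sort_rent[OF t(2), of Suc "s # map vs idx"]
    by (auto simp: ren_ok_def)
   have ev: "sat C (x # map (\<lambda>j. j k) idx) (Eq (Var 0) (rent Suc t)) \<longleftrightarrow> x = ?j k" for x
    using teval_rent[OF t(2), of "x # map (\<lambda>j. j k) idx" Suc "map (\<lambda>j. j k) idx" C] by simp
   from elem_sub_ex[OF N defp_wff[OF w] idx_tup(1)[OF Rel.prems(2)] N' teval_car[OF t(2) idx_tup(1)[OF Rel.prems(2)]]] ev
   show ?thesis by auto
  qed
  have js: "Sort C (?j k) = s" for k using teval_car[OF t(2) idx_tup(1)[OF Rel.prems(2)]] by (simp add: carrier_of_def)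
  have jJ: "?j \<in> J" "vs ?j = s" using jN js by (auto simp: sections_def vs_def)
  have ej: "el ?j = teval C (map el idx) t"
  proof -
   have w: "wff L (s # map vs idx) (Eq (Var 0) (rent Suc t))"
    using has_sort.intros(1)[of 0 "s # map vs idx" L] has_sort_rent[OF t(2), of Suc "s # map vs idx"]
    by (auto simp: ren_ok_def)
   have ev: "sat C (x # map g idx) (Eq (Var 0) (rent Suc t)) \<longleftrightarrow> x = teval C (map g idx) t" for x g
    using teval_rent[OF t(2), of "x # map g idx" Suc "map g idx" C] by simp
   have "sat C (map el (?j # idx)) (Eq (Var 0) (rent Suc t)) \<longleftrightarrow>
    eventually (\<lambda>k. sat C (map (\<lambda>j. j k) (?j # idx)) (Eq (Var 0) (rent Suc t))) F"
    by (rule elD, use jJ Rel.prems(2) in simp) (use defp_wff[OF w] jJ(2) in \<open>simp only: list.map\<close>)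
   then show ?thesis using ev[of _ el] ev[of _ "\<lambda>j. j _"] by simp
  qed
  have "el ?j \<in> Q \<longleftrightarrow> eventually (\<lambda>k. ?j k \<in> P k) F"
  proof
   assume "el ?j \<in> Q"
   then obtain j where j: "j \<in> J" "eventually (\<lambda>k. j k \<in> P k) F" "el ?j = el j" by (auto simp: Q_def)
   from el_eq[OF jJ(1) j(1,3)] j(2) show "eventually (\<lambda>k. ?j k \<in> P k) F" by eventually_elim simp
  qed (use jJ in \<open>auto simp: Q_def\<close>)
  moreover have "Sort C (el ?j) = s" using el_car[OF jJ(1)] jJ(2) by (simp add: carrier_of_def)
  ultimately show ?thesis unfolding Inr t(1) sat_pred using js ej by simp
 qed
next
 case (Neg phi) then show ?case using ultra_not[OF F(1)] by simp
next
 case (Conj phi psi) then show ?case using ultra_conj[of _ _ F] by simp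
next
 case (Ex s phi)
 show ?case
 proof
  assume "sat (ps M Q) (map el idx) (Ex s phi)"
  then obtain x where "x \<in> M" "Sort C x = s" "sat (ps M Q) (x # map el idx) phi" by (auto simp: carrier_pair)
  then obtain j where j: "j \<in> J" "vs j = s" "sat (ps M Q) (map el (j # idx)) phi"
   using el_car by (auto simp: M_def carrier_of_def)
  have "eventually (\<lambda>k. sat (ps (N k) (P k)) (map (\<lambda>j. j k) (j # idx)) phi) F"
   using Ex.IH[of "j # idx"] Ex.prems j by simp
  then show "eventually (\<lambda>k. sat (ps (N k) (P k)) (map (\<lambda>j. j k) idx) (Ex s phi)) F"
  proof eventually_elim
   case (elim k)
   have "j k \<in> N k" "Sort C (j k) = s" using j by (auto simp: sections_def vs_def)
   then show ?case using elim by (auto simp: carrier_pair)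
  qed
 next
  assume "eventually (\<lambda>k. sat (ps (N k) (P k)) (map (\<lambda>j. j k) idx) (Ex s phi)) F"
  then have "eventually (\<lambda>k. \<exists>x\<in>N k. Sort C x = s \<and> sat (ps (N k) (P k)) (x # map (\<lambda>j. j k) idx) phi) F"
   by eventually_elim (auto simp: carrier_pair)
  from choose_section[OF this] obtain j where j: "j \<in> J" "vs j = s"
   "eventually (\<lambda>k. sat (ps (N k) (P k)) (map (\<lambda>j. j k) (j # idx)) phi) F" by auto
  then have "sat (ps M Q) (map el (j # idx)) phi" using Ex.IH[of "j # idx"] Ex.prems by simp
  moreover have "el j \<in> M" "Sort C (el j) = s" using j el_car by (auto simp: M_def carrier_of_def)
  ultimately show "sat (ps M Q) (map el idx) (Ex s phi)" by (auto simp: carrier_pair)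
 qed
qed

lemma limit_elem_sub:
 assumes S: "\<And>k. elem_sub L C (S k)" "\<And>k. S k \<subseteq> N k"
 shows "elem_sub L C (el ` {j \<in> J. eventually (\<lambda>k. j k \<in> S k) F})"
proof (rule Tarski_Vaught[OF _ _ struct])
 show "el ` {j \<in> J. eventually (\<lambda>k. j k \<in> S k) F} \<subseteq> U" using el_car by (auto simp: carrier_of_def)
 fix sg s phi e x assume a: "wff L (s # sg) phi" "e \<in> tup sg" "set e \<subseteq> el ` {j \<in> J. eventually (\<lambda>k. j k \<in> S k) F}"
  "x \<in> car s" "sat C (x # e) phi"
 from a(3) have "\<exists>idx. set idx \<subseteq> {j \<in> J. eventually (\<lambda>k. j k \<in> S k) F} \<and> e = map el idx"
 proof (induction e)
  case (Cons x a)
  then obtain idx j where "set idx \<subseteq> {j \<in> J. eventually (\<lambda>k. j k \<in> S k) F}" "a = map el idx"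
   "j \<in> {j \<in> J. eventually (\<lambda>k. j k \<in> S k) F}" "x = el j" by auto
  then show ?case by (intro exI[of _ "j # idx"]) auto
 qed auto
 then obtain idx where idx: "set idx \<subseteq> J" "\<forall>j\<in>set idx. eventually (\<lambda>k. j k \<in> S k) F" "e = map el idx" by auto
 have sg: "sg = map vs idx" using idx_tup(2)[OF idx(1)] a(2) idx(3) tuples_sorts by metis
 have w: "wff L (map vs idx) (Ex s phi)" using a(1) sg by simp
 have "sat C (map el idx) (Ex s phi)" using a idx(3) by auto
 then have ev: "eventually (\<lambda>k. sat C (map (\<lambda>j. j k) idx) (Ex s phi)) F"
  using elD[OF idx(1) defp_wff[OF w]] by simp
 have "eventually (\<lambda>k. \<forall>j\<in>set idx. j k \<in> S k) F" by (rule eventually_ball_finite) (use idx(2) in auto)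
 with ev have "eventually (\<lambda>k. \<exists>x\<in>N k. Sort C x = s \<and> (x \<in> S k \<and> sat C (x # map (\<lambda>j. j k) idx) phi)) F"
 proof eventually_elim
  case (elim k)
  then obtain x where x: "x \<in> car s" "sat C (x # map (\<lambda>j. j k) idx) phi" by auto
  have w2: "defp L C (s # map vs idx) (\<lambda>w. sat C w phi)" using a(1) sg by (auto intro: defp_wff)
  from elem_sub_ex[OF S(1) w2 idx_tup(1)[OF idx(1)] _ x, of k] elim(2) S(2)[of k]
  show ?case by (auto simp: carrier_of_def)
 qed
 from choose_section[OF this] obtain j where j: "j \<in> J" "vs j = s"
  "eventually (\<lambda>k. j k \<in> S k \<and> sat C (j k # map (\<lambda>j. j k) idx) phi) F" by blast
 have "eventually (\<lambda>k. sat C (map (\<lambda>j. j k) (j # idx)) phi) F" using j(3) by eventually_elim simp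
 moreover have "defp L C (map vs (j # idx)) (\<lambda>w. sat C w phi)" using a(1) sg j(2) by (auto intro: defp_wff)
 ultimately have "sat C (map el (j # idx)) phi" using elD[of "j # idx" "\<lambda>w. sat C w phi"] j(1) idx(1) by simp
 moreover have "eventually (\<lambda>k. j k \<in> S k) F" using j(3) by eventually_elim simp
 ultimately show "\<exists>x\<in>el ` {j \<in> J. eventually (\<lambda>k. j k \<in> S k) F}. x \<in> car s \<and> sat C (x # e) phi"
  using j(1,2) el_car[OF j(1)] idx(3) by auto
qed

lemma M_elem: "elem_sub L C M"
proof -
 have "M = el ` {j \<in> J. eventually (\<lambda>k. j k \<in> N k) F}" unfolding M_def by (auto simp: sections_def)
 then show ?thesis using limit_elem_sub[of N] N by simp
qed

lemma Q_elem: "elem_sub L C Q"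
proof -
 have "Q = el ` {j \<in> J. eventually (\<lambda>k. j k \<in> P k \<inter> N k) F}" unfolding Q_def by (auto simp: sections_def)
 then show ?thesis using limit_elem_sub[of "\<lambda>k. P k \<inter> N k"] PN by simp
qed

lemma is_pair_MQ: "is_pair L C M Q"
 unfolding is_pair_def using M_elem elem_sub_between[OF M_elem Q_elem] by (auto simp: M_def Q_def)

text \<open>The language is countable, so the demand concerns types over countable sets. These are
  realised in an ultraproduct over an ultrafilter that refines the cofinite filter.\<close>

lemma saturated_MQ: "saturated pl (ps M Q) (cardSuc (theory_card L))"
 unfolding saturated_def
proof (intro allI impI, elim conjE)
 fix A s \<Gamma>
 assume A: "A \<subseteq> Univ (ps M Q)" "|A| <o cardSuc (theory_card L)" and \<Gamma>: "\<Gamma> \<subseteq> formulas_over pl (ps M Q) [s] A"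
  and fin: "\<forall>Dl\<subseteq>\<Gamma>. finite Dl --> (\<exists>a\<in>carrier_of (ps M Q) s. \<forall>(phi, c)\<in>Dl. sat (ps M Q) (a # c) phi)"
 have "Card_order (theory_card L)" by (simp add: theory_card_def card_of_Card_order)
 then have "|A| \<le>o theory_card L" using A(2) cardSuc_ordLeq_ordLess[of "theory_card L" "|A|"]
  by (metis card_of_Card_order cardSuc_ordLess_ordLeq)
 then have cA: "countable A" by (rule theory_countable)
 have "\<Gamma> \<subseteq> formulas pl \<times> lists A" using \<Gamma> by (auto simp: formulas_over_def formulas_def)
 moreover have "countable (formulas pl \<times> lists A)" using countable_pair_lang[OF ctbl] cA by (intro countable_SIGMA) auto
 ultimately have c\<Gamma>: "countable \<Gamma>" using countable_subset by blast
 have rep: "\<exists>idx. set idx \<subseteq> J \<and> c = map el idx \<and> wff pl (s # map vs idx) phi" if "(phi, c) \<in> \<Gamma>" for phi c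
 proof -
  have c: "set c \<subseteq> M" "wff pl (s # map (Sort C) c) phi" using \<Gamma> that A(1) by (auto simp: formulas_over_def)
  obtain idx where idx: "set idx \<subseteq> J" "c = map el idx" using M_list[OF c(1)] by blast
  have "map (Sort C) c = map vs idx" using tuples_sorts[OF idx_tup(2)[OF idx(1)]] idx(2) by simp
  then show ?thesis using idx c(2) by metis
 qed
 define r where "r \<gamma> = (SOME idx. set idx \<subseteq> J \<and> snd \<gamma> = map el idx \<and> wff pl (s # map vs idx) (fst \<gamma>))" for \<gamma>
 have r: "set (r \<gamma>) \<subseteq> J \<and> snd \<gamma> = map el (r \<gamma>) \<and> wff pl (s # map vs (r \<gamma>)) (fst \<gamma>)" if "\<gamma> \<in> \<Gamma>" for \<gamma>
 proof -
  have "(fst \<gamma>, snd \<gamma>) \<in> \<Gamma>" using that by simp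
  from someI_ex[OF rep[OF this]] show ?thesis by (simp add: r_def)
 qed
 have los: "sat (ps M Q) (el j # snd \<gamma>) (fst \<gamma>) \<longleftrightarrow> eventually (\<lambda>k. sat (ps (N k) (P k)) (j k # map (\<lambda>j. j k) (r \<gamma>)) (fst \<gamma>)) F"
  if "\<gamma> \<in> \<Gamma>" "j \<in> J" "vs j = s" for \<gamma> j
  using Los[of "j # r \<gamma>" "fst \<gamma>"] r[OF that(1)] that(2,3) by simp
 show "\<exists>a\<in>carrier_of (ps M Q) s. \<forall>(phi, c)\<in>\<Gamma>. sat (ps M Q) (a # c) phi"
 proof (cases "\<Gamma> = {}")
  case True then show ?thesis using fin by blast
 next
  case False
  define \<gamma> where "\<gamma> = from_nat_into \<Gamma>"
  have \<gamma>: "\<gamma> i \<in> \<Gamma>" for i using from_nat_into[OF False] by (simp add: \<gamma>_def)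
  define X where "X n k \<longleftrightarrow> (\<exists>x\<in>N k. Sort C x = s \<and> (\<forall>i<n. sat (ps (N k) (P k)) (x # map (\<lambda>j. j k) (r (\<gamma> i))) (fst (\<gamma> i))))" for n k
  have evX: "eventually (X n) F" for n
  proof -
   have "\<gamma> ` {..<n} \<subseteq> \<Gamma>" "finite (\<gamma> ` {..<n})" using \<gamma> by auto
   then have "\<exists>a\<in>carrier_of (ps M Q) s. \<forall>(phi, c)\<in>\<gamma> ` {..<n}. sat (ps M Q) (a # c) phi"
    using fin by (simp only: simp_thms)
   then obtain a where a: "a \<in> M" "Sort C a = s" "\<forall>(phi, c)\<in>\<gamma> ` {..<n}. sat (ps M Q) (a # c) phi"
    by (auto simp: carrier_pair)
   then obtain j where j: "j \<in> J" "a = el j" by (auto simp: M_def)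
   then have vj: "vs j = s" using el_car[OF j(1)] a(2) by (simp add: carrier_of_def)
   have "sat (ps M Q) (el j # snd (\<gamma> i)) (fst (\<gamma> i))" if "i < n" for i
    using a(3) that j(2) by (auto simp: split_beta)
   then have "eventually (\<lambda>k. \<forall>i\<in>{..<n}. sat (ps (N k) (P k)) (j k # map (\<lambda>j. j k) (r (\<gamma> i))) (fst (\<gamma> i))) F"
    using los[OF \<gamma> j(1) vj] by (intro eventually_ball_finite) auto
   then show ?thesis
   proof eventually_elim
    case (elim k)
    have "j k \<in> N k" "Sort C (j k) = s" using j(1) vj by (auto simp: sections_def vs_def)
    then show ?case using elim unfolding X_def by blast
   qed
  qed
  \<comment> \<open>The diagonal: in factor \<open>k\<close> as many of the first formulas as
    possible are satisfied together, but at most \<open>k\<close> of them. Along \<open>F\<close>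
    this number exceeds every bound.\<close>
  define m where "m k = Max {n. n \<le> k \<and> (n = 0 \<or> X n k)}" for k
  have mk: "m k \<le> k \<and> (m k = 0 \<or> X (m k) k)" for k
  proof -
   have "0 \<in> {n. n \<le> k \<and> (n = 0 \<or> X n k)}" "finite {n. n \<le> k \<and> (n = 0 \<or> X n k)}" by auto
   from Max_in[OF this(2)] this(1) have "m k \<in> {n. n \<le> k \<and> (n = 0 \<or> X n k)}" unfolding m_def by blast
   then show ?thesis by blast
  qed
  have mge: "n \<le> m k" if "n \<le> k" "X n k" for n k
   unfolding m_def by (rule Max_ge) (use that in auto)
  define Y where "Y k x \<longleftrightarrow> (\<forall>i<m k. sat (ps (N k) (P k)) (x # map (\<lambda>j. j k) (r (\<gamma> i))) (fst (\<gamma> i)))" for k x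
  have "eventually (\<lambda>k. \<exists>x\<in>N k. Sort C x = s \<and> Y k x) F"
   using evX[of 0]
  proof eventually_elim
   case (elim k)
   then show ?case using mk[of k] unfolding X_def Y_def by auto
  qed
  from choose_section[OF this] obtain j where j: "j \<in> J" "vs j = s" "eventually (\<lambda>k. Y k (j k)) F" by blast
  have "sat (ps M Q) (el j # snd g) (fst g)" if g: "g \<in> \<Gamma>" for g
  proof -
   obtain i where i: "g = \<gamma> i" using from_nat_into_surj[OF c\<Gamma> g] by (auto simp: \<gamma>_def)
   have "eventually (\<lambda>k. Suc i \<le> k) F" using F(2) eventually_ge_at_top[of "Suc i"] by (auto simp: le_filter_def)
   with j(3) evX[of "Suc i"] have "eventually (\<lambda>k. sat (ps (N k) (P k)) (j k # map (\<lambda>j. j k) (r g)) (fst g)) F"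
   proof eventually_elim
    case (elim k)
    then have "Suc i \<le> m k" using mge by blast
    then show ?case using elim(1) unfolding Y_def i by simp
   qed
   then show ?thesis using los[OF g j(1,2)] by blast
  qed
  moreover have "el j \<in> carrier_of (ps M Q) s" using j el_car[OF j(1)] by (auto simp: carrier_pair M_def carrier_of_def)
  ultimately show ?thesis by (intro bexI[of _ "el j"]) auto
 qed
qed

end

section \<open>Realising types of tuples by the extension property\<close>

context monster_model begin

lemma has_sort_Var: "has_sort L sg (Var i) s \<longleftrightarrow> i < length sg \<and> s = sg ! i"
 by (auto intro: has_sort.intros elim: has_sort.cases)

text \<open>The formula \<open>Ex s (Eq (Var 0) (Var (Suc i)))\<close> is well-formed only if
  variable \<open>i\<close> has sort \<open>s\<close>, so a type records the sorts of its
  variables.\<close>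

lemma tp_sorts:
 assumes t: "tp L C a A = tp L C b A" and l: "length a = length b" and a: "set a \<subseteq> U"
 shows "srt a = srt b"
proof (rule nth_equalityI)
 fix i assume i: "i < length (srt a)"
 let ?phi = "Ex (Sort C (a ! i)) (Eq (Var 0) (Var (Suc i))) :: ('s, 'f, 'r) fm"
 have "wff L (srt a) ?phi" using i by (auto simp: has_sort_Var)
 moreover have "sat C a ?phi" using i a by (auto intro!: bexI[of _ "a ! i"] carrier_of_sort)
 ultimately have "(?phi, []) \<in> tp L C a A" by (simp add: tp_def formulas_over_def)
 then have "(?phi, []) \<in> tp L C b A" using t by simp
 then show "srt a ! i = srt b ! i" using i l by (auto simp: tp_def formulas_over_def has_sort_Var)
qed (simp add: l)

lemma kdiv_aut:
 assumes k: "kdiv k A xi ty R d" and R: "def2 L C xi ty R" and d: "d \<in> tup ty" and A: "A \<subseteq> U" and h: "aut h"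
 shows "kdiv k (h ` A) xi ty R (map h d)"
proof -
 obtain c :: "nat => 'a list" where c: "\<forall>i. c i \<in> tup ty \<and> tp L C (c i) A = tp L C d A"
  "\<forall>I. finite I \<and> card I = k --> \<not> (\<exists>a\<in>tup xi. \<forall>i\<in>I. R a (c i))" using k unfolding kdiv_def by (elim exE conjE)
 obtain g where g: "aut g" "\<And>x. x \<in> U ==> g (h x) = x" "\<And>x. x \<in> U ==> h (g x) = x" using aut_inv[OF h] by blast
 have t: "tp L C (map h (c i)) (h ` A) = tp L C (map h d) (h ` A)" for i
 proof (rule tp_eqI)
  show "map h (c i) \<in> tup ty" "map h d \<in> tup ty" using aut_tup[OF h] c(1) d by auto
  fix c' phi assume c': "set c' \<subseteq> h ` A" "wff L (ty @ srt c') phi"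
  have c0: "set (map g c') \<subseteq> A" "map h (map g c') = c'"
  proof -
   show "set (map g c') \<subseteq> A" using c'(1) g(2) A by auto (metis (no_types, lifting) imageE subsetD)
   show "map h (map g c') = c'"
    by (rule aut_inv_map[where g = h and h = g, OF g(3)]) (use c'(1) A aut_U[OF h] in auto)
  qed
  have s: "srt (map g c') = srt c'" using tuples_sorts[OF aut_tup[OF g(1) tuples_self]] c'(1) A aut_U[OF h] by blast
  have "sat C (map h u @ c') phi = sat C (u @ map g c') phi" if "u \<in> tup ty" for u
  proof -
   have "u @ map g c' \<in> tup (ty @ srt c')" using tuples_appendI[OF that tuples_self[of "map g c'" C]] c0(1) A unfolding s by (meson subset_trans)
   from aut_sat[OF h c'(2) this] show ?thesis by (simp only: map_append c0(2))
  qed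
  moreover have "sat C (c i @ map g c') phi = sat C (d @ map g c') phi"
   by (rule tp_eq_sort[OF _ _ d c0(1) _ A]) (use c(1) defp_wff[OF c'(2), of C] s in \<open>auto simp del: map_map\<close>)
  ultimately show "sat C (map h (c i) @ c') phi = sat C (map h d @ c') phi" using c(1) d by simp
 qed
 have n: "\<not> (\<exists>a\<in>tup xi. \<forall>i\<in>I. R a (map h (c i)))" if "finite I" "card I = k" for I
 proof
  assume "\<exists>a\<in>tup xi. \<forall>i\<in>I. R a (map h (c i))"
  then obtain a where a: "a \<in> tup xi" "\<forall>i\<in>I. R a (map h (c i))" by blast
  have "R (map g a) (c i)" if "i \<in> I" for i
   using aut_def2[OF g(1) R a(1) aut_tup[OF h]] a(2) that c(1) aut_inv_map[where g = g and h = h, OF g(2) tuples_set] by auto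
  then show False using c(2) that aut_tup[OF g(1) a(1)] by blast
 qed
 show ?thesis unfolding kdiv_def
  by (rule exI[of _ "\<lambda>i. map h (c i)"]) (use t n c(1) aut_tup[OF h] in simp)
qed

end

context simple_monster begin

text \<open>Saturation realises nonforking extensions over small sets in the whole monster model.
  Hence \<open>T_Ext\<close> holds in this pair and in all its elementary substructures.\<close>

lemma extension_property_model:
 assumes P: "smod P" shows "is_pair L C U P" "extension_property L C U P"
proof -
 have "elem_sub L C U" unfolding elem_sub_def using struct by (simp add: restrict_Univ)
 then show "is_pair L C U P" unfolding is_pair_def restrict_Univ using smodD(3)[OF P] by blast
 show "extension_property L C U P" unfolding extension_property_def
 proof (intro allI impI, elim conjE)
  fix A I and b :: "('s, 'f, 'r) fm => 'a"
  assume a: "A \<subseteq> U" "|A| \<le>o theory_card L" "|I| \<le>o theory_card L" "b ` I \<subseteq> U"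
  have b: "b j \<in> car (Sort C (b j))" if "j \<in> I" for j using a(4) that by (auto simp: carrier_of_def)
  have bt: "map b is \<in> tup (srt (map b is))" if "set is \<subseteq> I" for "is"
   by (rule tuples_self) (use a(4) that in auto)
  have "\<exists>h. aut h \<and> (\<forall>x\<in>A \<union> {}. h x = x) \<and> (\<forall>idx. set idx \<subseteq> I --> indep L C (map (\<lambda>j. h (b j)) idx) P A)"
   by (rule nonfork_ext[OF sm_theory[OF a(3)] a(1) sm_theory[OF a(2)] _ _ smodD(1,2)[OF P] b])
    (use indep_empty[OF bt a(1) sm_theory[OF a(2)]] in \<open>auto intro: sm_finite\<close>)
  then obtain h where h: "aut h" "\<forall>x\<in>A. h x = x" "\<forall>idx. set idx \<subseteq> I --> indep L C (map (\<lambda>j. h (b j)) idx) P A" by auto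
  have "tp L C (map (\<lambda>j. h (b j)) is) A = tp L C (map b is) A" if "set is \<subseteq> I" for "is"
   using aut_tp[OF h(1,2) a(1) bt[OF that]] by (simp add: comp_def)
  then show "\<exists>a. a ` I \<subseteq> U \<and> (\<forall>is. set is \<subseteq> I --> tp L C (map a is) A = tp L C (map b is) A) \<and>
     (\<forall>is. set is \<subseteq> I --> indep L C (map a is) P A)"
   by (intro exI[of _ "\<lambda>j. h (b j)"]) (use h a(4) aut_U[OF h(1)] in auto)
 qed
qed

lemma extension_tuple:
 assumes EP: "extension_property L C M Q" and A: "A \<subseteq> M" "countable A" and d: "d \<in> tup ty" and M: "M \<subseteq> U"
 shows "\<exists>d'\<in>tup ty. set d' \<subseteq> M \<and> tp L C d' A = tp L C d A \<and> indep L C d' Q A"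
proof -
 \<comment> \<open>The extension property indexes the variables of a type by formulas; iterated
   negations of \<open>Fls\<close> serve as indices for the positions of a tuple.\<close>
 define \<iota> where "\<iota> n = ((Neg ^^ n) Fls :: ('s, 'f, 'r) fm)" for n
 have inj: "inj \<iota>"
 proof (rule injI)
  have "size (\<iota> n) = n + size (\<iota> 0)" for n by (induction n) (auto simp: \<iota>_def)
  then show "m = n" if "\<iota> m = \<iota> n" for m n using that by (metis add_right_cancel)
 qed
 let ?I = "\<iota> ` {..<length d}" and ?b = "\<lambda>f. d ! inv \<iota> f" and ?is = "map \<iota> [0..<length d]"
 have b: "map ?b ?is = d" by (rule nth_equalityI) (auto simp: inv_f_f[OF inj])
 have "A \<subseteq> M \<and> |A| \<le>o theory_card L \<and> |?I| \<le>o theory_card L \<and> ?b ` ?I \<subseteq> U"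
  using A countable_theory[OF A(2)] countable_theory[of ?I] tuples_set[OF d] by (auto simp: inv_f_f[OF inj])
 with EP obtain a where a: "a ` ?I \<subseteq> M" "\<forall>is. set is \<subseteq> ?I --> tp L C (map a is) A = tp L C (map ?b is) A"
  "\<forall>is. set is \<subseteq> ?I --> indep L C (map a is) Q A"
  unfolding extension_property_def by meson
 let ?d = "map a ?is"
 have i: "set ?is \<subseteq> ?I" by auto
 have t: "tp L C ?d A = tp L C d A" using a(2)[rule_format, OF i] b by simp
 have dM: "set ?d \<subseteq> M" using a(1) by auto
 have "srt ?d = srt d" by (rule tp_sorts[OF t]) (use dM M in auto)
 then have "?d \<in> tup ty" using dM M tuples_sorts[OF d] unfolding tuples_def by blast
 then show ?thesis using t dM a(3)[rule_format, OF i] by blast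
qed

end

context ultraproduct begin

text \<open>A sequence of tuples read as a tuple of sections, so that its limit is obtained by
  applying \<open>el\<close> entrywise.\<close>

definition "cs q sg = map (\<lambda>i k. q k ! i) [0..<length sg]" for q :: "nat => 'a list" and sg :: "'s list"

lemma cs:
 assumes "\<And>k. q k \<in> tup sg" "\<And>k. set (q k) \<subseteq> N k"
 shows "set (cs q sg) \<subseteq> J" "map vs (cs q sg) = sg" "map (\<lambda>j. j k) (cs q sg) = q k"
proof -
 have l: "length (q k) = length sg" for k by (rule tuples_length[OF assms(1)])
 have s: "Sort C (q k ! i) = sg ! i" if "i < length sg" for i k
  using tuples_nth[OF assms(1) that] by (simp add: carrier_of_def)
 show "set (cs q sg) \<subseteq> J" using assms(2) l s by (auto simp: cs_def sections_def subset_iff)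
 show "map vs (cs q sg) = sg" using s by (auto simp: cs_def vs_def intro: nth_equalityI)
 show "map (\<lambda>j. j k) (cs q sg) = q k" using l by (auto simp: cs_def intro: nth_equalityI)
qed

end

section \<open>Uniformity of forking in the base\<close>

context simple_monster begin

text \<open>On failure there are tuples \<open>q k\<close>, converging to the type of
  \<open>g\<close>, without any such \<open>e'\<close>. In the ultraproduct of countable pairs
  around them the limit of the \<open>q k\<close> has the type of \<open>g\<close>, so a suitable
  \<open>e\<close> exists, and the extension property places one inside the ultraproduct,
  independently from the predicate. Its coordinates in the factors contradict the choice of the
  \<open>q k\<close>.\<close>

lemma uniform_forking:
 assumes ep: "extension_property_first_order L C" and g: "g \<in> tup ty" and e: "e \<in> tup sg"
  and \<Omega>: "defp L C (ty @ sg) \<Omega>" "\<Omega> (g @ e)" and R: "stab xi (ty @ sg) R" and f: "fset (set g) xi {x. R x (g @ e)}"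
 shows "\<exists>\<chi>. defp L C ty \<chi> \<and> \<chi> g \<and>
  (\<forall>g'\<in>tup ty. \<chi> g' --> (\<exists>e'\<in>tup sg. \<Omega> (g' @ e') \<and> fset (set g') xi {x. R x (g' @ e')}))"
proof (rule ccontr)
 assume no: "\<not> ?thesis"
 note R2 = stab_def2[OF R]
 define \<Phi> where "\<Phi> = from_nat_into {phi. wff L ty phi}"
 have ct\<Phi>: "countable {phi. wff L ty phi}" using ctbl by (rule countable_subset[rotated]) (auto simp: formulas_def)
 have "wff L ty Fls" by simp
 then have \<Phi>: "wff L ty (\<Phi> i)" for i using from_nat_into[of "{phi. wff L ty phi}" i] unfolding \<Phi>_def by blast
 define \<chi> where "\<chi> k a \<longleftrightarrow> (\<forall>i\<in>{..<k}. sat C a (\<Phi> i) = sat C g (\<Phi> i))" for k :: nat and a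
 have "defp L C ty (\<chi> k)" for k unfolding \<chi>_def by (intro defp_ball defp_iff defp_const defp_wff \<Phi>) simp
 moreover have "\<chi> k g" for k by (simp add: \<chi>_def)
 ultimately have "\<exists>g'. g' \<in> tup ty \<and> \<chi> k g' \<and> \<not> (\<exists>e'\<in>tup sg. \<Omega> (g' @ e') \<and> fset (set g') xi {x. R x (g' @ e')})" for k
  using no by blast
 then have "\<forall>k. \<exists>g'. g' \<in> tup ty \<and> \<chi> k g' \<and> \<not> (\<exists>e'\<in>tup sg. \<Omega> (g' @ e') \<and> fset (set g') xi {x. R x (g' @ e')})" by blast
 from choice[OF this] obtain q :: "nat => 'a list" where q: "\<And>k. q k \<in> tup ty" "\<And>k. \<chi> k (q k)"
  "\<And>k. \<not> (\<exists>e'\<in>tup sg. \<Omega> (q k @ e') \<and> fset (set (q k)) xi {x. R x (q k @ e')})" by blast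
 \<comment> \<open>The predicate of pair number \<open>k\<close> is a model around
   \<open>q k\<close>, so that nonforking over \<open>q k\<close> becomes visible as a solution in
   the predicate.\<close>
 have "\<forall>k. \<exists>P. smod P \<and> set (q k) \<subseteq> P" using smod_ex[OF countable_finite[OF finite_set] tuples_set[OF q(1)]] by blast
 from choice[OF this] obtain P where P: "\<And>k. smod (P k)" "\<And>k. set (q k) \<subseteq> P k" by blast
 have "\<exists>N. countable N \<and> set (q k) \<subseteq> N \<and> elem_sub pl (ps U (P k)) N" for k
  by (rule Loewenheim_Skolem[OF pair_is_struct countable_pair_lang[OF ctbl]])
   (use tuples_set[OF q(1)] in \<open>auto intro: countable_finite\<close>)
 then have "\<forall>k. \<exists>N. countable N \<and> set (q k) \<subseteq> N \<and> elem_sub pl (ps U (P k)) N" ..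
 from choice[OF this] obtain N where N': "\<forall>k. countable (N k) \<and> set (q k) \<subseteq> N k \<and> elem_sub pl (ps U (P k)) (N k)" ..
 then have N: "countable (N k)" "set (q k) \<subseteq> N k" "elem_sub pl (ps U (P k)) (N k)" for k by simp_all
 obtain F :: "nat filter" where F: "F \<le> sequentially" "ultra F" using ultra_exists[OF trivial_limit_sequentially] by blast
 have NC: "elem_sub L C (N k)" "elem_sub L C (P k \<inter> N k)" for k using pair_elem_sub[OF N(3) smodD(3)[OF P(1)]] .
 obtain el where el: "lcor F (sections N) vs (\<lambda>j k. j k) el"
  using ulim[OF F(2) sm_sections[of N], where f = "\<lambda>j k. j k" and v = vs] N(1) sections_vs[of _ N, OF _ elem_sub_sub[OF NC(1)]] by blast
 interpret X: ultraproduct L C \<kappa> F N P el by unfold_locales (use F NC el in auto)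
 let ?M = X.M and ?Q = X.Q
 have MU: "?M \<subseteq> U" by (rule elem_sub_sub[OF X.M_elem])
 have QM: "?Q \<subseteq> ?M" by (auto simp: X.M_def X.Q_def)
 have in_Q: "set (map el (X.cs p sg')) \<subseteq> ?Q" if pp: "\<And>k. p k \<in> tup sg'" "\<And>k. set (p k) \<subseteq> N k" "eventually (\<lambda>k. set (p k) \<subseteq> P k) F" for p sg'
 proof -
  have "eventually (\<lambda>k. j k \<in> P k) F" if j: "j \<in> set (X.cs p sg')" for j
   using pp(3)
  proof eventually_elim
   case (elim k)
   have "j k \<in> set (map (\<lambda>j. j k) (X.cs p sg'))" using j by auto
   then show ?case unfolding X.cs(3)[OF pp(1,2)] using elim by blast
  qed
  then show ?thesis using X.cs(1)[OF pp(1,2)] by (auto simp: X.Q_def)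
 qed
 have "models (ps ?M ?Q) (T_Ext L C)"
  unfolding models_def
 proof
  fix phi assume phi: "phi \<in> T_Ext L C"
  then have w: "wff pl [] phi" by (simp add: T_Ext_def sentences_def)
  have "sat (ps (N k) (P k)) [] phi" for k
  proof -
   have "sat (ps U (P k)) [] phi" using phi extension_property_model[OF P(1)] unfolding T_Ext_def by blast
   then show ?thesis using elem_sub_sat[OF N(3) w, of "[]"] by (simp add: restrict_pair)
  qed
  then show "sat (ps ?M ?Q) [] phi" using X.Los[of "[]" phi] w by simp
 qed
 then have EP: "extension_property L C ?M ?Q"
  using ep X.is_pair_MQ X.saturated_MQ unfolding extension_property_first_order_def by blast
 let ?idx = "X.cs q ty"
 define gs where "gs = map el ?idx"
 note csq = X.cs[OF q(1) N(2)]
 have gs: "gs \<in> tup ty" using X.idx_tup(2)[OF csq(1)] csq(2) by (simp add: gs_def)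
 have gsQ: "set gs \<subseteq> ?Q" unfolding gs_def by (rule in_Q[OF q(1) N(2)]) (simp add: P(2))
 have tgs: "tp L C g {} = tp L C gs {}"
 proof (rule tp_eqI[OF g gs])
  fix c :: "'a list" and phi assume c: "set c \<subseteq> {}" "wff L (ty @ srt c) phi"
  then have w: "wff L ty phi" by simp
  then obtain i where i: "phi = \<Phi> i" using from_nat_into_surj[OF ct\<Phi>, of phi] by (auto simp: \<Phi>_def)
  have "sat C gs phi \<longleftrightarrow> eventually (\<lambda>k. sat C (q k) phi) F"
   using X.elD[OF csq(1), of "\<lambda>a. sat C a phi"] csq(2,3) defp_wff[OF w, of C] by (simp add: gs_def)
  also have "\<dots> \<longleftrightarrow> eventually (\<lambda>k. sat C g phi) F"
  proof -
   have "eventually (\<lambda>k. i < k) F" using F(1) eventually_gt_at_top[of i] by (auto simp: le_filter_def)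
   then have "eventually (\<lambda>k. sat C (q k) phi = sat C g phi) F"
    by eventually_elim (use q(2) i in \<open>auto simp: \<chi>_def\<close>)
   then show ?thesis by (rule eventually_cong) simp
  qed
  also have "\<dots> \<longleftrightarrow> sat C g phi" by (rule ultra_const[OF F(2)])
  finally show "sat C (g @ c) phi = sat C (gs @ c) phi" using c by simp
 qed
 obtain h where h: "aut h" "map h g = gs" using hom_tuple[OF g gs _ _ tgs] by (auto intro: sm_finite)
 let ?es = "map h e"
 have ge: "g @ e \<in> tup (ty @ sg)" using g e by (simp add: tuples_appendI)
 have es: "gs @ ?es \<in> tup (ty @ sg)" using aut_tup[OF h(1) ge] h(2) by simp
 have \<Omega>s: "\<Omega> (gs @ ?es)" using aut_defp[OF h(1) \<Omega>(1) ge] \<Omega>(2) h(2) by simp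
 obtain n where n: "\<not> lad n xi (ty @ sg) R" using R unfolding stab_def by (elim conjE exE)
 have "kdiv (Suc n) (set g) xi (ty @ sg) R (g @ e)"
  by (rule stab_kdiv[OF R n ge _ tuples_set[OF g] f]) (simp add: countable_finite)
 from kdiv_aut[OF this R2 ge tuples_set[OF g] h(1)] have "kdiv (Suc n) (set gs) xi (ty @ sg) R (gs @ ?es)"
  using h(2) by (metis list.set_map map_append)
 from kdiv_fset[OF this R2 es] have fs: "fset (set gs) xi {x. R x (gs @ ?es)}" .
 have st: "is_struct L (restrict_struct C ?Q)" using X.Q_elem by (simp add: elem_sub_def)
 \<comment> \<open>A countable model between \<open>gs\<close> and \<open>?Q\<close>:
   \<open>indep_misses\<close> needs a model as base, and the extension property a countable
   set.\<close>
 obtain A where A: "countable A" "set gs \<subseteq> A" "elem_sub L (restrict_struct C ?Q) A"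
  using Loewenheim_Skolem[OF st ctbl countable_finite[OF finite_set], of gs] gsQ by (auto simp: restrict_struct_def)
 have AQ: "A \<subseteq> ?Q" using elem_sub_sub[OF A(3)] by (simp add: restrict_struct_def)
 have smA: "smod A" unfolding smod_def using elem_sub_trans[OF X.Q_elem A(3)] sm_countable[OF A(1)] by blast
 have AU: "A \<subseteq> U" by (rule smodD(1)[OF smA])
 obtain h2 where h2: "aut h2" "\<forall>x\<in>set gs. h2 x = x" "misses A xi R (map h2 (gs @ ?es))"
  using forks_misses[OF smodD(1,2)[OF smA] tuples_set[OF gs] sm_finite[OF finite_set] tuples_set[OF es] sm_finite[OF finite_set]]
   R2 es fs by blast
 let ?d1 = "map h2 (gs @ ?es)"
 have d1: "?d1 \<in> tup (ty @ sg)" by (rule aut_tup[OF h2(1) es])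
 have d1g: "take (length ty) ?d1 = gs" using aut_fix_map[OF h2(2) subset_refl] gs by (simp add: tuples_length)
 have \<Omega>1: "\<Omega> ?d1" using aut_defp[OF h2(1) \<Omega>(1) es] \<Omega>s by simp
 \<comment> \<open>Since \<open>d2\<close> is independent from \<open>?Q\<close> over
   \<open>A\<close>, the relation will miss not only \<open>A\<close> but all of
   \<open>?Q\<close>.\<close>
 obtain d2 where d2: "d2 \<in> tup (ty @ sg)" "set d2 \<subseteq> ?M" "tp L C d2 A = tp L C ?d1 A" "indep L C d2 ?Q A"
  using extension_tuple[OF EP _ A(1) d1 MU] AQ QM by blast
 have \<Omega>2: "\<Omega> d2"
  using tp_eq_sort[OF d2(3,1) d1, of "[]" \<Omega>] \<Omega>(1) \<Omega>1 AU by simp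
 have d2g: "take (length ty) d2 = gs"
 proof -
  let ?E = "\<lambda>w. take (length ty) (take (length (ty @ sg)) w) = drop (length (ty @ sg)) w"
  have "defp L C ((ty @ sg) @ srt gs) ?E"
   unfolding tuples_sorts[OF gs]
   by (rule def2_defp[OF stab_def2[OF stab_eq] coord_comp[OF coord_fst coord_fst] coord_snd])
  from tp_eq_sort[OF d2(3,1) d1 A(2) this AU] have "?E (d2 @ gs) = ?E (?d1 @ gs)" .
  moreover have "length d2 = length (ty @ sg)" "length ?d1 = length (ty @ sg)" using tuples_length d2(1) d1 by blast+
  ultimately show ?thesis using d1g by simp
 qed
 have "misses A xi R d2" unfolding misses_def
 proof (intro ballI impI)
  fix x assume x: "x \<in> tup xi" "set x \<subseteq> A"
  let ?E = "\<lambda>w. R (drop (length (ty @ sg)) w) (take (length (ty @ sg)) w)"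
  have "defp L C ((ty @ sg) @ srt x) ?E"
   unfolding tuples_sorts[OF x(1)] by (rule def2_defp[OF R2 coord_snd coord_fst])
  from tp_eq_sort[OF d2(3,1) d1 x(2) this AU] have "?E (d2 @ x) = ?E (?d1 @ x)" .
  moreover have "length d2 = length (ty @ sg)" "length ?d1 = length (ty @ sg)" using tuples_length d2(1) d1 by blast+
  ultimately show "\<not> R x d2" using h2(3) x unfolding misses_def by simp
 qed
 from indep_misses[OF R smA d2(1) this d2(4)] QM MU have mQ: "misses ?Q xi R d2" unfolding misses_def by blast
 define e2 where "e2 = drop (length ty) d2"
 have d2e: "d2 = gs @ e2" unfolding e2_def using append_take_drop_id[of "length ty" d2] d2g by simp
 have e2: "e2 \<in> tup sg" "set e2 \<subseteq> ?M" using d2(1,2) gs unfolding d2e by simp_all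
 obtain ie where ie: "set ie \<subseteq> X.J" "e2 = map el ie" using X.M_list[OF e2(2)] by blast
 have vie: "map vs ie = sg" using X.idx_tup(2)[OF ie(1)] ie(2) e2(1) tuples_sorts by metis
 define x where "x k = map (\<lambda>j. j k) ie" for k
 have xt: "x k \<in> tup sg" for k unfolding x_def using X.idx_tup(1)[OF ie(1)] vie by simp
 have xN: "set (x k) \<subseteq> N k" for k unfolding x_def using ie(1) by (auto simp: sections_def)
 have "eventually (\<lambda>k. \<Omega> (q k @ x k)) F"
 proof -
  have "\<Omega> (map el (?idx @ ie)) \<longleftrightarrow> eventually (\<lambda>k. \<Omega> (map (\<lambda>j. j k) (?idx @ ie))) F"
   by (rule X.elD) (use csq ie(1) vie \<Omega>(1) in auto)
  then show ?thesis using \<Omega>2 csq(3) unfolding d2e gs_def ie(2) x_def by simp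
 qed
 \<comment> \<open>For almost all \<open>k\<close> the coordinates \<open>x k\<close> satisfy
   \<open>\<Omega>\<close>, so by the choice of \<open>q k\<close> the relation does not fork over
   \<open>q k\<close> and has a solution in \<open>P k\<close>; elementarity of the pair brings a
   solution into \<open>N k\<close>. The limit of these solutions will be a solution in
   \<open>?Q\<close>.\<close>
 then have ev: "eventually (\<lambda>k. \<exists>p\<in>tup xi. set p \<subseteq> P k \<inter> N k \<and> R p (q k @ x k)) F"
 proof eventually_elim
  case (elim k)
  have qx: "q k @ x k \<in> tup (ty @ sg)" using tuples_appendI[OF q(1) xt] .
  have "\<not> misses (P k) xi R (q k @ x k)"
   using misses_fset[OF R P(1) P(2) qx] q(3)[of k] elim xt[of k] by blast
  then obtain p where p: "p \<in> tup xi" "set p \<subseteq> P k" "R p (q k @ x k)" unfolding misses_def by blast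
  let ?E = "\<lambda>w. R (take (length xi) w) (drop (length xi) w) \<and> (\<forall>i\<in>{..<length xi}. w ! i \<in> P k)"
  have E: "?E (y @ q k @ x k) \<longleftrightarrow> R y (q k @ x k) \<and> set y \<subseteq> P k" if "y \<in> tup xi" for y
  proof -
   have "(\<forall>i\<in>{..<length xi}. (y @ q k @ x k) ! i \<in> P k) \<longleftrightarrow> set y \<subseteq> P k"
    using tuples_length[OF that] by (auto simp: nth_append in_set_conv_nth subset_iff)
   then show ?thesis using tuples_length[OF that] by simp
  qed
  have dE: "defp pl (ps U (P k)) (xi @ ty @ sg) ?E"
   by (intro defp_conj defp_liftf defp_ball defp_pred def2_defp[OF R2 coord_fst coord_snd]) auto
  have "\<exists>y\<in>tuples (ps U (P k)) xi. set y \<subseteq> N k \<and> ?E (y @ q k @ x k)"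
   by (rule elem_sub_exs[OF N(3) dE, where x = p])
    (use qx p E N(2) xN in \<open>auto simp: tuples_pair_U\<close>)
  then show ?case unfolding tuples_pair_U using E by blast
 qed
 have "\<exists>p. p \<in> tup xi \<and> set p \<subseteq> N k \<and> ((\<exists>p\<in>tup xi. set p \<subseteq> P k \<inter> N k \<and> R p (q k @ x k)) --> set p \<subseteq> P k \<and> R p (q k @ x k))" for k
 proof (cases "\<exists>p\<in>tup xi. set p \<subseteq> P k \<inter> N k \<and> R p (q k @ x k)")
  case False
  have "is_struct L (restrict_struct C (N k))" using NC(1)[of k] by (simp add: elem_sub_def)
  from tuples_nonempty[OF this, of xi] obtain a where "set a \<subseteq> N k" "srt a = xi" unfolding tuples_restrict by blast
  moreover from this have "a \<in> tup xi" using elem_sub_sub[OF NC(1)[of k]] unfolding tuples_def by blast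
  ultimately show ?thesis using False by blast
 qed blast
 then have "\<forall>k. \<exists>p. p \<in> tup xi \<and> set p \<subseteq> N k \<and> ((\<exists>p\<in>tup xi. set p \<subseteq> P k \<inter> N k \<and> R p (q k @ x k)) --> set p \<subseteq> P k \<and> R p (q k @ x k))"
  by blast
 from choice[OF this] obtain p :: "nat => 'a list" where p: "\<And>k. p k \<in> tup xi" "\<And>k. set (p k) \<subseteq> N k"
  "\<And>k. (\<exists>p\<in>tup xi. set p \<subseteq> P k \<inter> N k \<and> R p (q k @ x k)) ==> set (p k) \<subseteq> P k \<and> R (p k) (q k @ x k)" by blast
 have evp: "eventually (\<lambda>k. set (p k) \<subseteq> P k \<and> R (p k) (q k @ x k)) F" using ev by eventually_elim (rule p(3))
 note csp = X.cs[OF p(1,2)]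
 let ?p = "map el (X.cs p xi)"
 have "?p \<in> tup xi" using X.idx_tup(2)[OF csp(1)] csp(2) by simp
 moreover have "set ?p \<subseteq> ?Q" by (rule in_Q[OF p(1,2)]) (use evp in \<open>auto elim: eventually_mono\<close>)
 moreover have "R ?p d2"
 proof -
  let ?E = "\<lambda>w. R (take (length xi) w) (drop (length xi) w)"
  have "?E (map el (X.cs p xi @ ?idx @ ie)) \<longleftrightarrow> eventually (\<lambda>k. ?E (map (\<lambda>j. j k) (X.cs p xi @ ?idx @ ie))) F"
   by (rule X.elD) (use csp csq ie(1) vie def2_defp[OF R2 coord_fst coord_snd] in auto)
  moreover have "eventually (\<lambda>k. ?E (map (\<lambda>j. j k) (X.cs p xi @ ?idx @ ie))) F"
   using evp by eventually_elim (use csp(3) csq(3) tuples_length[OF p(1)] in \<open>simp add: x_def\<close>)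
  moreover have "length (X.cs p xi) = length xi" by (simp add: X.cs_def)
  ultimately show ?thesis unfolding d2e gs_def ie(2) by simp
 qed
 ultimately show False using mQ unfolding misses_def by blast
qed

end

section \<open>Algebraic closure and finite sets of requirements\<close>

context monster_model begin

lemma def2_all: "def2 L C xi ty R ==> defp L C ty (\<lambda>d. \<forall>x\<in>tup xi. R x d)"
 by (rule defp_cong[OF defp_all[OF def2_defp[OF _ coord_fst coord_snd]]]) (auto simp: tuples_length)

text \<open>Lets finitely many members of a type over \<open>D\<close> be treated as one formula in
  compactness arguments.\<close>

lemma over_conj:
 assumes "finite G" and D: "D \<subseteq> U" and G: "\<And>u P. (u, P) \<in> G ==> set u \<subseteq> D \<and> defp L C (xi @ srt u) P"
 shows "\<exists>u P. set u \<subseteq> D \<and> defp L C (xi @ srt u) P \<and> (\<forall>x\<in>tup xi. P (x @ u) \<longleftrightarrow> (\<forall>(u, P)\<in>G. P (x @ u)))"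
 using assms(1) G
proof (induction G rule: finite_induct)
 case empty
 show ?case by (rule exI[of _ "[]"], rule exI[of _ "\<lambda>_. True"]) (auto intro: defp_const)
next
 case (insert q G)
 obtain u1 P1 where q: "q = (u1, P1)" by (cases q)
 have 1: "set u1 \<subseteq> D" "defp L C (xi @ srt u1) P1" using insert.prems[of u1 P1] q by auto
 obtain u2 P2 where 2: "set u2 \<subseteq> D" "defp L C (xi @ srt u2) P2"
  "\<forall>x\<in>tup xi. P2 (x @ u2) \<longleftrightarrow> (\<forall>(u, P)\<in>G. P (x @ u))" using insert by (metis insertCI)
 let ?n = "length xi" and ?m = "length (xi @ srt u1)"
 let ?P = "\<lambda>w. P1 (take ?m w) \<and> P2 (take ?n w @ drop ?m w)"
 have "defp L C (xi @ srt (u1 @ u2)) ?P"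
  by (intro defp_conj defp_coord[OF 1(2) coord_take'] defp_coord[OF 2(2) coord_append[OF coord_take' coord_drop']]) auto
 moreover have "?P (x @ u1 @ u2) \<longleftrightarrow> P1 (x @ u1) \<and> P2 (x @ u2)" if "x \<in> tup xi" for x
  using tuples_length[OF that] by simp
 ultimately show ?case using 1(1) 2(1,3) q
  by (intro exI[of _ "u1 @ u2"] exI[of _ ?P]) (simp add: split_beta)
qed

text \<open>Every formula of the type of \<open>c\<close> over \<open>D\<close> has infinitely many
  solutions and so has one that avoids finitely many given elements of \<open>P\<close>; compactness
  does the rest.\<close>

lemma orbit_outside:
 assumes c: "c \<in> car s" "c \<notin> acl L C D" and D: "D \<subseteq> U" "sm D" and P: "P \<subseteq> U" "sm P"
 shows "\<exists>h. aut h \<and> (\<forall>x\<in>D. h x = x) \<and> h c \<notin> P"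
proof -
 define ok where "ok u Q \<longleftrightarrow> set u \<subseteq> D \<and> defp L C ([s] @ srt u) Q \<and> Q ([c] @ u)" for u and Q :: "'a list => bool"
 define A where "A = {([()], u, Q) | u Q. ok u Q}"
 define B where "B = {([()], [p], \<lambda>w :: 'a list. w ! 0 \<noteq> w ! 1) | p. p \<in> P \<inter> car s}"
 have "\<exists>e. (\<forall>j\<in>{()}. e j \<in> car s) \<and> (\<forall>(idx, u, Q)\<in>A \<union> B. Q (map e idx @ u))"
 proof (rule compactness[where B = "D \<union> P"])
  show "D \<union> P \<subseteq> U" "sm (D \<union> P)" "sm {()}" using D P by (auto intro: sm_Un sm_finite)
  fix idx u Q assume "(idx, u, Q) \<in> A \<union> B"
  then show "set idx \<subseteq> {()} \<and> set u \<subseteq> D \<union> P \<and> defp L C (map (\<lambda>_. s) idx @ srt u) Q"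
  proof (rule UnE)
   assume "(idx, u, Q) \<in> A" then have "idx = [()]" "ok u Q" by (simp_all add: A_def)
   then show ?thesis by (auto simp: ok_def)
  next
   assume "(idx, u, Q) \<in> B"
   then obtain p where p: "p \<in> P" "p \<in> car s" "idx = [()]" "u = [p]" "Q = (\<lambda>w. w ! 0 \<noteq> w ! 1)" unfolding B_def by (elim CollectE exE conjE IntE Pair_inject) auto
   have "defp L C (map (\<lambda>_. s) idx @ srt u) Q" unfolding p(5)
    by (intro defp_neg defp_eq) (use p(2-4) in \<open>simp_all add: carrier_of_def\<close>)
   then show ?thesis using p by simp
  qed
 next
  fix G assume G: "finite G" "G \<subseteq> A \<union> B"
  have "finite (snd ` (G \<inter> A))" using G by auto
  have okG: "ok u Q" if "(u, Q) \<in> snd ` (G \<inter> A)" for u Q using that by (auto simp: A_def)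
  obtain u Q where uQ: "set u \<subseteq> D" "defp L C ([s] @ srt u) Q"
   "\<forall>x\<in>tup [s]. Q (x @ u) \<longleftrightarrow> (\<forall>(u, Q)\<in>snd ` (G \<inter> A). Q (x @ u))"
   using over_conj[OF \<open>finite (snd ` (G \<inter> A))\<close> D(1), of "[s]"] okG[unfolded ok_def] by blast
  obtain phi where phi: "wff L ([s] @ srt u) phi" "\<forall>w\<in>tup ([s] @ srt u). Q w \<longleftrightarrow> sat C w phi" using uQ(2) unfolding defp_def by blast
  have ut: "u \<in> tup (srt u)" using uQ(1) D(1) by (intro tuples_self) auto
  have "\<forall>(u, Q)\<in>snd ` (G \<inter> A). Q ([c] @ u)" using okG[unfolded ok_def] by blast
  then have "Q ([c] @ u)" using bspec[OF uQ(3), of "[c]"] c(1) by (simp only: tuples_single)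
  then have "sat C (c # u) phi" using phi(2) ut c(1) by auto
  moreover have "Sort C c = s" "c \<in> U" using c(1) by (auto simp: carrier_of_def)
  ultimately have "infinite {x \<in> car s. sat C (x # u) phi}"
   using c(2) phi(1) uQ(1) unfolding acl_def formulas_over_def by auto
  moreover have "finite {p. ([()], [p], \<lambda>w :: 'a list. w ! 0 \<noteq> w ! 1) \<in> G}" (is "finite ?S")
  proof (rule inj_on_finite[OF _ _ G(1)])
   show "inj_on (\<lambda>p. ([()], [p], \<lambda>w :: 'a list. w ! 0 \<noteq> w ! 1)) ?S" by (auto simp: inj_on_def)
  qed auto
  ultimately obtain x where x: "x \<in> car s" "sat C (x # u) phi" "x \<notin> ?S"
   by (metis (no_types, lifting) finite_subset mem_Collect_eq subsetI)
  have "Q ([x] @ u)" using phi(2) x(1,2) ut by auto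
  then have QG: "\<forall>(u, Q)\<in>snd ` (G \<inter> A). Q ([x] @ u)" using uQ(3) x(1) by (simp only: tuples_single)
  have "Q (map (\<lambda>_. x) idx @ u)" if q: "(idx, u, Q) \<in> G" for idx u Q
  proof (cases "(idx, u, Q) \<in> A")
   case True
   then have "(u, Q) \<in> snd ` (G \<inter> A)" using q by force
   moreover have "idx = [()]" using True by (simp add: A_def)
   ultimately show ?thesis using bspec[OF QG, of "(u, Q)"] by simp
  next
   case False
   then have "(idx, u, Q) \<in> B" using q G(2) by blast
   then obtain p where p: "idx = [()]" "u = [p]" "Q = (\<lambda>w. w ! 0 \<noteq> w ! 1)" unfolding B_def by (elim CollectE exE conjE Pair_inject) auto
   then have "p \<noteq> x" using x(3) q by auto
   then show ?thesis using p by simp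
  qed
  then have "\<forall>(idx, u, Q)\<in>G. Q (map (\<lambda>_. x) idx @ u)" by blast
  then show "\<exists>e. (\<forall>j\<in>{()}. e j \<in> car s) \<and> (\<forall>(idx, u, Q)\<in>G. Q (map e idx @ u))"
   using x(1) by (intro exI[of _ "\<lambda>_. x"]) auto
 qed
 then obtain e where e: "e () \<in> car s" "\<forall>(idx, u, Q)\<in>A \<union> B. Q (map e idx @ u)" by blast
 have eA: "Q ([e ()] @ u)" if "ok u Q" for u Q
  using bspec[OF e(2), of "([()], u, Q)"] that by (auto simp: A_def)
 have "tp L C [c] D = tp L C [e ()] D"
 proof (rule tp_eqI[of _ "[s]"])
  fix u phi assume u: "set u \<subseteq> D" "wff L ([s] @ srt u) phi"
  have dn: "defp L C ([s] @ srt u) (\<lambda>w. sat C w phi)" "defp L C ([s] @ srt u) (\<lambda>w. \<not> sat C w phi)"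
   using u(2) by (auto intro: defp_neg defp_wff)
  have "sat C ([c] @ u) phi ==> sat C ([e ()] @ u) phi"
   by (rule eA) (use dn(1) u(1) in \<open>simp add: ok_def\<close>)
  moreover have "\<not> sat C ([c] @ u) phi ==> \<not> sat C ([e ()] @ u) phi"
   by (rule eA) (use dn(2) u(1) in \<open>simp add: ok_def\<close>)
  ultimately show "sat C ([c] @ u) phi = sat C ([e ()] @ u) phi" by blast
 qed (use c e in auto)
 from hom_tuple[OF _ _ D this, of "[s]"] c(1) e(1) obtain h where h: "aut h" "\<forall>x\<in>D. h x = x" "h c = e ()" by auto
 have "e () \<notin> P" using bspec[OF e(2), of "([()], [e ()], \<lambda>w. w ! 0 \<noteq> w ! 1)"] e(1) by (auto simp: B_def)
 then show ?thesis using h by metis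
qed

lemma acl_orbit:
 assumes "c \<in> acl L C D" "D \<subseteq> U" shows "finite {h c | h. aut h \<and> (\<forall>x\<in>D. h x = x)}"
proof -
 obtain phi u where c: "c \<in> U" "set u \<subseteq> D" "wff L ([Sort C c] @ srt u) phi" "sat C (c # u) phi"
  "finite {x \<in> car (Sort C c). sat C (x # u) phi}" using assms(1) unfolding acl_def formulas_over_def by auto
 have "h c \<in> {x \<in> car (Sort C c). sat C (x # u) phi}" if h: "aut h" "\<forall>x\<in>D. h x = x" for h
 proof -
  have "c # u \<in> tup ([Sort C c] @ srt u)" using c(1,2) assms(2) by (auto simp: carrier_of_sort intro!: tuples_self)
  from aut_sat[OF h(1) c(3) this] have "sat C (h c # u) phi" using aut_fix_map[OF h(2) c(2)] c(4) by simp
  then show ?thesis using aut_car[OF c(1) h(1)] c(1) by (simp add: carrier_of_sort)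
 qed
 then show ?thesis by (intro finite_subset[OF _ c(5)]) auto
qed

lemma acl_mono: "A \<subseteq> B ==> acl L C A \<subseteq> acl L C B"
 unfolding acl_def formulas_over_def by blast

end

context simple_monster begin

text \<open>The converse of \<open>forks_misses\<close>, with a single model above \<open>D\<close>:
  for stable relations, to fork over \<open>D\<close> is to miss that model after a move over
  \<open>D\<close>.\<close>

lemma misses_fset_aut:
 assumes R: "stab xi ty R" and d: "d \<in> tup ty" and D: "countable D" and P: "smod P" "D \<subseteq> P"
  and h: "aut h" "\<forall>x\<in>D. h x = x" "misses P xi R (map h d)"
 shows "fset D xi {x. R x d}"
proof -
 have DU: "D \<subseteq> U" using P(2) smodD(1)[OF P(1)] by blast
 note hd = aut_tup[OF h(1) d]
 from misses_fset[OF R P hd h(3)] show ?thesis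
  by (rule stab_fset_tp[OF R hd d D DU aut_tp[OF h(1,2) DU d]])
qed

lemma fset_aut:
 assumes R: "stab xi ty R" and d: "d \<in> tup ty" and D: "countable D" "D \<subseteq> U" and h: "aut h" and f: "fset D xi {x. R x d}"
 shows "fset (h ` D) xi {x. R x (map h d)}"
proof -
 obtain n where "\<not> lad n xi ty R" using R unfolding stab_def by (elim conjE exE)
 from stab_kdiv[OF R this d D f] kdiv_aut[OF _ stab_def2[OF R] d D(2) h]
 have "kdiv (Suc n) (h ` D) xi ty R (map h d)" by blast
 from kdiv_fset[OF this stab_def2[OF R] aut_tup[OF h d]] show ?thesis .
qed

lemma fset_inconsistent:
 assumes R: "def2 L C xi ty R" and d: "d \<in> tup ty" "set d \<subseteq> A" and A: "A \<subseteq> U" "sm A" and f: "fset A xi {x. R x d}" and x: "x \<in> tup xi"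
 shows "\<not> R x d"
proof
 assume r: "R x d"
 let ?P = "\<lambda>w. R (take (length xi) w) (drop (length xi) w)"
 have P: "?P (y @ d) = R y d" if "y \<in> tup xi" for y using tuples_length[OF that] by simp
 have "defp L C (xi @ srt d) ?P" using def2_defp[OF R coord_fst coord_snd] by (simp add: tuples_sorts[OF d(1)])
 from not_fset[OF A d(2) this x] have "\<not> fset A xi {y. ?P (y @ d)}" using P[OF x] r by blast
 then show False using fset_mono[OF f, of "{y. ?P (y @ d)}"] P by blast
qed

text \<open>If the disjunction in separate variables forks, a conjugate of it misses a model. Each
  disjunct then misses the model too, because the variables of the other one can be filled from the
  model.\<close>

lemma fset_disj:
 assumes R: "stab xi ty R" "stab xi' ty R'" and d: "d \<in> tup ty" and D: "countable D" "D \<subseteq> U"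
 shows "fset D (xi @ xi') {x. R (take (length xi) x) d \<or> R' (drop (length xi) x) d} \<longleftrightarrow>
  fset D xi {x. R x d} \<and> fset D xi' {x. R' x d}" (is "?l \<longleftrightarrow> ?r")
proof
 assume ?r
 then have "fset D (xi @ xi') ({x. take (length xi) x \<in> {x. R x d}} \<union> {x. drop (length xi) x \<in> {x. R' x d}})"
  using fset_Un fset_coord[OF _ coord_fst] fset_coord[OF _ coord_snd] by blast
 then show ?l by (rule fset_mono) auto
next
 assume l: ?l
 let ?S = "\<lambda>x d. R (take (length xi) x) d \<or> R' (drop (length xi) x) d"
 have S: "stab (xi @ xi') ty ?S" by (rule stab_disj[OF stab_coord[OF R(1) coord_fst coord_id] stab_coord[OF R(2) coord_snd coord_id]])
 obtain P where P: "smod P" "D \<subseteq> P" using smod_ex[OF D] by blast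
 note P' = smodD[OF P(1)]
 obtain h where h: "aut h" "\<forall>x\<in>D. h x = x" "misses P (xi @ xi') ?S (map h d)"
  using forks_misses[OF P'(1,2) D(2) sm_countable[OF D(1)] tuples_set[OF d] sm_finite[OF finite_set]] stab_def2[OF S] d l by blast
 have "is_struct L (restrict_struct C P)" using P'(3) by (simp add: elem_sub_def)
 note ne0 = tuples_nonempty[OF this, unfolded tuples_restrict]
 have ne: "\<exists>a. a \<in> tup \<zeta> \<and> set a \<subseteq> P" for \<zeta> using ne0[of \<zeta>] P'(1) unfolding tuples_def by blast
 obtain a where a: "a \<in> tup xi" "set a \<subseteq> P" using ne by blast
 obtain b where b: "b \<in> tup xi'" "set b \<subseteq> P" using ne by blast
 have 1: "misses P xi R (map h d)" unfolding misses_def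
 proof (intro ballI impI)
  fix x assume "x \<in> tup xi" "set x \<subseteq> P"
  then show "\<not> R x (map h d)" using bspec[OF h(3)[unfolded misses_def] tuples_appendI[OF _ b(1)], of x] b(2) by (simp add: tuples_length)
 qed
 have 2: "misses P xi' R' (map h d)" unfolding misses_def
 proof (intro ballI impI)
  fix x assume "x \<in> tup xi'" "set x \<subseteq> P"
  then show "\<not> R' x (map h d)" using bspec[OF h(3)[unfolded misses_def] tuples_appendI[OF a(1)], of x] a(2) tuples_length[OF a(1)] by simp
 qed
 show ?r using misses_fset_aut[OF R(1) d D(1) P h(1,2) 1] misses_fset_aut[OF R(2) d D(1) P h(1,2) 2] by blast
qed

text \<open>\<open>uniform_forking\<close> and \<open>basic_open\<close> deal with one requirement;
  this reduces finitely many to one, uniformly in the parameters and the base.\<close>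

lemma merge:
 assumes "finite S" "\<And>xi R. (xi, R) \<in> S ==> stab xi ty R"
 shows "\<exists>xi R. stab xi ty R \<and> (\<forall>d\<in>tup ty. \<forall>D. countable D --> D \<subseteq> U -->
  (fset D xi {x. R x d} \<longleftrightarrow> (\<forall>(xi, R)\<in>S. fset D xi {x. R x d})))"
 using assms
proof (induction S rule: finite_induct)
 case empty
 show ?case by (rule exI[of _ "[]"], rule exI[of _ "\<lambda>_ _. False"]) (auto intro: stab_const simp: fset_empty)
next
 case (insert q S)
 obtain xi1 R1 where q: "q = (xi1, R1)" by (cases q)
 have 1: "stab xi1 ty R1" using insert.prems q by auto
 obtain xi2 R2 where 2: "stab xi2 ty R2" "\<forall>d\<in>tup ty. \<forall>D. countable D --> D \<subseteq> U -->
  (fset D xi2 {x. R2 x d} \<longleftrightarrow> (\<forall>(xi, R)\<in>S. fset D xi {x. R x d}))" using insert by (metis insertCI)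
 have "stab (xi1 @ xi2) ty (\<lambda>x d. R1 (take (length xi1) x) d \<or> R2 (drop (length xi1) x) d)"
  by (rule stab_disj[OF stab_coord[OF 1 coord_fst coord_id] stab_coord[OF 2(1) coord_snd coord_id]])
 moreover have "fset D (xi1 @ xi2) {x. R1 (take (length xi1) x) d \<or> R2 (drop (length xi1) x) d} \<longleftrightarrow>
   (\<forall>(xi, R)\<in>insert q S. fset D xi {x. R x d})" if "d \<in> tup ty" "countable D" "D \<subseteq> U" for d D
  unfolding fset_disj[OF 1 2(1) that] using 2(2) that q by auto
 ultimately show ?case
  by (intro exI[of _ "xi1 @ xi2"] exI[of _ "\<lambda>x d. R1 (take (length xi1) x) d \<or> R2 (drop (length xi1) x) d"]) blast
qed

text \<open>With equality as the stable relation, nonalgebraicity becomes one more forking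
  requirement. If \<open>c\<close> is algebraic, a dividing sequence takes finitely many values and
  repeats one too often; otherwise \<open>c\<close> can be moved outside a model above
  \<open>D\<close>.\<close>

lemma fset_not_acl:
 assumes c: "c \<in> car s" and D: "countable D" "D \<subseteq> U"
 shows "fset D [s] {x. x = [c]} \<longleftrightarrow> c \<notin> acl L C D"
proof
 have ct: "[c] \<in> tup [s]" using c by simp
 note E = stab_eq[of "[s]"]
 { assume f: "fset D [s] {x. x = [c]}"
  obtain n where n: "\<not> lad n [s] [s] (\<lambda>x d. x = d)" using E unfolding stab_def by (elim conjE exE)
  from stab_kdiv[OF E n ct D f] obtain e :: "nat => 'a list" where e: "\<forall>i. e i \<in> tup [s] \<and> tp L C (e i) D = tp L C [c] D"
   "\<forall>I. finite I \<and> card I = Suc n --> \<not> (\<exists>a\<in>tup [s]. \<forall>i\<in>I. a = e i)" unfolding kdiv_def by (elim exE conjE)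
  show "c \<notin> acl L C D"
  proof
   assume "c \<in> acl L C D"
   from acl_orbit[OF this D(2)] have fin: "finite {h c | h. aut h \<and> (\<forall>x\<in>D. h x = x)}" .
   have hi: "\<exists>h. aut h \<and> (\<forall>x\<in>D. h x = x) \<and> map h [c] = e i" for i
    using hom_tuple[OF ct _ D(2) sm_countable[OF D(1)], of "e i"] e(1) by metis
   have "e i \<in> (\<lambda>x. [x]) ` {h c | h. aut h \<and> (\<forall>x\<in>D. h x = x)}" for i
   proof -
    from hi[of i] obtain h where "aut h" "\<forall>x\<in>D. h x = x" "e i = [h c]" by auto
    then show ?thesis by blast
   qed
   then have "range e \<subseteq> (\<lambda>x. [x]) ` {h c | h. aut h \<and> (\<forall>x\<in>D. h x = x)}" by (intro image_subsetI)
   then have "finite (range e)" by (rule finite_subset) (intro finite_imageI fin)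
   then obtain i0 where "infinite {i. e i = e i0}" using pigeonhole_infinite[of "UNIV :: nat set" e] by auto
   from infinite_arbitrarily_large[OF this, of "Suc n"] obtain I where "finite I" "card I = Suc n" "I \<subseteq> {i. e i = e i0}" by auto
   then show False using e by force
  qed }
 assume n: "c \<notin> acl L C D"
 obtain P where P: "smod P" "D \<subseteq> P" using smod_ex[OF D] by blast
 obtain h where h: "aut h" "\<forall>x\<in>D. h x = x" "h c \<notin> P"
  using orbit_outside[OF c n D(2) sm_countable[OF D(1)] smodD(1,2)[OF P(1)]] by blast
 have "misses P [s] (\<lambda>x d. x = d) (map h [c])" using h(3) by (auto simp: misses_def)
 from misses_fset_aut[OF E ct D(1) P h(1,2) this] show "fset D [s] {x. x = [c]}" .
qed

text \<open>Choose a model containing \<open>D\<close> and the finitely many conjugates of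
  \<open>c\<close>, and move \<open>d\<close> by \<open>h\<close> over \<open>D\<close> so that the
  relation misses it. The relation then forks over \<open>D\<close> with \<open>h c\<close>; moving
  back replaces \<open>h c\<close> by \<open>c\<close>.\<close>

lemma fset_acl:
 assumes R: "stab xi ty R" and d: "d \<in> tup ty" and D: "countable D" "D \<subseteq> U" and c: "c \<in> acl L C D" and f: "fset D xi {x. R x d}"
 shows "fset (insert c D) xi {x. R x d}"
proof -
 have cU: "c \<in> U" using c by (simp add: acl_def)
 let ?O = "{h c | h. aut h \<and> (\<forall>x\<in>D. h x = x)}"
 have "countable (D \<union> ?O)" using countable_finite[OF acl_orbit[OF c D(2)]] D(1) by simp
 moreover have "D \<union> ?O \<subseteq> U" using D(2) aut_U cU by auto
 ultimately obtain P where P: "smod P" "D \<union> ?O \<subseteq> P" using smod_ex by blast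
 obtain h where h: "aut h" "\<forall>x\<in>D. h x = x" "misses P xi R (map h d)"
  using forks_misses[OF smodD(1,2)[OF P(1)] D(2) sm_countable[OF D(1)] tuples_set[OF d] sm_finite[OF finite_set]] stab_def2[OF R] d f by blast
 have hd: "map h d \<in> tup ty" by (rule aut_tup[OF h(1) d])
 have "insert (h c) D \<subseteq> P" using P(2) h by blast
 from misses_fset[OF R P(1) this hd h(3)] have f1: "fset (insert (h c) D) xi {x. R x (map h d)}" .
 obtain g where g: "aut g" "\<And>x. x \<in> U ==> g (h x) = x" "\<And>x. x \<in> U ==> h (g x) = x" using aut_inv[OF h(1)] by blast
 have gD: "g x = x" if "x \<in> D" for x using g(2)[of x] bspec[OF h(2) that] subsetD[OF D(2) that] by simp
 have "fset (g ` insert (h c) D) xi {x. R x (map g (map h d))}"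
  by (rule fset_aut[OF R hd _ _ g(1) f1]) (use D aut_U[OF h(1) cU] in auto)
 moreover have "g ` insert (h c) D = insert c D" using gD g(2)[OF cU] by auto
 moreover have "map g (map h d) = d" by (rule aut_inv_map[where g = g and h = h, OF g(2) tuples_set[OF d]])
 ultimately show ?thesis by simp
qed

section \<open>Meeting requirements again over varying parameters\<close>

text \<open>A triple \<open>(xi, R, i)\<close> is a requirement with base the first \<open>i\<close>
  entries of \<open>d\<close>. The set \<open>B\<close> is added to all bases, to leave room for
  entries that are inserted into the tuple later.\<close>

definition holds :: "('s list \<times> ('a list => 'a list => bool) \<times> nat) set => 'a set => 'a list => bool" where
 "holds Dl B d \<longleftrightarrow> (\<forall>(xi, R, i)\<in>Dl. fset (set (take i d) \<union> B) xi {x. R x d})"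

lemma holdsD: "holds Dl B d ==> (xi, R, i) \<in> Dl ==> fset (set (take i d) \<union> B) xi {x. R x d}"
 unfolding holds_def by blast

text \<open>Induction along \<open>r\<close>: requirements based exactly at \<open>g\<close> are cut
  behind the next entry \<open>e\<close> into a part about \<open>g\<close> and \<open>e\<close>,
  and a remainder based at \<open>g\<close> with \<open>e\<close>. The induction hypothesis meets
  the remainders again on a definable set, and \<open>uniform_forking\<close> finds
  \<open>e'\<close> in that set for which the first parts fork.\<close>

lemma extend_conditions:
 assumes ep: "extension_property_first_order L C"
 shows "r \<in> tup \<rho> ==> g \<in> tup ty ==> defp L C (ty @ \<rho>) Th ==> Th (g @ r) ==> finite Dl ==>
  (\<And>xi R i. (xi, R, i) \<in> Dl ==> stab xi (ty @ \<rho>) R \<and> length ty \<le> i) ==> holds Dl {} (g @ r) ==>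
  \<exists>\<chi>. defp L C ty \<chi> \<and> \<chi> g \<and> (\<forall>g'\<in>tup ty. \<chi> g' --> (\<forall>B. countable B --> B \<subseteq> U -->
   (\<exists>r'\<in>tup \<rho>. Th (g' @ r') \<and> holds Dl B (g' @ r'))))"
proof (induction \<rho> arbitrary: ty g r Th Dl)
 case Nil
 then have r: "r = []" by simp
 \<comment> \<open>Once the tuple is exhausted every base contains all parameters, and forking over
   a set that contains the parameters is inconsistency, a first-order condition.\<close>
 let ?\<chi> = "\<lambda>g. Th g \<and> (\<forall>q\<in>Dl. \<forall>x\<in>tup (fst q). \<not> fst (snd q) x g)"
 have st: "stab (fst q) ty (fst (snd q)) \<and> length ty \<le> snd (snd q)" if "q \<in> Dl" for q
  using Nil(6)[of "fst q" "fst (snd q)" "snd (snd q)"] that by simp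
 have "defp L C ty ?\<chi>"
  using Nil(3) st by (intro defp_conj defp_ball[OF Nil(5)] def2_all def2_neg) (auto dest: stab_def2)
 moreover have "?\<chi> g"
 proof (intro conjI ballI)
  show "Th g" using Nil(4) r by simp
  fix q x assume q: "q \<in> Dl" "x \<in> tup (fst q)"
  have "take (snd (snd q)) g = g" using st[OF q(1)] tuples_length[OF Nil(2)] by simp
  then have "fset (set g) (fst q) {x. fst (snd q) x g}"
   using holdsD[OF Nil(7), of "fst q" "fst (snd q)" "snd (snd q)"] q(1) r by simp
  then show "\<not> fst (snd q) x g"
   by (rule fset_inconsistent[OF stab_def2[OF conjunct1[OF st[OF q(1)]]] Nil(2) subset_refl tuples_set[OF Nil(2)] sm_finite[OF finite_set] _ q(2)])
 qed
 moreover have "holds Dl B g'" if "g' \<in> tup ty" "?\<chi> g'" for B g'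
  unfolding holds_def
 proof (intro ballI, clarify)
  fix xi R i assume "(xi, R, i) \<in> Dl"
  then have "\<forall>x\<in>tup xi. \<not> R x g'" using that(2) by fastforce
  then show "fset (set (take i g') \<union> B) xi {x. R x g'}" by (intro fset_mono[OF fset_empty]) auto
 qed
 ultimately show ?case by (intro exI[of _ ?\<chi>]) auto
next
 case (Cons s \<rho>)
 obtain e r1 where r: "r = e # r1" "e \<in> car s" "r1 \<in> tup \<rho>"
  using Cons.prems(1) tuples_length[OF Cons.prems(1)] by (cases r) simp_all
 let ?k = "Suc (length ty)"
 note lg = tuples_length[OF Cons.prems(2)]
 \<comment> \<open>The requirements based at \<open>g\<close>; those based further on are left to
   the induction hypothesis as they stand.\<close>
 define Dl0 where "Dl0 = {q \<in> Dl. snd (snd q) = length ty}"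
 have fin: "finite Dl0" "finite (Dl - Dl0)" using Cons.prems(5) by (auto simp: Dl0_def)
 have st: "stab (fst q) (ty @ s # \<rho>) (fst (snd q)) \<and> length ty \<le> snd (snd q)" if "q \<in> Dl" for q
  using Cons.prems(6)[of "fst q" "fst (snd q)" "snd (snd q)"] that by simp
 have gr: "g @ r \<in> tup (ty @ s # \<rho>)" using Cons.prems(1,2) by (simp add: tuples_appendI)
 have tk: "take ?k (g @ r) = g @ [e]" "take ?k (ty @ s # \<rho>) = ty @ [s]" using lg r(1) by simp_all
 have "\<exists>Z. stab (fst q) (ty @ [s]) Z \<and> fset (set g) (fst q) {x. Z x (g @ [e])} \<and>
  fset (set (g @ [e])) (fst q) {x. fst (snd q) x (g @ r) \<and> \<not> Z x (g @ [e])}" if q: "q \<in> Dl0" for q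
 proof -
  have "fset (set g) (fst q) {x. fst (snd q) x (g @ r)}"
   using holdsD[OF Cons.prems(7), of "fst q" "fst (snd q)" "snd (snd q)"] q lg by (simp add: Dl0_def)
  from decompose[where R = "fst (snd q)" and k = ?k, OF _ gr _ this] show ?thesis
   unfolding tk using st[of q] q by (auto simp: Dl0_def)
 qed
 then have "\<forall>q\<in>Dl0. \<exists>Z. stab (fst q) (ty @ [s]) Z \<and> fset (set g) (fst q) {x. Z x (g @ [e])} \<and>
  fset (set (g @ [e])) (fst q) {x. fst (snd q) x (g @ r) \<and> \<not> Z x (g @ [e])}" by blast
 from bchoice[OF this] obtain Z where Z: "\<forall>q\<in>Dl0. stab (fst q) (ty @ [s]) (Z q) \<and> fset (set g) (fst q) {x. Z q x (g @ [e])} \<and>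
  fset (set (g @ [e])) (fst q) {x. fst (snd q) x (g @ r) \<and> \<not> Z q x (g @ [e])}" ..
 let ?c = "\<lambda>q. (fst q, \<lambda>x d. fst (snd q) x d \<and> \<not> Z q x (take ?k d), ?k)"
 define Dl' where "Dl' = (Dl - Dl0) \<union> ?c ` Dl0"
 have co: "coord (ty @ s # \<rho>) (ty @ [s]) (take ?k)" by (rule coord_take') simp
 have "\<exists>\<chi>. defp L C (ty @ [s]) \<chi> \<and> \<chi> (g @ [e]) \<and> (\<forall>g'\<in>tup (ty @ [s]). \<chi> g' --> (\<forall>B. countable B --> B \<subseteq> U -->
   (\<exists>r'\<in>tup \<rho>. Th (g' @ r') \<and> holds Dl' B (g' @ r'))))"
 proof (rule Cons.IH[OF r(3)])
  show "g @ [e] \<in> tup (ty @ [s])" using Cons.prems(2) r(2) by (simp add: tuples_appendI)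
  show "defp L C ((ty @ [s]) @ \<rho>) Th" "Th ((g @ [e]) @ r1)" "finite Dl'"
   using Cons.prems(3,4) r(1) fin by (simp_all add: Dl'_def)
  show "stab xi ((ty @ [s]) @ \<rho>) R \<and> length (ty @ [s]) \<le> i" if mem: "(xi, R, i) \<in> Dl'" for xi R i
  proof (cases "(xi, R, i) \<in> Dl - Dl0")
   case True then show ?thesis using st[of "(xi, R, i)"] by (auto simp: Dl0_def)
  next
   case False
   then obtain q where q: "q \<in> Dl0" "(xi, R, i) = ?c q" using mem unfolding Dl'_def by blast
   have "stab (fst q) (ty @ s # \<rho>) (\<lambda>x d. fst (snd q) x d \<and> \<not> Z q x (take ?k d))"
   proof (intro stab_conj stab_neg stab_coord[OF _ coord_id co])
    show "stab (fst q) (ty @ s # \<rho>) (fst (snd q))" using st[of q] q(1) by (simp add: Dl0_def)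
    show "stab (fst q) (ty @ [s]) (Z q)" using bspec[OF Z q(1)] by blast
   qed
   then show ?thesis using q(2) by simp
  qed
  show "holds Dl' {} ((g @ [e]) @ r1)" unfolding holds_def
  proof (intro ballI, clarify)
   fix xi R i assume a: "(xi, R, i) \<in> Dl'"
   show "fset (set (take i ((g @ [e]) @ r1)) \<union> {}) xi {x. R x ((g @ [e]) @ r1)}"
   proof (cases "(xi, R, i) \<in> Dl - Dl0")
    case True then show ?thesis using holdsD[OF Cons.prems(7), of xi R i] r(1) by simp
   next
    case False
    then obtain q where q: "q \<in> Dl0" "(xi, R, i) = ?c q" using a unfolding Dl'_def by blast
    have "fset (set (g @ [e])) (fst q) {x. fst (snd q) x (g @ r) \<and> \<not> Z q x (g @ [e])}" using Z q(1) by blast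
    then show ?thesis using q(2) lg r(1) by simp
   qed
  qed
 qed
 then obtain \<chi>1 where \<chi>1: "defp L C (ty @ [s]) \<chi>1" "\<chi>1 (g @ [e])"
  and \<chi>1': "\<forall>g'\<in>tup (ty @ [s]). \<chi>1 g' --> (\<forall>B. countable B --> B \<subseteq> U --> (\<exists>r'\<in>tup \<rho>. Th (g' @ r') \<and> holds Dl' B (g' @ r')))"
  by (elim exE conjE)
 have \<chi>1ex: "\<exists>r'\<in>tup \<rho>. Th (g' @ r') \<and> holds Dl' B (g' @ r')"
  if "g' \<in> tup (ty @ [s])" "\<chi>1 g'" "countable B" "B \<subseteq> U" for g' B
  using bspec[OF \<chi>1' that(1)] that(2-4) by simp
 let ?S = "(\<lambda>q. (fst q, Z q)) ` Dl0"
 have "stab xi (ty @ [s]) R" if m: "(xi, R) \<in> ?S" for xi R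
 proof -
  from m obtain q where q: "q \<in> Dl0" "xi = fst q" "R = Z q" by (elim imageE Pair_inject)
  show ?thesis using bspec[OF Z q(1)] q(2,3) by simp
 qed
 note mg = merge[where S = "?S", OF finite_imageI[OF fin(1)] this]
 obtain xi R where R: "stab xi (ty @ [s]) R"
  and R'': "\<forall>d\<in>tup (ty @ [s]). \<forall>D. countable D --> D \<subseteq> U --> (fset D xi {x. R x d} \<longleftrightarrow> (\<forall>(xi, R)\<in>?S. fset D xi {x. R x d}))"
  by (rule exE[OF mg], assumption, elim exE conjE)
 have R': "fset D xi {x. R x d} \<longleftrightarrow> (\<forall>q\<in>Dl0. fset D (fst q) {x. Z q x d})" if "d \<in> tup (ty @ [s])" "countable D" "D \<subseteq> U" for d D
  using bspec[OF R'' that(1)] that(2,3) by simp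
 have cg: "countable (set u)" for u :: "'a list" by (simp add: countable_finite)
 have es: "[e] \<in> tup [s]" using r(2) by simp
 have "\<forall>q\<in>Dl0. fset (set g) (fst q) {x. Z q x (g @ [e])}" 
  by (rule ballI, drule bspec[OF Z], elim conjE)
 then have "fset (set g) xi {x. R x (g @ [e])}"
  by (rule iffD2[OF R'[OF tuples_appendI[OF Cons.prems(2) es] cg tuples_set[OF Cons.prems(2)]]])
 from uniform_forking[OF ep Cons.prems(2) es \<chi>1(1,2) R this] obtain \<chi> where \<chi>: "defp L C ty \<chi>" "\<chi> g"
  and \<chi>': "\<forall>g'\<in>tup ty. \<chi> g' --> (\<exists>e'\<in>tup [s]. \<chi>1 (g' @ e') \<and> fset (set g') xi {x. R x (g' @ e')})" by (elim exE conjE)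
 have "\<exists>r'\<in>tup (s # \<rho>). Th (g' @ r') \<and> holds Dl B (g' @ r')"
  if g': "g' \<in> tup ty" "\<chi> g'" and B: "countable B" "B \<subseteq> U" for g' B
 proof -
  obtain e' where e': "e' \<in> tup [s]" "\<chi>1 (g' @ e')" "fset (set g') xi {x. R x (g' @ e')}" using bspec[OF \<chi>' g'(1)] g'(2) by (elim impE bexE conjE)
  have ge: "g' @ e' \<in> tup (ty @ [s])" using tuples_appendI[OF g'(1) e'(1)] .
  have fZ: "fset (set g') (fst q) {x. Z q x (g' @ e')}" if "q \<in> Dl0" for q
   by (rule bspec[OF iffD1[OF R'[OF ge cg tuples_set[OF g'(1)]] e'(3)] that])
  have "set g' \<union> B \<subseteq> U" "countable (set g' \<union> B)" using tuples_set[OF g'(1)] B cg by auto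
  then obtain P where P: "smod P" "set g' \<union> B \<subseteq> P" using smod_ex by blast
  \<comment> \<open>Moving \<open>e'\<close> over \<open>g'\<close> away from a model around
    \<open>g'\<close> and \<open>B\<close> adds \<open>B\<close> to the base of the first
    parts.\<close>
  obtain h where h: "aut h" "\<forall>x\<in>set g'. h x = x" "\<And>xi R. def2 L C xi (ty @ [s]) R ==>
   fset (set g') xi {x. R x (g' @ e')} ==> misses P xi R (map h (g' @ e'))"
   using forks_misses[OF smodD(1,2)[OF P(1)] tuples_set[OF g'(1)] sm_finite[OF finite_set] tuples_set[OF ge] sm_finite[OF finite_set]] ge
   by blast
  obtain e1 where e1: "map h e' = [e1]" using aut_tup[OF h(1) e'(1)] by (rule tuples_singleE)
  have hge: "map h (g' @ e') = g' @ [e1]" using aut_fix_map[OF h(2) subset_refl] e1 by simp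
  have ge1: "g' @ [e1] \<in> tup (ty @ [s])" using aut_tup[OF h(1) ge] hge by simp
  have fZ1: "fset (set g' \<union> B) (fst q) {x. Z q x (g' @ [e1])}" if q: "q \<in> Dl0" for q
  proof -
   have s: "stab (fst q) (ty @ [s]) (Z q)" using bspec[OF Z q] by blast
   from misses_fset[OF s P ge1] h(3)[OF stab_def2[OF s] fZ[OF q]] show ?thesis unfolding hge by blast
  qed
  have "\<chi>1 (g' @ [e1])" using aut_defp[OF h(1) \<chi>1(1) ge] e'(2) hge by simp
  from \<chi>1ex[OF ge1 this B] obtain r' where r': "r' \<in> tup \<rho>" "Th ((g' @ [e1]) @ r')" "holds Dl' B ((g' @ [e1]) @ r')" by blast
  let ?d = "g' @ e1 # r'"
  have lg': "length g' = length ty" by (rule tuples_length[OF g'(1)])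
  have BU: "set (take ?k ?d) \<union> B \<subseteq> U"
   using tuples_set[OF ge1] B(2) lg' by simp
  have "holds Dl B ?d" unfolding holds_def
  proof (intro ballI, clarify)
   fix xi R i assume a: "(xi, R, i) \<in> Dl"
   show "fset (set (take i ?d) \<union> B) xi {x. R x ?d}"
   proof (cases "(xi, R, i) \<in> Dl0")
    case False
    then have "(xi, R, i) \<in> Dl'" using a by (simp add: Dl'_def)
    from holdsD[OF r'(3) this] show ?thesis by simp
   next
    case True
    then have "?c (xi, R, i) \<in> Dl'" unfolding Dl'_def by blast
    then have "(xi, \<lambda>x d. R x d \<and> \<not> Z (xi, R, i) x (take ?k d), ?k) \<in> Dl'" by simp
    from holdsD[OF r'(3) this] have "fset (set (take ?k ?d) \<union> B) xi {x. R x ?d \<and> \<not> Z (xi, R, i) x (g' @ [e1])}"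
     using lg' by simp
    from fset_base_mono[OF this _ BU, of "set g' \<union> B"]
    have "fset (set g' \<union> B) xi {x. R x ?d \<and> \<not> Z (xi, R, i) x (g' @ [e1])}" using lg' by auto
    \<comment> \<open>The remainder and the first part together cover \<open>R\<close>, both now
      over \<open>g'\<close> and \<open>B\<close>.\<close>
    from fset_Un[OF this fZ1[OF True, unfolded fst_conv]] have "fset (set g' \<union> B) xi {x. R x ?d}" by (rule fset_mono) auto
    then show ?thesis using True lg' by (simp add: Dl0_def)
   qed
  qed
  then show ?thesis using r'(1,2) ge1 g'(1) by (intro bexI[of _ "e1 # r'"]) auto
 qed
 then show ?case using \<chi>(1,2) by (intro exI[of _ \<chi>]) blast
qed

end

section \<open>Stable dependence and rank in terms of finitely many requirements\<close>

lemma coord_set: "coord sg ty r ==> length a = length sg ==> set (r a) \<subseteq> set a"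
 unfolding coord_def by (elim exE conjE) auto

lemma coord_sublist:
 assumes "set c' \<subseteq> set c" "c \<in> tuples M ty"
 shows "\<exists>r. coord ty (map (Sort M) c') r \<and> r c = c'"
proof -
 have "\<exists>ix. set ix \<subseteq> {..<length c} \<and> c' = map ((!) c) ix" using assms(1)
 proof (induction c')
  case (Cons x c')
  then obtain ix i where "set ix \<subseteq> {..<length c}" "c' = map ((!) c) ix" "i < length c" "c ! i = x"
   by (auto simp: in_set_conv_nth)
  then show ?case by (intro exI[of _ "i # ix"]) auto
 qed auto
 then obtain ix where ix: "set ix \<subseteq> {..<length c}" "c' = map ((!) c) ix" by blast
 have "map (Sort M) c' = map ((!) ty) ix" using ix tuples_sorts[OF assms(2)] by (auto simp: subset_iff)
 moreover have "\<forall>i\<in>set ix. i < length ty" using ix(1) tuples_length[OF assms(2)] by auto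
 ultimately have "coord ty (map (Sort M) c') (\<lambda>a. map ((!) a) ix)" by (intro coord_map_nth)
 then show ?thesis using ix(2) by blast
qed

context monster_model begin

lemma def2_iff: "def2 L C xi ty R ==> def2 L C xi ty S ==> def2 L C xi ty (\<lambda>x d. R x d = S x d)"
 by (rule defp_def2, rule defp_iff; rule def2_defp[OF _ coord_fst coord_snd])

lemma def2_eq: "def2 L C sg sg (\<lambda>x d. x = d)"
 using stab_eq by (rule stab_def2)

lemma def2_append: "defp L C (xi @ ty) P ==> def2 L C xi ty (\<lambda>x d. P (x @ d))"
 by (rule defp_def2) simp

lemma def2_ex: "def2 L C xi ty R ==> defp L C ty (\<lambda>d. \<exists>x\<in>tup xi. R x d)"
 by (rule defp_cong[OF defp_ex[OF def2_defp[OF _ coord_fst coord_snd]]]) (auto simp: tuples_length)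

text \<open>The form in which membership in a definable closure enters a condition: the tuple
  \<open>y\<close> is the one defined by \<open>Q\<close> from some of the parameters, and
  \<open>R\<close> relates it to others.\<close>

lemma defp_unique:
 assumes R: "def2 L C sg \<mu> R" "coord \<Lambda> \<mu> p" and Q: "def2 L C sg \<nu> Q" "coord \<Lambda> \<nu> q"
 shows "defp L C \<Lambda> (\<lambda>d. \<exists>y\<in>tup sg. R y (p d) \<and> (\<forall>y'\<in>tup sg. Q y' (q d) \<longleftrightarrow> y' = y))"
proof -
 let ?n = "length sg"
 have "def2 L C sg (sg @ \<Lambda>) (\<lambda>y' v. Q y' (q (drop ?n v)) = (y' = take ?n v))"
  by (rule def2_iff[OF def2_coord[OF Q(1) coord_id coord_comp[OF coord_snd Q(2)]] def2_coord[OF def2_eq coord_id coord_fst]])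
 from defp_conj[OF def2_defp[OF R(1) coord_fst coord_comp[OF coord_snd R(2)]] def2_all[OF this]]
 have "defp L C (sg @ \<Lambda>) (\<lambda>v. R (take ?n v) (p (drop ?n v)) \<and> (\<forall>y'\<in>tup sg. Q y' (q (drop ?n v)) = (y' = take ?n v)))" .
 from defp_ex[OF this] show ?thesis by (rule defp_cong) (simp add: tuples_length)
qed

lemma dcl_tuple:
 assumes a: "a \<in> tup sg" "set a \<subseteq> dcl L C B" and B: "B \<subseteq> U"
 shows "\<exists>u Q. set u \<subseteq> B \<and> def2 L C sg (srt u) Q \<and> (\<forall>y\<in>tup sg. Q y u \<longleftrightarrow> y = a)"
proof -
 note l = tuples_length[OF a(1)]
 have "\<exists>q. set (snd q) \<subseteq> B \<and> wff L ([sg ! i] @ srt (snd q)) (fst q) \<and>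
   {x \<in> car (sg ! i). sat C (x # snd q) (fst q)} = {a ! i}" if i: "i < length sg" for i
 proof -
  have "a ! i \<in> dcl L C B" "Sort C (a ! i) = sg ! i" using i a l tuples_nth[OF a(1) i] by (auto simp: carrier_of_def)
  then show ?thesis unfolding dcl_def formulas_over_def by fastforce
 qed
 then have "\<forall>i\<in>{..<length sg}. \<exists>q. set (snd q) \<subseteq> B \<and> wff L ([sg ! i] @ srt (snd q)) (fst q) \<and>
   {x \<in> car (sg ! i). sat C (x # snd q) (fst q)} = {a ! i}" by blast
 from bchoice[OF this] obtain q where q: "\<forall>i\<in>{..<length sg}. set (snd (q i)) \<subseteq> B \<and> wff L ([sg ! i] @ srt (snd (q i))) (fst (q i)) \<and>
   {x \<in> car (sg ! i). sat C (x # snd (q i)) (fst (q i))} = {a ! i}" ..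
 let ?P = "\<lambda>i w. sat C ([w ! i] @ drop (length sg) w) (fst (q i))"
 let ?G = "(\<lambda>i. (snd (q i), ?P i)) ` {..<length sg}"
 have "set u \<subseteq> B \<and> defp L C (sg @ srt u) P" if m: "(u, P) \<in> ?G" for u P
 proof -
  from m obtain i where i: "i < length sg" "u = snd (q i)" "P = ?P i" by auto
  have "wff L ([sg ! i] @ srt u) (fst (q i))" "set u \<subseteq> B" using q i by auto
  moreover have "coord (sg @ srt u) [sg ! i] (\<lambda>w. [w ! i])" by (rule coord_nth) (use i in \<open>auto simp: nth_append\<close>)
  ultimately show ?thesis unfolding i(3) using defp_coord[OF defp_wff coord_append[OF _ coord_snd]] by blast
 qed
 from over_conj[where G = ?G, OF finite_imageI[OF finite_lessThan] B this]
 obtain u P where u: "set u \<subseteq> B" "defp L C (sg @ srt u) P" "\<forall>x\<in>tup sg. P (x @ u) \<longleftrightarrow> (\<forall>(u, P)\<in>?G. P (x @ u))" by blast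
 have "P (y @ u) \<longleftrightarrow> y = a" if y: "y \<in> tup sg" for y
 proof -
  have "P (y @ u) \<longleftrightarrow> (\<forall>i\<in>{..<length sg}. sat C (y ! i # snd (q i)) (fst (q i)))"
   using bspec[OF u(3) y] tuples_length[OF y] by (simp add: nth_append)
  also have "\<dots> \<longleftrightarrow> (\<forall>i\<in>{..<length sg}. y ! i = a ! i)"
  proof (rule ball_cong[OF refl])
   fix i assume i: "i \<in> {..<length sg}"
   have "y ! i \<in> car (sg ! i)" using tuples_nth[OF y] i by simp
   then have "sat C (y ! i # snd (q i)) (fst (q i)) \<longleftrightarrow> y ! i \<in> {x \<in> car (sg ! i). sat C (x # snd (q i)) (fst (q i))}" by simp
   then show "sat C (y ! i # snd (q i)) (fst (q i)) \<longleftrightarrow> y ! i = a ! i" using bspec[OF q i] by simp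
  qed
  also have "\<dots> \<longleftrightarrow> y = a" using l tuples_length[OF y] by (auto intro: nth_equalityI)
  finally show ?thesis .
 qed
 then show ?thesis using u(1) def2_append[OF u(2)] by (intro exI[of _ u] exI[of _ "\<lambda>x d. P (x @ d)"]) blast
qed

lemma dcl_unique:
 assumes Q: "def2 L C sg \<mu> Q" and u: "u \<in> tup \<mu>" "set u \<subseteq> B" and B: "B \<subseteq> U" and a: "a \<in> tup sg" "\<forall>y\<in>tup sg. Q y u \<longleftrightarrow> y = a"
 shows "set a \<subseteq> dcl L C B"
proof
 fix x assume "x \<in> set a"
 then obtain i where i: "i < length sg" "x = a ! i" using tuples_length[OF a(1)] by (auto simp: in_set_conv_nth)
 let ?s = "sg ! i"
 have x: "x \<in> car ?s" using tuples_nth[OF a(1) i(1)] i(2) by simp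
 have "defp L C (sg @ [?s] @ \<mu>) (\<lambda>v. v ! i = v ! length sg \<and> Q (take (length sg) v) (drop 1 (drop (length sg) v)))"
  by (intro defp_conj defp_eq def2_defp[OF Q coord_fst coord_comp[OF coord_snd coord_drop']]) (use i in \<open>auto simp: nth_append\<close>)
 from defp_ex[OF this] obtain phi where phi: "wff L ([?s] @ \<mu>) phi" "\<forall>w\<in>tup ([?s] @ \<mu>).
  (\<exists>y\<in>tup sg. (y @ w) ! i = (y @ w) ! length sg \<and> Q (take (length sg) (y @ w)) (drop 1 (drop (length sg) (y @ w)))) \<longleftrightarrow> sat C w phi"
  unfolding defp_def by blast
 have "sat C (z # u) phi \<longleftrightarrow> z = x" if z: "z \<in> car ?s" for z
 proof -
  have "sat C (z # u) phi \<longleftrightarrow> (\<exists>y\<in>tup sg. y ! i = z \<and> Q y u)"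
   using bspec[OF phi(2), of "z # u"] z u(1) i(1) by (auto simp: tuples_length nth_append)
  then show ?thesis using a i(2) by auto
 qed
 then have "{z \<in> car ?s. sat C (z # u) phi} = {x}" using x by auto
 then show "x \<in> dcl L C B"
  unfolding dcl_def formulas_over_def using x phi(1) u tuples_sorts[OF u(1)] by (auto simp: carrier_of_def)
qed

lemma SU_se_ge_base: "SU_se_ge L C \<kappa> n a B ==> A \<subseteq> B ==> SU_se_ge L C \<kappa> n a A"
proof (cases n)
 case (Suc m)
 assume "SU_se_ge L C \<kappa> n a B" "A \<subseteq> B"
 then obtain B0 B1 where "B \<subseteq> B0" "B0 \<subseteq> B1" "small C \<kappa> B1" "\<not> stably_indep L C a B1 B0" "SU_se_ge L C \<kappa> m a B1"
  unfolding Suc SU_se_ge.simps by (elim exE conjE)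
 moreover have "A \<subseteq> B0" using \<open>A \<subseteq> B\<close> \<open>B \<subseteq> B0\<close> by (rule subset_trans)
 ultimately show ?thesis unfolding Suc SU_se_ge.simps by (intro exI conjI)
qed simp

lemma SU_se_ge_Suc: "SU_se_ge L C \<kappa> (Suc n) a A ==> SU_se_ge L C \<kappa> n a A"
proof (induction n arbitrary: A)
 case (Suc n)
 then obtain B0 B1 where "A \<subseteq> B0" "B0 \<subseteq> B1" "small C \<kappa> B1" "\<not> stably_indep L C a B1 B0" "SU_se_ge L C \<kappa> (Suc n) a B1"
  unfolding SU_se_ge.simps(2)[of _ _ _ "Suc n"] by (elim exE conjE)
 moreover from Suc.IH[OF this(5)] have "SU_se_ge L C \<kappa> n a B1" .
 ultimately show ?case unfolding SU_se_ge.simps(2)[of _ _ _ n] by (intro exI conjI)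
qed simp

lemma SU_se_ge_le: "SU_se_ge L C \<kappa> n a A ==> m \<le> n ==> SU_se_ge L C \<kappa> m a A"
 by (induction n) (auto simp del: SU_se_ge.simps(2) simp: le_Suc_eq dest: SU_se_ge_Suc)

end

context simple_monster begin

text \<open>Stable dependence mentions a canonical parameter in the definable closure of
  \<open>B1\<close>. Quantifying over its class replaces it by real parameters from
  \<open>B1\<close>; membership of \<open>y\<close> in the definable closure of \<open>B0\<close>
  and \<open>c\<close> is turned into the formula \<open>Q\<close>.\<close>

lemma stably_dependent_witness:
 assumes nd: "\<not> stably_indep L C [c] B1 B0" and B: "B0 \<subseteq> U" "B1 \<subseteq> U" and c: "c \<in> U"
 shows "\<exists>sg u b Q R y. set u \<subseteq> B0 \<union> {c} \<and> set b \<subseteq> B1 \<and> def2 L C sg (srt u) Q \<and> stab sg (srt b) R \<and>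
  y \<in> tup sg \<and> (\<forall>y'\<in>tup sg. Q y' u \<longleftrightarrow> y' = y) \<and> R y b \<and> fset B0 sg {x. R x b}"
proof -
 obtain sg ty phi b y where w: "b \<in> tup ty" "stable_formula L C sg ty phi" "canonical_parameter C sg phi b \<in> dcl_imaginaries L C ty B1"
  "y \<in> tup sg" "set y \<subseteq> dcl L C (B0 \<union> set [c])" "sat C (y @ b) phi" "divides L C B0 sg phi b"
  using nd unfolding stably_indep_def by (simp only: not_all not_imp not_not bex_simps ball_simps) (elim exE bexE conjE, rule that)
 obtain psi v where psi: "set v \<subseteq> B1" "wff L (ty @ srt v) psi" "canonical_parameter C sg phi b = {b' \<in> tup ty. sat C (b' @ v) psi}"
  using w(3) unfolding dcl_imaginaries_def formulas_over_def by auto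
 have vt: "v \<in> tup (srt v)" using psi(1) B by (intro tuples_self) auto
 have st: "wff L (sg @ ty) phi" "stab sg ty (\<lambda>x d. sat C (x @ d) phi)" using w(2) unfolding stable_formula_stab by blast+
 let ?phi = "\<lambda>x d. sat C (x @ d) phi"
 let ?E = "\<lambda>d' d. \<forall>x\<in>tup sg. ?phi x d' = ?phi x d"
 \<comment> \<open>\<open>w\<close> codes the class of \<open>d\<close>: the formula
   \<open>psi\<close> with parameters \<open>w\<close> defines exactly the tuples that give the same
   instance of \<open>phi\<close> as \<open>d\<close>. Hence every nonempty instance of
   \<open>?R\<close> is an instance of \<open>phi\<close>, which makes \<open>?R\<close>
   stable.\<close>
 let ?Cls = "\<lambda>d w. \<forall>d'\<in>tup ty. sat C (d' @ w) psi = ?E d' d"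
 let ?R = "\<lambda>x w. \<exists>d\<in>tup ty. ?Cls d w \<and> ?phi x d"
 note phi2 = stab_def2[OF st(2)]
 have E2: "def2 L C ty ty ?E" by (rule defp_def2[OF defp_all_iff[OF phi2 phi2]])
 have "def2 L C ty (ty @ srt v) (\<lambda>d' z. sat C (d' @ drop (length ty) z) psi = ?E d' (take (length ty) z))"
  by (rule def2_iff[OF def2_coord[OF def2_wff[OF psi(2)] coord_id coord_snd] def2_coord[OF E2 coord_id coord_fst]])
 from defp_def2[OF def2_all[OF this]] have Cls: "def2 L C ty (srt v) ?Cls" .
 have "defp L C (ty @ sg @ srt v) (\<lambda>z. ?Cls (take (length ty) z) (drop (length sg) (drop (length ty) z)) \<and>
   ?phi (take (length sg) (drop (length ty) z)) (take (length ty) z))"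
  by (rule defp_conj[OF def2_defp[OF Cls coord_fst coord_comp[OF coord_snd coord_snd]] def2_defp[OF phi2 coord_slice coord_fst]]) simp
 from def2_append[OF defp_ex[OF this]] have "def2 L C sg (srt v) ?R"
  by (rule def2_cong) (simp add: tuples_length cong: bex_cong)
 then have R: "stab sg (srt v) ?R"
 proof (rule stab_instances[OF st(2)])
  fix w :: "'a list"
  show "(\<forall>x\<in>tup sg. \<not> ?R x w) \<or> (\<exists>d\<in>tup ty. \<forall>x\<in>tup sg. ?R x w = ?phi x d)"
  proof (cases "\<exists>d\<in>tup ty. ?Cls d w")
   case True
   then obtain d where d: "d \<in> tup ty" "?Cls d w" ..
   have "?R x w = ?phi x d" if x: "x \<in> tup sg" for x
   proof
    assume "?R x w"
    then obtain d2 where d2: "d2 \<in> tup ty" "?Cls d2 w" "?phi x d2" by (elim bexE conjE)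
    have "sat C (d2 @ w) psi" using bspec[OF d2(2) d2(1)] by simp
    then have "?E d2 d" using bspec[OF d(2) d2(1)] by simp
    then show "?phi x d" using d2(3) x by blast
   qed (use d in blast)
   then show ?thesis using d(1) by blast
  qed blast
 qed
 have "?Cls b v"
 proof
  fix d' assume d': "d' \<in> tup ty"
  have "d' \<in> canonical_parameter C sg phi b \<longleftrightarrow> ?E d' b" using d' unfolding canonical_parameter_def tuples_sorts[OF w(1)] by simp
  then show "sat C (d' @ v) psi = ?E d' b" using d' unfolding psi(3) by simp
 qed
 moreover have "?phi x b" if hx: "?R x v" "x \<in> tup sg" for x
 proof -
  obtain d where d: "d \<in> tup ty" "?Cls d v" "?phi x d" using hx(1) by (elim bexE conjE)
  have "sat C (b @ v) psi" using bspec[OF \<open>?Cls b v\<close> w(1)] by simp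
  then have "?E b d" using bspec[OF d(2) w(1)] by simp
  then show ?thesis using d(3) hx(2) by blast
 qed
 ultimately have Rb: "?R x v \<longleftrightarrow> ?phi x b" if "x \<in> tup sg" for x using w(1) that by blast
 obtain k where "kdiv k B0 sg ty ?phi b" using w(7) divides_kdiv[OF w(1), of sg ?phi phi B0] by blast
 from kdiv_fset[OF this phi2 w(1)] have f: "fset B0 sg {x. ?R x v}" by (rule fset_mono) (simp only: mem_Collect_eq Rb)
 have r: "?R y v" using Rb[OF w(4)] w(6) by blast
 have "B0 \<union> set [c] \<subseteq> U" using B c by auto
 from dcl_tuple[OF w(4,5) this] obtain u Q where u: "set u \<subseteq> B0 \<union> set [c]" "def2 L C sg (srt u) Q" "\<forall>y'\<in>tup sg. Q y' u \<longleftrightarrow> y' = y"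
  by (elim exE conjE)
 have "set u \<subseteq> B0 \<union> {c}" using u(1) by simp
 then show ?thesis
  by (rule_tac exI[where x = sg], rule_tac exI[where x = u], rule_tac exI[where x = v], rule_tac exI[where x = Q],
    rule_tac exI[where x = ?R], rule_tac exI[where x = y]) (intro conjI psi(1) u(2,3) R w(4) r f)
qed

lemma stably_dependentI:
 assumes R: "stab sg \<mu> R" and b: "b \<in> tup \<mu>" "set b \<subseteq> B1" and B0: "B0 \<subseteq> U" "countable B0"
  and y: "y \<in> tup sg" "set y \<subseteq> dcl L C (B0 \<union> {c})" "R y b" and f: "fset B0 sg {x. R x b}"
 shows "\<not> stably_indep L C [c] B1 B0"
proof -
 obtain phi where phi: "wff L (sg @ \<mu>) phi" "\<forall>x\<in>tup sg. \<forall>d\<in>tup \<mu>. R x d \<longleftrightarrow> sat C (x @ d) phi" using stab_def2[OF R] unfolding def2_def by (elim exE conjE)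
 have "stab sg \<mu> (\<lambda>x d. sat C (x @ d) phi)" by (rule stab_cong[OF R]) (use phi(2) in blast)
 then have st: "stable_formula L C sg \<mu> phi" unfolding stable_formula_stab using phi(1) by blast
 note phi2 = def2_wff[OF phi(1), of C]
 obtain psi where psi: "wff L (\<mu> @ \<mu>) psi" "\<forall>w\<in>tup (\<mu> @ \<mu>). (\<forall>x\<in>tup sg. sat C (x @ take (length \<mu>) w) phi = sat C (x @ drop (length \<mu>) w) phi) \<longleftrightarrow> sat C w psi"
  using defp_all_iff[OF phi2 phi2] unfolding defp_def by (elim exE conjE)
 have "canonical_parameter C sg phi b = {b' \<in> tup \<mu>. sat C (b' @ b) psi}"
  unfolding canonical_parameter_def tuples_sorts[OF b(1)]
 proof (rule Collect_cong, rule conj_cong[OF refl])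
  fix b' assume b': "b' \<in> tup \<mu>"
  show "(\<forall>a\<in>tup sg. sat C (a @ b') phi = sat C (a @ b) phi) = sat C (b' @ b) psi"
   using bspec[OF psi(2) tuples_appendI[OF b' b(1)]] tuples_length[OF b'] by simp
 qed
 then have cp: "canonical_parameter C sg phi b \<in> dcl_imaginaries L C \<mu> B1"
  unfolding dcl_imaginaries_def formulas_over_def using psi(1) b(2) tuples_sorts[OF b(1)] by auto
 obtain n where "\<not> lad n sg \<mu> R" using R unfolding stab_def by (elim conjE exE)
 from stab_kdiv[OF R this b(1) B0(2,1) f] have dv: "divides L C B0 sg phi b"
  using divides_kdiv[OF b(1), of sg R phi B0] phi(2) by blast
 show ?thesis
 proof
  assume i: "stably_indep L C [c] B1 B0"
  have "\<exists>a'\<in>tup sg. set a' \<subseteq> dcl L C (B0 \<union> set [c]) \<and> sat C (a' @ b) phi" using y phi(2) b(1) by auto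
  then show False using i st cp dv b(1) unfolding stably_indep_def by blast
 qed
qed

text \<open>Each of the \<open>n\<close> dependences uses finitely many elements: parameters
  \<open>b0\<close> from \<open>B0\<close> that, with \<open>c\<close>, define the tuple, and
  parameters \<open>b1\<close> from \<open>B1\<close> of the forking instance. Forking over
  \<open>B0\<close> is retained over the subset formed by \<open>g\<close> and \<open>b0\<close>,
  which is the base of the new requirement.\<close>

lemma rank_conditions:
 assumes c: "c \<in> car s"
 shows "g \<in> tup ty ==> SU_se_ge L C \<kappa> n [c] (set g) ==>
  \<exists>\<beta> b \<Psi> Dl. b \<in> tup \<beta> \<and> defp L C (ty @ \<beta> @ [s]) \<Psi> \<and> finite Dl \<and>
   (\<forall>q\<in>Dl. stab (fst q) (ty @ \<beta> @ [s]) (fst (snd q)) \<and> snd (snd q) \<le> length ty + length \<beta>) \<and>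
   \<Psi> (g @ b @ [c]) \<and> holds Dl {} (g @ b @ [c]) \<and>
   (\<forall>g'\<in>tup ty. \<forall>b'\<in>tup \<beta>. \<forall>c'\<in>car s. \<Psi> (g' @ b' @ [c']) --> holds Dl {} (g' @ b' @ [c']) --> SU_se_ge L C \<kappa> n [c'] (set g'))"
proof (induction n arbitrary: ty g)
 case 0
 show ?case
  by (rule exI[of _ "[]"], rule exI[of _ "[]"], rule exI[of _ "\<lambda>_. True"], rule exI[of _ "{}"])
   (simp add: defp_const holds_def)
next
 case (Suc n)
 from Suc.prems(2) obtain B0 B1 where B: "set g \<subseteq> B0" "B0 \<subseteq> B1" "small C \<kappa> B1" "\<not> stably_indep L C [c] B1 B0" "SU_se_ge L C \<kappa> n [c] B1"
  unfolding SU_se_ge.simps by (elim exE conjE)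
 have BU: "B0 \<subseteq> U" "B1 \<subseteq> U" using B(2,3) by (auto simp: small_def)
 have cU: "c \<in> U" using c by (simp add: carrier_of_def)
 obtain sg u b1 Q R y where w: "set u \<subseteq> B0 \<union> {c}" "set b1 \<subseteq> B1" "def2 L C sg (srt u) Q" "stab sg (srt b1) R"
  "y \<in> tup sg" "\<forall>y'\<in>tup sg. Q y' u \<longleftrightarrow> y' = y" "R y b1" "fset B0 sg {x. R x b1}"
  using stably_dependent_witness[OF B(4) BU cU] by (elim exE conjE)
 \<comment> \<open>The element \<open>c\<close> may occur in \<open>u\<close>. It is removed, since
   it need not lie in \<open>B0\<close> and is supplied by the last coordinate.\<close>
 define b0 where "b0 = filter (\<lambda>x. x \<noteq> c) u"
 have b0: "set b0 \<subseteq> B0" "set u \<subseteq> set (b0 @ [c])" using w(1) by (auto simp: b0_def)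
 define \<beta>0 where "\<beta>0 = srt b0"
 define \<beta>1 where "\<beta>1 = srt b1"
 have t0: "b0 \<in> tup \<beta>0" unfolding \<beta>0_def by (rule tuples_self) (use b0(1) BU in auto)
 have t1: "b1 \<in> tup \<beta>1" unfolding \<beta>1_def by (rule tuples_self) (use w(2) BU in auto)
 have ct: "[c] \<in> tup [s]" using c by simp
 obtain r where r: "coord (\<beta>0 @ [s]) (srt u) r" "r (b0 @ [c]) = u"
  using coord_sublist[OF b0(2) tuples_appendI[OF t0 ct]] by blast
 have "set (g @ b0 @ b1) \<subseteq> B1" using B(1,2) b0(1) w(2) by auto
 from SU_se_ge_base[OF B(5) this] have "SU_se_ge L C \<kappa> n [c] (set (g @ b0 @ b1))" .
 from Suc.IH[OF tuples_appendI[OF Suc.prems(1) tuples_appendI[OF t0 t1]] this]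
 obtain \<beta>2 b2 \<Psi> Dl where IH: "b2 \<in> tup \<beta>2" "defp L C ((ty @ \<beta>0 @ \<beta>1) @ \<beta>2 @ [s]) \<Psi>" "finite Dl"
   "\<forall>q\<in>Dl. stab (fst q) ((ty @ \<beta>0 @ \<beta>1) @ \<beta>2 @ [s]) (fst (snd q)) \<and> snd (snd q) \<le> length (ty @ \<beta>0 @ \<beta>1) + length \<beta>2"
   "\<Psi> ((g @ b0 @ b1) @ b2 @ [c])" "holds Dl {} ((g @ b0 @ b1) @ b2 @ [c])"
  and IHs: "\<forall>g'\<in>tup (ty @ \<beta>0 @ \<beta>1). \<forall>b'\<in>tup \<beta>2. \<forall>c'\<in>car s. \<Psi> (g' @ b' @ [c']) --> holds Dl {} (g' @ b' @ [c']) --> SU_se_ge L C \<kappa> n [c'] (set g')"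
  by (elim exE conjE)
 define \<Lambda> where "\<Lambda> = ty @ (\<beta>0 @ \<beta>1 @ \<beta>2) @ [s]"
 have \<Lambda>: "(ty @ \<beta>0 @ \<beta>1) @ \<beta>2 @ [s] = \<Lambda>" by (simp add: \<Lambda>_def)
 define p0 where "p0 d = take (length \<beta>0) (drop (length ty) d)" for d :: "'a list"
 define p1 where "p1 d = take (length \<beta>1) (drop (length ty + length \<beta>0) d)" for d :: "'a list"
 define pc where "pc d = drop (length (ty @ \<beta>0 @ \<beta>1 @ \<beta>2)) d" for d :: "'a list"
 have co: "coord \<Lambda> \<beta>0 p0" "coord \<Lambda> \<beta>1 p1" "coord \<Lambda> [s] pc"
  unfolding p0_def p1_def pc_def by (rule coord_slice coord_drop', simp add: \<Lambda>_def)+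
 have pv: "p0 (g' @ (a0 @ a1 @ a2) @ [c']) = a0" "p1 (g' @ (a0 @ a1 @ a2) @ [c']) = a1" "pc (g' @ (a0 @ a1 @ a2) @ [c']) = [c']"
  if "g' \<in> tup ty" "a0 \<in> tup \<beta>0" "a1 \<in> tup \<beta>1" "a2 \<in> tup \<beta>2" for g' a0 a1 a2 c'
  using tuples_length[OF that(1)] tuples_length[OF that(2)] tuples_length[OF that(3)] tuples_length[OF that(4)]
  by (simp_all add: p0_def p1_def pc_def)
 let ?W = "\<lambda>d. \<exists>y\<in>tup sg. R y (p1 d) \<and> (\<forall>y'\<in>tup sg. Q y' (r (p0 d @ pc d)) \<longleftrightarrow> y' = y)"
 have W: "defp L C \<Lambda> ?W"
  by (rule defp_unique[OF stab_def2[OF w(4)[folded \<beta>1_def]] co(2) w(3) coord_comp[OF coord_append[OF co(1,3)] r(1)]])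
 let ?k = "length ty + length \<beta>0"
 \<comment> \<open>Index \<open>?k\<close> ends the base after \<open>b0\<close>, before the
   parameters of the forking instance.\<close>
 let ?Dl = "insert (sg, \<lambda>x d. R x (p1 d), ?k) Dl"
 let ?b = "b0 @ b1 @ b2"
 have stR: "stab sg \<Lambda> (\<lambda>x d. R x (p1 d))" by (rule stab_coord[OF w(4)[folded \<beta>1_def] coord_id co(2)])
 have tk: "take ?k (g' @ (a0 @ a1 @ a2) @ [c']) = g' @ a0" if "g' \<in> tup ty" "a0 \<in> tup \<beta>0" for g' a0 a1 a2 c'
  using tuples_length[OF that(1)] tuples_length[OF that(2)] by simp
 note P = Suc.prems(1) t0 t1 IH(1)
 show ?case
 proof (rule exI[of _ "\<beta>0 @ \<beta>1 @ \<beta>2"], rule exI[of _ ?b], rule exI[of _ "\<lambda>d. \<Psi> d \<and> ?W d"], rule exI[of _ ?Dl], intro conjI)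
  show "?b \<in> tup (\<beta>0 @ \<beta>1 @ \<beta>2)" using t0 t1 IH(1) by (simp add: tuples_appendI)
  show "defp L C (ty @ (\<beta>0 @ \<beta>1 @ \<beta>2) @ [s]) (\<lambda>d. \<Psi> d \<and> ?W d)" using defp_conj[OF IH(2)[unfolded \<Lambda>] W] unfolding \<Lambda>_def .
  show "finite ?Dl" using IH(3) by simp
  show "\<forall>q\<in>?Dl. stab (fst q) (ty @ (\<beta>0 @ \<beta>1 @ \<beta>2) @ [s]) (fst (snd q)) \<and> snd (snd q) \<le> length ty + length (\<beta>0 @ \<beta>1 @ \<beta>2)"
   using IH(4)[unfolded \<Lambda>] stR unfolding \<Lambda>_def by (simp add: add.assoc)
  show "\<Psi> (g @ ?b @ [c])" using IH(5) by simp
  show "?W (g @ ?b @ [c])" unfolding pv[OF P] r(2) using w(5-7) by blast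
  have "set (g @ b0) \<subseteq> B0" using B(1) b0(1) by simp
  from fset_base_mono[OF w(8) this BU(1)] have "fset (set (g @ b0)) sg {x. R x b1}" .
  then have "fset (set (take ?k (g @ ?b @ [c])) \<union> {}) sg {x. R x (p1 (g @ ?b @ [c]))}"
   unfolding tk[OF P(1,2)] pv[OF P] by simp
  then show "holds ?Dl {} (g @ ?b @ [c])" using IH(6) unfolding holds_def by simp
  show "\<forall>g'\<in>tup ty. \<forall>b'\<in>tup (\<beta>0 @ \<beta>1 @ \<beta>2). \<forall>c'\<in>car s. \<Psi> (g' @ b' @ [c']) \<and> ?W (g' @ b' @ [c']) -->
   holds ?Dl {} (g' @ b' @ [c']) --> SU_se_ge L C \<kappa> (Suc n) [c'] (set g')"
  proof (intro ballI impI, elim conjE)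
   fix g' b' c' assume g': "g' \<in> tup ty" and b': "b' \<in> tup (\<beta>0 @ \<beta>1 @ \<beta>2)" and c': "c' \<in> car s"
    and \<Psi>': "\<Psi> (g' @ b' @ [c'])" and W': "?W (g' @ b' @ [c'])" and h': "holds ?Dl {} (g' @ b' @ [c'])"
   obtain a0 a12 where a0: "b' = a0 @ a12" "a0 \<in> tup \<beta>0" "a12 \<in> tup (\<beta>1 @ \<beta>2)" by (rule tuples_appendE[OF b'])
   obtain a1 a2 where a12: "a12 = a1 @ a2" "a1 \<in> tup \<beta>1" "a2 \<in> tup \<beta>2" by (rule tuples_appendE[OF a0(3)])
   have be: "b' = a0 @ a1 @ a2" using a0(1) a12(1) by simp
   note P' = g' a0(2) a12(2,3)
   let ?B0 = "set (g' @ a0)" and ?B1 = "set (g' @ a0 @ a1)"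
   have B1U: "?B1 \<subseteq> U" using tuples_set[OF g'] tuples_set[OF a0(2)] tuples_set[OF a12(2)] by simp
   have c't: "[c'] \<in> tup [s]" using c' by simp
   have "holds Dl {} (g' @ b' @ [c'])" using h' unfolding holds_def by simp
   then have "SU_se_ge L C \<kappa> n [c'] ?B1"
    using bspec[OF bspec[OF bspec[OF IHs tuples_appendI[OF g' tuples_appendI[OF a0(2) a12(2)]]] a12(3)] c'] \<Psi>' unfolding be by simp
   moreover have "\<not> stably_indep L C [c'] ?B1 ?B0"
   proof -
    obtain z where z: "z \<in> tup sg" "R z a1" "\<forall>y'\<in>tup sg. Q y' (r (a0 @ [c'])) \<longleftrightarrow> y' = z"
     using W' unfolding be pv[OF P'] by blast
    have "fset (set (take ?k (g' @ b' @ [c'])) \<union> {}) sg {x. R x (p1 (g' @ b' @ [c']))}" using h' unfolding holds_def by simp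
    then have f: "fset ?B0 sg {x. R x a1}" unfolding be tk[OF P'(1,2)] pv[OF P'] by simp
    have ac: "a0 @ [c'] \<in> tup (\<beta>0 @ [s])" by (rule tuples_appendI[OF a0(2) c't])
    have "set z \<subseteq> dcl L C (?B0 \<union> {c'})"
    proof (rule dcl_unique[OF w(3) coord_tuples[OF r(1) ac] _ _ z(1,3)])
     show "set (r (a0 @ [c'])) \<subseteq> ?B0 \<union> {c'}" using coord_set[OF r(1) tuples_length[OF ac]] by auto
     show "?B0 \<union> {c'} \<subseteq> U" using B1U c' by (auto simp: carrier_of_def)
    qed
    from stably_dependentI[OF w(4)[folded \<beta>1_def] a12(2) _ _ _ z(1) this z(2) f, of ?B1] show ?thesis
     using B1U by (simp add: countable_finite subset_iff)
   qed
   moreover have "small C \<kappa> ?B1" using B1U sm_finite[of ?B1] unfolding small_def sm_def by blast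
   moreover have "set g' \<subseteq> ?B0" "?B0 \<subseteq> ?B1" by auto
   ultimately show "SU_se_ge L C \<kappa> (Suc n) [c'] (set g')" unfolding SU_se_ge.simps by (intro exI conjI)
  qed
 qed
qed

end

section \<open>Values of definable functions and open sets of unbounded rank\<close>

context monster_model begin

text \<open>The values at the finitely many conjugates of \<open>a\<close> form a finite set that
  contains all conjugates of \<open>c\<close>.\<close>

lemma acl_value:
 assumes phi: "wff L [s', s] phi" and a: "a \<in> car s" "a \<in> acl L C {}" and c: "{x \<in> car s'. sat C [x, a] phi} = {c}"
 shows "c \<in> acl L C {}"
proof (rule ccontr)
 assume n: "c \<notin> acl L C {}"
 have cs: "c \<in> car s'" "sat C [c, a] phi" using c by auto
 let ?O = "{h a | h. aut h \<and> (\<forall>x\<in>{}. h x = x)}"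
 define P where "P = {x \<in> U. \<exists>y\<in>?O. {z \<in> car s'. sat C [z, y] phi} = {x}}"
 have "P \<subseteq> (\<lambda>y. THE x. {z \<in> car s'. sat C [z, y] phi} = {x}) ` ?O"
 proof
  fix x assume "x \<in> P"
  then obtain y where y: "y \<in> ?O" "{z \<in> car s'. sat C [z, y] phi} = {x}" unfolding P_def by blast
  have "(THE x. {z \<in> car s'. sat C [z, y] phi} = {x}) = x" unfolding y(2) by auto
  then show "x \<in> (\<lambda>y. THE x. {z \<in> car s'. sat C [z, y] phi} = {x}) ` ?O" using y(1) by (intro image_eqI) auto
 qed
 then have "finite P" by (rule finite_subset) (intro finite_imageI acl_orbit[OF a(2) empty_subsetI])
 then obtain h where h: "aut h" "h c \<notin> P"
  using orbit_outside[OF cs(1) n _ sm_finite _ sm_finite[of P]] by (auto simp: P_def)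
 have at: "[z, a] \<in> tup [s', s]" if "z \<in> car s'" for z using that a(1) by simp
 obtain g where g: "aut g" "\<And>x. x \<in> U ==> g (h x) = x" "\<And>x. x \<in> U ==> h (g x) = x" using aut_inv[OF h(1)] by blast
 have zh: "z = h c" if z: "z \<in> car s'" "sat C [z, h a] phi" for z
 proof -
  have zU: "z \<in> U" using z by (simp add: carrier_of_def)
  have gz: "g z \<in> car s'" using aut_car[OF zU g(1)] z(1) by simp
  have "sat C [g z, a] phi" using aut_sat[OF h(1) phi at[OF gz]] z(2) g(3)[OF zU] by simp
  then have "g z \<in> {x \<in> car s'. sat C [x, a] phi}" using gz by simp
  then have "g z = c" unfolding c by simp
  then show ?thesis using g(3)[OF zU] by simp
 qed
 have hc: "h c \<in> car s'" "h c \<in> U" using aut_car[OF _ h(1), of c s'] cs(1) by (simp_all add: carrier_of_def)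
 have "sat C [h c, h a] phi" using aut_sat[OF h(1) phi at[OF cs(1)]] cs(2) by simp
 then have A: "{z \<in> car s'. sat C [z, h a] phi} = {h c}"
  by (intro equalityI subsetI) (simp_all add: zh hc(1))
 have B: "h a \<in> ?O" using h(1) by (intro CollectI exI[of _ h]) simp
 have "h c \<in> P" unfolding P_def by (rule CollectI, rule conjI[OF hc(2)], rule bexI[where x = "h a"]) (rule A, rule B)
 then show False using h(2) by (rule notE[rotated])
qed

lemma value_acl:
 assumes phi: "wff L [s', s] phi" and a: "a \<in> car s" and c: "{x \<in> car s'. sat C [x, a] phi} = {c}"
 shows "c \<in> acl L C {a}"
proof -
 have "c \<in> car s'" "sat C [c, a] phi" using c by auto
 moreover from this have "Sort C c = s'" "c \<in> U" by (auto simp: carrier_of_def)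
 ultimately show ?thesis unfolding acl_def formulas_over_def using phi a c
  by (intro CollectI conjI bexI[of _ "(phi, [a])"]) (auto simp: carrier_of_def)
qed

text \<open>The conclusion of the theorem, negated: the source of points of large rank in open
  sets.\<close>

definition no_bounded_open :: bool where
 "no_bounded_open \<longleftrightarrow> \<not> (\<exists>A sg W. finite A \<and> A \<subseteq> U \<and> tau_f_inf_open L C sg A W \<and>
  unbounded L C A W \<and> bounded_finite_SU_se L C \<kappa> sg A W)"

text \<open>If no point of \<open>W\<close> had rank at least \<open>n\<close>, the finite set of
  ranks on \<open>W\<close> would have a maximum, and \<open>W\<close> would be an unbounded open
  set of bounded finite rank.\<close>

lemma rank_unbounded:
 assumes H: no_bounded_open and A: "finite A" "A \<subseteq> U" and W: "tau_f_basic L C sg A W" "type_definable L C sg A W" "unbounded L C A W"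
 shows "\<exists>x\<in>W. SU_se_ge L C \<kappa> n x A"
proof (rule ccontr)
 assume no: "\<not> ?thesis"
 obtain \<Gamma> where \<Gamma>: "\<Gamma> \<subseteq> formulas_over L C sg A" "W = {a \<in> tup sg. \<forall>(phi, c)\<in>\<Gamma>. sat C (a @ c) phi}"
  using W(2) unfolding type_definable_def by (elim exE conjE)
 have Wt: "a \<in> tup sg" if "a \<in> W" for a using that \<Gamma>(2) by blast
 \<comment> \<open>A type-definable set over \<open>A\<close> is a union of sets of realisations, so
   it is recovered from its set of types.\<close>
 have inv: "b \<in> W" if "a \<in> W" "b \<in> tup sg" "tp L C b A = tp L C a A" for a b
 proof -
  have "sat C (b @ c) phi" if q: "(phi, c) \<in> \<Gamma>" for phi c
  proof -
   have "(phi, c) \<in> tp L C a A" using q \<Gamma> \<open>a \<in> W\<close> unfolding tp_def tuples_sorts[OF Wt[OF \<open>a \<in> W\<close>]] by auto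
   then have "(phi, c) \<in> tp L C b A" using \<open>tp L C b A = tp L C a A\<close> by simp
   then show ?thesis by (simp add: tp_def)
  qed
  then show ?thesis using \<Gamma>(2) \<open>b \<in> tup sg\<close> by blast
 qed
 let ?V = "(\<lambda>a. tp L C a A) ` W"
 have Weq: "W = (\<Union>p\<in>?V. realisations L C sg A p)"
 proof
  show "W \<subseteq> (\<Union>p\<in>?V. realisations L C sg A p)" using Wt unfolding realisations_def by auto
  show "(\<Union>p\<in>?V. realisations L C sg A p) \<subseteq> W" using inv unfolding realisations_def by auto
 qed
 have "openin (tau_f L C sg A) ?V" unfolding tau_f_def
  by (rule topology_generated_by_Basis) (use W(1) in blast)
 then have o: "tau_f_open L C sg A W" unfolding tau_f_open_def using Weq by blast
 have "openin (tau_f_inf L C sg A) ?V" unfolding tau_f_inf_def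
  by (rule topology_generated_by_Basis) (use o W(2) in blast)
 then have oi: "tau_f_inf_open L C sg A W" unfolding tau_f_inf_open_def using Weq by blast
 have le: "SU_se L C \<kappa> x A \<le> enat n" if "x \<in> W" for x
 proof -
  have "m \<le> n" if "SU_se_ge L C \<kappa> m x A" for m
   using SU_se_ge_le[OF that, of n] no \<open>x \<in> W\<close> by (meson nat_le_linear)
  then show ?thesis unfolding SU_se_def by (auto intro!: SUP_least)
 qed
 define R where "R = {SU_se L C \<kappa> a A | p a. p \<in> type_space L C sg A \<and>
        realisations L C sg A p \<subseteq> W \<and> a \<in> realisations L C sg A p}"
 have Rn: "r \<le> enat n" if "r \<in> R" for r using that le unfolding R_def by blast
 obtain a where a: "a \<in> W" using W(3) unfolding unbounded_def by blast
 have "SU_se L C \<kappa> a A \<in> R" unfolding R_def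
 proof (rule CollectI, rule exI[of _ "tp L C a A"], rule exI[of _ a], intro conjI)
  show "tp L C a A \<in> type_space L C sg A" using Wt[OF a] by (simp add: type_space_def)
  show "realisations L C sg A (tp L C a A) \<subseteq> W" using inv[OF a] by (auto simp: realisations_def)
 qed (use Wt[OF a] in \<open>simp_all add: realisations_def\<close>)
 define S where "S = {m. enat m \<in> R}"
 have S: "m \<in> S \<and> r = enat m" if "r \<in> R" "m = the_enat r" for r m
  using Rn[OF that(1)] that by (cases r) (auto simp: S_def)
 have "finite S" by (rule finite_subset[of _ "{..n}"]) (use Rn[of "enat _"] in \<open>auto simp: S_def\<close>)
 moreover have "S \<noteq> {}" using S[OF \<open>SU_se L C \<kappa> a A \<in> R\<close> refl] by blast
 ultimately have "Max S \<in> S" "\<And>m. m \<in> S ==> m \<le> Max S" by auto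
 then have "enat (Max S) \<in> R \<and> (\<forall>r\<in>R. r \<le> enat (Max S))" using S by (metis S_def enat_ord_simps(1) mem_Collect_eq)
 then have "bounded_finite_SU_se L C \<kappa> sg A W" unfolding bounded_finite_SU_se_def Let_def R_def by blast
 then show False using H A oi W(3) unfolding no_bounded_open_def by blast
qed

end

context simple_monster begin

lemma basic_open:
 assumes g: "g \<in> tup ty" and R: "stab xi (ty @ [s]) R" and \<chi>: "defp L C (ty @ [s]) \<chi>"
 defines "W \<equiv> {e \<in> tup [s]. \<chi> (g @ e) \<and> fset (set g) xi {x. R x (g @ e)}}"
 shows "tau_f_basic L C [s] (set g) W" "type_definable L C [s] (set g) W"
proof -
 let ?n = "length xi"
 note gU = tuples_set[OF g] and R2 = stab_def2[OF R]
 have cg: "countable (set g)" and smg: "sm (set g)" by (simp_all add: countable_finite sm_finite)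
 have get: "g @ e \<in> tup (ty @ [s])" if "e \<in> tup [s]" for e by (rule tuples_appendI[OF g that])
 let ?q = "\<lambda>v. drop (Suc ?n) v @ take 1 (drop ?n v)"
 have q: "coord ((xi @ [s]) @ ty) (ty @ [s]) ?q" by (rule coord_append[OF coord_drop' coord_slice]) simp_all
 \<comment> \<open>The definable condition is absorbed by the disjunct \<open>\<not> \<chi>\<close>:
   where \<open>\<chi>\<close> fails, the formula holds everywhere and does not fork.\<close>
 have "defp L C ((xi @ [s]) @ ty) (\<lambda>v. R (take ?n v) (?q v) \<or> \<not> \<chi> (?q v))"
  by (intro defp_disj defp_neg defp_coord[OF \<chi> q] def2_defp[OF R2 coord_take' q]) simp
 then obtain phi where phi: "wff L ((xi @ [s]) @ ty) phi" "\<forall>v\<in>tup ((xi @ [s]) @ ty). (R (take ?n v) (?q v) \<or> \<not> \<chi> (?q v)) = sat C v phi"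
  unfolding defp_def by (elim exE conjE)
 have phie: "sat C (x @ e @ g) phi \<longleftrightarrow> R x (g @ e) \<or> \<not> \<chi> (g @ e)" if "x \<in> tup xi" "e \<in> tup [s]" for x e
  using bspec[OF phi(2), of "(x @ e) @ g"] tuples_appendI[OF tuples_appendI[OF that] g] tuples_length[OF that(1)] tuples_length[OF that(2)] by simp
 have "forks L C (set g) xi phi (e @ g) \<longleftrightarrow> \<chi> (g @ e) \<and> fset (set g) xi {x. R x (g @ e)}" if e: "e \<in> tup [s]" for e
 proof (cases "\<chi> (g @ e)")
  case True
  have "fset (set g) xi {x. sat C (x @ e @ g) phi} \<longleftrightarrow> fset (set g) xi {x. R x (g @ e)}"
   using phie[OF _ e] True by (auto elim!: fset_mono)
  then show ?thesis using True by (simp add: forks_fset)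
 next
  case False
  obtain x where x: "x \<in> tup xi" using tuples_nonempty[OF struct] by blast
  have "\<not> fset (set g) xi {y. True}"
   using not_fset[OF gU smg, of "[]" xi "\<lambda>_. True" x] x by (simp add: defp_const)
  moreover have "fset (set g) xi {y. True}" if "fset (set g) xi {x. sat C (x @ e @ g) phi}"
   by (rule fset_mono[OF that]) (use phie[OF _ e] False in simp)
  ultimately show ?thesis using False by (auto simp: forks_fset)
 qed
 then have "W = {e \<in> tup [s]. forks L C (set g) xi phi (e @ g)}" unfolding W_def by blast
 moreover have "(phi, g) \<in> formulas_over L C (xi @ [s]) (set g)"
  using phi(1) tuples_sorts[OF g] by (simp add: formulas_over_def)
 ultimately show "tau_f_basic L C [s] (set g) W" unfolding tau_f_basic_def by blast
 obtain P where P: "smod P" "set g \<subseteq> P" using smod_ex[OF cg gU] by blast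
 note P' = smodD[OF P(1)]
 \<comment> \<open>Up to conjugacy over \<open>g\<close>, forking means to miss the fixed model
   \<open>P\<close>, a type-definable condition with parameters in \<open>P\<close>.
   \<open>W\<close> consists of the conjugates of \<open>MS\<close> over \<open>g\<close>, and
   \<open>\<Gamma>\<close> collects the formulas over \<open>g\<close> that hold on
   \<open>MS\<close>; compactness shows that they suffice.\<close>
 define MS where "MS = {c \<in> car s. \<chi> (g @ [c]) \<and> misses P xi R (g @ [c])}"
 define \<Gamma> where "\<Gamma> = {q \<in> formulas_over L C [s] (set g). \<forall>c\<in>MS. sat C ([c] @ snd q) (fst q)}"
 have 1: "\<forall>(phi, u)\<in>\<Gamma>. sat C (e @ u) phi" if eW: "e \<in> W" for e
 proof (rule ballI, clarify)
  fix phi u assume u: "(phi, u) \<in> \<Gamma>"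
  obtain c where c: "e = [c]" "c \<in> car s" using eW unfolding W_def by (auto elim: tuples_singleE)
  have ct: "[c] \<in> tup [s]" using c(2) by simp
  have W': "\<chi> (g @ [c])" "fset (set g) xi {x. R x (g @ [c])}" using eW c(1) by (auto simp: W_def)
  obtain h where h: "aut h" "\<forall>x\<in>set g. h x = x" "misses P xi R (map h (g @ [c]))"
   using forks_misses[OF P'(1,2) gU smg tuples_set[OF get[OF ct]] sm_finite[OF finite_set]] R2 get[OF ct] W'(2) by blast
  have hg: "map h (g @ [c]) = g @ [h c]" using aut_fix_map[OF h(2) subset_refl] by simp
  have "h c \<in> MS" unfolding MS_def
   using h(3) aut_defp[OF h(1) \<chi> get[OF ct]] W'(1) aut_tup[OF h(1) ct] hg by simp
  then have s: "sat C ([h c] @ u) phi" using u unfolding \<Gamma>_def by auto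
  have uf: "set u \<subseteq> set g" "wff L ([s] @ srt u) phi" using u unfolding \<Gamma>_def formulas_over_def by auto
  have "u \<in> tup (srt u)" using uf(1) gU by (intro tuples_self) auto
  from aut_sat[OF h(1) uf(2) tuples_appendI[OF ct this]] s show "sat C (e @ u) phi"
   using aut_fix_map[OF h(2) uf(1)] c(1) by simp
 qed
 have 2: "e \<in> W" if e: "e \<in> tup [s]" "\<forall>(phi, u)\<in>\<Gamma>. sat C (e @ u) phi" for e
 proof -
  obtain c where c: "e = [c]" "c \<in> car s" using e(1) by (rule tuples_singleE)
  have ct: "[c] \<in> tup [s]" using c(2) by simp
  have realize: "\<exists>c'\<in>MS. Q ([c'] @ u)" if Q: "set u \<subseteq> set g" "defp L C ([s] @ srt u) Q" "Q ([c] @ u)" for u Q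
  proof (rule ccontr)
   assume n: "\<not> ?thesis"
   obtain psi where psi: "wff L ([s] @ srt u) psi" "\<forall>v\<in>tup ([s] @ srt u). (\<not> Q v) = sat C v psi"
    using defp_neg[OF Q(2)] unfolding defp_def by (elim exE conjE)
   have ut: "u \<in> tup (srt u)" using Q(1) gU by (intro tuples_self) auto
   have spsi: "sat C ([z] @ u) psi \<longleftrightarrow> \<not> Q ([z] @ u)" if "z \<in> car s" for z
    using bspec[OF psi(2) tuples_appendI[OF _ ut], of "[z]"] that by simp
   have "(psi, u) \<in> \<Gamma>" unfolding \<Gamma>_def using Q(1) psi(1) n spsi by (auto simp: formulas_over_def MS_def)
   then show False using bspec[OF e(2)] spsi[OF c(2)] Q(3) c(1) by fastforce
  qed
  define ok where "ok u Q \<longleftrightarrow> set u \<subseteq> set g \<and> defp L C ([s] @ srt u) Q \<and> Q ([c] @ u)" for u and Q :: "'a list => bool"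
  define T1 where "T1 = {([()], u, Q) | u Q. ok u Q}"
  let ?N = "\<lambda>w. \<not> R (take ?n (drop 1 w)) (drop ?n (drop 1 w) @ take 1 w)"
  define T2 where "T2 = (\<lambda>p. ([()], p @ g, ?N)) ` {p \<in> tup xi. set p \<subseteq> P}"
  have "\<exists>e. (\<forall>j\<in>{()}. e j \<in> car s) \<and> (\<forall>(idx, u, Q)\<in>T1 \<union> T2. Q (map e idx @ u))"
  proof (rule compactness[where B = P])
   show "P \<subseteq> U" "sm P" "sm {()}" using P' by (auto intro: sm_finite)
   fix idx u Q assume "(idx, u, Q) \<in> T1 \<union> T2"
   then show "set idx \<subseteq> {()} \<and> set u \<subseteq> P \<and> defp L C (map (\<lambda>_. s) idx @ srt u) Q"
   proof (rule UnE)
    assume "(idx, u, Q) \<in> T1"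
    then have "idx = [()]" "ok u Q" by (simp_all add: T1_def)
    then show ?thesis using P(2) by (auto simp: ok_def)
   next
    assume "(idx, u, Q) \<in> T2"
    then obtain p where p: "p \<in> tup xi" "set p \<subseteq> P" "idx = [()]" "u = p @ g" "Q = ?N"
     unfolding T2_def by (elim imageE CollectE conjE Pair_inject)
    have "defp L C ([s] @ xi @ ty) ?N"
     by (intro defp_neg def2_defp[OF R2 coord_slice coord_append[OF coord_comp[OF coord_drop' coord_drop'] coord_take']]) auto
    then show ?thesis using p P(2) tuples_sorts[OF p(1)] tuples_sorts[OF g] by simp
   qed
  next
   fix G assume G: "finite G" "G \<subseteq> T1 \<union> T2"
   have fG: "finite (snd ` (G \<inter> T1))" using G by auto
   have okG: "ok u Q" if "(u, Q) \<in> snd ` (G \<inter> T1)" for u Q using that by (auto simp: T1_def)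
   obtain u Q where uQ: "set u \<subseteq> set g" "defp L C ([s] @ srt u) Q"
    "\<forall>x\<in>tup [s]. Q (x @ u) \<longleftrightarrow> (\<forall>(u, Q)\<in>snd ` (G \<inter> T1). Q (x @ u))"
    using over_conj[OF fG gU, of "[s]"] okG[unfolded ok_def] by blast
   have "\<forall>(u, Q)\<in>snd ` (G \<inter> T1). Q ([c] @ u)" using okG[unfolded ok_def] by blast
   then have "Q ([c] @ u)" using bspec[OF uQ(3) ct] by (simp only:)
   from realize[OF uQ(1,2) this] obtain c' where c': "c' \<in> MS" "Q ([c'] @ u)" ..
   have c's: "c' \<in> car s" using c'(1) by (simp add: MS_def)
   have QG: "\<forall>(u, Q)\<in>snd ` (G \<inter> T1). Q ([c'] @ u)" using bspec[OF uQ(3), of "[c']"] c'(2) c's by (simp only: tuples_single)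
   have "Q (map (\<lambda>_. c') idx @ u)" if qG: "(idx, u, Q) \<in> G" for idx u Q
   proof (cases "(idx, u, Q) \<in> T1")
    case True
    then have "(u, Q) \<in> snd ` (G \<inter> T1)" using qG by force
    moreover have "idx = [()]" using True by (simp add: T1_def)
    ultimately show ?thesis using bspec[OF QG, of "(u, Q)"] by simp
   next
    case False
    then have "(idx, u, Q) \<in> T2" using qG G(2) by blast
    then obtain p where p: "p \<in> tup xi" "set p \<subseteq> P" "idx = [()]" "u = p @ g" "Q = ?N"
     unfolding T2_def by (elim imageE CollectE conjE Pair_inject)
    have "\<not> R p (g @ [c'])" using c'(1) p(1,2) unfolding MS_def misses_def by blast
    then show ?thesis unfolding p(3-5) using tuples_length[OF p(1)] by simp
   qed
   then show "\<exists>e. (\<forall>j\<in>{()}. e j \<in> car s) \<and> (\<forall>(idx, u, Q)\<in>G. Q (map e idx @ u))"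
    using c's by (intro exI[of _ "\<lambda>_. c'"]) blast
  qed
  then obtain f where f: "f () \<in> car s" "\<forall>(idx, u, Q)\<in>T1 \<union> T2. Q (map f idx @ u)" by blast
  let ?c = "f ()"
  have c't: "[?c] \<in> tup [s]" using f(1) by simp
  have fT1: "Q ([?c] @ u)" if "ok u Q" for u Q using bspec[OF f(2), of "([()], u, Q)"] that by (auto simp: T1_def)
  have ms: "misses P xi R (g @ [?c])" unfolding misses_def
  proof (intro ballI impI)
   fix p assume p: "p \<in> tup xi" "set p \<subseteq> P"
   then have "([()], p @ g, ?N) \<in> T2" unfolding T2_def by blast
   then show "\<not> R p (g @ [?c])" using bspec[OF f(2), of "([()], p @ g, ?N)"] tuples_length[OF p(1)] by simp
  qed
  have "tp L C [c] (set g) = tp L C [?c] (set g)"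
  proof (rule tp_eqI[OF ct c't])
   fix u phi assume u: "set u \<subseteq> set g" "wff L ([s] @ srt u) phi"
   have dn: "defp L C ([s] @ srt u) (\<lambda>w. sat C w phi)" "defp L C ([s] @ srt u) (\<lambda>w. \<not> sat C w phi)"
    using u(2) by (auto intro: defp_neg defp_wff)
   have "sat C ([c] @ u) phi ==> sat C ([?c] @ u) phi" by (rule fT1) (use dn(1) u(1) in \<open>simp add: ok_def\<close>)
   moreover have "\<not> sat C ([c] @ u) phi ==> \<not> sat C ([?c] @ u) phi" by (rule fT1) (use dn(2) u(1) in \<open>simp add: ok_def\<close>)
   ultimately show "sat C ([c] @ u) phi = sat C ([?c] @ u) phi" by blast
  qed
  from hom_tuple[OF ct c't gU smg this] obtain h where h: "aut h" "\<forall>x\<in>set g. h x = x" "h c = ?c" by auto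
  have hg: "map h (g @ [c]) = g @ [?c]" using aut_fix_map[OF h(2) subset_refl] h(3) by simp
  have "fset (set g) xi {x. R x (g @ [c])}"
   by (rule misses_fset_aut[OF R get[OF ct] cg P h(1,2)]) (simp only: hg ms)
  moreover have "\<chi> (g @ [c])"
  proof (rule ccontr)
   assume n: "\<not> \<chi> (g @ [c])"
   have "defp L C ([s] @ srt g) (\<lambda>w. \<not> \<chi> (drop 1 w @ take 1 w))" unfolding tuples_sorts[OF g]
    by (intro defp_neg defp_coord[OF \<chi> coord_append[OF coord_drop' coord_take']]) auto
   from realize[OF subset_refl this] n show False unfolding MS_def by auto
  qed
  ultimately show ?thesis unfolding W_def using c by simp
 qed
 have "W = {a \<in> tup [s]. \<forall>(phi, c)\<in>\<Gamma>. sat C (a @ c) phi}"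
 proof
  show "W \<subseteq> {a \<in> tup [s]. \<forall>(phi, c)\<in>\<Gamma>. sat C (a @ c) phi}" using 1 unfolding W_def by blast
 qed (use 2 in blast)
 moreover have "\<Gamma> \<subseteq> formulas_over L C [s] (set g)" unfolding \<Gamma>_def by blast
 ultimately show "type_definable L C [s] (set g) W" unfolding type_definable_def by blast
qed

section \<open>Conditions and the insertion of a value\<close>

definition valid :: "'s list => ('a list => bool) => ('s list \<times> ('a list => 'a list => bool) \<times> nat) set => bool" where
 "valid ty Th Dl \<longleftrightarrow> defp L C ty Th \<and> finite Dl \<and> (\<forall>q\<in>Dl. stab (fst q) ty (fst (snd q)))"

text \<open>The points of a condition. The parameters \<open>d\<close> are quantified away, so that
  a condition can be refined by inserting further ones.\<close>

definition kset :: "'s => 's list => ('a list => bool) => ('s list \<times> ('a list => 'a list => bool) \<times> nat) set => 'a set" where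
 "kset s ty Th Dl = {a \<in> car s. \<exists>d\<in>tup ty. Th (d @ [a]) \<and> holds Dl {} (d @ [a])}"

lemma holds_Un: "holds (A \<union> B) X d \<longleftrightarrow> holds A X d \<and> holds B X d"
 unfolding holds_def by blast

lemma holds_image: "holds ((\<lambda>q. (f q, R q, i q)) ` A) X d \<longleftrightarrow> (\<forall>q\<in>A. fset (set (take (i q) d) \<union> X) (f q) {x. R q x d})"
 by (simp add: holds_def)

lemma holds_iff: "holds A X d \<longleftrightarrow> (\<forall>q\<in>A. fset (set (take (snd (snd q)) d) \<union> X) (fst q) {x. fst (snd q) x d})"
 by (simp add: holds_def split_beta)

end

lemma Collect_eq_singleton: "c \<in> A ==> (\<forall>z\<in>A. Q z = (z = c)) \<longleftrightarrow> {x \<in> A. Q x} = {c}"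
 by auto

context simple_monster begin

text \<open>The tuple of the new condition consists of \<open>g\<close>, the rank witnesses
  \<open>b\<close>, the new value \<open>c'\<close>, the remaining parameters \<open>r'\<close>, and
  the point. Its requirements imply the old ones after deletion of \<open>b\<close> and
  \<open>c'\<close>, and they imply that the value has rank at least \<open>n\<close> over
  \<open>g\<close>.\<close>

lemma insert_value:
 assumes ep: "extension_property_first_order L C" and H: no_bounded_open
  and V: "valid (ty @ [s]) Th Dl" and a: "a \<in> kset s ty Th Dl"
  and phi: "wff L [s', s] phi" and sing: "{x \<in> car s'. sat C [x, a] phi} = {c}" and nc: "c \<notin> acl L C {}"
 shows "\<exists>ty' Th' Dl'. valid (ty' @ [s]) Th' Dl' \<and> kset s ty' Th' Dl' \<subseteq> kset s ty Th Dl \<and> \<not> kset s ty' Th' Dl' \<subseteq> acl L C {} \<and>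
  (\<forall>a\<in>kset s ty' Th' Dl'. \<forall>c. {x \<in> car s'. sat C [x, a] phi} = {c} --> SU_se_ge L C \<kappa> n [c] {})"
proof -
 obtain d where d: "d \<in> tup ty" "Th (d @ [a])" "holds Dl {} (d @ [a])" and as: "a \<in> car s"
  using a unfolding kset_def by blast
 let ?D = "d @ [a]"
 have DT: "?D \<in> tup (ty @ [s])" using d(1) as by simp
 note DU = tuples_set[OF DT]
 have cs: "c \<in> car s'" using sing by auto
 \<comment> \<open>Position \<open>0\<close> qualifies because \<open>c\<close> is not algebraic.
   Segments containing the point \<open>a\<close> are excluded, as \<open>c\<close> is algebraic
   over \<open>a\<close>; so \<open>c\<close> is algebraic over every initial segment longer than
   \<open>m\<close>.\<close>
 define S where "S = {i. i \<le> length d \<and> c \<notin> acl L C (set (take i ?D))}"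
 define m where "m = Max S"
 have "finite S" "0 \<in> S" using nc by (auto simp: S_def)
 then have mS: "m \<in> S" and mM: "\<And>i. i \<in> S ==> i \<le> m" unfolding m_def by (auto intro: Max_in)
 have big: "c \<in> acl L C (set (take i ?D))" if "m < i" for i
 proof (cases "i \<le> length d")
  case True
  then show ?thesis using mM[of i] that by (auto simp: S_def)
 next
  case False
  then have "{a} \<subseteq> set (take i ?D)" by simp
  then show ?thesis using value_acl[OF phi as sing] acl_mono by blast
 qed
 define g where "g = take m d"
 define r where "r = drop m d"
 define tyg where "tyg = take m ty"
 define \<rho> where "\<rho> = drop m ty"
 have T: "ty @ [s] = tyg @ \<rho> @ [s]" "ty = tyg @ \<rho>" by (simp_all add: tyg_def \<rho>_def)
 have dgr: "d = g @ r" by (simp add: g_def r_def)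
 have ml: "m \<le> length d" using mS by (simp add: S_def)
 have gt: "g \<in> tup tyg" and rt: "r \<in> tup \<rho>" unfolding g_def r_def tyg_def \<rho>_def by (rule tuples_take[OF d(1)], rule tuples_drop[OF d(1)])
 have lg: "length g = m" "length tyg = m" using ml tuples_length[OF d(1)] by (simp_all add: g_def tyg_def)
 have tl: "length g' = m" if "g' \<in> tup tyg" for g' using tuples_length[OF that] lg(2) by simp
 have cng: "c \<notin> acl L C (set g)" using mS ml by (simp add: S_def g_def)
 have gU: "set g \<subseteq> U" by (rule tuples_set[OF gt])
 have ctg: "countable (set u)" for u :: "'a list" by (simp add: countable_finite)
 \<comment> \<open>Deletes the inserted entry, so that the old formulas can be read in the longer
   tuple.\<close>
 define del where "del E = take m E @ drop (Suc m) E" for E :: "'a list"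
 define \<Lambda> where "\<Lambda> = tyg @ [s'] @ \<rho> @ [s]"
 have coD: "coord \<Lambda> (ty @ [s]) del" unfolding T(1) del_def
  by (rule coord_append[OF coord_take' coord_drop']) (simp_all add: \<Lambda>_def lg)
 have delv: "del (g' @ [c'] @ w) = g' @ w" if "g' \<in> tup tyg" for g' c' w
  using tl[OF that] by (simp add: del_def)
 define Th1 where "Th1 E \<longleftrightarrow> Th (del E) \<and> (\<forall>x\<in>tup [s']. sat C (x @ drop (length (tyg @ [s'] @ \<rho>)) E) phi = (x = take 1 (drop m E)))" for E
 have Th1: "defp L C \<Lambda> Th1"
 proof -
  have w: "wff L ([s'] @ [s]) phi" using phi by simp
  have "[s] = drop (length (tyg @ [s'] @ \<rho>)) \<Lambda>" by (simp add: \<Lambda>_def)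
  from coord_drop'[OF this] have 1: "def2 L C [s'] \<Lambda> (\<lambda>x E. sat C (x @ drop (length (tyg @ [s'] @ \<rho>)) E) phi)"
   by (rule def2_coord[OF def2_wff[OF w] coord_id])
  have "[s'] = take 1 (drop m \<Lambda>)" by (simp add: \<Lambda>_def lg)
  from def2_coord[OF def2_eq coord_id coord_slice[OF this]]
  have 2: "def2 L C [s'] \<Lambda> (\<lambda>x E. x = take 1 (drop m E))" .
  have "defp L C (ty @ [s]) Th" using V by (simp add: valid_def)
  from defp_conj[OF defp_coord[OF this coD] def2_all[OF def2_iff[OF 1 2]]] show ?thesis unfolding Th1_def .
 qed
 have Th1v: "Th1 (g' @ [c'] @ r' @ [a']) \<longleftrightarrow> Th (g' @ r' @ [a']) \<and> {x \<in> car s'. sat C [x, a'] phi} = {c'}"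
  if "g' \<in> tup tyg" "c' \<in> car s'" "r' \<in> tup \<rho>" for g' c' r' a'
 proof -
  have v: "drop (length (tyg @ [s'] @ \<rho>)) (g' @ [c'] @ r' @ [a']) = [a']" "take 1 (drop m (g' @ [c'] @ r' @ [a'])) = [c']"
   using tl[OF that(1)] lg tuples_length[OF that(3)] by simp_all
  have "tup [s'] = (\<lambda>z. [z]) ` car s'" by (auto elim: tuples_singleE)
  then have "(\<forall>x\<in>tup [s']. sat C (x @ [a']) phi = (x = [c'])) \<longleftrightarrow> (\<forall>z\<in>car s'. sat C [z, a'] phi = (z = c'))" by simp
  also have "\<dots> \<longleftrightarrow> {x \<in> car s'. sat C [x, a'] phi} = {c'}" by (rule Collect_eq_singleton[OF that(2)])
  finally show ?thesis unfolding Th1_def v delv[OF that(1)] by simp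
 qed
 \<comment> \<open>\<open>Dl0\<close> holds the requirements with bases inside \<open>g\<close>,
   \<open>Dl1\<close> those with bases reaching beyond the inserted value.\<close>
 define Dl0 where "Dl0 = {q \<in> Dl. snd (snd q) \<le> m}"
 define Dl1 where "Dl1 = {q \<in> Dl. m < snd (snd q)}"
 have fin: "finite Dl0" "finite Dl1" using V by (simp_all add: valid_def Dl0_def Dl1_def)
 have Vs: "stab (fst q) (ty @ [s]) (fst (snd q))" if "q \<in> Dl" for q using V that unfolding valid_def by blast
 have Vh: "fset (set (take (snd (snd q)) ?D)) (fst q) {x. fst (snd q) x ?D}" if "q \<in> Dl" for q
  using bspec[OF d(3)[unfolded holds_iff] that] by simp
 let ?E = "g @ [c] @ r @ [a]"
 have ET: "?E \<in> tup \<Lambda>" unfolding \<Lambda>_def using gt cs rt as by (simp add: tuples_appendI)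
 have delE: "del ?E = ?D" unfolding delv[OF gt] by (simp add: dgr)
 have takeE: "take m ?E = g" "take (Suc m) ?E = g @ [c]" using lg by simp_all
 have take\<Lambda>: "take m \<Lambda> = tyg" "take (Suc m) \<Lambda> = tyg @ [s']" using lg by (simp_all add: \<Lambda>_def)
 have coM: "coord \<Lambda> tyg (take m)" "coord \<Lambda> (tyg @ [s']) (take (Suc m))" by (rule coord_take', simp add: take\<Lambda>)+
 \<comment> \<open>Two cuts: the one at \<open>g\<close> separates a part \<open>Z1\<close> about
   \<open>g\<close> alone, with the old base; the one behind \<open>c\<close> separates from the
   rest a part \<open>Z2\<close> about \<open>g\<close> and \<open>c\<close> that forks over
   \<open>g\<close>. What is left forks over \<open>g\<close> and \<open>c\<close>.\<close>
 have ex: "\<exists>Z. stab (fst q) tyg (fst Z) \<and> stab (fst q) (tyg @ [s']) (snd Z) \<and>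
   fset (set (take (snd (snd q)) g)) (fst q) {x. fst Z x g} \<and> fset (set g) (fst q) {x. snd Z x (g @ [c])} \<and>
   fset (set (g @ [c])) (fst q) {x. (fst (snd q) x ?D \<and> \<not> fst Z x g) \<and> \<not> snd Z x (g @ [c])}" if q: "q \<in> Dl0" for q
 proof -
  have qDl: "q \<in> Dl" "snd (snd q) \<le> m" using q by (simp_all add: Dl0_def)
  have tk: "take m ?D = g" "take m (ty @ [s]) = tyg" using ml tuples_length[OF d(1)] by (simp_all add: g_def tyg_def)
  have ti: "take (snd (snd q)) ?D = take (snd (snd q)) g" using qDl(2) ml by (simp add: g_def min_absorb1)
  have sub: "set (take (snd (snd q)) g) \<subseteq> set (take m ?D)" unfolding tk by (rule set_take_subset)
  obtain Z1 where Z1: "stab (fst q) tyg Z1" "fset (set (take (snd (snd q)) g)) (fst q) {x. Z1 x g}"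
   "fset (set g) (fst q) {x. fst (snd q) x ?D \<and> \<not> Z1 x g}"
   using decompose[where R = "fst (snd q)" and k = m, OF Vs[OF qDl(1)] DT sub Vh[OF qDl(1), unfolded ti]] unfolding tk
   by (elim exE conjE)
  let ?W = "\<lambda>x E. fst (snd q) x (del E) \<and> \<not> Z1 x (take m E)"
  have W: "stab (fst q) \<Lambda> ?W"
   by (rule stab_conj[OF stab_coord[OF Vs[OF qDl(1)] coord_id coD] stab_neg[OF stab_coord[OF Z1(1) coord_id coM(1)]]])
  have fW: "fset (set g) (fst q) {x. ?W x ?E}" unfolding delE takeE by (rule Z1(3))
  have sub2: "set g \<subseteq> set (take (Suc m) ?E)" unfolding takeE by auto
  obtain Z2 where Z2: "stab (fst q) (tyg @ [s']) Z2" "fset (set g) (fst q) {x. Z2 x (g @ [c])}"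
   "fset (set (g @ [c])) (fst q) {x. (fst (snd q) x ?D \<and> \<not> Z1 x g) \<and> \<not> Z2 x (g @ [c])}"
   using decompose[where R = ?W and k = "Suc m", OF W ET sub2 fW] unfolding takeE take\<Lambda> delE by (elim exE conjE)
  show ?thesis by (rule exI[of _ "(Z1, Z2)"]) (simp only: fst_conv snd_conv Z1 Z2 simp_thms)
 qed
 obtain Z where Z: "\<forall>q\<in>Dl0. stab (fst q) tyg (fst (Z q)) \<and> stab (fst q) (tyg @ [s']) (snd (Z q)) \<and>
   fset (set (take (snd (snd q)) g)) (fst q) {x. fst (Z q) x g} \<and> fset (set g) (fst q) {x. snd (Z q) x (g @ [c])} \<and>
   fset (set (g @ [c])) (fst q) {x. (fst (snd q) x ?D \<and> \<not> fst (Z q) x g) \<and> \<not> snd (Z q) x (g @ [c])}"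
  using bchoice[OF ballI[OF ex]] by (rule exE)
 \<comment> \<open>What must hold of the entries behind \<open>c\<close>: the requirements with long
   bases, shifted by one since \<open>c\<close> now belongs to the base, and the remainders of the
   two cuts.\<close>
 define DlC where "DlC = (\<lambda>q. (fst q, \<lambda>x E. fst (snd q) x (del E), Suc (snd (snd q)))) ` Dl1 \<union>
  (\<lambda>q. (fst q, \<lambda>x E. (fst (snd q) x (del E) \<and> \<not> fst (Z q) x (take m E)) \<and> \<not> snd (Z q) x (take (Suc m) E), Suc m)) ` Dl0"
 have stC: "stab (fst q) \<Lambda> (fst (snd q)) \<and> Suc m \<le> snd (snd q)" if q: "q \<in> DlC" for q
  using q unfolding DlC_def
 proof (elim UnE imageE)
  fix p assume p: "p \<in> Dl1" "q = (fst p, \<lambda>x E. fst (snd p) x (del E), Suc (snd (snd p)))"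
  have "p \<in> Dl" "m < snd (snd p)" using p(1) by (simp_all add: Dl1_def)
  then show ?thesis using stab_coord[OF Vs coord_id coD] p(2) by simp
 next
  fix p assume p: "p \<in> Dl0"
   "q = (fst p, \<lambda>x E. (fst (snd p) x (del E) \<and> \<not> fst (Z p) x (take m E)) \<and> \<not> snd (Z p) x (take (Suc m) E), Suc m)"
  have "p \<in> Dl" using p(1) by (simp add: Dl0_def)
  note zz = conjunct1[OF bspec[OF Z p(1)]] conjunct1[OF conjunct2[OF bspec[OF Z p(1)]]]
  have "stab (fst p) \<Lambda> (\<lambda>x E. (fst (snd p) x (del E) \<and> \<not> fst (Z p) x (take m E)) \<and> \<not> snd (Z p) x (take (Suc m) E))"
   by (rule stab_conj[OF stab_conj[OF stab_coord[OF Vs[OF \<open>p \<in> Dl\<close>] coord_id coD] stab_neg[OF stab_coord[OF zz(1) coord_id coM(1)]]]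
    stab_neg[OF stab_coord[OF zz(2) coord_id coM(2)]]])
  then show ?thesis using p(2) by simp
 qed
 have hC: "holds DlC {} ?E" unfolding DlC_def holds_Un holds_image delE takeE
 proof (intro conjI ballI)
  fix q assume q: "q \<in> Dl1"
  then have qDl: "q \<in> Dl" "m < snd (snd q)" by (simp_all add: Dl1_def)
  let ?i = "snd (snd q)"
  have "set (take ?i ?D) \<subseteq> U" using DU set_take_subset[of ?i ?D] by blast
  from fset_acl[OF Vs[OF qDl(1)] DT ctg this big[OF qDl(2)] Vh[OF qDl(1)]]
  have f: "fset (insert c (set (take ?i ?D))) (fst q) {x. fst (snd q) x ?D}" .
  have "set (take (Suc ?i) ?E) \<union> {} = insert c (set (take ?i ?D))"
   using qDl(2) lg by (simp add: dgr Suc_diff_le)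
  then show "fset (set (take (Suc ?i) ?E) \<union> {}) (fst q) {x. fst (snd q) x ?D}" using f by simp
 next
  fix q assume q: "q \<in> Dl0"
  show "fset (set (g @ [c]) \<union> {}) (fst q) {x. (fst (snd q) x ?D \<and> \<not> fst (Z q) x g) \<and> \<not> snd (Z q) x (g @ [c])}"
   unfolding Un_empty_right using bspec[OF Z q] by (elim conjE)
 qed
 have ex2: "\<exists>\<chi>. defp L C (tyg @ [s']) \<chi> \<and> \<chi> (g @ [c]) \<and> (\<forall>g'\<in>tup (tyg @ [s']). \<chi> g' --> (\<forall>B. countable B --> B \<subseteq> U -->
   (\<exists>r'\<in>tup (\<rho> @ [s]). Th1 (g' @ r') \<and> holds DlC B (g' @ r'))))"
 proof (rule extend_conditions[OF ep, of "r @ [a]"])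
  show "r @ [a] \<in> tup (\<rho> @ [s])" "g @ [c] \<in> tup (tyg @ [s'])" using rt as gt cs by (simp_all add: tuples_appendI)
  show "defp L C ((tyg @ [s']) @ \<rho> @ [s]) Th1" using Th1 by (simp add: \<Lambda>_def)
  show "Th1 ((g @ [c]) @ r @ [a])" using Th1v[OF gt cs rt, of a] d(2) sing by (simp add: dgr)
  show "finite DlC" using fin by (simp add: DlC_def)
  show "stab xi ((tyg @ [s']) @ \<rho> @ [s]) R \<and> length (tyg @ [s']) \<le> i" if "(xi, R, i) \<in> DlC" for xi R i
   using stC[OF that] lg by (simp add: \<Lambda>_def)
  show "holds DlC {} ((g @ [c]) @ r @ [a])" using hC by simp
 qed
 obtain \<chi> where \<chi>: "defp L C (tyg @ [s']) \<chi>" "\<chi> (g @ [c])"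
  and \<chi>': "\<forall>g'\<in>tup (tyg @ [s']). \<chi> g' --> (\<forall>B. countable B --> B \<subseteq> U -->
   (\<exists>r'\<in>tup (\<rho> @ [s]). Th1 (g' @ r') \<and> holds DlC B (g' @ r')))"
  using ex2 by (elim exE conjE)
 \<comment> \<open>The forking requirements on the new value over \<open>g\<close>: it is not
   algebraic, and the parts \<open>Z2\<close> fork.\<close>
 let ?S = "insert ([s'], \<lambda>x e. x = drop m e) ((\<lambda>q. (fst q, snd (Z q))) ` Dl0)"
 have stS: "stab xi (tyg @ [s']) R" if q: "(xi, R) \<in> ?S" for xi R
  using q
 proof (elim insertE imageE)
  assume "(xi, R) = ([s'], \<lambda>x e. x = drop m e)"
  then show ?thesis using stab_coord[OF stab_eq coord_id coord_drop', of "[s']" m "tyg @ [s']"] lg by simp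
 next
  fix p assume p: "p \<in> Dl0" "(xi, R) = (fst p, snd (Z p))"
  have "stab (fst p) (tyg @ [s']) (snd (Z p))" using bspec[OF Z p(1)] by (elim conjE)
  then show ?thesis using p(2) by simp
 qed
 have "finite ?S" using fin by simp
 note mg = merge[where S = ?S, OF this stS]
 obtain xiM RM where RM: "stab xiM (tyg @ [s']) RM"
  and RM'': "\<forall>d\<in>tup (tyg @ [s']). \<forall>D. countable D --> D \<subseteq> U --> (fset D xiM {x. RM x d} \<longleftrightarrow> (\<forall>(xi, R)\<in>?S. fset D xi {x. R x d}))"
  by (rule exE[OF mg], assumption, elim exE conjE)
 have RM': "fset (set g) xiM {x. RM x (g @ e)} \<longleftrightarrow> fset (set g) [s'] {x. x = e} \<and> (\<forall>q\<in>Dl0. fset (set g) (fst q) {x. snd (Z q) x (g @ e)})"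
  if "e \<in> tup [s']" for e
  using bspec[OF RM'' tuples_appendI[OF gt that]] ctg gU lg by simp
 let ?W = "{e \<in> tup [s']. \<chi> (g @ e) \<and> fset (set g) xiM {x. RM x (g @ e)}}"
 have ct: "[c] \<in> tup [s']" using cs by simp
 have "\<forall>q\<in>Dl0. fset (set g) (fst q) {x. snd (Z q) x (g @ [c])}" by (rule ballI, drule bspec[OF Z], elim conjE)
 then have inW: "[c] \<in> ?W" using RM'[OF ct] fset_not_acl[OF cs ctg gU] cng ct \<chi>(2) by simp
 \<comment> \<open>The old value \<open>c\<close> lies in this open set and is not algebraic over
   \<open>g\<close>.\<close>
 have "unbounded L C (set g) ?W" unfolding unbounded_def
 proof
  assume A: "\<forall>a\<in>?W. set a \<subseteq> acl L C (set g)"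
  from bspec[OF A inW] cng show False by simp
 qed
 from rank_unbounded[OF H finite_set gU basic_open[OF gt RM \<chi>(1)] this]
 obtain e where e: "e \<in> ?W" "SU_se_ge L C \<kappa> n e (set g)" by (rule bexE)
 obtain c' where c': "e = [c']" "c' \<in> car s'" using e(1) by (auto elim: tuples_singleE)
 have c't: "[c'] \<in> tup [s']" using c'(2) by simp
 have "fset (set g) xiM {x. RM x (g @ [c'])}" "\<chi> (g @ [c'])" using e(1) c'(1) by auto
 then have c'n: "c' \<notin> acl L C (set g)" and c'Z: "\<forall>q\<in>Dl0. fset (set g) (fst q) {x. snd (Z q) x (g @ [c'])}" and c'\<chi>: "\<chi> (g @ [c'])"
  using RM'[OF c't] fset_not_acl[OF c'(2) ctg gU] by simp_all
 obtain \<beta> b \<Psi> DlR where b: "b \<in> tup \<beta>" and \<Psi>: "defp L C (tyg @ \<beta> @ [s']) \<Psi>" and finR: "finite DlR"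
  and stR: "\<forall>q\<in>DlR. stab (fst q) (tyg @ \<beta> @ [s']) (fst (snd q)) \<and> snd (snd q) \<le> length tyg + length \<beta>"
  and \<Psi>b: "\<Psi> (g @ b @ [c'])" and hR: "holds DlR {} (g @ b @ [c'])"
  and rank: "\<forall>g'\<in>tup tyg. \<forall>b'\<in>tup \<beta>. \<forall>c'\<in>car s'. \<Psi> (g' @ b' @ [c']) --> holds DlR {} (g' @ b' @ [c']) --> SU_se_ge L C \<kappa> n [c'] (set g')"
  using rank_conditions[OF c'(2) gt e(2)[unfolded c'(1)]] by (elim exE conjE)
 \<comment> \<open>The remaining entries are found again for \<open>c'\<close>, with
   \<open>b\<close> added to the bases because \<open>b\<close> will precede them in the
   tuple.\<close>
 have "\<exists>r'\<in>tup (\<rho> @ [s]). Th1 ((g @ [c']) @ r') \<and> holds DlC (set b) ((g @ [c']) @ r')"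
  by (rule spec[OF mp[OF bspec[OF \<chi>' tuples_appendI[OF gt c't]] c'\<chi>], THEN mp, THEN mp, OF ctg tuples_set[OF b]])
 then obtain rr where rr: "rr \<in> tup (\<rho> @ [s])" "Th1 ((g @ [c']) @ rr)" "holds DlC (set b) ((g @ [c']) @ rr)"
  by (elim bexE conjE)
 obtain r' ra where r': "rr = r' @ ra" "r' \<in> tup \<rho>" "ra \<in> tup [s]" by (rule tuples_appendE[OF rr(1)])
 obtain a' where a': "ra = [a']" "a' \<in> car s" using r'(3) by (rule tuples_singleE)
 define F where "F g b c r a = (g @ b @ [c] @ r) @ [a]" for g b r and c a :: 'a
 define tyF where "tyF = tyg @ \<beta> @ [s'] @ \<rho>"
 let ?mb = "m + length \<beta>"
 define dl where "dl F = take m F @ drop ?mb F" for F :: "'a list"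
 define rk where "rk F = take (Suc ?mb) F" for F :: "'a list"
 have co: "coord (tyF @ [s]) \<Lambda> dl" "coord (tyF @ [s]) (tyg @ \<beta> @ [s']) rk" "coord (tyF @ [s]) tyg (take m)"
  unfolding \<Lambda>_def dl_def rk_def
  by (rule coord_append[OF coord_take' coord_drop'] coord_take', simp_all add: tyF_def lg)+
 have Fv: "dl (F g1 b1 c1 r1 a1) = g1 @ [c1] @ r1 @ [a1]" "rk (F g1 b1 c1 r1 a1) = g1 @ b1 @ [c1]" "take m (F g1 b1 c1 r1 a1) = g1"
   "take (Suc m) (g1 @ [c1] @ r1 @ [a1]) = g1 @ [c1]" "take m (g1 @ [c1] @ r1 @ [a1]) = g1"
  if "g1 \<in> tup tyg" "b1 \<in> tup \<beta>" for g1 b1 c1 r1 a1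
  using tl[OF that(1)] tuples_length[OF that(2)] by (simp_all add: dl_def rk_def F_def)
 define ThF where "ThF x \<longleftrightarrow> Th1 (dl x) \<and> \<Psi> (rk x)" for x
 \<comment> \<open>Four groups: the parts about \<open>g\<close> with their old bases, the parts
   about \<open>g\<close> and the new value with base \<open>g\<close>, the requirements for the
   rank, and those for the entries behind the value, whose bases grow by the length of
   \<open>b\<close>.\<close>
 define DlF where "DlF = (\<lambda>q. (fst q, \<lambda>x w. fst (Z q) x (take m w), snd (snd q))) ` Dl0 \<union>
  (\<lambda>q. (fst q, \<lambda>x w. snd (Z q) x (take (Suc m) (dl w)), m)) ` Dl0 \<union>
  (\<lambda>q. (fst q, \<lambda>x w. fst (snd q) x (rk w), snd (snd q))) ` DlR \<union>
  (\<lambda>q. (fst q, \<lambda>x w. fst (snd q) x (dl w), snd (snd q) + length \<beta>)) ` DlC"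
 have hF: "holds DlF {} (F g1 b1 c1 r1 a1) \<longleftrightarrow>
   (\<forall>q\<in>Dl0. fset (set (take (snd (snd q)) g1)) (fst q) {x. fst (Z q) x g1}) \<and>
   (\<forall>q\<in>Dl0. fset (set g1) (fst q) {x. snd (Z q) x (g1 @ [c1])}) \<and>
   holds DlR {} (g1 @ b1 @ [c1]) \<and> holds DlC (set b1) (g1 @ [c1] @ r1 @ [a1])"
  if t: "g1 \<in> tup tyg" "b1 \<in> tup \<beta>" for g1 b1 c1 r1 a1
 proof -
  have l: "length g1 = m" "length b1 = length \<beta>" using tl[OF t(1)] tuples_length[OF t(2)] .
  have 1: "take (snd (snd q)) (F g1 b1 c1 r1 a1) = take (snd (snd q)) g1" if "q \<in> Dl0" for q
   using that l by (simp add: Dl0_def F_def)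
  have 2: "take (snd (snd q)) (F g1 b1 c1 r1 a1) = take (snd (snd q)) (g1 @ b1 @ [c1])" if "q \<in> DlR" for q
   using bspec[OF stR that] l lg by (simp add: F_def)
  have 3: "set (take (snd (snd q) + length \<beta>) (F g1 b1 c1 r1 a1)) = set (take (snd (snd q)) (g1 @ [c1] @ r1 @ [a1])) \<union> set b1" if qC: "q \<in> DlC" for q
  proof -
   obtain j where j: "snd (snd q) = Suc m + j" using le_Suc_ex[OF conjunct2[OF stC[OF qC]]] by (elim exE)
   show ?thesis unfolding j using l by (auto simp: F_def)
  qed
  show ?thesis unfolding DlF_def holds_Un holds_image Fv[OF t] Un_empty_right
   by (simp add: 1 2 3 holds_iff[of DlR] holds_iff[of DlC] cong: ball_cong)
 qed
 have valF: "valid (tyF @ [s]) ThF DlF" unfolding valid_def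
 proof (intro conjI)
  show "defp L C (tyF @ [s]) ThF" unfolding ThF_def by (rule defp_conj[OF defp_coord[OF Th1 co(1)] defp_coord[OF \<Psi> co(2)]])
  show "finite DlF" unfolding DlF_def using fin finR by (simp add: DlC_def)
  note zz = conjunct1[OF bspec[OF Z]] conjunct1[OF conjunct2[OF bspec[OF Z]]]
  show "\<forall>q\<in>DlF. stab (fst q) (tyF @ [s]) (fst (snd q))" unfolding DlF_def ball_Un
   using stab_coord[OF zz(1) coord_id co(3)] stab_coord[OF zz(2) coord_id coord_comp[OF co(1) coM(2)]]
    stab_coord[OF conjunct1[OF bspec[OF stR]] coord_id co(2)] stab_coord[OF conjunct1[OF stC] coord_id co(1)]
   by simp
 qed
 have in_old: "a1 \<in> kset s ty Th Dl \<and> (\<forall>c. {x \<in> car s'. sat C [x, a1] phi} = {c} --> SU_se_ge L C \<kappa> n [c] {})"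
  if a1: "a1 \<in> kset s tyF ThF DlF" for a1
 proof -
  obtain w where a1s: "a1 \<in> car s" and w: "w \<in> tup tyF" "ThF (w @ [a1])" "holds DlF {} (w @ [a1])"
   using a1 unfolding kset_def by blast
  obtain g1 w1 where g1: "w = g1 @ w1" "g1 \<in> tup tyg" "w1 \<in> tup (\<beta> @ [s'] @ \<rho>)" by (rule tuples_appendE[OF w(1)[unfolded tyF_def]])
  obtain b1 w2 where b1: "w1 = b1 @ w2" "b1 \<in> tup \<beta>" "w2 \<in> tup ([s'] @ \<rho>)" by (rule tuples_appendE[OF g1(3)])
  obtain w3 r1 where r1: "w2 = w3 @ r1" "w3 \<in> tup [s']" "r1 \<in> tup \<rho>" by (rule tuples_appendE[OF b1(3)])
  obtain c1 where c1: "w3 = [c1]" "c1 \<in> car s'" using r1(2) by (rule tuples_singleE)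
  have we: "w @ [a1] = F g1 b1 c1 r1 a1" using g1(1) b1(1) r1(1) c1(1) by (simp add: F_def)
  note t = g1(2) b1(2)
  have Thw: "Th1 (g1 @ [c1] @ r1 @ [a1])" "\<Psi> (g1 @ b1 @ [c1])" using w(2) unfolding we ThF_def Fv[OF t] by simp_all
  note hw0 = w(3)[unfolded we hF[OF t]]
  note hw = conjunct1[OF hw0] conjunct1[OF conjunct2[OF hw0]] conjunct1[OF conjunct2[OF conjunct2[OF hw0]]]
   conjunct2[OF conjunct2[OF conjunct2[OF hw0]]]
  have Th': "Th (g1 @ r1 @ [a1])" "{x \<in> car s'. sat C [x, a1] phi} = {c1}" using Thw(1) Th1v[OF g1(2) c1(2) r1(3)] by simp_all
  have "SU_se_ge L C \<kappa> n [c1] (set g1)"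
   using bspec[OF bspec[OF bspec[OF rank g1(2)] b1(2)] c1(2)] Thw(2) hw(3) by simp
  then have "SU_se_ge L C \<kappa> n [c1] {}" by (rule SU_se_ge_base) simp
  then have R: "\<forall>c. {x \<in> car s'. sat C [x, a1] phi} = {c} --> SU_se_ge L C \<kappa> n [c] {}" unfolding Th'(2) by simp
  have l1: "length g1 = m" by (rule tl[OF g1(2)])
  have aU: "a1 \<in> U" "c1 \<in> U" using a1s c1(2) by (simp_all add: carrier_of_def)
  have UU: "set g1 \<subseteq> U" "set b1 \<subseteq> U" "set r1 \<subseteq> U" using tuples_set[OF g1(2)] tuples_set[OF b1(2)] tuples_set[OF r1(3)] .
  have bU: "set (take j (g1 @ [c1] @ r1 @ [a1])) \<union> set b1 \<subseteq> U" for j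
   using set_take_subset[of j "g1 @ [c1] @ r1 @ [a1]"] UU aU by auto
  let ?D1 = "g1 @ r1 @ [a1]"
  have d1: "del (g1 @ [c1] @ r1 @ [a1]) = ?D1" by (rule delv[OF g1(2)])
  note hC' = hw(4)[unfolded DlC_def holds_Un holds_image d1 Fv[OF t]]
  have "fset (set (take (snd (snd q)) ?D1)) (fst q) {x. fst (snd q) x ?D1}" if q: "q \<in> Dl" for q
  proof (cases "q \<in> Dl0")
   case False
   then have q1: "q \<in> Dl1" "m < snd (snd q)" using q by (auto simp: Dl0_def Dl1_def)
   have f: "fset (set (take (Suc (snd (snd q))) (g1 @ [c1] @ r1 @ [a1])) \<union> set b1) (fst q) {x. fst (snd q) x ?D1}"
    by (rule bspec[OF conjunct1[OF hC'] q1(1)])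
   show ?thesis
    by (rule fset_base_mono[OF f _ bU]) (use q1(2) l1 in \<open>auto simp: Suc_diff_le\<close>)
  next
   case True
   let ?i = "snd (snd q)"
   have ti: "take ?i ?D1 = take ?i g1" using True l1 by (simp add: Dl0_def)
   have sub: "set (take ?i g1) \<subseteq> set g1" by (rule set_take_subset)
   have f3: "fset (set (g1 @ [c1]) \<union> set b1) (fst q)
     {x. (fst (snd q) x ?D1 \<and> \<not> fst (Z q) x g1) \<and> \<not> snd (Z q) x (g1 @ [c1])}"
    by (rule bspec[OF conjunct2[OF hC'] True])
   have 3: "fset (set (take ?i g1)) (fst q) {x. (fst (snd q) x ?D1 \<and> \<not> fst (Z q) x g1) \<and> \<not> snd (Z q) x (g1 @ [c1])}"
    by (rule fset_base_mono[OF f3]) (use sub UU aU in auto)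
   note 2 = fset_base_mono[OF bspec[OF hw(2) True] sub UU(1)]
   \<comment> \<open>The three parts of a requirement that was cut all fork over its old base, since
     this base is contained in each of theirs.\<close>
   from fset_Un[OF fset_Un[OF bspec[OF hw(1) True] 2] 3] show ?thesis unfolding ti by (rule fset_mono) auto
  qed
  then have "holds Dl {} ((g1 @ r1) @ [a1])" unfolding holds_iff by simp
  moreover have "g1 @ r1 \<in> tup ty" unfolding T(2) by (rule tuples_appendI[OF g1(2) r1(3)])
  moreover have "Th ((g1 @ r1) @ [a1])" using Th'(1) by simp
  ultimately show ?thesis using a1s R unfolding kset_def by blast
 qed
 have a'F: "a' \<in> kset s tyF ThF DlF" unfolding kset_def
 proof (intro CollectI conjI bexI[of _ "g @ b @ [c'] @ r'"])
  show "a' \<in> car s" by (rule a'(2))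
  show "g @ b @ [c'] @ r' \<in> tup tyF" unfolding tyF_def by (intro tuples_appendI gt b c't r'(2))
  have rr': "(g @ [c']) @ rr = g @ [c'] @ r' @ [a']" using r'(1) a'(1) by simp
  have 1: "ThF (F g b c' r' a')" unfolding ThF_def Fv[OF gt b] using rr(2)[unfolded rr'] \<Psi>b by simp
  then show "ThF ((g @ b @ [c'] @ r') @ [a'])" by (simp add: F_def)
  have "\<forall>q\<in>Dl0. fset (set (take (snd (snd q)) g)) (fst q) {x. fst (Z q) x g}" by (rule ballI, drule bspec[OF Z], elim conjE)
  then have "holds DlF {} (F g b c' r' a')" unfolding hF[OF gt b] using c'Z hR rr(3)[unfolded rr'] by simp
  then show "holds DlF {} ((g @ b @ [c'] @ r') @ [a'])" by (simp add: F_def)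
 qed
 have "{x \<in> car s'. sat C [x, a'] phi} = {c'}" using rr(2) Th1v[OF gt c'(2) r'(2), of a'] r'(1) a'(1) by simp
 \<comment> \<open>Otherwise its value \<open>c'\<close> would be algebraic as well.\<close>
 then have "a' \<notin> acl L C {}" using acl_value[OF phi a'(2)] c'n acl_mono[of "{}" "set g"] by blast
 then have "\<not> kset s tyF ThF DlF \<subseteq> acl L C {}" using a'F by (auto dest: subsetD)
 moreover have "kset s tyF ThF DlF \<subseteq> kset s ty Th Dl" by (rule subsetI) (rule conjunct1[OF in_old])
 ultimately show ?thesis using valF in_old
  by (intro exI[of _ tyF] exI[of _ ThF], intro exI[of _ DlF] conjI ballI) simp_all
qed

section \<open>Limits of points of a condition\<close>

lemma kset_aut:
 assumes V: "valid (ty @ [s]) Th Dl" and a: "a \<in> kset s ty Th Dl" and h: "aut h"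
 shows "h a \<in> kset s ty Th Dl"
proof -
 obtain d where d: "d \<in> tup ty" "Th (d @ [a])" "holds Dl {} (d @ [a])" and as: "a \<in> car s" using a unfolding kset_def by blast
 let ?D = "d @ [a]"
 have DT: "?D \<in> tup (ty @ [s])" using d(1) as by simp
 have hD: "map h ?D = map h d @ [h a]" by simp
 have "fset (set (take (snd (snd q)) (map h ?D))) (fst q) {x. fst (snd q) x (map h ?D)}" if "q \<in> Dl" for q
 proof -
  let ?A = "set (take (snd (snd q)) ?D)"
  have st: "stab (fst q) (ty @ [s]) (fst (snd q))" using V that unfolding valid_def by blast
  have f: "fset ?A (fst q) {x. fst (snd q) x ?D}" using bspec[OF d(3)[unfolded holds_iff] that] by simp
  have "?A \<subseteq> U" using tuples_set[OF DT] set_take_subset[of _ ?D] by (rule subset_trans[rotated])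
  from fset_aut[OF st DT _ this h f] show ?thesis by (simp add: take_map countable_finite del: map_append)
 qed
 then have "holds Dl {} (map h d @ [h a])" unfolding hD holds_iff by simp
 moreover have "Th (map h d @ [h a])" using aut_defp[OF h _ DT, of Th] V d(2) by (simp add: valid_def)
 moreover have "h a \<in> car s" using aut_tup[OF h, of "[a]" "[s]"] as by simp
 ultimately show ?thesis unfolding kset_def using aut_tup[OF h d(1)] by blast
qed

text \<open>Together with the parameters, dividing sequences for all requirements are carried to the
  limit; their inconsistency survives because the numbers come from the ladder bounds and are the
  same for all \<open>k\<close>. The limit point has the type of \<open>b\<close>, and conditions
  are invariant under automorphisms.\<close>

lemma kset_closed:
 fixes F :: "nat filter"
 assumes V: "valid (ty @ [s]) Th Dl" and F: "ultra F" and ev: "eventually (\<lambda>k. a k \<in> kset s ty Th Dl) F" and b: "b \<in> car s"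
  and lim: "\<And>P. defp L C [s] P ==> eventually (\<lambda>k. P [a k]) F ==> P [b]"
 shows "b \<in> kset s ty Th Dl"
proof -
 let ?ty = "ty @ [s]" and ?n = "length (ty @ [s])"
 have "finite Dl" using V by (simp add: valid_def)
 then obtain cs where cs: "set cs = Dl" using finite_list by blast
 have st: "stab (fst q) ?ty (fst (snd q))" if "q \<in> Dl" for q using V that unfolding valid_def by blast
 have "\<forall>q\<in>Dl. \<exists>n. \<not> lad n (fst q) ?ty (fst (snd q))"
 proof
  fix q assume "q \<in> Dl"
  from st[OF this] show "\<exists>n. \<not> lad n (fst q) ?ty (fst (snd q))" unfolding stab_def by (rule conjunct2)
 qed
 from bchoice[OF this] obtain N where N: "\<forall>q\<in>Dl. \<not> lad (N q) (fst q) ?ty (fst (snd q))" ..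
 obtain D0 where D0: "D0 \<in> tup ?ty" using tuples_nonempty[OF struct] by blast
 \<comment> \<open>Entry \<open>(0, 0)\<close> holds the tuple, entry \<open>(Suc t, j)\<close> the
   term \<open>j\<close> of the dividing sequence for requirement number \<open>t\<close>.\<close>
 define good where "good k X \<longleftrightarrow> X (0, 0) \<in> tup ?ty \<and> Th (X (0, 0)) \<and> drop (length ty) (X (0, 0)) = [a k] \<and>
  (\<forall>t<length cs. \<forall>j. X (Suc t, j) \<in> tup ?ty \<and>
   tp L C (X (Suc t, j)) (set (take (snd (snd (cs ! t))) (X (0, 0)))) = tp L C (X (0, 0)) (set (take (snd (snd (cs ! t))) (X (0, 0))))) \<and>
  (\<forall>t<length cs. \<forall>I. finite I \<and> card I = Suc (N (cs ! t)) -->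
   \<not> (\<exists>x\<in>tup (fst (cs ! t)). \<forall>j\<in>I. fst (snd (cs ! t)) x (X (Suc t, j))))" for k and X :: "nat \<times> nat => 'a list"
 have ex: "\<exists>X. good k X" if k: "a k \<in> kset s ty Th Dl" for k
 proof -
  obtain d where d: "d \<in> tup ty" "Th (d @ [a k])" "holds Dl {} (d @ [a k])" and as: "a k \<in> car s" using k unfolding kset_def by blast
  let ?D = "d @ [a k]"
  have DT: "?D \<in> tup ?ty" using d(1) as by simp
  have "\<exists>e :: nat => 'a list. (\<forall>j. e j \<in> tup ?ty \<and> tp L C (e j) (set (take (snd (snd (cs ! t))) ?D)) = tp L C ?D (set (take (snd (snd (cs ! t))) ?D))) \<and>
   (\<forall>I. finite I \<and> card I = Suc (N (cs ! t)) --> \<not> (\<exists>x\<in>tup (fst (cs ! t)). \<forall>j\<in>I. fst (snd (cs ! t)) x (e j)))"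
   if t: "t \<in> {..<length cs}" for t
  proof -
   have q: "cs ! t \<in> Dl" using t cs by auto
   let ?A = "set (take (snd (snd (cs ! t))) ?D)"
   have "?A \<subseteq> U" using tuples_set[OF DT] set_take_subset[of _ ?D] by (rule subset_trans[rotated])
   moreover have "fset ?A (fst (cs ! t)) {x. fst (snd (cs ! t)) x ?D}" using bspec[OF d(3)[unfolded holds_iff] q] by simp
   ultimately show ?thesis
    using stab_kdiv[OF st[OF q] bspec[OF N q] DT countable_finite[OF finite_set]] unfolding kdiv_def by blast
  qed
  then have "\<forall>t\<in>{..<length cs}. \<exists>e :: nat => 'a list. (\<forall>j. e j \<in> tup ?ty \<and> tp L C (e j) (set (take (snd (snd (cs ! t))) ?D)) = tp L C ?D (set (take (snd (snd (cs ! t))) ?D))) \<and>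
   (\<forall>I. finite I \<and> card I = Suc (N (cs ! t)) --> \<not> (\<exists>x\<in>tup (fst (cs ! t)). \<forall>j\<in>I. fst (snd (cs ! t)) x (e j)))" by (rule ballI)
  from bchoice[OF this] obtain e :: "nat => nat => 'a list" where e: "\<forall>t\<in>{..<length cs}. (\<forall>j. e t j \<in> tup ?ty \<and> tp L C (e t j) (set (take (snd (snd (cs ! t))) ?D)) = tp L C ?D (set (take (snd (snd (cs ! t))) ?D))) \<and>
   (\<forall>I. finite I \<and> card I = Suc (N (cs ! t)) --> \<not> (\<exists>x\<in>tup (fst (cs ! t)). \<forall>j\<in>I. fst (snd (cs ! t)) x (e t j)))" ..
  have "good k (\<lambda>(x, j). case x of 0 => ?D | Suc t => e t j)"
   unfolding good_def using DT d(2) e tuples_length[OF d(1)] by simp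
  then show ?thesis by (rule exI[of "good k"])
 qed
 define X where "X k = (if a k \<in> kset s ty Th Dl then SOME X. good k X else (\<lambda>_. D0))" for k
 have gX: "good k (X k)" if "a k \<in> kset s ty Th Dl" for k using someI_ex[OF ex[OF that]] that by (simp add: X_def)
 have evg: "eventually (\<lambda>k. good k (X k)) F" using ev by eventually_elim (rule gX)
 \<comment> \<open>Entries that \<open>good\<close> does not control are replaced by
   \<open>D0\<close> if necessary, to keep all sequences well-sorted.\<close>
 define c where "c k x = (if X k x \<in> tup ?ty then X k x else D0)" for k x
 have ct: "c k x \<in> tup ?ty" for k x using D0 by (simp add: c_def)
 have "sm (UNIV :: (nat \<times> nat) set)" by (rule sm_countable) simp
 from tulim[OF F this, of c "\<lambda>_. ?ty"] ct obtain Y where Yt: "\<And>x. Y x \<in> tup ?ty"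
  and Y: "\<And>xs P. defp L C (concat (map (\<lambda>_. ?ty) xs)) P ==> P (concat (map Y xs)) \<longleftrightarrow> eventually (\<lambda>k. P (concat (map (c k) xs))) F"
  by auto
 have c0: "c k (0, 0) = X k (0, 0)" if "good k (X k)" for k using that by (simp add: c_def good_def)
 have cS: "c k (Suc t, j) = X k (Suc t, j)" if "good k (X k)" "t < length cs" for k t j using that by (simp add: c_def good_def)
 let ?D = "Y (0, 0)"
 note DT = Yt[of "(0, 0)"]
 have Y1: "P ?D \<longleftrightarrow> eventually (\<lambda>k. P (c k (0, 0))) F" if "defp L C ?ty P" for P using Y[of "[(0, 0)]" P] that by simp
 have ThD: "Th ?D"
 proof (rule iffD2[OF Y1])
  show "defp L C ?ty Th" using V by (simp add: valid_def)
  show "eventually (\<lambda>k. Th (c k (0, 0))) F" using evg by eventually_elim (simp add: c0 good_def)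
 qed
 obtain d y where dy: "?D = d @ y" "d \<in> tup ty" "y \<in> tup [s]" by (rule tuples_appendE[OF DT])
 obtain a1 where a1: "y = [a1]" "a1 \<in> car s" using dy(3) by (rule tuples_singleE)
 have "fset (set (take (snd (snd q)) ?D)) (fst q) {x. fst (snd q) x ?D}" if q: "q \<in> Dl" for q
 proof -
  obtain t where t: "t < length cs" "q = cs ! t" using q cs by (metis in_set_conv_nth)
  let ?i = "snd (snd q)"
  have tpt: "tp L C (Y (Suc t, j)) (set (take ?i ?D)) = tp L C ?D (set (take ?i ?D))" for j
  proof (rule tp_eq_setI[OF Yt DT tuples_take[OF DT]])
   fix P assume P: "defp L C (?ty @ take ?i ?ty) P" "P (Y (Suc t, j) @ take ?i ?D)"
   let ?T = "\<lambda>w. P (take ?n w @ take ?i (drop ?n w)) = P (drop ?n w @ take ?i (drop ?n w))"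
   have co: "coord (?ty @ ?ty) (take ?i ?ty) (\<lambda>w. take ?i (drop ?n w))" by (rule coord_comp[OF coord_snd coord_take])
   have "defp L C (?ty @ ?ty) ?T"
    by (intro defp_iff defp_coord[OF P(1) coord_append[OF coord_fst co]] defp_coord[OF P(1) coord_append[OF coord_snd co]])
   then have "?T (concat (map Y [(Suc t, j), (0, 0)])) \<longleftrightarrow> eventually (\<lambda>k. ?T (concat (map (c k) [(Suc t, j), (0, 0)]))) F"
    by (intro Y) simp
   moreover have "eventually (\<lambda>k. ?T (concat (map (c k) [(Suc t, j), (0, 0)]))) F"
    using evg
   proof eventually_elim
    case (elim k)
    let ?Z = "X k (Suc t, j)" and ?D = "X k (0, 0)"
    have Zt: "?Z \<in> tup ?ty" "?D \<in> tup ?ty" "tp L C ?Z (set (take ?i ?D)) = tp L C ?D (set (take ?i ?D))"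
     using elim t unfolding good_def by simp_all
    have "set (take ?i ?D) \<subseteq> U" using tuples_set[OF Zt(2)] set_take_subset[of ?i ?D] by (rule subset_trans[rotated])
    then have "P (?Z @ take ?i ?D) = P (?D @ take ?i ?D)"
     by (intro tp_eq_sort[OF Zt(3,1,2) subset_refl]) (use P(1) tuples_sorts[OF tuples_take[OF Zt(2)]] in simp_all)
    then show ?case using c0[OF elim] cS[OF elim t(1)] tuples_length[OF Zt(1)] by simp
   qed
   ultimately have "?T (concat (map Y [(Suc t, j), (0, 0)]))" by (rule iffD2)
   then show "P (?D @ take ?i ?D)" using P(2) tuples_length[OF Yt[of "(Suc t, j)"]] by simp
  qed
  have inc: "\<not> (\<exists>x\<in>tup (fst q). \<forall>j\<in>I. fst (snd q) x (Y (Suc t, j)))" if I: "finite I" "card I = Suc (N q)" for I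
  proof -
   obtain js where js: "set js = I" using finite_list[OF I(1)] by blast
   let ?xs = "map (\<lambda>j. (Suc t, j)) js"
   let ?T = "\<lambda>w. \<exists>x\<in>tup (fst q). \<forall>u<length ?xs. fst (snd q) x (slice ?n u w)"
   have Tc: "?T (concat (map f ?xs)) \<longleftrightarrow> (\<exists>x\<in>tup (fst q). \<forall>j\<in>I. fst (snd q) x (f (Suc t, j)))" if f: "\<And>z. f z \<in> tup ?ty" for f
   proof -
    have "slice ?n u (concat (map f ?xs)) = f (?xs ! u)" if "u < length ?xs" for u
     by (rule slice_concat[OF tuples_length[OF f] that])
    then show ?thesis by (simp add: js[symmetric] all_set_conv_all_nth)
   qed
   have "defp L C (concat (map (\<lambda>_. ?ty) ?xs)) ?T"
    using defp_common[OF stab_def2[OF st[OF q]], of "length ?xs"] by (simp add: map_const_concat[of ?xs "\<lambda>_. ?ty" ?ty] map_const_concat[of js "\<lambda>_. ?ty" ?ty] comp_def)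
   from Y[OF this] have "?T (concat (map Y ?xs)) \<longleftrightarrow> eventually (\<lambda>k. ?T (concat (map (c k) ?xs))) F" .
   moreover have "eventually (\<lambda>k. \<not> ?T (concat (map (c k) ?xs))) F" using evg
   proof eventually_elim
    case (elim k)
    have "\<not> (\<exists>x\<in>tup (fst q). \<forall>j\<in>I. fst (snd q) x (X k (Suc t, j)))" using elim t I unfolding good_def by blast
    then show ?case unfolding Tc[of "c k", OF ct] cS[OF elim t(1)] .
   qed
   ultimately have "\<not> ?T (concat (map Y ?xs))" using ultra_not[OF F] by blast
   then show ?thesis unfolding Tc[of Y, OF Yt] .
  qed
  have "kdiv (Suc (N q)) (set (take ?i ?D)) (fst q) ?ty (fst (snd q)) ?D"
   unfolding kdiv_def by (rule exI[of _ "\<lambda>j. Y (Suc t, j)"], intro conjI allI impI Yt tpt, elim conjE, rule inc)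
  from kdiv_fset[OF this stab_def2[OF st[OF q]] DT] show ?thesis .
 qed
 then have "holds Dl {} (d @ [a1])" unfolding holds_iff dy(1)[symmetric, unfolded a1(1)] by simp
 then have a1K: "a1 \<in> kset s ty Th Dl" unfolding kset_def using dy(1,2) a1 ThD by auto
 have lim1: "P [b]" if P: "defp L C [s] P" "P [a1]" for P
 proof -
  have ld: "length d = length ty" by (rule tuples_length[OF dy(2)])
  have "P (drop (length ty) ?D)" using P(2) dy(1) a1(1) ld by simp
  then have "eventually (\<lambda>k. P (drop (length ty) (c k (0, 0)))) F"
   by (rule iffD1[OF Y1[OF defp_coord[OF P(1) coord_snd]]])
  with evg have "eventually (\<lambda>k. P [a k]) F" by eventually_elim (simp add: c0 good_def)
  then show ?thesis by (rule lim[OF P(1)])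
 qed
 \<comment> \<open>Both \<open>a1\<close> and \<open>b\<close> are limits of the \<open>a k\<close>
   along \<open>F\<close>.\<close>
 have "tp L C [a1] {} = tp L C [b] {}"
 proof (rule tp_eqI[of _ "[s]"])
  fix u phi assume u: "set u \<subseteq> {}" "wff L ([s] @ srt u) phi"
  then have w: "wff L [s] phi" by simp
  show "sat C ([a1] @ u) phi = sat C ([b] @ u) phi"
   using lim1[OF defp_wff[OF w]] lim1[OF defp_neg[OF defp_wff[OF w]]] u(1) by auto
 qed (use a1 b in simp_all)
 from hom_tuple[OF _ _ _ _ this, of "[s]"] a1(2) b obtain h where "aut h" "h a1 = b" by (auto intro: sm_finite)
 then show ?thesis using kset_aut[OF V a1K] by blast
qed

lemma kset_restrict:
 assumes V: "valid (ty @ [s]) Th Dl" and P: "defp L C [s] P"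
 shows "valid (ty @ [s]) (\<lambda>w. Th w \<and> P (drop (length ty) w)) Dl"
  "kset s ty (\<lambda>w. Th w \<and> P (drop (length ty) w)) Dl = {a \<in> kset s ty Th Dl. P [a]}"
proof -
 show "valid (ty @ [s]) (\<lambda>w. Th w \<and> P (drop (length ty) w)) Dl"
  using V defp_conj[OF _ defp_coord[OF P coord_snd]] by (simp add: valid_def)
 show "kset s ty (\<lambda>w. Th w \<and> P (drop (length ty) w)) Dl = {a \<in> kset s ty Th Dl. P [a]}"
  unfolding kset_def by (auto simp: tuples_length)
qed

text \<open>A nonalgebraic value is the case of \<open>insert_value\<close>. If the value of
  \<open>phi\<close> at \<open>a\<close> is algebraic, or \<open>phi\<close> does not define a value
  at \<open>a\<close>, a formula true of \<open>a\<close> forces the same at every point that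
  satisfies it, and restricting the condition to this formula is enough.\<close>

lemma restrict_value:
 assumes ep: "extension_property_first_order L C" and H: no_bounded_open
  and V: "valid (ty @ [s]) Th Dl" and a: "a \<in> kset s ty Th Dl" "a \<notin> acl L C {}" and phi: "wff L [s', s] phi"
 shows "\<exists>ty' Th' Dl'. valid (ty' @ [s]) Th' Dl' \<and> kset s ty' Th' Dl' \<subseteq> kset s ty Th Dl \<and> \<not> kset s ty' Th' Dl' \<subseteq> acl L C {} \<and>
  (\<forall>a\<in>kset s ty' Th' Dl'. \<forall>c. {x \<in> car s'. sat C [x, a] phi} = {c} --> c \<in> acl L C {} \<or> SU_se_ge L C \<kappa> n [c] {})"
proof -
 have as: "a \<in> car s" using a(1) by (simp add: kset_def)
 have phi': "wff L ([s'] @ [s]) phi" using phi by simp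
 have *: ?thesis if P: "defp L C [s] P" "P [a]"
  "\<And>a1 c1. a1 \<in> car s ==> P [a1] ==> {x \<in> car s'. sat C [x, a1] phi} = {c1} ==> c1 \<in> acl L C {}" for P
 proof -
  note K = kset_restrict[OF V P(1)]
  have "a \<in> kset s ty (\<lambda>w. Th w \<and> P (drop (length ty) w)) Dl" unfolding K(2) using a(1) P(2) by simp
  moreover have "a1 \<in> car s \<and> P [a1]" if "a1 \<in> kset s ty (\<lambda>w. Th w \<and> P (drop (length ty) w)) Dl" for a1
   using that unfolding K(2) by (simp add: kset_def)
  ultimately show ?thesis using K a(2) P(3)
   by (intro exI[of _ ty] exI[of _ "\<lambda>w. Th w \<and> P (drop (length ty) w)"], intro exI[of _ Dl]) blast
 qed
 show ?thesis
 proof (cases "\<exists>c. {x \<in> car s'. sat C [x, a] phi} = {c}")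
  case True
  then obtain c where c: "{x \<in> car s'. sat C [x, a] phi} = {c}" ..
  have cs: "c \<in> car s'" "sat C [c, a] phi" using c by auto
  then have cs': "Sort C c = s'" by (simp add: carrier_of_def)
  show ?thesis
  proof (cases "c \<in> acl L C {}")
   case True
   then obtain psi where psi: "wff L [s'] psi" "sat C [c] psi" "finite {x \<in> car s'. sat C [x] psi}"
    unfolding acl_def formulas_over_def using cs' by auto
   have d: "defp L C [s] (\<lambda>e. \<exists>x\<in>tup [s']. sat C (x @ e) phi \<and> sat C x psi)"
    by (rule def2_ex, rule def2_conj[OF def2_wff[OF phi']], rule def2_swap[OF def2_param[OF defp_wff[OF psi(1)]]])
   show ?thesis
   proof (rule *[OF d])
    show "\<exists>x\<in>tup [s']. sat C (x @ [a]) phi \<and> sat C x psi" by (rule bexI[of _ "[c]"]) (use cs psi in simp_all)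
    fix a1 c1 assume A: "\<exists>x\<in>tup [s']. sat C (x @ [a1]) phi \<and> sat C x psi" "{x \<in> car s'. sat C [x, a1] phi} = {c1}"
    obtain x where x: "x \<in> tup [s']" "sat C (x @ [a1]) phi" "sat C x psi" using A(1) by (elim bexE conjE)
    obtain z where z: "x = [z]" "z \<in> car s'" using x(1) by (rule tuples_singleE)
    have "z \<in> {x \<in> car s'. sat C [x, a1] phi}" using x z by simp
    then have "c1 = z" unfolding A(2) by simp
    moreover have "Sort C z = s'" "z \<in> U" using z(2) by (simp_all add: carrier_of_def)
    ultimately show "c1 \<in> acl L C {}" unfolding acl_def formulas_over_def
     using psi x(3) z by (intro CollectI conjI bexI[of _ "(psi, [])"]) auto
   qed
  next
   case False
   from insert_value[OF ep H V a(1) phi c this, of n] show ?thesis by (elim exE conjE) (intro exI conjI, assumption+, blast)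
  qed
 next
  case False
  have tp1: "(\<exists>y\<in>tup [s']. True \<and> (\<forall>y'\<in>tup [s']. sat C (y' @ [e]) phi \<longleftrightarrow> y' = y)) \<longleftrightarrow> (\<exists>c. {x \<in> car s'. sat C [x, e] phi} = {c})" (is "?l \<longleftrightarrow> ?r") for e
  proof
   assume ?l
   then obtain y where y: "y \<in> tup [s']" "\<forall>y'\<in>tup [s']. sat C (y' @ [e]) phi \<longleftrightarrow> y' = y" by (elim bexE conjE)
   obtain z where z: "y = [z]" "z \<in> car s'" using y(1) by (rule tuples_singleE)
   have "\<forall>x\<in>car s'. sat C [x, e] phi = (x = z)"
   proof
    fix x assume "x \<in> car s'"
    then show "sat C [x, e] phi = (x = z)" using bspec[OF y(2), of "[x]"] z(1) by simp
   qed
   then show ?r using Collect_eq_singleton[OF z(2)] by (intro exI[of _ z]) (rule iffD1)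
  next
   assume ?r
   then obtain z where z: "{x \<in> car s'. sat C [x, e] phi} = {z}" ..
   have zs: "z \<in> car s'" using z by auto
   have e: "\<forall>x\<in>car s'. sat C [x, e] phi = (x = z)" by (rule iffD2[OF Collect_eq_singleton[OF zs] z])
   show ?l
   proof (rule bexI[of _ "[z]"], intro conjI ballI TrueI)
    fix y' assume "y' \<in> tup [s']"
    then obtain x where "y' = [x]" "x \<in> car s'" by (rule tuples_singleE)
    then show "sat C (y' @ [e]) phi = (y' = [z])" using bspec[OF e, of x] by simp
   qed (use zs in simp)
  qed
  have T: "def2 L C [s'] [] (\<lambda>_ _. True)" by (rule def2_param[OF defp_const])
  show ?thesis
  proof (rule *[OF defp_neg[OF defp_unique[OF T coord_nil def2_wff[OF phi'] coord_id]]])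
   show "\<not> (\<exists>y\<in>tup [s']. True \<and> (\<forall>y'\<in>tup [s']. sat C (y' @ [a]) phi \<longleftrightarrow> y' = y))" unfolding tp1 using False .
   fix a1 c1 assume "\<not> (\<exists>y\<in>tup [s']. True \<and> (\<forall>y'\<in>tup [s']. sat C (y' @ [a1]) phi \<longleftrightarrow> y' = y))" "{x \<in> car s'. sat C [x, a1] phi} = {c1}"
   then show "c1 \<in> acl L C {}" unfolding tp1 by blast
  qed
 qed
qed

text \<open>A Baire category argument: the sets \<^term>\<open>kset s ty Th Dl\<close> are closed under limits, so
 countably many requirements can be met one after the other.\<close>

lemma infinite_rank_element:
 assumes ep: "extension_property_first_order L C" and H: no_bounded_open and s: "\<not> car s \<subseteq> acl L C {}"
 shows "\<exists>b\<in>car s - acl L C {}. \<forall>a'\<in>dcl L C {b} - acl L C {}. SU_se L C \<kappa> [a'] {} = \<infinity>"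
proof -
 define Kq where "Kq q = kset s (fst q) (fst (snd q)) (snd (snd q))"
  for q :: "'s list \<times> ('a list => bool) \<times> ('s list \<times> ('a list => 'a list => bool) \<times> nat) set"
 define Inv where "Inv q \<longleftrightarrow> valid (fst q @ [s]) (fst (snd q)) (snd (snd q)) \<and> \<not> Kq q \<subseteq> acl L C {}"
  for q :: "'s list \<times> ('a list => bool) \<times> ('s list \<times> ('a list => 'a list => bool) \<times> nat) set"
 \<comment> \<open>The tasks: a formula, a sort for its value, and a rank. There are countably
   many.\<close>
 let ?S = "formulas L \<times> (UNIV :: 's set) \<times> (UNIV :: nat set)"
 have ctS: "countable ?S" using ctbl countable_sorts[OF ctbl] by (intro countable_SIGMA) auto
 have "(Fls, undefined, 0) \<in> ?S" by (simp add: formulas_def)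
 then have neS: "?S \<noteq> {}" by blast
 define X where "X = from_nat_into ?S"
 define Val where "Val phi s' n K \<longleftrightarrow> (\<forall>a\<in>K. \<forall>c. {x \<in> car s'. sat C [x, a] phi} = {c} --> c \<in> acl L C {} \<or> SU_se_ge L C \<kappa> n [c] {})"
  for phi s' n K
 \<comment> \<open>The formula of task \<open>k\<close> is used twice: as the definition of a value,
   and, if it has finitely many solutions, as a formula to be avoided. The latter keeps the limit
   from being algebraic.\<close>
 define Good where "Good k K \<longleftrightarrow> (wff L [fst (snd (X k)), s] (fst (X k)) --> Val (fst (X k)) (fst (snd (X k))) (snd (snd (X k))) K) \<and>
  (wff L [s] (fst (X k)) --> finite {x \<in> car s. sat C [x] (fst (X k))} --> (\<forall>a\<in>K. \<not> sat C [a] (fst (X k))))" for k K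
 have Ks: "Kq q \<subseteq> car s" for q unfolding Kq_def kset_def by blast
 have step1: "\<exists>q'. Inv q' \<and> Kq q' \<subseteq> Kq q \<and> (wff L [s', s] phi --> Val phi s' n (Kq q'))" if q: "Inv q" for q phi s' n
 proof (cases "wff L [s', s] phi")
  case True
  obtain a where a: "a \<in> kset s (fst q) (fst (snd q)) (snd (snd q))" "a \<notin> acl L C {}" using q unfolding Inv_def Kq_def by blast
  have V: "valid (fst q @ [s]) (fst (snd q)) (snd (snd q))" using q by (simp add: Inv_def)
  obtain ty' Th' Dl' where r: "valid (ty' @ [s]) Th' Dl'" "kset s ty' Th' Dl' \<subseteq> Kq q" "\<not> kset s ty' Th' Dl' \<subseteq> acl L C {}"
   "Val phi s' n (kset s ty' Th' Dl')"
   using restrict_value[OF ep H V a True, of n] unfolding Kq_def Val_def by (elim exE conjE)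
  show ?thesis by (rule exI[of _ "(ty', Th', Dl')"]) (use r in \<open>simp add: Inv_def Kq_def\<close>)
 qed (use q in blast)
 have step2: "\<exists>q'. Inv q' \<and> Kq q' \<subseteq> Kq q \<and> (wff L [s] phi --> finite {x \<in> car s. sat C [x] phi} --> (\<forall>a\<in>Kq q'. \<not> sat C [a] phi))"
  if q: "Inv q" for q phi
 proof (cases "wff L [s] phi \<and> finite {x \<in> car s. sat C [x] phi}")
  case True
  obtain a where a: "a \<in> Kq q" "a \<notin> acl L C {}" using q unfolding Inv_def by blast
  have as: "a \<in> car s" using a(1) Ks by blast
  have na: "\<not> sat C [a] phi"
  proof
   assume "sat C [a] phi"
   then have "a \<in> acl L C {}" unfolding acl_def formulas_over_def using True as
    by (intro CollectI conjI bexI[of _ "(phi, [])"]) (auto simp: carrier_of_def)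
   then show False using a(2) by blast
  qed
  have V: "valid (fst q @ [s]) (fst (snd q)) (snd (snd q))" using q by (simp add: Inv_def)
  have "wff L [s] phi" using True by blast
  note K = kset_restrict[OF V defp_neg[OF defp_wff[OF this]]]
  let ?q = "(fst q, \<lambda>w. fst (snd q) w \<and> \<not> sat C (drop (length (fst q)) w) phi, snd (snd q))"
  have e: "Kq ?q = {a \<in> Kq q. \<not> sat C [a] phi}" unfolding Kq_def fst_conv snd_conv K(2) ..
  have "\<not> Kq ?q \<subseteq> acl L C {}" unfolding e using a na by blast
  then have "Inv ?q" using K(1) by (simp add: Inv_def)
  then show ?thesis by (rule_tac exI[where x = ?q]) (simp add: e)
 qed (use q in blast)
 have step: "\<exists>q'. Inv q' \<and> (Kq q' \<subseteq> Kq q \<and> Good k (Kq q'))" if q: "Inv q" for q k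
 proof -
  obtain q1 where q1: "Inv q1" "Kq q1 \<subseteq> Kq q"
   "wff L [fst (snd (X k)), s] (fst (X k)) --> Val (fst (X k)) (fst (snd (X k))) (snd (snd (X k))) (Kq q1)"
   using step1[OF q] by blast
  obtain q2 where q2: "Inv q2" "Kq q2 \<subseteq> Kq q1"
   "wff L [s] (fst (X k)) --> finite {x \<in> car s. sat C [x] (fst (X k))} --> (\<forall>a\<in>Kq q2. \<not> sat C [a] (fst (X k)))"
   using step2[OF q1(1)] by blast
  have "Good k (Kq q2)" unfolding Good_def using q1(3) q2(2,3) unfolding Val_def by blast
  then show ?thesis using q1(2) q2(1,2) by blast
 qed
 \<comment> \<open>The trivial condition, whose points are all elements of the sort.\<close>
 have init: "Inv ([], \<lambda>_. True, {})"
 proof -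
  have "kset s [] (\<lambda>_. True) {} = car s" by (simp add: kset_def holds_def)
  then show ?thesis using s by (simp add: Inv_def Kq_def valid_def defp_const)
 qed
 obtain q where q: "\<And>k. Inv (q k)" "\<And>k. Kq (q (Suc k)) \<subseteq> Kq (q k)" "\<And>k. Good k (Kq (q (Suc k)))"
  using dependent_nat_choice[of "\<lambda>_. Inv" "\<lambda>k x y. Kq y \<subseteq> Kq x \<and> Good k (Kq y)"] init step by metis
 have mono: "Kq (q k) \<subseteq> Kq (q l)" if "l \<le> k" for k l
  using that by (induction rule: dec_induct) (use q(2) in auto)
 have "\<forall>k. \<exists>a. a \<in> Kq (q k)" using q(1) unfolding Inv_def by blast
 from choice[OF this] obtain a where a: "\<forall>k. a k \<in> Kq (q k)" ..
 obtain F :: "nat filter" where F: "F \<le> sequentially" "ultra F" using ultra_exists[OF trivial_limit_sequentially] by blast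
 have as: "a k \<in> car s" for k using a Ks by blast
 have "\<exists>e. lcor F {()} (\<lambda>_. s) (\<lambda>_. a) e" by (rule ulim[OF F(2) sm_finite]) (simp_all add: as)
 then obtain e where e: "lcor F {()} (\<lambda>_. s) (\<lambda>_. a) e" ..
 let ?b = "e ()"
 have bs: "?b \<in> car s" using e by (simp add: lcor_def)
 have lim: "P [?b]" if "defp L C [s] P" "eventually (\<lambda>k. P [a k]) F" for P
  using lcorD[OF F(2) e, of "[()]" P] that as by simp
 \<comment> \<open>The conditions decrease, so almost all \<open>a k\<close> are points of condition
   \<open>l\<close>, which is closed under limits.\<close>
 have bK: "?b \<in> Kq (q l)" for l
 proof -
  have "eventually (\<lambda>k. l \<le> k) F" using F(1) eventually_ge_at_top[of l] by (auto simp: le_filter_def)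
  then have ev: "eventually (\<lambda>k. a k \<in> kset s (fst (q l)) (fst (snd (q l))) (snd (snd (q l)))) F"
  proof eventually_elim
   case (elim k)
   show ?case using mono[OF elim] a unfolding Kq_def by blast
  qed
  have "valid (fst (q l) @ [s]) (fst (snd (q l))) (snd (snd (q l)))" using q(1)[of l] by (simp add: Inv_def)
  then show ?thesis unfolding Kq_def by (rule kset_closed[where a = a, OF _ F(2) ev bs]) (rule lim)
 qed
 have X: "\<exists>k. X k = (phi, s', n)" if "phi \<in> formulas L" for phi s' n
  using from_nat_into_surj[OF ctS, of "(phi, s', n)"] that by (auto simp: X_def)
 have bn: "?b \<notin> acl L C {}"
 proof
  assume "?b \<in> acl L C {}"
  then obtain psi where psi: "wff L [s] psi" "sat C [?b] psi" "finite {x \<in> car s. sat C [x] psi}"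
   unfolding acl_def formulas_over_def using bs by (auto simp: carrier_of_def)
  have "psi \<in> formulas L" using psi(1) by (auto simp: formulas_def)
  then obtain k where k: "X k = (psi, s, 0)" using X by blast
  show False using q(3)[of k] bK[of "Suc k"] psi unfolding Good_def k by simp
 qed
 have "SU_se L C \<kappa> [a'] {} = \<infinity>" if a': "a' \<in> dcl L C {?b}" "a' \<notin> acl L C {}" for a'
 proof -
  let ?s = "Sort C a'"
  obtain phi0 u where u: "set u \<subseteq> {?b}" "wff L ([?s] @ srt u) phi0" "{x \<in> car ?s. sat C (x # u) phi0} = {a'}"
   using a'(1) unfolding dcl_def formulas_over_def by auto
  have bt: "[?b] \<in> tup [s]" using bs by simp
  \<comment> \<open>The parameters \<open>u\<close> are repetitions of the single element
    \<open>?b\<close>; the coordinate map \<open>r\<close> brings the definition of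
    \<open>a'\<close> into the form with one parameter that the tasks use.\<close>
  obtain r where r: "coord [s] (srt u) r" "r [?b] = u" using coord_sublist[of u "[?b]" C "[s]"] u(1) bt by auto
  have "coord ([?s] @ [s]) ([?s] @ srt u) (\<lambda>w. take 1 w @ r (drop 1 w))"
   by (rule coord_append[OF coord_take' coord_comp[OF coord_drop' r(1)]]) simp_all
  from defp_coord[OF defp_wff[OF u(2)] this] obtain phi where phi: "wff L [?s, s] phi"
   "\<forall>w\<in>tup [?s, s]. sat C (take 1 w @ r (drop 1 w)) phi0 = sat C w phi" unfolding defp_def by auto
  have "{x \<in> car ?s. sat C [x, ?b] phi} = {x \<in> car ?s. sat C (x # u) phi0}"
  proof (rule Collect_cong, rule conj_cong[OF refl])
   fix x assume "x \<in> car ?s"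
   then show "sat C [x, ?b] phi = sat C (x # u) phi0" using bspec[OF phi(2), of "[x, ?b]"] bs r(2) by simp
  qed
  then have sing: "{x \<in> car ?s. sat C [x, ?b] phi} = {a'}" using u(3) by simp
  have ge: "SU_se_ge L C \<kappa> n [a'] {}" for n
  proof -
   have "phi \<in> formulas L" using phi(1) by (auto simp: formulas_def)
   then obtain k where k: "X k = (phi, ?s, n)" using X by blast
   have "Val phi ?s n (Kq (q (Suc k)))" using q(3)[of k] phi(1) unfolding Good_def k by simp
   then show ?thesis using bK[of "Suc k"] sing a'(2) unfolding Val_def by blast
  qed
  have "enat n \<le> SU_se L C \<kappa> [a'] {}" for n unfolding SU_se_def by (rule SUP_upper) (use ge in simp)
  then show ?thesis by (metis enat_ord_simps(1) not_enat_eq not_less_eq_eq order_refl)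
 qed
 then show ?thesis using bs bn by blast
qed

end

theorem theorem9p4:
  fixes L :: "('s, 'f, 'r) lang"
    and T :: "('s, 'f, 'r) fm set"
    and C :: "('s, 'f, 'r, 'a) struct"
    and \<kappa> :: "'k rel"
    and s :: 's
  assumes "complete_theory L T"
    and "monster L T C \<kappa>"
    and "countable (formulas L)"
    and "simple_theory L C"
    and "extension_property_first_order L C"
    and "Lstp_eq_stp L C \<kappa>"
    and "\<not> carrier_of C s \<subseteq> acl L C {}"
    and "\<forall>a \<in> carrier_of C s - acl L C {}.
           \<exists>a' \<in> dcl L C {a} - acl L C {}. SU_se L C \<kappa> [a'] {} < \<infinity>"
  shows "\<exists>A \<sigma> U. finite A \<and> A \<subseteq> Univ C \<and> tau_f_inf_open L C \<sigma> A U \<and>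
           unbounded L C A U \<and> bounded_finite_SU_se L C \<kappa> \<sigma> A U"
proof (rule ccontr)
  assume no: "\<not> ?thesis"
  interpret simple_monster L C \<kappa>
    by unfold_locales (use assms(2-4) in \<open>simp_all add: monster_def\<close>)
  have no_bounded_open unfolding no_bounded_open_def using no .
  from infinite_rank_element[OF assms(5) this assms(7)] obtain b where
    b: "b \<in> car s - acl L C {}" "\<forall>a'\<in>dcl L C {b} - acl L C {}. SU_se L C \<kappa> [a'] {} = \<infinity>" by (elim bexE)
  from bspec[OF assms(8) b(1)] b(2) show False by auto
qed

end
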